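(* Let $N\geq 1$ and $0<\alpha<N$. Then, for any $m>0$, the equation $$-\Delta u+\omega u+|x|^{2}u+(I_{\alpha}\ast|u|^{2})u=0 \quad\text{in } \mathbb{R}^N$$ possesses a unique normalized ground state $Q$ with the prescribed mass $\mathcal{M}(Q)=m$; that is, the variational problem $d(m)=\inf\{\mathcal{E}(u) : u\in H(\mathbb{R}^N),\ \mathcal{M}(u)=m\}$ has exactly one positive minimizer $Q$. Moreover, all minimizers of this variational problem are in the set $\{Qe^{i\theta} : \theta\in\mathbb{R}\}$.
   Context: Functions on $\mathbb{R}^N$ are complex-valued. The Riesz potential $I_\alpha:\mathbb{R}^N\setminus\{0\}\to\mathbb{R}$ is $I_{\alpha}(x)=\dfrac{\Gamma(\frac{N-\alpha}{2})}{\Gamma(\frac{\alpha}{2})\pi^{N/2}2^{\alpha}|x|^{N-\alpha}}$, where $\Gamma$ is the Gamma function, and $*$ denotes convolution on $\mathbb{R}^N$. The energy space is $H(\mathbb{R}^{N})=\{u\in H^{1}(\mathbb{R}^{N}) : \int_{\mathbb{R}^{N}}|x|^{2}|u|^{2}dx<\infty\}$. The mass and energy are $\mathcal{M}(u)=\int_{\mathbb{R}^{N}}|u|^{2}dx$ and $\mathcal{E}(u)=\frac{1}{2}\int_{\mathbb{R}^{N}}\big(|\nabla u|^{2}+|x|^{2}|u|^{2}+\frac{1}{2}(I_{\alpha}\ast|u|^{2})|u|^{2}\big)dx$. A normalized ground state of mass $m$ is a positive minimizer of the variational problem $d(m)$; the displayed equation is the Euler-Lagrange equation of that problem, where $\omega\in\mathbb{R}$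 is the (not prescribed) Lagrange multiplier of the mass constraint. *)

theory Defs
  imports "HOL-Analysis.Analysis"
begin

text \<open>
  The ambient space is \<open>real ^ 'n\<close>, so \<open>N = CARD('n) \<ge> 1\<close>. Elements of function spaces are
  represented by Borel functions, and equality in these spaces is equality almost everywhere with
  respect to Lebesgue measure \<open>lborel\<close>.
\<close>

definition partial_deriv :: "'n \<Rightarrow> (real ^ 'n \<Rightarrow> complex) \<Rightarrow> real ^ 'n \<Rightarrow> complex" where
  "partial_deriv i f x = frechet_derivative f (at x) (axis i 1)"

primrec C_k :: "nat \<Rightarrow> (real ^ 'n \<Rightarrow> complex) \<Rightarrow> bool" where
  "C_k 0 f \<longleftrightarrow> continuous_on UNIV f"
| "C_k (Suc k) f \<longleftrightarrow> (\<forall>x. f differentiable (at x)) \<and> (\<forall>i. C_k k (partial_deriv i f))"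

definition test_function :: "(real ^ 'n \<Rightarrow> complex) \<Rightarrow> bool" where
  "test_function \<phi> \<longleftrightarrow> (\<forall>k. C_k k \<phi>) \<and> compact (closure {x. \<phi> x \<noteq> 0})"

definition locally_integrable :: "(real ^ 'n \<Rightarrow> 'b :: {banach, second_countable_topology}) \<Rightarrow> bool"
  where "locally_integrable f \<longleftrightarrow>
    f \<in> borel_measurable lborel \<and> (\<forall>K. compact K \<longrightarrow> set_integrable lborel K f)"

definition square_integrable :: "(real ^ 'n \<Rightarrow> 'b :: real_normed_vector) \<Rightarrow> bool" where
  "square_integrable f \<longleftrightarrow>
    f \<in> borel_measurable lborel \<and> integrable lborel (\<lambda>x. (norm (f x))\<^sup>2)"

definition has_weak_gradient :: "(real ^ 'n \<Rightarrow> complex) \<Rightarrow> (real ^ 'n \<Rightarrow> complex ^ 'n) \<Rightarrow> bool" where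
  "has_weak_gradient u G \<longleftrightarrow>
    locally_integrable u \<and> locally_integrable G \<and>
    (\<forall>\<phi> i. test_function \<phi> \<longrightarrow>
      (LINT x|lborel. u x * partial_deriv i \<phi> x) = - (LINT x|lborel. G x $ i * \<phi> x))"

text \<open>A weak gradient is unique up to null sets, so the choice below is immaterial.\<close>

definition weak_gradient :: "(real ^ 'n \<Rightarrow> complex) \<Rightarrow> real ^ 'n \<Rightarrow> complex ^ 'n" where
  "weak_gradient u = (SOME G. has_weak_gradient u G)"

definition sobolev_H1 :: "(real ^ 'n \<Rightarrow> complex) set" where
  "sobolev_H1 =
    {u. square_integrable u \<and> (\<exists>G. has_weak_gradient u G \<and> square_integrable G)}"

definition energy_space :: "(real ^ 'n \<Rightarrow> complex) set" where
  "energy_space =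
    {u \<in> sobolev_H1. integrable lborel (\<lambda>x. (norm x)\<^sup>2 * (norm (u x))\<^sup>2)}"

text \<open>The value at \<open>x = 0\<close>, where the Riesz potential is undefined, is the junk value \<open>0\<close>.\<close>

definition riesz_potential :: "real \<Rightarrow> real ^ 'n \<Rightarrow> real" where
  "riesz_potential \<alpha> x =
    Gamma ((real CARD('n) - \<alpha>) / 2) /
    (Gamma (\<alpha> / 2) * pi powr (real CARD('n) / 2) * 2 powr \<alpha> * norm x powr (real CARD('n) - \<alpha>))"

text \<open>
  Convolution of nonnegative functions. It is \<open>ennreal\<close>-valued, and so is the energy: for
  \<open>\<alpha> < N - 4\<close> the nonlocal term of the energy is infinite for some \<open>u\<close> in the energy space,
  where a Bochner integral would return \<open>0\<close>.
\<close>

definition nn_convolution :: "(real ^ 'n \<Rightarrow> ennreal) \<Rightarrow> (real ^ 'n \<Rightarrow> ennreal) \<Rightarrow> real ^ 'n \<Rightarrow> ennreal"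
  where "nn_convolution f g x = (\<integral>\<^sup>+ y. f (x - y) * g y \<partial>lborel)"

definition hartree_potential :: "real \<Rightarrow> (real ^ 'n \<Rightarrow> complex) \<Rightarrow> real ^ 'n \<Rightarrow> ennreal" where
  "hartree_potential \<alpha> u =
    nn_convolution (\<lambda>x. ennreal (riesz_potential \<alpha> x)) (\<lambda>x. ennreal ((norm (u x))\<^sup>2))"

definition mass :: "(real ^ 'n \<Rightarrow> complex) \<Rightarrow> real" where
  "mass u = (LINT x|lborel. (norm (u x))\<^sup>2)"

definition energy :: "real \<Rightarrow> (real ^ 'n \<Rightarrow> complex) \<Rightarrow> ennreal" where
  "energy \<alpha> u = 1 / 2 *
    (\<integral>\<^sup>+ x. ennreal ((norm (weak_gradient u x))\<^sup>2)
          + ennreal ((norm x)\<^sup>2 * (norm (u x))\<^sup>2)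
          + 1 / 2 * (hartree_potential \<alpha> u x * ennreal ((norm (u x))\<^sup>2)) \<partial>lborel)"

definition min_energy :: "'n::finite itself \<Rightarrow> real \<Rightarrow> real \<Rightarrow> ennreal" where
  "min_energy _ \<alpha> m =
    (INF u \<in> {u \<in> (energy_space :: (real ^ 'n \<Rightarrow> complex) set). mass u = m}. energy \<alpha> u)"

definition is_minimizer :: "real \<Rightarrow> real \<Rightarrow> (real ^ 'n \<Rightarrow> complex) \<Rightarrow> bool" where
  "is_minimizer \<alpha> m u \<longleftrightarrow>
    u \<in> energy_space \<and> mass u = m \<and> energy \<alpha> u = min_energy TYPE('n) \<alpha> m"

definition normalized_ground_state :: "real \<Rightarrow> real \<Rightarrow> (real ^ 'n \<Rightarrow> complex) \<Rightarrow> bool" where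
  "normalized_ground_state \<alpha> m Q \<longleftrightarrow>
    is_minimizer \<alpha> m Q \<and> (AE x in lborel. Im (Q x) = 0 \<and> Re (Q x) > 0)"

text \<open>
  Weak form of \<open>- \<Delta> u + \<omega> u + |x|\<^sup>2 u + (I\<^sub>\<alpha> * |u|\<^sup>2) u = 0\<close>. The finiteness and local
  integrability conditions ensure that neither \<open>enn2real\<close> nor the integral of the nonlocal term
  takes a default value.
\<close>

definition weak_solution :: "real \<Rightarrow> real \<Rightarrow> (real ^ 'n \<Rightarrow> complex) \<Rightarrow> bool" where
  "weak_solution \<alpha> \<omega> u \<longleftrightarrow>
    u \<in> energy_space \<and>
    (AE x in lborel. hartree_potential \<alpha> u x < \<infinity>) \<and>
    locally_integrable (\<lambda>x. of_real (enn2real (hartree_potential \<alpha> u x)) * u x) \<and>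
    (\<forall>\<phi>. test_function \<phi> \<longrightarrow>
      (LINT x|lborel. (\<Sum>i\<in>UNIV. weak_gradient u x $ i * partial_deriv i \<phi> x)
        + of_real \<omega> * u x * \<phi> x
        + of_real ((norm x)\<^sup>2) * u x * \<phi> x
        + of_real (enn2real (hartree_potential \<alpha> u x)) * u x * \<phi> x) = 0)"

end

theory Submission
  imports Defs
begin

text \<open>
  The kinetic energy is written as a supremum of difference quotients, which reduces inequalities for it
  to pointwise inequalities between increments. Hence \<open>|u|\<close> has at most the kinetic energy of \<open>u\<close>, and
  \<open>sqrt ((1 - t) |u|\<^sup>2 + t |v|\<^sup>2)\<close> has at most the interpolated one. The Riesz kernel is a superposition of
  Gaussians, so the nonlocal term is a positive definite quadratic form in \<open>|u|\<^sup>2\<close>, strictly so on functions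
  of finite mass. The energy is therefore strictly convex in \<open>|u|\<^sup>2\<close>, and all minimizers have the same modulus.
  Convexity also yields existence: almost minimizers that almost maximize a strictly concave functional
  converge.

  For the phase, perturb only the positive part of \<open>Re u\<close> towards a positive reference function. The
  convexity defect of the kinetic energy bounds the increments of a logarithm which blows up on the zero
  set, so this positive part vanishes or is positive almost everywhere. Applied to all rotations
  \<open>e\<^sup>i\<^sup>s u\<close>, this forces the phase of \<open>u\<close> to be constant. The equation is the first variation of the energy.
\<close>

section \<open>Translations\<close>

text \<open>Two obstacles shape the details. The nonlocal energy may be infinite on the energy
  space, so a minimizer cannot be perturbed freely: it is moved towards the explicit function
  \<open>ref\<close>, exp(-|x|), whose energy is finite and which is bounded below on balls, or
  along test functions, which \<open>ref\<close> dominates up to a constant. And differences of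
  infinite quantities are meaningless, so inequalities in \<open>ennreal\<close> stay free of
  subtraction (positive definiteness of the nonlocal form D reads 2 D(a,b) \<le> D(a,a) + D(b,b))
  until finiteness permits passing to real numbers.

  Strict convexity comes from the nonlocal term; the kinetic part enters the uniqueness proof only
  as a convex functional. Its convexity defect plays the part of a maximum principle: minimality
  makes the defect at most of order t when a fraction t of \<open>ref\<close> is blended in, so
  after division by t the weighted increments of the logarithm stay bounded as t tends to 0. Mass
  cannot escape in the limit, because the trap controls the tails while bounded kinetic energy and
  convergence almost everywhere control the rest.\<close>

lemma nn_integral_translate:
  fixes f :: "'a::euclidean_space \<Rightarrow> ennreal"
  assumes [measurable]: "f \<in> borel_measurable borel"
  shows "(\<integral>\<^sup>+x. f (x + z) \<partial>lborel) = (\<integral>\<^sup>+x. f x \<partial>lborel)"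
proof -
  have "(\<integral>\<^sup>+x. f x \<partial>lborel) = (\<integral>\<^sup>+x. f x \<partial>distr lborel borel ((+) z))"
    by (simp add: lborel_distr_plus)
  also have "\<dots> = (\<integral>\<^sup>+x. f (x + z) \<partial>lborel)"
    by (subst nn_integral_distr) (auto simp: add.commute)
  finally show ?thesis by simp
qed

lemma integrable_translate:
  fixes f :: "'a::euclidean_space \<Rightarrow> 'b::{banach, second_countable_topology}"
  assumes "integrable lborel f"
  shows "integrable lborel (\<lambda>x. f (x + z))"
proof -
  have [measurable]: "f \<in> borel_measurable borel"
    using assms by (auto dest: borel_measurable_integrable)
  have "integrable (distr lborel borel ((+) z)) f"
    using assms by (simp add: lborel_distr_plus)
  then have "integrable lborel (\<lambda>x. f (z + x))"
    by (subst (asm) integrable_distr_eq) auto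
  then show ?thesis by (simp add: add.commute)
qed

lemma integral_translate:
  fixes f :: "'a::euclidean_space \<Rightarrow> 'b::{banach, second_countable_topology}"
  assumes [measurable]: "f \<in> borel_measurable borel"
  shows "(LINT x|lborel. f (x + z)) = (LINT x|lborel. f x)"
proof -
  have "(LINT x|lborel. f x) = (LINT x|distr lborel borel ((+) z). f x)"
    by (simp add: lborel_distr_plus)
  also have "\<dots> = (LINT x|lborel. f (x + z))"
    by (subst integral_distr) (auto simp: add.commute)
  finally show ?thesis by simp
qed

lemma AE_translate:
  fixes P :: "'a::euclidean_space \<Rightarrow> bool"
  assumes "AE x in lborel. P x"
  shows "AE x in lborel. P (x + z)"
proof -
  obtain N where N: "N \<in> null_sets lborel" "{x. \<not> P x} \<subseteq> N"
    using assms by (auto simp: eventually_ae_filter)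
  have Nm[measurable]: "N \<in> sets borel" using N by auto
  have "(\<integral>\<^sup>+x. indicator N (x + z) \<partial>lborel) = (\<integral>\<^sup>+x. indicator N x \<partial>(lborel::'a measure))"
    by (rule nn_integral_translate) auto
  also have "\<dots> = 0" using N by auto
  finally have "AE x in lborel. indicator N (x + z) = (0::ennreal)"
    by (subst (asm) nn_integral_0_iff_AE) auto
  then show ?thesis
    by eventually_elim (use N(2) in \<open>auto simp: indicator_def split: if_splits\<close>)
qed

section \<open>Test functions\<close>

lemma partial_derivI:
  "(f has_derivative f') (at x) \<Longrightarrow> partial_deriv i f x = f' (axis i 1)"
  unfolding partial_deriv_def by (metis frechet_derivative_at)

lemma C_k_continuous: "C_k k f \<Longrightarrow> continuous_on UNIV f"
  by (cases k) (auto intro: continuous_at_imp_continuous_on differentiable_imp_continuous_within)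

lemma C_k_Suc_imp: "C_k (Suc k) f \<Longrightarrow> C_k k f"
proof (induction k arbitrary: f)
  case 0
  then show ?case using C_k_continuous[OF 0] by simp
next
  case (Suc k)
  then show ?case by (metis C_k.simps(2))
qed

lemma C_k_add: "C_k k f \<Longrightarrow> C_k k g \<Longrightarrow> C_k k (\<lambda>x. f x + g x)"
proof (induction k arbitrary: f g)
  case 0
  then show ?case by (auto intro: continuous_intros)
next
  case (Suc k)
  have "partial_deriv i (\<lambda>x. f x + g x) = (\<lambda>x. partial_deriv i f x + partial_deriv i g x)" for i
  proof
    fix x
    have "(f has_derivative frechet_derivative f (at x)) (at x)"
         "(g has_derivative frechet_derivative g (at x)) (at x)"
      using Suc.prems by (auto simp: frechet_derivative_works[symmetric])
    then show "partial_deriv i (\<lambda>x. f x + g x) x = partial_deriv i f x + partial_deriv i g x"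
      unfolding partial_deriv_def[of _ f] partial_deriv_def[of _ g]
      by (intro partial_derivI has_derivative_add)
  qed
  then show ?case using Suc by auto
qed

lemma C_k_mult: "C_k k f \<Longrightarrow> C_k k g \<Longrightarrow> C_k k (\<lambda>x. f x * g x)"
proof (induction k arbitrary: f g)
  case 0
  then show ?case by (auto intro: continuous_intros)
next
  case (Suc k)
  have "partial_deriv i (\<lambda>x. f x * g x) =
      (\<lambda>x. f x * partial_deriv i g x + partial_deriv i f x * g x)" for i
  proof
    fix x
    have "(f has_derivative frechet_derivative f (at x)) (at x)"
         "(g has_derivative frechet_derivative g (at x)) (at x)"
      using Suc.prems by (auto simp: frechet_derivative_works[symmetric])
    then show "partial_deriv i (\<lambda>x. f x * g x) x = f x * partial_deriv i g x + partial_deriv i f x * g x"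
      unfolding partial_deriv_def[of _ f] partial_deriv_def[of _ g]
      by (intro partial_derivI has_derivative_mult)
  qed
  moreover have "C_k k (\<lambda>x. f x * partial_deriv i g x + partial_deriv i f x * g x)" for i
    using Suc.prems C_k_Suc_imp by (intro C_k_add Suc.IH) auto
  ultimately show ?case using Suc.prems by auto
qed

lemma C_k_bounded_linear:
  assumes "bounded_linear L"
  shows "C_k k f \<Longrightarrow> C_k k (\<lambda>x. L (f x))"
proof (induction k arbitrary: f)
  case 0
  then show ?case using assms by (auto intro: bounded_linear.continuous_on)
next
  case (Suc k)
  have d: "((\<lambda>x. L (f x)) has_derivative (\<lambda>h. L (frechet_derivative f (at x) h))) (at x)" for x
    using Suc.prems by (intro bounded_linear.has_derivative[OF assms])
      (auto simp: frechet_derivative_works[symmetric])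
  have "partial_deriv i (\<lambda>x. L (f x)) = (\<lambda>x. L (partial_deriv i f x))" for i
    using partial_derivI[OF d] by (auto simp: partial_deriv_def)
  then show ?case using Suc d by (auto simp: differentiable_def)
qed

lemma C_k_translate: "C_k k f \<Longrightarrow> C_k k (\<lambda>x. f (x + c))"
proof (induction k arbitrary: f)
  case 0
  then show ?case
    by (auto intro!: continuous_on_compose2[of UNIV f UNIV "\<lambda>x. x + c"] continuous_intros)
next
  case (Suc k)
  have d: "((\<lambda>x. f (x + c)) has_derivative frechet_derivative f (at (x + c))) (at x)" for x
  proof -
    have "(f has_derivative frechet_derivative f (at (x + c))) (at (x + c))"
      using Suc.prems by (auto simp: frechet_derivative_works[symmetric])
    from has_derivative_compose[of "\<lambda>x. x + c" "\<lambda>h. h" x UNIV f, OF _ this]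
    show ?thesis by (simp add: has_derivative_ident has_derivative_add_const)
  qed
  have "partial_deriv i (\<lambda>x. f (x + c)) = (\<lambda>x. partial_deriv i f (x + c))" for i
    using partial_derivI[OF d] by (auto simp: partial_deriv_def)
  then show ?case using Suc d by (auto simp: differentiable_def)
qed

lemma C_k_const: "C_k k (\<lambda>_::real ^ 'n. c)"
proof (induction k arbitrary: c)
  case (Suc k)
  have "partial_deriv i (\<lambda>_::real ^ 'n. c) = (\<lambda>_. 0)" for i
    using partial_derivI[OF has_derivative_const[of c]] by auto
  then show ?case using Suc by auto
qed auto

lemma C_k_prod: "finite I \<Longrightarrow> (\<And>j. j \<in> I \<Longrightarrow> C_k k (f j)) \<Longrightarrow> C_k k (\<lambda>x. \<Prod>j\<in>I. f j x)"
  by (induction I rule: finite_induct) (auto intro: C_k_const C_k_mult)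

text \<open>The functions \<open>exp (-1/s) / s^m\<close> on \<open>s > 0\<close>, extended by zero, have derivatives in their own
  linear span.\<close>

definition rbump :: "nat \<Rightarrow> real \<Rightarrow> real" where
  "rbump m s = (if s > 0 then exp (- 1 / s) / s ^ m else 0)"

text \<open>With n = m + 2, raising exp y \<ge> y at y = 1/(n s) to the n-th power gives exp (1/s)
  \<ge> (1/(n s))^n; two powers of s remain after division by s^m. The quadratic bound is what makes
  the derivative at 0 exist and vanish.\<close>

lemma abs_rbump_le: "\<bar>rbump m s\<bar> \<le> real (m + 2) ^ (m + 2) * s\<^sup>2"
proof (cases "s > 0")
  case True
  obtain n where n: "n = m + 2" by simp
  then have "real n > 0" by simp
  have "(1 / (real n * s)) ^ n \<le> exp (1 / (real n * s)) ^ n"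
    using True by (intro power_mono order_trans[OF _ exp_ge_add_one_self]) auto
  also have "\<dots> = exp (1 / s)"
  proof -
    have "real n * (1 / (real n * s)) = 1 / s" using True \<open>real n > 0\<close> by simp
    then show ?thesis by (metis exp_of_nat_mult)
  qed
  finally have "1 / (real n ^ n * s ^ n) \<le> exp (1 / s)"
    by (simp add: power_divide power_mult_distrib)
  then have "exp (- 1 / s) \<le> real n ^ n * s ^ n"
    using True \<open>real n > 0\<close> by (simp add: exp_minus field_simps)
  then have "exp (- 1 / s) / s ^ m \<le> real n ^ n * s ^ n / s ^ m"
    using True by (intro divide_right_mono) auto
  also have "\<dots> = real n ^ n * s\<^sup>2" using True by (simp add: n power_add power2_eq_square)
  finally show ?thesis using True by (simp add: rbump_def n)
qed (simp add: rbump_def)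

lemma DERIV_rbump: "(rbump m has_real_derivative rbump (m + 2) s - real m * rbump (m + 1) s) (at s)"
proof -
  consider "s > 0" | "s < 0" | "s = 0" by linarith
  then show ?thesis
  proof cases
    case 1
    have "((\<lambda>s. exp (- 1 / s) / s ^ m) has_real_derivative
        (exp (- 1 / s) * (1 / s\<^sup>2) * s ^ m - exp (- 1 / s) * (real m * s ^ (m - 1))) / (s ^ m * s ^ m)) (at s)"
      using 1 by (auto intro!: derivative_eq_intros simp: power2_eq_square)
    also have "(exp (- 1 / s) * (1 / s\<^sup>2) * s ^ m - exp (- 1 / s) * (real m * s ^ (m - 1))) / (s ^ m * s ^ m)
        = rbump (m + 2) s - real m * rbump (m + 1) s"
      using 1 by (cases m) (auto simp: rbump_def field_simps power2_eq_square)
    finally show ?thesis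
      by (rule has_field_derivative_transform_within_open[of _ _ _ "{0<..}"])
         (use 1 in \<open>auto simp: rbump_def\<close>)
  next
    case 2
    have "((\<lambda>s. 0) has_real_derivative 0) (at s)" by simp
    then have "(rbump m has_real_derivative 0) (at s)"
      by (rule has_field_derivative_transform_within_open[of _ _ _ "{..<0}"])
         (use 2 in \<open>auto simp: rbump_def\<close>)
    then show ?thesis using 2 by (simp add: rbump_def)
  next
    \<comment> \<open>The one point that is not local calculus: here the difference quotient is
      bounded by \<open>C * \<bar>h\<bar>\<close>.\<close>
    case 3
    define C where "C = real (m + 2) ^ (m + 2)"
    have "((\<lambda>h. C * \<bar>h\<bar>) \<longlongrightarrow> C * \<bar>0\<bar>) (at 0)" by (intro tendsto_intros)
    then have lim: "((\<lambda>h. C * \<bar>h\<bar>) \<longlongrightarrow> 0) (at 0)" by simp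
    have "((\<lambda>h. rbump m h / h) \<longlongrightarrow> 0) (at 0)"
    proof (rule Lim_null_comparison[OF _ lim])
      have "norm (rbump m h / h) \<le> C * \<bar>h\<bar>" if "h \<noteq> 0" for h
      proof -
        have "\<bar>rbump m h\<bar> \<le> (C * \<bar>h\<bar>) * \<bar>h\<bar>"
          using abs_rbump_le[of m h] by (simp add: C_def power2_eq_square mult.assoc)
        then show ?thesis using that by (simp add: divide_simps)
      qed
      then show "\<forall>\<^sub>F h in at 0. norm (rbump m h / h) \<le> C * \<bar>h\<bar>"
        by (auto simp: eventually_at_filter)
    qed
    then have "((\<lambda>h. (rbump m (0 + h) - rbump m 0) / h) \<longlongrightarrow> 0) (at 0)"
      by (simp add: rbump_def[of m 0])
    then show ?thesis using 3 by (simp add: DERIV_def rbump_def)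
  qed
qed

text \<open>The index m is arbitrary in the induction because each derivative passes to m + 1 and m
  + 2. The affine argument, with p of either sign, provides both faces of a box.\<close>

lemma C_k_rbump: "C_k k (\<lambda>x::real ^ 'n. complex_of_real (rbump m (p * x $ j + q)))"
proof (induction k arbitrary: m)
  case 0
  have "continuous_on UNIV (rbump m)"
    using DERIV_rbump by (meson DERIV_continuous continuous_at_imp_continuous_on)
  then show ?case
    by (auto intro!: continuous_intros continuous_on_compose2[of UNIV "rbump m"])
next
  case (Suc k)
  define l where "l = (\<lambda>x::real ^ 'n. p * x $ j + q)"
  have d: "((\<lambda>x. complex_of_real (rbump m (l x))) has_derivative
     (\<lambda>h. complex_of_real ((rbump (m + 2) (l x) - real m * rbump (m + 1) (l x)) * (p * h $ j)))) (at x)" for x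
  proof (rule bounded_linear.has_derivative[OF bounded_linear_of_real])
    have "(l has_derivative (\<lambda>h. p * h $ j)) (at x)"
      unfolding l_def
      by (auto intro!: derivative_eq_intros bounded_linear_imp_has_derivative)
    moreover have "(rbump m has_derivative (\<lambda>h. (rbump (m + 2) (l x) - real m * rbump (m + 1) (l x)) * h)) (at (l x))"
      using DERIV_rbump[of m "l x"] by (simp add: has_field_derivative_def)
    ultimately show "((\<lambda>x. rbump m (l x)) has_derivative
        (\<lambda>h. (rbump (m + 2) (l x) - real m * rbump (m + 1) (l x)) * (p * h $ j))) (at x)"
      by (rule has_derivative_compose)
  qed
  have "partial_deriv i (\<lambda>x. complex_of_real (rbump m (l x))) =
     (\<lambda>x. complex_of_real (p * axis i 1 $ j) * complex_of_real (rbump (m + 2) (l x)) +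
          complex_of_real (- real m * p * axis i 1 $ j) * complex_of_real (rbump (m + 1) (l x)))" for i
    using partial_derivI[OF d] by (auto simp: algebra_simps)
  moreover have "C_k k (\<lambda>x. complex_of_real (p * axis i 1 $ j) * complex_of_real (rbump (m + 2) (l x)) +
          complex_of_real (- real m * p * axis i 1 $ j) * complex_of_real (rbump (m + 1) (l x)))" for i :: 'n
    using Suc unfolding l_def by (intro C_k_add C_k_mult C_k_const) auto
  ultimately show ?case using d unfolding l_def by (auto simp: differentiable_def)
qed

section \<open>Closure properties of test functions\<close>

lemma test_function_iff: "test_function \<phi> \<longleftrightarrow> (\<forall>k. C_k k \<phi>) \<and> bounded {x. \<phi> x \<noteq> 0}"
  by (simp add: test_function_def)

lemma test_function_add: "test_function f \<Longrightarrow> test_function g \<Longrightarrow> test_function (\<lambda>x. f x + g x)"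
  unfolding test_function_iff
  by (auto intro: C_k_add intro: bounded_subset[of "{x. f x \<noteq> 0} \<union> {x. g x \<noteq> 0}"])

lemma test_function_linear:
  "bounded_linear L \<Longrightarrow> test_function f \<Longrightarrow> test_function (\<lambda>x. L (f x))"
proof -
  assume L: "bounded_linear L" and f: "test_function f"
  have "{x. L (f x) \<noteq> 0} \<subseteq> {x. f x \<noteq> 0}" using linear_simps(3)[OF L] by auto
  then show ?thesis using f C_k_bounded_linear[OF L] bounded_subset
    unfolding test_function_iff by blast
qed

lemma test_function_cmult: "test_function f \<Longrightarrow> test_function (\<lambda>x. c * f x)"
  by (rule test_function_linear) (auto intro: bounded_linear_intros)

lemma test_function_translate:
  assumes "test_function f"
  shows "test_function (\<lambda>x. f (x + c))"
proof -
  have "{x. f (x + c) \<noteq> 0} = (\<lambda>x. - c + x) ` {x. f x \<noteq> 0}"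
  proof (intro set_eqI iffI)
    fix x assume "x \<in> {x. f (x + c) \<noteq> 0}"
    then show "x \<in> (\<lambda>x. - c + x) ` {x. f x \<noteq> 0}"
      by (intro image_eqI[of _ _ "x + c"]) auto
  qed (auto simp: add.commute)
  then show ?thesis using assms unfolding test_function_iff
    using bounded_translation[of "{x. f x \<noteq> 0}" "- c"] by (auto intro: C_k_translate)
qed

lemma test_function_has_derivative:
  "test_function f \<Longrightarrow> (f has_derivative frechet_derivative f (at x)) (at x)"
  unfolding test_function_iff frechet_derivative_works[symmetric] by (metis C_k.simps(2))

text \<open>Off the closure f vanishes on a whole neighbourhood; a mere zero of f would say nothing
  about the derivative there.\<close>

lemma partial_deriv_eq_0:
  assumes "x \<notin> closure {x. f x \<noteq> 0}"
  shows "partial_deriv i f x = 0"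
proof -
  have "((\<lambda>_. 0) has_derivative (\<lambda>_. 0)) (at x)" by simp
  then have "(f has_derivative (\<lambda>_. 0)) (at x)"
    using assms closure_subset[of "{x. f x \<noteq> 0}"]
    by (auto intro!: has_derivative_transform_within_open[of "\<lambda>_. 0" _ x UNIV "- closure {x. f x \<noteq> 0}" f])
  from partial_derivI[OF this] show ?thesis by simp
qed

lemma test_function_partial_deriv:
  assumes "test_function f"
  shows "test_function (partial_deriv i f)"
proof -
  have "{x. partial_deriv i f x \<noteq> 0} \<subseteq> closure {x. f x \<noteq> 0}"
    using partial_deriv_eq_0 by blast
  then show ?thesis using assms unfolding test_function_iff
    by (metis C_k.simps(2) bounded_closure bounded_subset)
qed

lemma test_function_continuous: "test_function f \<Longrightarrow> continuous_on UNIV f"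
  by (meson C_k_continuous test_function_iff)

lemma test_function_measurable [measurable_dest]: "test_function f \<Longrightarrow> f \<in> borel_measurable borel"
  by (intro borel_measurable_continuous_onI test_function_continuous)

lemma test_function_support:
  assumes "test_function f"
  obtains R where "R > 0" "\<And>x. R \<le> norm x \<Longrightarrow> f x = 0"
proof -
  obtain R where "\<forall>x\<in>{x. f x \<noteq> 0}. norm x \<le> R"
    using assms by (auto simp: test_function_iff bounded_iff)
  then have "f x = 0" if "\<bar>R\<bar> + 1 \<le> norm x" for x using that by force
  then show ?thesis by (intro that[of "\<bar>R\<bar> + 1"]) auto
qed

lemma test_function_bounded:
  assumes "test_function f"
  obtains B where "B > 0" "\<And>x. norm (f x) \<le> B"
proof -
  have "compact (f ` closure {x. f x \<noteq> 0})"
    using assms test_function_continuous[OF assms]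
    by (intro compact_continuous_image) (auto simp: test_function_def intro: continuous_on_subset)
  then obtain B where B: "B > 0" "\<forall>y\<in>f ` closure {x. f x \<noteq> 0}. norm y \<le> B"
    using compact_imp_bounded bounded_pos by blast
  have "norm (f x) \<le> B" for x
    using B closure_subset[of "{x. f x \<noteq> 0}"] by (cases "f x = 0") auto
  then show ?thesis using that B by blast
qed

lemma integrable_compact_support:
  fixes f :: "real ^ 'n \<Rightarrow> 'b::{banach, second_countable_topology}"
  assumes "continuous_on UNIV f" "\<And>x. R \<le> norm x \<Longrightarrow> f x = 0"
  shows "integrable lborel f"
proof -
  have "integrable lborel (\<lambda>x. indicator (cball 0 R) x *\<^sub>R f x)"
    by (rule borel_integrable_compact) (auto intro: continuous_on_subset[OF assms(1)])
  also have "(\<lambda>x. indicator (cball 0 R) x *\<^sub>R f x) = f"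
    using assms(2) by (auto simp: indicator_def fun_eq_iff)
  finally show ?thesis .
qed

lemma integrable_test_function: "test_function f \<Longrightarrow> integrable lborel f"
  by (metis integrable_compact_support test_function_continuous test_function_support)

lemma square_integrable_test_function:
  assumes "test_function f"
  shows "square_integrable f"
proof -
  obtain R where "R > 0" "\<And>x. R \<le> norm x \<Longrightarrow> f x = 0"
    using test_function_support[OF assms] by blast
  then have "integrable lborel (\<lambda>x. (norm (f x))\<^sup>2)"
    by (intro integrable_compact_support[of _ R] continuous_intros test_function_continuous assms) auto
  then show ?thesis using assms by (auto simp: square_integrable_def)
qed

lemma test_function_mult: "test_function f \<Longrightarrow> test_function g \<Longrightarrow> test_function (\<lambda>x. f x * g x)"
proof -
  assume f: "test_function f" and g: "test_function g"
  have "{x. f x * g x \<noteq> 0} \<subseteq> {x. f x \<noteq> 0}" by auto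
  then show ?thesis using f g C_k_mult bounded_subset unfolding test_function_iff by blast
qed

section \<open>The fundamental lemma\<close>

text \<open>Open boxes are stable under intersection and generate the Borel sets, so the sets over
  which f integrates to 0 include all Borel sets. Complements need the integral over the whole
  space, which is the limit over growing boxes.\<close>

lemma AE_zero_if_box_integrals_zero:
  fixes f :: "'a::euclidean_space \<Rightarrow> real"
  assumes int: "integrable lborel f" and zero: "\<And>a b. (LINT x:box a b|lborel. f x) = 0"
  shows "AE x in lborel. f x = 0"
proof -
  have [measurable]: "f \<in> borel_measurable borel"
    using int by (auto dest: borel_measurable_integrable)
  have sint: "set_integrable lborel A f" if "A \<in> sets borel" for A
    using that int unfolding set_integrable_def by (intro integrable_mult_indicator) auto
  let ?G = "range (\<lambda>(a, b). box a b :: 'a set)"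
  let ?B = "\<lambda>n::nat. box (- (real n *\<^sub>R One)) (real n *\<^sub>R One) :: 'a set"
  have "(\<lambda>n. LINT x:?B n|lborel. f x) \<longlonglongrightarrow> (LINT x|lborel. f x)"
    unfolding set_lebesgue_integral_def
  proof (rule integral_dominated_convergence[where w = "\<lambda>x. norm (f x)"])
    have "(\<lambda>n. indicator (?B n) x *\<^sub>R f x) \<longlonglongrightarrow> f x" for x
    proof -
      obtain n where n: "x \<in> ?B n" using UN_box_eq_UNIV by blast
      have "x \<in> ?B k" if "k \<ge> n" for k
      proof -
        have "real n \<le> real k" using that by simp
        then show ?thesis using n by (force simp: mem_box)
      qed
      then show ?thesis
        by (intro tendsto_eventually) (auto simp: eventually_sequentially indicator_def intro!: exI[of _ n])
    qed
    then show "AE x in lborel. (\<lambda>n. indicator (?B n) x *\<^sub>R f x) \<longlonglongrightarrow> f x" by simp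
  qed (use int in \<open>auto simp: indicator_def\<close>)
  then have tot: "(LINT x|lborel. f x) = 0" by (simp add: zero LIMSEQ_const_iff)
  have all: "(LINT x:A|lborel. f x) = 0" if "A \<in> sets borel" for A
  proof (rule sigma_sets_induct_disjoint[of ?G UNIV A])
    show "Int_stable ?G" by (auto simp: Int_stable_def box_Int_box)
    have eq: "sets (borel::'a measure) = sigma_sets UNIV ?G" by (simp add: borel_eq_box)
    then show "A \<in> sigma_sets UNIV ?G" using that by blast
    show "(LINT x:UNIV - B|lborel. f x) = 0"
      if "B \<in> sigma_sets UNIV ?G" "(LINT x:B|lborel. f x) = 0" for B
    proof -
      have [measurable]: "B \<in> sets borel" using that eq by blast
      have "(LINT x:B \<union> (UNIV - B)|lborel. f x) = (LINT x:B|lborel. f x) + (LINT x:UNIV - B|lborel. f x)"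
        by (intro set_integral_Un sint) auto
      then show ?thesis using that tot by (simp add: set_lebesgue_integral_def)
    qed
    show "(LINT x:(\<Union>i. B i)|lborel. f x) = 0"
      if "disjoint_family B" "range B \<subseteq> sigma_sets UNIV ?G" "\<And>i. (LINT x:B i|lborel. f x) = 0"
      for B :: "nat \<Rightarrow> 'a set"
    proof -
      have m: "B i \<in> sets lborel" for i using that(2) eq by auto
      have "(LINT x:(\<Union>i. B i)|lborel. f x) = (\<Sum>i. (LINT x:(B i)|lborel. f x))"
        using m that(1) by (intro lebesgue_integral_countable_add sint) (auto simp: disjoint_family_on_def)
      then show ?thesis using that(3) by simp
    qed
  qed (use zero in \<open>auto simp: set_lebesgue_integral_def\<close>)
  have "AE x in lborel. f x = (\<lambda>_. 0) x"
    by (rule density_unique_real) (use int all in auto)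
  then show ?thesis by simp
qed

section \<open>Smooth approximation of indicators of boxes\<close>

lemma rbump_0_tendsto: "(\<lambda>n. rbump 0 (real n * s)) \<longlonglongrightarrow> (if s > 0 then 1 else 0)"
proof (cases "s > 0")
  case True
  have "(\<lambda>n. exp (- (1 / s) * (1 / real n))) \<longlonglongrightarrow> exp (- (1 / s) * 0)"
    by (intro tendsto_intros lim_1_over_n)
  then have "(\<lambda>n. exp (- (1 / s) * (1 / real n))) \<longlonglongrightarrow> 1" by simp
  then have "(\<lambda>n. rbump 0 (real n * s)) \<longlonglongrightarrow> 1"
    by (rule Lim_transform_eventually)
       (use True in \<open>auto simp: eventually_sequentially rbump_def mult.commute intro!: exI[of _ 1]\<close>)
  then show ?thesis using True by simp
next
  case False
  then have "rbump 0 (real n * s) = 0" for n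
    by (simp add: rbump_def zero_less_mult_iff)
  then show ?thesis using False by simp
qed

lemma rbump_0_bounds: "0 \<le> rbump 0 s" "rbump 0 s \<le> 1"
  by (auto simp: rbump_def)

text \<open>Test functions with values in [0,1] and support in \<open>cbox a b\<close>, converging
  pointwise to the indicator of the open box as n grows. Each coordinate contributes one factor for
  either face.\<close>

definition box_bump :: "real ^ 'n \<Rightarrow> real ^ 'n \<Rightarrow> nat \<Rightarrow> real ^ 'n \<Rightarrow> real" where
  "box_bump a b n x = (\<Prod>j\<in>UNIV. rbump 0 (real n * (x $ j - a $ j)) * rbump 0 (real n * (b $ j - x $ j)))"

lemma box_bump_bounds: "0 \<le> box_bump a b n x" "box_bump a b n x \<le> 1"
  unfolding box_bump_def using rbump_0_bounds
  by (auto intro!: prod_nonneg prod_le_1 mult_le_one)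

lemma box_bump_eq_0: "x \<notin> cbox a b \<Longrightarrow> box_bump a b n x = 0"
proof -
  assume "x \<notin> cbox a b"
  then obtain j where "x $ j < a $ j \<or> b $ j < x $ j" by (auto simp: mem_box_cart not_le)
  then have "rbump 0 (real n * (x $ j - a $ j)) * rbump 0 (real n * (b $ j - x $ j)) = 0"
    by (auto simp: rbump_def zero_less_mult_iff)
  then show ?thesis unfolding box_bump_def by (intro prod_zero) auto
qed

lemma box_bump_tendsto: "(\<lambda>n. box_bump a b n x) \<longlonglongrightarrow> indicator (box a b) x"
proof -
  have "(\<lambda>n. box_bump a b n x) \<longlonglongrightarrow>
     (\<Prod>j\<in>UNIV. (if x $ j - a $ j > 0 then 1 else 0) * (if b $ j - x $ j > 0 then 1 else 0))"
    unfolding box_bump_def by (intro tendsto_intros rbump_0_tendsto)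
  also have "(\<Prod>j\<in>UNIV. (if x $ j - a $ j > 0 then 1 else 0) * (if b $ j - x $ j > 0 then 1 else 0))
     = (indicator (box a b) x :: real)"
  proof (cases "x \<in> box a b")
    case False
    then obtain j where "\<not> (a $ j < x $ j \<and> x $ j < b $ j)" by (force simp: mem_box_cart)
    then show ?thesis using False by (intro trans[OF prod_zero]) (auto intro!: bexI[of _ j])
  qed (auto simp: mem_box_cart)
  finally show ?thesis .
qed

lemma test_function_box_bump: "test_function (\<lambda>x. complex_of_real (box_bump a b n x))"
proof -
  have "{x. complex_of_real (box_bump a b n x) \<noteq> 0} \<subseteq> cbox a b"
    using box_bump_eq_0 by fastforce
  moreover have "C_k k (\<lambda>x. complex_of_real (box_bump a b n x))" for k
  proof -
    have 1: "real n * (x $ j - a $ j) = real n * x $ j + (- real n * a $ j)" for x j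
      by (simp add: algebra_simps)
    have 2: "real n * (b $ j - x $ j) = - real n * x $ j + real n * b $ j" for x j
      by (simp add: algebra_simps)
    show ?thesis unfolding box_bump_def of_real_prod of_real_mult 1 2
      by (intro C_k_prod C_k_mult C_k_rbump) auto
  qed
  ultimately show ?thesis unfolding test_function_iff using bounded_subset[OF bounded_cbox] by blast
qed

text \<open>Dominated convergence turns bumps into indicators of boxes. Only bumps occur in the
  hypothesis, because the Gaussian argument for the nonlocal term tests against continuous functions
  with values in [0,1].\<close>

lemma AE_zero_if_bump_integrals_zero:
  fixes f :: "real ^ 'n \<Rightarrow> complex"
  assumes loc: "locally_integrable f"
    and zero: "\<And>a b n. (LINT x|lborel. f x * complex_of_real (box_bump a b n x)) = 0"
  shows "AE x in lborel. f x = 0"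
proof -
  have [measurable]: "f \<in> borel_measurable borel" using loc by (auto simp: locally_integrable_def)
  have sint: "set_integrable lborel (cbox a b) f" for a b
    using loc by (auto simp: locally_integrable_def)
  have sint': "set_integrable lborel (box a b) f" for a b
    by (rule set_integrable_subset[OF sint[of a b]]) (auto intro: subsetD[OF box_subset_cbox])
  have box: "(LINT x:box a b|lborel. f x) = 0" for a b
  proof -
    have "(\<lambda>n. LINT x|lborel. f x * complex_of_real (box_bump a b n x)) \<longlonglongrightarrow>
        (LINT x|lborel. f x * complex_of_real (indicator (box a b) x))"
    proof (rule integral_dominated_convergence[where w = "\<lambda>x. norm (indicator (cbox a b) x *\<^sub>R f x)"])
      show "AE x in lborel. (\<lambda>n. f x * complex_of_real (box_bump a b n x)) \<longlonglongrightarrow>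
          f x * complex_of_real (indicator (box a b) x)"
        by (intro AE_I2 tendsto_intros box_bump_tendsto)
      show "integrable lborel (\<lambda>x. norm (indicator (cbox a b) x *\<^sub>R f x))"
        by (rule integrable_norm[OF sint[of a b, unfolded set_integrable_def]])
      show "AE x in lborel. norm (f x * complex_of_real (box_bump a b n x)) \<le>
          norm (indicator (cbox a b) x *\<^sub>R f x)" for n
      proof (intro AE_I2)
        fix x show "norm (f x * complex_of_real (box_bump a b n x)) \<le> norm (indicator (cbox a b) x *\<^sub>R f x)"
          using box_bump_bounds[of a b n x] box_bump_eq_0[of x a b n]
          by (cases "x \<in> cbox a b") (auto simp: norm_mult mult_left_le)
      qed
    qed (use test_function_measurable[OF test_function_box_bump] in \<open>auto intro!: borel_measurable_times\<close>)
    then have "(LINT x|lborel. f x * complex_of_real (indicator (box a b) x)) = 0"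
      by (simp add: zero LIMSEQ_const_iff)
    then show ?thesis
      by (simp add: set_lebesgue_integral_def scaleR_conv_of_real mult.commute)
  qed
  let ?B = "\<lambda>n::nat. box (- (real n *\<^sub>R One)) (real n *\<^sub>R One) :: (real^'n) set"
  have "AE x in lborel. indicator (?B n) x *\<^sub>R f x = 0" for n
  proof -
    \<comment> \<open>As f is only locally integrable, it is cut off to a large box. Boxes intersect
      in boxes, so the integrals of the truncation over boxes vanish as well.\<close>
    let ?h = "\<lambda>x. indicator (?B n) x *\<^sub>R f x"
    have i: "integrable lborel ?h" by (rule sint'[unfolded set_integrable_def])
    have b: "(LINT x:box a b|lborel. ?h x) = 0" for a b
    proof -
      obtain c d where cd: "box a b \<inter> ?B n = box c d" by (simp only: box_Int_box)
      have "(LINT x:box a b|lborel. ?h x) = (LINT x:box a b \<inter> ?B n|lborel. f x)"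
        unfolding set_lebesgue_integral_def by (simp add: indicator_inter_arith)
      then show ?thesis using box cd by simp
    qed
    have bi: "set_integrable lborel (box a b) ?h" for a b
      unfolding set_integrable_def by (rule integrable_mult_indicator[OF _ i]) auto
    have "AE x in lborel. Re (?h x) = 0"
    proof (rule AE_zero_if_box_integrals_zero)
      show "(LINT x:box a b|lborel. Re (?h x)) = 0" for a b
        using b[of a b] integral_Re[OF bi[of a b, unfolded set_integrable_def]]
        by (simp add: set_lebesgue_integral_def mult.assoc)
    qed (rule integrable_Re[OF i])
    moreover have "AE x in lborel. Im (?h x) = 0"
    proof (rule AE_zero_if_box_integrals_zero)
      show "(LINT x:box a b|lborel. Im (?h x)) = 0" for a b
        using b[of a b] integral_Im[OF bi[of a b, unfolded set_integrable_def]]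
        by (simp add: set_lebesgue_integral_def mult.assoc)
    qed (rule integrable_Im[OF i])
    ultimately show ?thesis by eventually_elim (auto simp: complex_eq_iff)
  qed
  then have "AE x in lborel. \<forall>n. indicator (?B n) x *\<^sub>R f x = 0" unfolding AE_all_countable by blast
  then show ?thesis
  proof eventually_elim
    case (elim x)
    obtain n where "x \<in> ?B n" using UN_box_eq_UNIV by blast
    then show ?case using spec[OF elim, of n] by simp
  qed
qed

lemma fundamental_lemma:
  fixes f :: "real ^ 'n \<Rightarrow> complex"
  assumes "locally_integrable f"
    and "\<And>\<phi>. test_function \<phi> \<Longrightarrow> (LINT x|lborel. f x * \<phi> x) = 0"
  shows "AE x in lborel. f x = 0"
  using assms by (intro AE_zero_if_bump_integrals_zero) (auto intro: test_function_box_bump)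

section \<open>Difference quotients of test functions\<close>

lemma test_function_vector_derivative:
  assumes "test_function \<phi>"
  shows "((\<lambda>t. \<phi> (x + t *\<^sub>R axis i 1)) has_vector_derivative partial_deriv i \<phi> (x + t *\<^sub>R axis i 1)) (at t)"
proof -
  let ?p = "x + t *\<^sub>R axis i (1::real)"
  have "((\<lambda>t. x + t *\<^sub>R axis i 1) has_derivative (\<lambda>h. h *\<^sub>R axis i 1)) (at t)"
    by (auto intro!: derivative_eq_intros)
  from has_derivative_compose[OF this test_function_has_derivative[OF assms]]
  have d: "((\<lambda>t. \<phi> (x + t *\<^sub>R axis i 1)) has_derivative
      (\<lambda>h. frechet_derivative \<phi> (at ?p) (h *\<^sub>R axis i 1))) (at t)" .
  have "frechet_derivative \<phi> (at ?p) (h *\<^sub>R axis i 1) = h *\<^sub>R partial_deriv i \<phi> ?p" for h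
    unfolding partial_deriv_def
    using linear_frechet_derivative[OF differentiableI[OF test_function_has_derivative[OF assms]]]
    by (rule linear_scale)
  with d show ?thesis by (simp add: has_vector_derivative_def)
qed

lemma test_function_lipschitz:
  assumes "test_function \<phi>"
  obtains B where "B > 0" "\<And>x h. norm (\<phi> (x + h *\<^sub>R axis i 1) - \<phi> x) \<le> B * \<bar>h\<bar>"
proof -
  obtain B where B: "B > 0" "\<And>x. norm (partial_deriv i \<phi> x) \<le> B"
    using test_function_bounded[OF test_function_partial_deriv[OF assms]] by blast
  have "norm (\<phi> (x + h *\<^sub>R axis i 1) - \<phi> (x + 0 *\<^sub>R axis i 1)) \<le> B * norm (h - 0)" for x h
  proof (rule differentiable_bound[of UNIV "\<lambda>t. \<phi> (x + t *\<^sub>R axis i 1)"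
        "\<lambda>t h. h *\<^sub>R partial_deriv i \<phi> (x + t *\<^sub>R axis i 1)"])
    show "((\<lambda>t. \<phi> (x + t *\<^sub>R axis i 1)) has_derivative (\<lambda>h. h *\<^sub>R partial_deriv i \<phi> (x + t *\<^sub>R axis i 1)))
       (at t within UNIV)" for t
      using test_function_vector_derivative[OF assms, of x i t] by (simp add: has_vector_derivative_def)
    show "onorm (\<lambda>h. h *\<^sub>R partial_deriv i \<phi> (x + t *\<^sub>R axis i 1)) \<le> B" for t
      by (rule onorm_le) (use mult_left_mono[OF B(2) abs_ge_zero] in \<open>auto simp: mult.commute[of B]\<close>)
  qed auto
  then show ?thesis using that B by auto
qed

lemma difference_quotient_tendsto:
  assumes u: "locally_integrable u" and \<phi>: "test_function \<phi>"
    and h: "h \<longlonglongrightarrow> 0" "\<And>n. h n \<noteq> 0"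
  shows "(\<lambda>n. LINT x|lborel. u x * ((\<phi> (x + h n *\<^sub>R axis i 1) - \<phi> x) / of_real (h n))) \<longlonglongrightarrow>
     (LINT x|lborel. u x * partial_deriv i \<phi> x :: complex)"
proof -
  have [measurable]: "u \<in> borel_measurable borel" using u by (auto simp: locally_integrable_def)
  have [measurable]: "\<phi> \<in> borel_measurable borel" "partial_deriv i \<phi> \<in> borel_measurable borel"
    using \<phi> by (auto intro: test_function_measurable test_function_partial_deriv)
  obtain R where R: "R > 0" "\<And>x. R \<le> norm x \<Longrightarrow> \<phi> x = 0" using test_function_support[OF \<phi>] by blast
  obtain B where B: "B > 0" "\<And>x h. norm (\<phi> (x + h *\<^sub>R axis i 1) - \<phi> x) \<le> B * \<bar>h\<bar>"
    using test_function_lipschitz[OF \<phi>] by blast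
  \<comment> \<open>A bound for the steps keeps all shifted supports inside one ball of radius R +
    H, on which u is integrable.\<close>
  obtain H where H: "\<And>n. \<bar>h n\<bar> \<le> H"
    using h(1) convergent_imp_Bseq[of h] by (auto simp: convergent_def Bseq_def)
  show ?thesis
  proof (rule integral_dominated_convergence[where w = "\<lambda>x. B * norm (indicator (cball 0 (R + H)) x *\<^sub>R u x)"])
    have "set_integrable lborel (cball 0 (R + H)) u" using u by (auto simp: locally_integrable_def)
    then show "integrable lborel (\<lambda>x. B * norm (indicator (cball 0 (R + H)) x *\<^sub>R u x))"
      unfolding set_integrable_def by (intro integrable_mult_right integrable_norm)
    have "(\<lambda>n. (\<phi> (x + h n *\<^sub>R axis i 1) - \<phi> x) / of_real (h n)) \<longlonglongrightarrow> partial_deriv i \<phi> x" for x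
    proof -
      have "((\<lambda>s. (\<phi> (x + s *\<^sub>R axis i 1) - \<phi> x) /\<^sub>R s) \<longlongrightarrow> partial_deriv i \<phi> x) (at 0)"
      proof -
        have "((\<lambda>s. norm (\<phi> (x + s *\<^sub>R axis i 1) - \<phi> x - s *\<^sub>R partial_deriv i \<phi> x) / \<bar>s\<bar>) \<longlongrightarrow> 0) (at 0)"
          using test_function_vector_derivative[OF \<phi>, of x i 0]
          by (simp add: has_vector_derivative_def has_derivative_iff_norm)
        then have "((\<lambda>s. norm ((\<phi> (x + s *\<^sub>R axis i 1) - \<phi> x) /\<^sub>R s - partial_deriv i \<phi> x)) \<longlongrightarrow> 0) (at 0)"
        proof (rule Lim_transform_eventually)
          have "norm (d - s *\<^sub>R p) / \<bar>s\<bar> = norm (d /\<^sub>R s - p)" if "s \<noteq> 0" for d p :: complex and s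
          proof -
            have "d /\<^sub>R s - p = (d - s *\<^sub>R p) /\<^sub>R s" using that by (simp add: algebra_simps)
            then show ?thesis by (simp add: divide_inverse mult.commute)
          qed
          then show "\<forall>\<^sub>F s in at 0. norm (\<phi> (x + s *\<^sub>R axis i 1) - \<phi> x - s *\<^sub>R partial_deriv i \<phi> x) / \<bar>s\<bar> =
             norm ((\<phi> (x + s *\<^sub>R axis i 1) - \<phi> x) /\<^sub>R s - partial_deriv i \<phi> x)"
            by (auto simp: eventually_at_filter)
        qed
        then show ?thesis by (simp add: tendsto_dist_iff[of _ "partial_deriv i \<phi> x"] dist_norm)
      qed
      then have "(\<lambda>n. (\<phi> (x + h n *\<^sub>R axis i 1) - \<phi> x) /\<^sub>R h n) \<longlonglongrightarrow> partial_deriv i \<phi> x"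
      proof (rule filterlim_compose)
        show "filterlim h (at 0) sequentially" using h by (simp add: filterlim_at)
      qed
      then show ?thesis by (simp add: scaleR_conv_of_real divide_inverse mult.commute)
    qed
    then show "AE x in lborel. (\<lambda>n. u x * ((\<phi> (x + h n *\<^sub>R axis i 1) - \<phi> x) / of_real (h n))) \<longlonglongrightarrow>
        u x * partial_deriv i \<phi> x"
      by (intro AE_I2 tendsto_mult tendsto_const)
    show "AE x in lborel. norm (u x * ((\<phi> (x + h n *\<^sub>R axis i 1) - \<phi> x) / of_real (h n))) \<le>
       B * norm (indicator (cball 0 (R + H)) x *\<^sub>R u x)" for n
    proof (intro AE_I2)
      fix x
      show "norm (u x * ((\<phi> (x + h n *\<^sub>R axis i 1) - \<phi> x) / of_real (h n))) \<le>
       B * norm (indicator (cball 0 (R + H)) x *\<^sub>R u x)"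
      proof (cases "norm x \<le> R + H")
        case True
        have "norm ((\<phi> (x + h n *\<^sub>R axis i 1) - \<phi> x) / of_real (h n)) \<le> B"
          using B(2)[of x "h n"] h(2)[of n] by (simp add: norm_divide divide_simps)
        from mult_left_mono[OF this norm_ge_zero[of "u x"]] show ?thesis using True
          by (simp only: norm_mult) (simp add: mult.commute[of B])
      next
        case False
        have "norm x \<le> norm (x + h n *\<^sub>R axis i (1::real)) + norm (h n *\<^sub>R axis i (1::real))"
          by (metis add_diff_cancel norm_triangle_ineq4)
        then have "R \<le> norm (x + h n *\<^sub>R axis i 1)" "R \<le> norm x"
          using False H[of n] by auto
        then show ?thesis using R(2) B(1) by simp
      qed
    qed
  qed measurable
qed

text \<open>Difference quotients tested against the constant 1 integrate to 0 by translation
  invariance, and so does their limit.\<close>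

lemma integral_partial_deriv_eq_0:
  assumes "test_function \<phi>"
  shows "(LINT x|lborel. partial_deriv i \<phi> x) = 0"
proof -
  have [measurable]: "\<phi> \<in> borel_measurable borel" using assms by (rule test_function_measurable)
  have one: "locally_integrable (\<lambda>x::real^'a. 1 :: complex)"
    unfolding locally_integrable_def
    by (auto simp: set_integrable_def intro!: integrable_scaleR_left integrable_real_indicator
        emeasure_bounded_finite compact_imp_bounded borel_compact)
  have "(\<lambda>n. LINT x|lborel. 1 * ((\<phi> (x + (1 / real (Suc n)) *\<^sub>R axis i 1) - \<phi> x) / of_real (1 / real (Suc n))))
     \<longlonglongrightarrow> (LINT x|lborel. 1 * partial_deriv i \<phi> x)"
    by (rule difference_quotient_tendsto[OF one assms]) (use LIMSEQ_Suc[OF lim_1_over_n] in auto)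
  moreover have "(LINT x|lborel. 1 * ((\<phi> (x + h *\<^sub>R axis i 1) - \<phi> x) / of_real h)) = 0" for h
    using integrable_test_function[OF assms]
    by (simp add: integral_translate integrable_translate Bochner_Integration.integral_diff)
  ultimately have "(\<lambda>n. 0) \<longlonglongrightarrow> (LINT x|lborel. 1 * partial_deriv i \<phi> x)" by (simp only:)
  then show ?thesis by (simp add: LIMSEQ_const_iff)
qed

lemma test_function_integral_by_parts:
  assumes "test_function \<phi>" "test_function \<psi>"
  shows "(LINT x|lborel. \<phi> x * partial_deriv i \<psi> x) = - (LINT x|lborel. partial_deriv i \<phi> x * \<psi> x)"
proof -
  have "partial_deriv i (\<lambda>x. \<phi> x * \<psi> x) x = \<phi> x * partial_deriv i \<psi> x + partial_deriv i \<phi> x * \<psi> x" for x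
    using partial_derivI[OF has_derivative_mult[OF assms[THEN test_function_has_derivative]]]
    by (simp add: partial_deriv_def)
  moreover have "integrable lborel (\<lambda>x. \<phi> x * partial_deriv i \<psi> x)"
      "integrable lborel (\<lambda>x. partial_deriv i \<phi> x * \<psi> x)"
    by (intro integrable_test_function test_function_mult test_function_partial_deriv assms)+
  ultimately show ?thesis
    using integral_partial_deriv_eq_0[OF test_function_mult[OF assms], of i]
    by (simp add: add_eq_0_iff)
qed

section \<open>Square integrable functions\<close>

lemma nn_integral_exp_neg_real:
  fixes c :: real
  assumes "c > 0"
  shows "(\<integral>\<^sup>+t. ennreal (exp (- c * \<bar>t\<bar>)) \<partial>lborel) < \<infinity>"
proof -
  have half: "(\<integral>\<^sup>+t. ennreal (exp (- c * t)) * indicator {0..} t \<partial>lborel) = ennreal (0 - (- exp (- c * 0) / c))"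
  proof (rule nn_integral_FTC_atLeast)
    show "((\<lambda>t. - exp (- c * t) / c) has_real_derivative exp (- c * t)) (at t)" for t
      using assms by (auto intro!: derivative_eq_intros)
    have "((\<lambda>t. exp (- (c * t))) \<longlongrightarrow> 0) at_top"
      using assms by (auto intro!: filterlim_compose[OF exp_at_bot] filterlim_uminus_at_bot_at_top
          filterlim_compose[OF filterlim_uminus_at_bot_at_top] filterlim_tendsto_pos_mult_at_top[OF tendsto_const] filterlim_ident)
    then have "((\<lambda>t. - exp (- c * t) / c) \<longlongrightarrow> - 0 / c) at_top"
      by (intro tendsto_intros) (use assms in auto)
    then show "((\<lambda>t. - exp (- c * t) / c) \<longlongrightarrow> 0) at_top" by simp
  qed auto
  have "(\<integral>\<^sup>+t. ennreal (exp (- c * \<bar>t\<bar>)) \<partial>lborel) \<le>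
    (\<integral>\<^sup>+t. ennreal (exp (- c * t)) * indicator {0..} t + ennreal (exp (- c * - t)) * indicator {0..} (- t) \<partial>lborel)"
    by (intro nn_integral_mono) (auto simp: indicator_def)
  also have "\<dots> = (\<integral>\<^sup>+t. ennreal (exp (- c * t)) * indicator {0..} t \<partial>lborel) +
     (\<integral>\<^sup>+t. ennreal (exp (- c * - t)) * indicator {0..} (- t) \<partial>lborel)"
    by (intro nn_integral_add) auto
  also have "(\<integral>\<^sup>+t. ennreal (exp (- c * - t)) * indicator {0..} (- t) \<partial>lborel) =
     (\<integral>\<^sup>+t. ennreal (exp (- c * t)) * indicator {0..} t \<partial>lborel)"
    by (subst (2) nn_integral_real_affine[where c = "-1" and t = 0]) auto
  finally show ?thesis unfolding half by (rule le_less_trans) auto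
qed

text \<open>The norm is at least the average of the absolute values of the coordinates, so
  exp(-a|x|) is dominated by a product of one-dimensional exponentials of rate a / DIM.\<close>

lemma nn_integral_exp_neg_norm:
  assumes "a > 0"
  shows "(\<integral>\<^sup>+x. ennreal (exp (- a * norm x)) \<partial>(lborel :: 'a::euclidean_space measure)) < \<infinity>"
proof -
  define c where "c = a / real DIM('a)"
  have c: "c > 0" using assms by (simp add: c_def)
  have "exp (- a * norm x) \<le> (\<Prod>b\<in>Basis. exp (- c * \<bar>x \<bullet> b\<bar>))" for x :: 'a
  proof -
    have "(\<Sum>b\<in>Basis. \<bar>x \<bullet> b\<bar>) \<le> (\<Sum>b\<in>(Basis::'a set). norm x)"
      by (intro sum_mono Basis_le_norm)
    then have "c * (\<Sum>b\<in>Basis. \<bar>x \<bullet> b\<bar>) \<le> c * (real DIM('a) * norm x)"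
      using c by (intro mult_left_mono) auto
    also have "\<dots> = a * norm x" by (simp add: c_def)
    finally have "- a * norm x \<le> (\<Sum>b\<in>Basis. - c * \<bar>x \<bullet> b\<bar>)"
      by (simp add: sum_distrib_left sum_negf)
    then show ?thesis by (simp add: exp_sum[symmetric] del: sum_negf)
  qed
  then have "(\<integral>\<^sup>+x. ennreal (exp (- a * norm x)) \<partial>(lborel :: 'a measure)) \<le>
     (\<integral>\<^sup>+x. (\<Prod>b\<in>Basis. ennreal (exp (- c * \<bar>x \<bullet> b\<bar>))) \<partial>(lborel :: 'a measure))"
    by (intro nn_integral_mono) (simp add: prod_ennreal ennreal_leI)
  also have "\<dots> = (\<Prod>b\<in>(Basis :: 'a set). \<integral>\<^sup>+t. ennreal (exp (- c * \<bar>t\<bar>)) \<partial>lborel)"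
    by (rule nn_integral_lborel_prod) auto
  also have "\<dots> < \<infinity>"
    using nn_integral_exp_neg_real[OF c] by (simp add: power_less_top_ennreal)
  finally show ?thesis .
qed

lemma nn_integral_le_of_AE_tendsto:
  fixes u :: "nat \<Rightarrow> 'a \<Rightarrow> ennreal"
  assumes [measurable]: "\<And>n. u n \<in> borel_measurable M"
    and lim: "AE x in M. (\<lambda>n. u n x) \<longlonglongrightarrow> U x"
    and le: "\<And>n. (\<integral>\<^sup>+x. u n x \<partial>M) \<le> c n" and c: "c \<longlonglongrightarrow> C"
  shows "(\<integral>\<^sup>+x. U x \<partial>M) \<le> C"
proof -
  have "(\<integral>\<^sup>+x. U x \<partial>M) = (\<integral>\<^sup>+x. liminf (\<lambda>n. u n x) \<partial>M)"
    using lim by (intro nn_integral_cong_AE) (auto elim!: eventually_mono simp: lim_imp_Liminf)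
  also have "\<dots> \<le> liminf (\<lambda>n. \<integral>\<^sup>+x. u n x \<partial>M)" by (rule nn_integral_liminf) measurable
  also have "\<dots> \<le> liminf c" by (intro Liminf_mono always_eventually allI le)
  also have "\<dots> = C" by (rule lim_imp_Liminf[OF _ c]) simp
  finally show ?thesis .
qed

text \<open>A positive weight does not affect convergence at a point, but it makes the L^1 size of
  the increments finite for functions that are merely square integrable.\<close>

lemma AE_convergent_if_summable_differences:
  fixes f :: "nat \<Rightarrow> 'a \<Rightarrow> 'b::{banach, second_countable_topology}"
  assumes [measurable]: "\<And>n. f n \<in> borel_measurable M" "\<gamma> \<in> borel_measurable M"
    and pos: "\<And>x. \<gamma> x > 0"
    and fin: "(\<Sum>n. \<integral>\<^sup>+x. ennreal (\<gamma> x * norm (f (Suc n) x - f n x)) \<partial>M) < \<infinity>"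
  shows "AE x in M. convergent (\<lambda>n. f n x)"
proof -
  have "(\<integral>\<^sup>+x. (\<Sum>n. ennreal (\<gamma> x * norm (f (Suc n) x - f n x))) \<partial>M) < \<infinity>"
    using fin by (subst nn_integral_suminf) auto
  then have "AE x in M. (\<Sum>n. ennreal (\<gamma> x * norm (f (Suc n) x - f n x))) \<noteq> \<infinity>"
    by (intro nn_integral_PInf_AE) auto
  then show ?thesis
  proof eventually_elim
    case (elim x)
    then have "summable (\<lambda>n. \<gamma> x * norm (f (Suc n) x - f n x))"
      by (intro summable_suminf_not_top) (use pos[of x] in auto)
    then have "summable (\<lambda>n. norm (f (Suc n) x - f n x))"
      using pos[of x] by (subst (asm) summable_cmult_iff) auto
    then have "summable (\<lambda>n. f (Suc n) x - f n x)" by (rule summable_norm_cancel)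
    then have "convergent (\<lambda>n. \<Sum>k<n. f (Suc k) x - f k x)" by (simp add: summable_iff_convergent)
    then have "convergent (\<lambda>n. f n x - f 0 x)"
      by (simp only: sum_lessThan_telescope[of "\<lambda>n. f n x"])
    then have "convergent (\<lambda>n. (f n x - f 0 x) + f 0 x)"
      by (intro convergent_add convergent_const)
    then show ?case by simp
  qed
qed

section \<open>The squared L^2 norm\<close>

definition sqnorm :: "(real ^ 'n \<Rightarrow> 'b::euclidean_space) \<Rightarrow> ennreal" where
  "sqnorm f = (\<integral>\<^sup>+x. ennreal ((norm (f x))\<^sup>2) \<partial>lborel)"

lemma square_integrable_iff:
  fixes f :: "real ^ 'n \<Rightarrow> 'b::euclidean_space"
  shows "square_integrable f \<longleftrightarrow> f \<in> borel_measurable borel \<and> sqnorm f < \<infinity>"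
  unfolding square_integrable_def sqnorm_def by (auto simp: integrable_iff_bounded)

lemma square_integrableD:
  fixes f :: "real ^ 'n \<Rightarrow> 'b::euclidean_space"
  assumes "square_integrable f"
  shows "f \<in> borel_measurable borel" "integrable lborel (\<lambda>x. (norm (f x))\<^sup>2)"
  using assms by (auto simp: square_integrable_def)

lemma sqnorm_eq_integral:
  fixes f :: "real ^ 'n \<Rightarrow> 'b::euclidean_space"
  assumes "square_integrable f"
  shows "sqnorm f = ennreal (LINT x|lborel. (norm (f x))\<^sup>2)"
  unfolding sqnorm_def using assms by (intro nn_integral_eq_integral) (auto simp: square_integrable_def)

lemma norm_add_square_le:
  fixes a b :: "'a::real_normed_vector"
  shows "(norm (a + b))\<^sup>2 \<le> 2 * (norm a)\<^sup>2 + 2 * (norm b)\<^sup>2"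
proof -
  have "(norm (a + b))\<^sup>2 \<le> (norm a + norm b)\<^sup>2" by (intro power_mono norm_triangle_ineq) auto
  also have "\<dots> \<le> 2 * (norm a)\<^sup>2 + 2 * (norm b)\<^sup>2"
    using zero_le_power2[of "norm a - norm b"] by (simp add: power2_eq_square algebra_simps)
  finally show ?thesis .
qed

lemma sqnorm_add_le:
  fixes f g :: "real ^ 'n \<Rightarrow> 'b::euclidean_space"
  assumes [measurable]: "f \<in> borel_measurable borel" "g \<in> borel_measurable borel"
  shows "sqnorm (\<lambda>x. f x + g x) \<le> 2 * sqnorm f + 2 * sqnorm g"
proof -
  have "sqnorm (\<lambda>x. f x + g x) \<le> (\<integral>\<^sup>+x. 2 * ennreal ((norm (f x))\<^sup>2) + 2 * ennreal ((norm (g x))\<^sup>2) \<partial>lborel)"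
    unfolding sqnorm_def
  proof (intro nn_integral_mono)
    fix x
    have "ennreal ((norm (f x + g x))\<^sup>2) \<le> ennreal (2 * (norm (f x))\<^sup>2 + 2 * (norm (g x))\<^sup>2)"
      by (intro ennreal_leI norm_add_square_le)
    also have "\<dots> = 2 * ennreal ((norm (f x))\<^sup>2) + 2 * ennreal ((norm (g x))\<^sup>2)"
      by (simp add: ennreal_mult)
    finally show "ennreal ((norm (f x + g x))\<^sup>2) \<le> 2 * ennreal ((norm (f x))\<^sup>2) + 2 * ennreal ((norm (g x))\<^sup>2)" .
  qed
  also have "\<dots> = 2 * sqnorm f + 2 * sqnorm g"
    unfolding sqnorm_def by (simp add: nn_integral_add nn_integral_cmult)
  finally show ?thesis .
qed

lemma sqnorm_cmult:
  fixes f :: "real ^ 'n \<Rightarrow> complex"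
  assumes [measurable]: "f \<in> borel_measurable borel"
  shows "sqnorm (\<lambda>x. c * f x) = ennreal ((norm c)\<^sup>2) * sqnorm f"
  unfolding sqnorm_def by (simp add: nn_integral_cmult[symmetric] norm_mult power_mult_distrib ennreal_mult)

lemma square_integrable_add:
  fixes f g :: "real ^ 'n \<Rightarrow> 'b::euclidean_space"
  assumes "square_integrable f" "square_integrable g"
  shows "square_integrable (\<lambda>x. f x + g x)"
proof -
  have "2 * sqnorm f + 2 * sqnorm g < \<infinity>"
    using assms by (auto simp: square_integrable_iff ennreal_mult_less_top)
  then show ?thesis using assms le_less_trans[OF sqnorm_add_le[of f g]]
    unfolding square_integrable_iff by auto
qed

lemma square_integrable_cmult:
  fixes f :: "real ^ 'n \<Rightarrow> complex"
  shows "square_integrable f \<Longrightarrow> square_integrable (\<lambda>x. c * f x)"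
  unfolding square_integrable_iff by (auto simp: sqnorm_cmult ennreal_mult_less_top)

lemma square_integrable_uminus:
  fixes f :: "real ^ 'n \<Rightarrow> 'b::euclidean_space"
  shows "square_integrable f \<Longrightarrow> square_integrable (\<lambda>x. - f x)"
  unfolding square_integrable_def by auto

lemma square_integrable_diff:
  fixes f g :: "real ^ 'n \<Rightarrow> 'b::euclidean_space"
  assumes "square_integrable f" "square_integrable g"
  shows "square_integrable (\<lambda>x. f x - g x)"
  using square_integrable_add[OF assms(1) square_integrable_uminus[OF assms(2)]] by simp

lemma square_integrable_cnj:
  "square_integrable f \<Longrightarrow> square_integrable (\<lambda>x. cnj (f x))"
  unfolding square_integrable_def
  by (auto intro: measurable_compose[OF _ borel_measurable_continuous_onI] continuous_intros)

lemma square_integrable_translate: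
  fixes f :: "real ^ 'n \<Rightarrow> 'b::euclidean_space"
  shows "square_integrable f \<Longrightarrow> square_integrable (\<lambda>x. f (x + z))"
  unfolding square_integrable_def using integrable_translate[of "\<lambda>x. (norm (f x))\<^sup>2" z] by auto

lemma integrable_mult_square_integrable:
  fixes f g :: "real ^ 'n \<Rightarrow> complex"
  assumes "square_integrable f" "square_integrable g"
  shows "integrable lborel (\<lambda>x. f x * g x)"
proof (rule Bochner_Integration.integrable_bound)
  show "integrable lborel (\<lambda>x. (norm (f x))\<^sup>2 + (norm (g x))\<^sup>2)"
    using assms by (auto simp: square_integrable_def)
  show "(\<lambda>x. f x * g x) \<in> borel_measurable lborel"
    using assms by (auto simp: square_integrable_def)
  show "AE x in lborel. norm (f x * g x) \<le> norm ((norm (f x))\<^sup>2 + (norm (g x))\<^sup>2)"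
  proof (intro AE_I2)
    fix x
    have "2 * (norm (f x) * norm (g x)) \<le> (norm (f x))\<^sup>2 + (norm (g x))\<^sup>2"
      using sum_squares_bound[of "norm (f x)" "norm (g x)"] by simp
    moreover have "0 \<le> norm (f x) * norm (g x)" by simp
    ultimately show "norm (f x * g x) \<le> norm ((norm (f x))\<^sup>2 + (norm (g x))\<^sup>2)"
      unfolding norm_mult real_norm_def by linarith
  qed
qed

lemma integral_mult_bound:
  fixes f g :: "real ^ 'n \<Rightarrow> complex"
  assumes "square_integrable f" "square_integrable g"
  shows "2 * norm (LINT x|lborel. f x * g x) \<le>
    (LINT x|lborel. (norm (f x))\<^sup>2) + (LINT x|lborel. (norm (g x))\<^sup>2)"
proof -
  have i: "integrable lborel (\<lambda>x. f x * g x)" using integrable_mult_square_integrable[OF assms] .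
  have "2 * norm (LINT x|lborel. f x * g x) \<le> 2 * (LINT x|lborel. norm (f x * g x))"
    by (intro mult_left_mono integral_norm_bound) auto
  also have "\<dots> = (LINT x|lborel. 2 * norm (f x * g x))" by simp
  also have "\<dots> \<le> (LINT x|lborel. (norm (f x))\<^sup>2 + (norm (g x))\<^sup>2)"
  proof (intro integral_mono)
    show "2 * norm (f x * g x) \<le> (norm (f x))\<^sup>2 + (norm (g x))\<^sup>2" for x
      using sum_squares_bound[of "norm (f x)" "norm (g x)"] by (simp add: norm_mult)
    show "integrable lborel (\<lambda>x. 2 * norm (f x * g x))"
      by (intro integrable_mult_right integrable_norm i)
  qed (use assms in \<open>auto simp: square_integrable_def\<close>)
  also have "\<dots> = (LINT x|lborel. (norm (f x))\<^sup>2) + (LINT x|lborel. (norm (g x))\<^sup>2)"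
    using assms by (intro Bochner_Integration.integral_add) (auto simp: square_integrable_def)
  finally show ?thesis .
qed

lemma square_integrable_imp_locally_integrable:
  fixes f :: "real ^ 'n \<Rightarrow> 'b::euclidean_space"
  assumes "square_integrable f"
  shows "locally_integrable f"
proof -
  have [measurable]: "f \<in> borel_measurable borel" using assms by (rule square_integrableD)
  have "set_integrable lborel K f" if "compact K" for K
    unfolding set_integrable_def
  proof (rule Bochner_Integration.integrable_bound)
    have [measurable]: "K \<in> sets borel" using that by (rule borel_compact)
    have "integrable lborel (indicator K :: _ \<Rightarrow> real)"
      using that by (intro integrable_real_indicator emeasure_bounded_finite compact_imp_bounded) auto
    then show "integrable lborel (\<lambda>x. indicator K x + (norm (f x))\<^sup>2)"
      using assms by (auto simp: square_integrable_def)
    show "AE x in lborel. norm (indicator K x *\<^sub>R f x) \<le> norm (indicator K x + (norm (f x))\<^sup>2)"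
    proof (intro AE_I2)
      fix x
      have "norm (f x) \<le> 1 + (norm (f x))\<^sup>2"
        using zero_le_power2[of "norm (f x) - 1"] by (simp add: power2_eq_square algebra_simps)
           (smt (verit) mult_nonneg_nonneg norm_ge_zero)
      then show "norm (indicator K x *\<^sub>R f x) \<le> norm (indicator K x + (norm (f x))\<^sup>2)"
        by (auto simp: indicator_def)
    qed
    show "(\<lambda>x. indicator K x *\<^sub>R f x) \<in> borel_measurable lborel" by measurable
  qed
  then show ?thesis using assms by (auto simp: locally_integrable_def)
qed

text \<open>Completeness with a rate. After weighting by exp(-|x|), Young's inequality with the
  factors 2^(-n) and 2^n turns the rate 8^(-n) of the squared norms into terms of size 2^(-n) and
  4^(-n). The increments are thus summable in L^1 and the sequence converges almost everywhere;
  Fatou returns the same rate for the limit.\<close>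

lemma L2_limit:
  fixes f :: "nat \<Rightarrow> real ^ 'n \<Rightarrow> complex"
  assumes sq: "\<And>n. square_integrable (f n)"
    and cauchy: "\<And>n k. n \<le> k \<Longrightarrow> sqnorm (\<lambda>x. f n x - f k x) \<le> ennreal (C / 8 ^ n)"
  obtains g where "square_integrable g" "\<And>n. sqnorm (\<lambda>x. f n x - g x) \<le> ennreal (C / 8 ^ n)"
proof -
  have [measurable]: "f n \<in> borel_measurable borel" for n using sq by (rule square_integrableD)
  define \<gamma> where "\<gamma> = (\<lambda>x::real ^ 'n. exp (- norm x))"
  have [measurable]: "\<gamma> \<in> borel_measurable borel" by (simp add: \<gamma>_def)
  define A where "A = (\<integral>\<^sup>+x. ennreal ((\<gamma> x)\<^sup>2) \<partial>lborel)"
  have "(\<gamma> x)\<^sup>2 = exp (- 2 * norm x)" for x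
    unfolding \<gamma>_def by (simp add: exp_of_nat_mult[symmetric])
  then have A: "A < \<infinity>" using nn_integral_exp_neg_norm[of 2, where 'a = "real ^ 'n"] by (simp add: A_def)
  obtain a where a: "A = ennreal a" "a \<ge> 0" using A by (cases A) auto
  have "(\<Sum>n. \<integral>\<^sup>+x. ennreal (\<gamma> x * norm (f (Suc n) x - f n x)) \<partial>lborel) \<le>
      (\<Sum>n. ennreal ((a + \<bar>C\<bar>) * (1 / 2) ^ n))"
  proof (intro suminf_le allI)
    fix n
    have "\<gamma> x * norm (f (Suc n) x - f n x) \<le> (1 / 2) ^ n * (\<gamma> x)\<^sup>2 + 2 ^ n * (norm (f n x - f (Suc n) x))\<^sup>2" for x
    proof -
      define p where "p = \<gamma> x"
      define q where "q = norm (f n x - f (Suc n) x)"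
      have pq: "p \<ge> 0" "q \<ge> 0" by (auto simp: p_def \<gamma>_def q_def)
      have "0 \<le> (p - 2 ^ n * q)\<^sup>2" by simp
      then have "2 * (2 ^ n * (p * q)) \<le> p\<^sup>2 + 2 ^ n * 2 ^ n * q\<^sup>2"
        by (simp add: power2_eq_square algebra_simps)
      then have "2 ^ n * (p * q) \<le> p\<^sup>2 + 2 ^ n * 2 ^ n * q\<^sup>2"
        using pq by (smt (verit) mult_nonneg_nonneg zero_le_power)
      then have "p * q \<le> (1 / 2) ^ n * p\<^sup>2 + 2 ^ n * q\<^sup>2"
        by (simp add: field_simps power_divide)
      then show ?thesis by (simp add: p_def q_def norm_minus_commute)
    qed
    then have "(\<integral>\<^sup>+x. ennreal (\<gamma> x * norm (f (Suc n) x - f n x)) \<partial>lborel) \<le>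
       (\<integral>\<^sup>+x. ennreal ((1 / 2) ^ n) * ennreal ((\<gamma> x)\<^sup>2) + ennreal (2 ^ n) * ennreal ((norm (f n x - f (Suc n) x))\<^sup>2) \<partial>lborel)"
      by (intro nn_integral_mono) (simp flip: ennreal_mult ennreal_plus)
    also have "\<dots> = ennreal ((1 / 2) ^ n) * A + ennreal (2 ^ n) * sqnorm (\<lambda>x. f n x - f (Suc n) x)"
      unfolding A_def sqnorm_def by (subst nn_integral_add) (auto simp: nn_integral_cmult)
    also have "\<dots> \<le> ennreal ((1 / 2) ^ n) * ennreal a + ennreal (2 ^ n) * ennreal (\<bar>C\<bar> / 8 ^ n)"
      unfolding a(1)
      by (intro add_left_mono mult_left_mono order_trans[OF cauchy] ennreal_leI divide_right_mono) auto
    also have "\<dots> = ennreal ((1 / 2) ^ n * a + 2 ^ n * (\<bar>C\<bar> / 8 ^ n))"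
      using a(2) by (simp flip: ennreal_mult ennreal_plus)
    also have "\<dots> \<le> ennreal ((a + \<bar>C\<bar>) * (1 / 2) ^ n)"
    proof (intro ennreal_leI)
      have "(2::real) ^ n * (1 / 8 ^ n) = (1 / 4) ^ n"
        by (simp add: power_divide[symmetric] power_mult_distrib[symmetric] flip: power_divide)
      also have "\<dots> \<le> (1 / 2) ^ n" by (intro power_mono) auto
      finally have "\<bar>C\<bar> * (2 ^ n * (1 / 8 ^ n)) \<le> \<bar>C\<bar> * (1 / 2) ^ n" by (intro mult_left_mono) auto
      then show "(1 / 2) ^ n * a + 2 ^ n * (\<bar>C\<bar> / 8 ^ n) \<le> (a + \<bar>C\<bar>) * (1 / 2) ^ n"
        by (simp add: algebra_simps)
    qed
    finally show "(\<integral>\<^sup>+x. ennreal (\<gamma> x * norm (f (Suc n) x - f n x)) \<partial>lborel) \<le>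
      ennreal ((a + \<bar>C\<bar>) * (1 / 2) ^ n)" .
  qed auto
  also have "\<dots> = ennreal (\<Sum>n. (a + \<bar>C\<bar>) * (1 / 2) ^ n)"
    using a(2) by (intro suminf_ennreal2) (auto intro!: summable_mult summable_geometric)
  also have "\<dots> < \<infinity>" by simp
  finally have "AE x in lborel. convergent (\<lambda>n. f n x)"
    by (intro AE_convergent_if_summable_differences[where \<gamma> = \<gamma>]) (auto simp: \<gamma>_def)
  then have conv: "AE x in lborel. (\<lambda>n. f n x) \<longlonglongrightarrow> lim (\<lambda>n. f n x)"
    by eventually_elim (simp add: convergent_LIMSEQ_iff)
  define g where "g x = lim (\<lambda>n. f n x)" for x
  have [measurable]: "g \<in> borel_measurable borel" unfolding g_def by measurable
  have le: "sqnorm (\<lambda>x. f n x - g x) \<le> ennreal (C / 8 ^ n)" for n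
    unfolding sqnorm_def
  proof (rule nn_integral_le_of_AE_tendsto)
    show "(\<integral>\<^sup>+x. ennreal ((norm (f n x - f (n + k) x))\<^sup>2) \<partial>lborel) \<le> ennreal (C / 8 ^ n)" for k
      using cauchy[of n "n + k"] by (simp add: sqnorm_def)
    show "AE x in lborel. (\<lambda>k. ennreal ((norm (f n x - f (n + k) x))\<^sup>2)) \<longlonglongrightarrow> ennreal ((norm (f n x - g x))\<^sup>2)"
      using conv
    proof eventually_elim
      case (elim x)
      have "(\<lambda>k. f (n + k) x) \<longlonglongrightarrow> g x"
        using LIMSEQ_ignore_initial_segment[OF elim, of n] by (simp add: g_def add.commute)
      then show ?case by (intro tendsto_intros)
    qed
  qed auto
  have "square_integrable (\<lambda>x. f 0 x - g x)"
    using le_less_trans[OF le[of 0] ennreal_less_top] by (auto simp: square_integrable_iff)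
  from square_integrable_diff[OF sq[of 0] this] have "square_integrable g" by simp
  then show ?thesis using le that by blast
qed

lemma integral_norm_square_add:
  fixes f g :: "real ^ 'n \<Rightarrow> complex" and e :: real
  assumes "square_integrable f" "square_integrable g"
  shows "(LINT x|lborel. (norm (f x + of_real e * g x))\<^sup>2) =
    (LINT x|lborel. (norm (f x))\<^sup>2) + 2 * e * Re (LINT x|lborel. cnj (f x) * g x) +
    e\<^sup>2 * (LINT x|lborel. (norm (g x))\<^sup>2)"
proof -
  have i: "integrable lborel (\<lambda>x. cnj (f x) * g x)"
    by (intro integrable_mult_square_integrable square_integrable_cnj assms)
  have "(norm (f x + of_real e * g x))\<^sup>2 =
      (norm (f x))\<^sup>2 + 2 * e * Re (cnj (f x) * g x) + e\<^sup>2 * (norm (g x))\<^sup>2" for x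
    by (simp add: cmod_power2) (simp add: power2_eq_square algebra_simps)
  then have "(LINT x|lborel. (norm (f x + of_real e * g x))\<^sup>2) =
    (LINT x|lborel. (norm (f x))\<^sup>2 + 2 * e * Re (cnj (f x) * g x) + e\<^sup>2 * (norm (g x))\<^sup>2)"
    by (simp only:)
  also have "\<dots> = (LINT x|lborel. (norm (f x))\<^sup>2) + (LINT x|lborel. 2 * e * Re (cnj (f x) * g x)) +
      (LINT x|lborel. e\<^sup>2 * (norm (g x))\<^sup>2)"
    using assms[THEN square_integrableD(2)]
    by (simp only: Bochner_Integration.integral_add integrable_mult_right integrable_Re[OF i]
        Bochner_Integration.integrable_add)
  also have "(LINT x|lborel. 2 * e * Re (cnj (f x) * g x)) = 2 * e * Re (LINT x|lborel. cnj (f x) * g x)"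
    by (simp only: integral_mult_right_zero integral_Re[OF i])
  finally show ?thesis by simp
qed

text \<open>Riesz representation on a subspace T of L^2 that need not be closed. Applied to all
  multiples of \<phi>, the quadratic bound encodes boundedness of \<open>\<l>\<close> with squared
  norm S, without square roots. The functional J, twice the real part of \<open>\<l>\<close> minus
  the squared norm, is bounded by S; the parallelogram law makes almost maximizers a Cauchy
  sequence, and stationarity of their limit represents \<open>\<l>\<close>.\<close>

lemma riesz_representation:
  fixes T :: "(real ^ 'n \<Rightarrow> complex) set" and \<l> :: "(real ^ 'n \<Rightarrow> complex) \<Rightarrow> complex"
  assumes sq: "\<And>\<phi>. \<phi> \<in> T \<Longrightarrow> square_integrable \<phi>"
    and add: "\<And>\<phi> \<psi>. \<phi> \<in> T \<Longrightarrow> \<psi> \<in> T \<Longrightarrow> (\<lambda>x. \<phi> x + \<psi> x) \<in> T"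
    and cmult: "\<And>\<phi> c. \<phi> \<in> T \<Longrightarrow> (\<lambda>x. c * \<phi> x) \<in> T"
    and ne: "\<phi>0 \<in> T"
    and ladd: "\<And>\<phi> \<psi>. \<phi> \<in> T \<Longrightarrow> \<psi> \<in> T \<Longrightarrow> \<l> (\<lambda>x. \<phi> x + \<psi> x) = \<l> \<phi> + \<l> \<psi>"
    and lcmult: "\<And>\<phi> c. \<phi> \<in> T \<Longrightarrow> \<l> (\<lambda>x. c * \<phi> x) = c * \<l> \<phi>"
    and bnd: "\<And>\<phi>. \<phi> \<in> T \<Longrightarrow> 2 * Re (\<l> \<phi>) \<le> S + (LINT x|lborel. (norm (\<phi> x))\<^sup>2)"
  shows "\<exists>g. square_integrable g \<and> (LINT x|lborel. (norm (g x))\<^sup>2) \<le> S \<and>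
    (\<forall>\<psi>\<in>T. \<l> \<psi> = (LINT x|lborel. g x * \<psi> x))"
proof -
  define N where "N f = (LINT x|lborel. (norm (f x))\<^sup>2)" for f :: "real ^ 'n \<Rightarrow> complex"
  define J where "J \<phi> = 2 * Re (\<l> \<phi>) - N \<phi>" for \<phi>
  define s where "s = Sup (J ` T)"
  have N0: "N f \<ge> 0" for f unfolding N_def by (intro integral_nonneg_AE) auto
  have Nadd: "N (\<lambda>x. f x + of_real e * g x) = N f + 2 * e * Re (LINT x|lborel. cnj (f x) * g x) + e\<^sup>2 * N g"
    if "square_integrable f" "square_integrable g" for f g e
    unfolding N_def by (rule integral_norm_square_add[OF that])
  have sqN: "sqnorm f = ennreal (N f)" if "square_integrable f" for f
    unfolding N_def by (rule sqnorm_eq_integral[OF that])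
  have JS: "J \<phi> \<le> S" if "\<phi> \<in> T" for \<phi> using bnd[OF that] by (simp add: J_def N_def)
  then have bdd: "bdd_above (J ` T)" by (auto simp: bdd_above_def)
  have Js: "J \<phi> \<le> s" if "\<phi> \<in> T" for \<phi> unfolding s_def using that bdd by (intro cSup_upper) auto
  \<comment> \<open>The parallelogram law, combined with the fact that J at the midpoint is at most
    s.\<close>
  have par: "N (\<lambda>x. \<phi> x - \<psi> x) \<le> 4 * s - 2 * J \<phi> - 2 * J \<psi>" if T: "\<phi> \<in> T" "\<psi> \<in> T" for \<phi> \<psi>
  proof -
    define p where "p = (\<lambda>x. (1/2) * (\<phi> x + \<psi> x))"
    have p: "p \<in> T" unfolding p_def by (intro cmult add T)
    have lp: "\<l> p = (1/2) * (\<l> \<phi> + \<l> \<psi>)" unfolding p_def using T by (simp only: lcmult add ladd)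
    have "N p = (1/4) * N (\<lambda>x. \<phi> x + of_real 1 * \<psi> x)"
      by (simp add: N_def p_def norm_mult norm_divide power_divide)
    then have "4 * N p = N \<phi> + 2 * Re (LINT x|lborel. cnj (\<phi> x) * \<psi> x) + N \<psi>"
      using Nadd[OF sq[OF T(1)] sq[OF T(2)], of 1] by simp
    moreover have "N (\<lambda>x. \<phi> x - \<psi> x) = N \<phi> - 2 * Re (LINT x|lborel. cnj (\<phi> x) * \<psi> x) + N \<psi>"
      using Nadd[OF sq[OF T(1)] sq[OF T(2)], of "-1"] by simp
    moreover have "J p \<le> s" using Js p by blast
    ultimately show ?thesis unfolding J_def lp by (simp add: field_simps)
  qed
  have "\<exists>\<phi>\<in>T. s - 1 / 8 ^ n < J \<phi>" for n :: nat
  proof -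
    have "s - 1 / 8 ^ n < Sup (J ` T)" unfolding s_def by simp
    then show ?thesis using ne by (subst (asm) less_cSup_iff) (auto simp: bdd)
  qed
  then obtain \<phi> where \<phi>: "\<And>n::nat. \<phi> n \<in> T" "\<And>n. s - 1 / 8 ^ n < J (\<phi> n)" by metis
  have cauchy: "sqnorm (\<lambda>x. \<phi> n x - \<phi> k x) \<le> ennreal (4 / 8 ^ n)" if "n \<le> k" for n k
  proof -
    have "1 / 8 ^ k \<le> (1::real) / 8 ^ n" using that by (intro divide_left_mono power_increasing) auto
    then have "N (\<lambda>x. \<phi> n x - \<phi> k x) \<le> 4 / 8 ^ n"
      using par[OF \<phi>(1) \<phi>(1), of n k] \<phi>(2)[of n] \<phi>(2)[of k] by linarith
    then show ?thesis by (simp add: sqN square_integrable_diff sq \<phi>(1) ennreal_leI)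
  qed
  obtain f where f: "square_integrable f" "\<And>n. sqnorm (\<lambda>x. \<phi> n x - f x) \<le> ennreal (4 / 8 ^ n)"
    using L2_limit[OF sq[OF \<phi>(1)] cauchy] by blast
  have Nf: "N (\<lambda>x. \<phi> n x - f x) \<le> 4 / 8 ^ n" for n
    using f(2)[of n] by (simp add: sqN square_integrable_diff sq \<phi>(1) f(1))
  have dsq: "square_integrable (\<lambda>x. cnj (\<phi> n x - f x))" for n
    by (intro square_integrable_cnj square_integrable_diff sq \<phi> f)
  \<comment> \<open>The representing pairing is bilinear rather than sesquilinear, hence the
    conjugate.\<close>
  define g where "g x = cnj (f x)" for x
  have g: "square_integrable g" unfolding g_def by (intro square_integrable_cnj f)
  have decay: "(\<lambda>n. c / b ^ n) \<longlonglongrightarrow> 0" if "b > 1" for b c :: real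
    using that by (rule LIMSEQ_divide_realpow_zero)
  have re: "Re (\<l> \<psi>) = Re (LINT x|lborel. g x * \<psi> x)" if \<psi>: "\<psi> \<in> T" for \<psi>
  proof -
    define X where "X = Re (\<l> \<psi>) - Re (LINT x|lborel. g x * \<psi> x)"
    define Y where "Y n = Re (LINT x|lborel. cnj (\<phi> n x - f x) * \<psi> x)" for n
    have "\<bar>Y n\<bar> \<le> (4 + N \<psi>) / 2 ^ n" for n
    proof -
      \<comment> \<open>Balancing the two factors by 2^n turns the squared distance 4 / 8^n into a
        bound of order 2^(-n); the unbalanced estimate would leave the full squared norm of
        \<psi>.\<close>
      have split: "(LINT x|lborel. cnj (\<phi> n x - f x) * \<psi> x) =
          (LINT x|lborel. (2 ^ n * cnj (\<phi> n x - f x)) * ((1 / 2 ^ n) * \<psi> x))"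
        by (intro Bochner_Integration.integral_cong) auto
      have "2 * norm (LINT x|lborel. cnj (\<phi> n x - f x) * \<psi> x) \<le>
          N (\<lambda>x. 2 ^ n * cnj (\<phi> n x - f x)) + N (\<lambda>x. (1 / 2 ^ n) * \<psi> x)"
        unfolding split N_def
        by (rule integral_mult_bound[OF square_integrable_cmult[OF dsq] square_integrable_cmult[OF sq[OF \<psi>]]])
      also have "N (\<lambda>x. 2 ^ n * cnj (\<phi> n x - f x)) = 4 ^ n * N (\<lambda>x. \<phi> n x - f x)"
      proof -
        have "(norm (2 ^ n * cnj (\<phi> n x - f x)))\<^sup>2 = 4 ^ n * (norm (\<phi> n x - f x))\<^sup>2" for x
        proof -
          have "((2::real) ^ n)\<^sup>2 = 4 ^ n" by (simp add: power_mult[symmetric] mult.commute[of n] power_mult)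
          then show ?thesis by (simp add: norm_mult norm_power power_mult_distrib flip: complex_cnj_diff)
        qed
        then show ?thesis by (simp add: N_def)
      qed
      also have "N (\<lambda>x. (1 / 2 ^ n) * \<psi> x) = N \<psi> / 4 ^ n"
      proof -
        have "(norm ((1 / 2 ^ n) * \<psi> x))\<^sup>2 = (norm (\<psi> x))\<^sup>2 / 4 ^ n" for x
        proof -
          have "((2::real) ^ n)\<^sup>2 = 4 ^ n" by (simp add: power_mult[symmetric] mult.commute[of n] power_mult)
          then show ?thesis by (simp add: norm_divide norm_power power_divide)
        qed
        then show ?thesis by (simp add: N_def)
      qed
      also have "4 ^ n * N (\<lambda>x. \<phi> n x - f x) \<le> 4 ^ n * (4 / 8 ^ n)"
        using Nf by (intro mult_left_mono) auto
      also have "4 ^ n * (4 / 8 ^ n) = (4::real) / 2 ^ n"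
      proof -
        have "(8::real) ^ n = 4 ^ n * 2 ^ n" by (simp flip: power_mult_distrib)
        then show ?thesis by simp
      qed
      also have "N \<psi> / 4 ^ n \<le> N \<psi> / 2 ^ n"
        using N0[of \<psi>] by (intro divide_left_mono power_mono) auto
      finally have "2 * norm (LINT x|lborel. cnj (\<phi> n x - f x) * \<psi> x) \<le> (4 + N \<psi>) / 2 ^ n"
        by (simp add: add_divide_distrib)
      moreover have "\<bar>Y n\<bar> \<le> norm (LINT x|lborel. cnj (\<phi> n x - f x) * \<psi> x)"
        unfolding Y_def by (rule abs_Re_le_cmod)
      moreover have "0 \<le> norm (LINT x|lborel. cnj (\<phi> n x - f x) * \<psi> x)" by simp
      ultimately show ?thesis by linarith
    qed
    then have Y: "Y \<longlonglongrightarrow> 0"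
      by (intro Lim_null_comparison[OF _ decay[of 2 "4 + N \<psi>"]] always_eventually) auto
    \<comment> \<open>First variation at the limit: J at \<open>\<phi> n\<close> is within 8^(-n) of
      s, whereas J at the perturbed function is at most s.\<close>
    have key: "2 * e * X \<le> e\<^sup>2 * N \<psi>" for e
    proof -
      have "2 * e * (X - Y n) \<le> 1 / 8 ^ n + e\<^sup>2 * N \<psi>" for n
      proof -
        have q: "(\<lambda>x. \<phi> n x + of_real e * \<psi> x) \<in> T" by (intro add cmult \<phi> \<psi>)
        have "\<l> (\<lambda>x. \<phi> n x + of_real e * \<psi> x) = \<l> (\<phi> n) + of_real e * \<l> \<psi>"
          using \<phi>(1) \<psi> by (simp add: ladd cmult lcmult)
        then have "J (\<lambda>x. \<phi> n x + of_real e * \<psi> x) =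
            J (\<phi> n) + 2 * e * (Re (\<l> \<psi>) - Re (LINT x|lborel. cnj (\<phi> n x) * \<psi> x)) - e\<^sup>2 * N \<psi>"
          unfolding J_def Nadd[OF sq[OF \<phi>(1)] sq[OF \<psi>]] by (simp add: algebra_simps)
        moreover have YY: "(LINT x|lborel. cnj (\<phi> n x - f x) * \<psi> x) =
            (LINT x|lborel. cnj (\<phi> n x) * \<psi> x) - (LINT x|lborel. g x * \<psi> x)"
          unfolding g_def complex_cnj_diff left_diff_distrib
          by (intro Bochner_Integration.integral_diff integrable_mult_square_integrable
              square_integrable_cnj sq \<phi> \<psi> f)
        moreover have "X - Y n = Re (\<l> \<psi>) - Re (LINT x|lborel. cnj (\<phi> n x) * \<psi> x)"
          unfolding X_def Y_def YY by simp
        ultimately have "J (\<lambda>x. \<phi> n x + of_real e * \<psi> x) = J (\<phi> n) + 2 * e * (X - Y n) - e\<^sup>2 * N \<psi>"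
          by (simp only:)
        then show ?thesis using Js[OF q] \<phi>(2)[of n] by linarith
      qed
      moreover have "(\<lambda>n. 2 * e * (X - Y n)) \<longlonglongrightarrow> 2 * e * (X - 0)" by (intro tendsto_intros Y)
      moreover have "(\<lambda>n. 1 / 8 ^ n + e\<^sup>2 * N \<psi>) \<longlonglongrightarrow> 0 + e\<^sup>2 * N \<psi>" by (intro tendsto_intros decay) auto
      ultimately show ?thesis by (auto intro: LIMSEQ_le)
    qed
    \<comment> \<open>With this e the linear term beats the quadratic one unless X = 0; the summand
      1 guards against a vanishing norm of \<psi>.\<close>
    define e where "e = X / (N \<psi> + 1)"
    have pos: "N \<psi> + 1 > 0" using N0[of \<psi>] by simp
    have "2 * e * X * (N \<psi> + 1)\<^sup>2 \<le> e\<^sup>2 * N \<psi> * (N \<psi> + 1)\<^sup>2" by (intro mult_right_mono key) auto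
    then have "2 * X\<^sup>2 * (N \<psi> + 1) \<le> X\<^sup>2 * N \<psi>"
      using pos by (simp add: e_def power_divide power2_eq_square mult_ac)
    then have "X\<^sup>2 * (N \<psi> + 2) \<le> 0" by (simp add: algebra_simps)
    then have "X = 0" using N0[of \<psi>] by (simp add: mult_le_0_iff)
    then show ?thesis by (simp add: X_def)
  qed
  have eq: "\<l> \<psi> = (LINT x|lborel. g x * \<psi> x)" if \<psi>: "\<psi> \<in> T" for \<psi>
  proof (rule complex_eqI)
    show "Re (\<l> \<psi>) = Re (LINT x|lborel. g x * \<psi> x)" by (rule re[OF \<psi>])
    have "Re (\<l> (\<lambda>x. \<i> * \<psi> x)) = Re (LINT x|lborel. g x * (\<i> * \<psi> x))" by (intro re cmult \<psi>)
    also have "(LINT x|lborel. g x * (\<i> * \<psi> x)) = \<i> * (LINT x|lborel. g x * \<psi> x)"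
      by (simp add: mult.left_commute[of _ \<i>])
    finally show "Im (\<l> \<psi>) = Im (LINT x|lborel. g x * \<psi> x)" by (simp add: lcmult[OF \<psi>])
  qed
  \<comment> \<open>Since \<phi> n is represented through g, expanding the squared distance gives N
    (f - \<phi> n) = N f - J (\<phi> n), and J is at most S.\<close>
  have "N f \<le> S + 4 / 8 ^ n" for n
  proof -
    have "N (\<lambda>x. f x - \<phi> n x) = N f - 2 * Re (LINT x|lborel. g x * \<phi> n x) + N (\<phi> n)"
      using Nadd[OF f(1) sq[OF \<phi>(1)], of "-1" n] by (simp add: g_def)
    moreover have "N (\<lambda>x. f x - \<phi> n x) = N (\<lambda>x. \<phi> n x - f x)" by (simp add: N_def norm_minus_commute)
    moreover have "J (\<phi> n) = 2 * Re (LINT x|lborel. g x * \<phi> n x) - N (\<phi> n)"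
      by (simp add: J_def eq[OF \<phi>(1)])
    ultimately show ?thesis using Nf[of n] JS[OF \<phi>(1)[of n]] by linarith
  qed
  moreover have "(\<lambda>n. S + 4 / 8 ^ n) \<longlonglongrightarrow> S + 0" by (intro tendsto_intros decay) auto
  ultimately have "N f \<le> S" by (auto intro: LIMSEQ_le_const)
  then have "N g \<le> S" by (simp add: N_def g_def)
  then show ?thesis using g eq unfolding N_def by blast
qed

section \<open>Weak gradients and difference quotients\<close>

definition diff2 :: "'n::finite \<Rightarrow> real \<Rightarrow> (real ^ 'n \<Rightarrow> 'b::euclidean_space) \<Rightarrow> ennreal" where
  "diff2 i h u = sqnorm (\<lambda>x. u (x + h *\<^sub>R axis i 1) - u x)"

text \<open>The supremum of the difference quotients is meaningful for every Borel function, and inequalities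
  between increments of functions carry over to it.\<close>

definition kin :: "'n::finite \<Rightarrow> (real ^ 'n \<Rightarrow> 'b::euclidean_space) \<Rightarrow> ennreal" where
  "kin i u = (SUP h\<in>{0<..}. ennreal (1 / h\<^sup>2) * diff2 i h u)"

definition kinetic :: "(real ^ 'n::finite \<Rightarrow> 'b::euclidean_space) \<Rightarrow> ennreal" where
  "kinetic u = (\<Sum>i\<in>UNIV. kin i u)"

lemma quotient_le_kin: "h > 0 \<Longrightarrow> ennreal (1 / h\<^sup>2) * diff2 i h u \<le> kin i u"
  unfolding kin_def by (rule SUP_upper) auto

lemma diff2_le_kin:
  assumes "h > 0"
  shows "diff2 i h u \<le> ennreal (h\<^sup>2) * kin i u"
proof -
  have "diff2 i h u = ennreal (h\<^sup>2) * (ennreal (1 / h\<^sup>2) * diff2 i h u)"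
    using assms by (simp add: mult.assoc[symmetric] ennreal_mult[symmetric])
  also have "\<dots> \<le> ennreal (h\<^sup>2) * kin i u" by (intro mult_left_mono quotient_le_kin assms) auto
  finally show ?thesis .
qed

lemma kin_leI:
  assumes "\<And>h. h > 0 \<Longrightarrow> diff2 i h u \<le> ennreal (h\<^sup>2) * C"
  shows "kin i u \<le> C"
  unfolding kin_def
proof (rule SUP_least)
  fix h :: real assume "h \<in> {0<..}"
  then have h: "h > 0" by simp
  have "ennreal (1 / h\<^sup>2) * diff2 i h u \<le> ennreal (1 / h\<^sup>2) * (ennreal (h\<^sup>2) * C)"
    by (intro mult_left_mono assms h) auto
  also have "\<dots> = C" using h by (simp add: mult.assoc[symmetric] ennreal_mult[symmetric])
  finally show "ennreal (1 / h\<^sup>2) * diff2 i h u \<le> C" .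
qed

lemma locally_integrable_diff:
  "locally_integrable f \<Longrightarrow> locally_integrable g \<Longrightarrow> locally_integrable (\<lambda>x. f x - g x)"
  unfolding locally_integrable_def by (auto intro: set_integral_diff)

lemma locally_integrable_nth:
  fixes G :: "real ^ 'n \<Rightarrow> complex ^ 'n"
  assumes "locally_integrable G"
  shows "locally_integrable (\<lambda>x. G x $ i)"
proof -
  have [measurable]: "G \<in> borel_measurable borel" using assms by (simp add: locally_integrable_def)
  have "(\<lambda>x. G x $ i) \<in> borel_measurable borel"
    by (rule measurable_compose[OF _ borel_measurable_continuous_onI]) (auto intro!: continuous_intros)
  moreover have "set_integrable lborel K (\<lambda>x. G x $ i)" if "compact K" for K
    using assms that integrable_bounded_linear[OF bounded_linear_vec_nth, of lborel _ i]
    unfolding locally_integrable_def set_integrable_def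
    by (auto simp flip: vector_scaleR_component)
  ultimately show ?thesis by (simp add: locally_integrable_def)
qed

lemma partial_deriv_translate:
  assumes "test_function \<phi>"
  shows "partial_deriv i (\<lambda>x. \<phi> (x + c)) x = partial_deriv i \<phi> (x + c)"
proof -
  have "((\<lambda>x. \<phi> (x + c)) has_derivative frechet_derivative \<phi> (at (x + c))) (at x)"
    using has_derivative_compose[of "\<lambda>x. x + c" "\<lambda>h. h" x UNIV \<phi>, OF _ test_function_has_derivative[OF assms]]
    by (simp add: has_derivative_ident has_derivative_add_const)
  from partial_derivI[OF this] show ?thesis by (simp add: partial_deriv_def)
qed

lemma partial_deriv_add:
  assumes "test_function f" "test_function g"
  shows "partial_deriv i (\<lambda>x. f x + g x) x = partial_deriv i f x + partial_deriv i g x"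
  using partial_derivI[OF has_derivative_add[OF assms[THEN test_function_has_derivative]]]
  by (simp add: partial_deriv_def)

lemma partial_deriv_linear:
  assumes "bounded_linear L" "test_function f"
  shows "partial_deriv i (\<lambda>x. L (f x)) x = L (partial_deriv i f x)"
  using partial_derivI[OF bounded_linear.has_derivative[OF assms(1) test_function_has_derivative[OF assms(2)]]]
  by (simp add: partial_deriv_def)

lemma partial_deriv_cmult:
  "test_function f \<Longrightarrow> partial_deriv i (\<lambda>x. c * f x) x = c * partial_deriv i f x"
  by (rule partial_deriv_linear[OF bounded_linear_mult_right])

section \<open>Increments and weak derivatives\<close>

text \<open>A is the average of g over the segment from x to x + h e_i. By Cauchy-Schwarz averaging
  does not increase the L^2 norm, and by Fubini A can be tested one translate at a time.\<close>

lemma line_average: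
  fixes g :: "real ^ 'n \<Rightarrow> complex" and i :: 'n and h :: real
  assumes g: "square_integrable g"
  defines "A \<equiv> (\<lambda>x. LINT t|lborel. indicator {0..1} t *\<^sub>R g (x + (t * h) *\<^sub>R axis i 1))"
  shows "square_integrable A" "sqnorm A \<le> sqnorm g"
    and "\<And>\<phi>. square_integrable \<phi> \<Longrightarrow> (LINT x|lborel. A x * \<phi> x) =
      (LINT t|lborel. indicator {0..1} t *\<^sub>R (LINT x|lborel. g (x + (t * h) *\<^sub>R axis i 1) * \<phi> x))"
proof -
  let ?e = "axis i 1 :: real ^ 'n"
  have [measurable]: "g \<in> borel_measurable borel" by (rule square_integrableD[OF g])
  have [measurable]: "(\<lambda>(x, t). indicator {0..1} t *\<^sub>R g (x + (t * h) *\<^sub>R ?e))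
      \<in> borel_measurable (lborel \<Otimes>\<^sub>M lborel)" by measurable
  have A [measurable]: "A \<in> borel_measurable borel" unfolding A_def by measurable
  have "sqnorm A \<le> (\<integral>\<^sup>+x. (\<integral>\<^sup>+t. indicator {0..1} t * ennreal ((norm (g (x + (t * h) *\<^sub>R ?e)))\<^sup>2) \<partial>lborel) \<partial>lborel)"
    unfolding sqnorm_def
  proof (intro nn_integral_mono)
    fix x
    let ?f = "\<lambda>t. indicator {0..1} t *\<^sub>R g (x + (t * h) *\<^sub>R ?e)"
    have "ennreal (norm (A x)) \<le> (\<integral>\<^sup>+t. ennreal (norm (?f t)) \<partial>lborel)"
    \<comment> \<open>On lines where g is not integrable the Bochner integral has the default value
      0, and the estimate holds trivially.\<close>
    proof (cases "integrable lborel ?f")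
      case True
      then show ?thesis unfolding A_def by (rule integral_norm_bound_ennreal)
    next
      case False
      then show ?thesis by (simp add: A_def not_integrable_integral_eq)
    qed
    also have "\<dots> = (\<integral>\<^sup>+t. indicator {0..1} t * ennreal (norm (?f t)) \<partial>lborel)"
      by (intro nn_integral_cong) (auto simp: indicator_def)
    finally have "(ennreal (norm (A x)))\<^sup>2 \<le> (\<integral>\<^sup>+t. indicator {0..1} t * ennreal (norm (?f t)) \<partial>lborel)\<^sup>2"
      by (rule power_mono) auto
    also have "\<dots> \<le> (\<integral>\<^sup>+t. (indicator {0..1::real} t)\<^sup>2 \<partial>lborel) * (\<integral>\<^sup>+t. (ennreal (norm (?f t)))\<^sup>2 \<partial>lborel)"
      using Cauchy_Schwarz_nn_integral[of "\<lambda>t. indicator {0..1::real} t" lborel "\<lambda>t. ennreal (norm (?f t))"] by simp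
    also have "(\<integral>\<^sup>+t. (indicator {0..1::real} t)\<^sup>2 \<partial>lborel) = (1::ennreal)"
    proof -
      have "(\<integral>\<^sup>+t. (indicator {0..1::real} t)\<^sup>2 \<partial>lborel) = (\<integral>\<^sup>+t. indicator {0..1::real} t \<partial>lborel)"
        by (intro nn_integral_cong) (auto simp: indicator_def)
      then show ?thesis by simp
    qed
    also have "1 * (\<integral>\<^sup>+t. (ennreal (norm (?f t)))\<^sup>2 \<partial>lborel) =
       (\<integral>\<^sup>+t. indicator {0..1} t * ennreal ((norm (g (x + (t * h) *\<^sub>R ?e)))\<^sup>2) \<partial>lborel)"
      by (simp, intro nn_integral_cong) (auto simp: indicator_def ennreal_power)
    finally show "ennreal ((norm (A x))\<^sup>2) \<le>
       (\<integral>\<^sup>+t. indicator {0..1} t * ennreal ((norm (g (x + (t * h) *\<^sub>R ?e)))\<^sup>2) \<partial>lborel)"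
      by (simp add: ennreal_power)
  qed
  also have "\<dots> = (\<integral>\<^sup>+t. (\<integral>\<^sup>+x. indicator {0..1} t * ennreal ((norm (g (x + (t * h) *\<^sub>R ?e)))\<^sup>2) \<partial>lborel) \<partial>lborel)"
    by (rule lborel_pair.Fubini') measurable
  also have "\<dots> = (\<integral>\<^sup>+t. indicator {0..1} t * sqnorm g \<partial>(lborel :: real measure))"
    unfolding sqnorm_def
    by (intro nn_integral_cong)
       (simp add: nn_integral_cmult nn_integral_translate[of "\<lambda>x. ennreal ((norm (g x))\<^sup>2)"])
  also have "\<dots> = sqnorm g" by (simp add: nn_integral_multc)
  finally show le: "sqnorm A \<le> sqnorm g" .
  then show "square_integrable A" using g le_less_trans[OF le] A by (auto simp: square_integrable_iff)
  fix \<phi> :: "real ^ 'n \<Rightarrow> complex" assume \<phi>: "square_integrable \<phi>"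
  have [measurable]: "\<phi> \<in> borel_measurable borel" by (rule square_integrableD[OF \<phi>])
  let ?F = "\<lambda>x t. indicator {0..1} t *\<^sub>R (g (x + (t * h) *\<^sub>R ?e) * \<phi> x)"
  have F: "integrable (lborel \<Otimes>\<^sub>M lborel) (\<lambda>(x, t). ?F x t)"
  proof (rule integrableI_bounded)
    show "(\<lambda>(x, t). ?F x t) \<in> borel_measurable (lborel \<Otimes>\<^sub>M lborel)" by measurable
    have "(\<integral>\<^sup>+z. ennreal (norm (case z of (x, t) \<Rightarrow> ?F x t)) \<partial>(lborel \<Otimes>\<^sub>M lborel)) =
       (\<integral>\<^sup>+t. (\<integral>\<^sup>+x. ennreal (norm (?F x t)) \<partial>lborel) \<partial>lborel)"
      by (subst lborel_pair.nn_integral_snd[symmetric]) (auto simp: split_beta')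
    also have "\<dots> \<le> (\<integral>\<^sup>+t. indicator {0..1} t * (sqnorm g + sqnorm \<phi>) \<partial>(lborel :: real measure))"
    proof (intro nn_integral_mono)
      fix t :: real
      have "(\<integral>\<^sup>+x. ennreal (norm (?F x t)) \<partial>lborel) \<le>
         (\<integral>\<^sup>+x. indicator {0..1} t * (ennreal ((norm (g (x + (t * h) *\<^sub>R ?e)))\<^sup>2) + ennreal ((norm (\<phi> x))\<^sup>2)) \<partial>lborel)"
      proof (intro nn_integral_mono)
        fix x
        have "a * b \<le> a\<^sup>2 + b\<^sup>2" if "a \<ge> 0" "b \<ge> 0" for a b :: real
          using sum_squares_bound[of a b] mult_nonneg_nonneg[OF that] by linarith
        then show "ennreal (norm (?F x t)) \<le>
           indicator {0..1} t * (ennreal ((norm (g (x + (t * h) *\<^sub>R ?e)))\<^sup>2) + ennreal ((norm (\<phi> x))\<^sup>2))"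
          by (auto simp: indicator_def norm_mult ennreal_leI simp flip: ennreal_plus)
      qed
      also have "\<dots> = indicator {0..1} t * (sqnorm g + sqnorm \<phi>)"
        unfolding sqnorm_def
        by (simp add: nn_integral_cmult nn_integral_add nn_integral_translate[of "\<lambda>x. ennreal ((norm (g x))\<^sup>2)"])
      finally show "(\<integral>\<^sup>+x. ennreal (norm (?F x t)) \<partial>lborel) \<le> indicator {0..1} t * (sqnorm g + sqnorm \<phi>)" .
    qed
    also have "\<dots> = sqnorm g + sqnorm \<phi>" by (simp add: nn_integral_multc)
    also have "\<dots> < \<infinity>" using g \<phi> by (auto simp: square_integrable_iff)
    finally show "(\<integral>\<^sup>+z. ennreal (norm (case z of (x, t) \<Rightarrow> ?F x t)) \<partial>(lborel \<Otimes>\<^sub>M lborel)) < \<infinity>" .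
  qed
  have "(LINT x|lborel. A x * \<phi> x) = (LINT x|lborel. LINT t|lborel. ?F x t)"
    unfolding A_def by (intro Bochner_Integration.integral_cong refl) (simp flip: scaleR_left_commute mult_scaleR_left)
  also have "\<dots> = (LINT t|lborel. LINT x|lborel. ?F x t)"
    using lborel_pair.Fubini_integral[OF F] by simp
  also have "\<dots> = (LINT t|lborel. indicator {0..1} t *\<^sub>R (LINT x|lborel. g (x + (t * h) *\<^sub>R ?e) * \<phi> x))"
    by simp
  finally show "(LINT x|lborel. A x * \<phi> x) =
    (LINT t|lborel. indicator {0..1} t *\<^sub>R (LINT x|lborel. g (x + (t * h) *\<^sub>R ?e) * \<phi> x))" .
qed

text \<open>The increment u(x + h e_i) - u(x) is h times the average of g over the segment. This is
  verified against test functions: the shifts are moved onto \<phi>, to which the fundamental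
  theorem of calculus applies.\<close>

lemma diff2_le_weak_gradient:
  fixes u :: "real ^ 'n \<Rightarrow> complex"
  assumes u: "square_integrable u" and g: "square_integrable g" and h: "h > 0"
    and weak: "\<And>\<phi>. test_function \<phi> \<Longrightarrow>
      (LINT x|lborel. u x * partial_deriv i \<phi> x) = - (LINT x|lborel. g x * \<phi> x)"
  shows "diff2 i h u \<le> ennreal (h\<^sup>2) * sqnorm g"
proof -
  let ?e = "axis i 1 :: real ^ 'n"
  have [measurable]: "g \<in> borel_measurable borel" "u \<in> borel_measurable borel"
    using g u square_integrableD(1) by blast+
  define A where "A x = (LINT t|lborel. indicator {0..1} t *\<^sub>R g (x + (t * h) *\<^sub>R ?e))" for x
  define f where "f x = u (x + h *\<^sub>R ?e) - u x - of_real h * A x" for x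
  note A = line_average[OF g, where i = i and h = h, folded A_def]
  have fsq: "square_integrable f" unfolding f_def
    by (intro square_integrable_diff square_integrable_translate u square_integrable_cmult A)
  have "AE x in lborel. f x = 0"
  proof (rule fundamental_lemma[OF square_integrable_imp_locally_integrable[OF fsq]])
    fix \<phi> :: "real ^ 'n \<Rightarrow> complex" assume \<phi>: "test_function \<phi>"
    have [measurable]: "\<phi> \<in> borel_measurable borel" using \<phi> by (rule test_function_measurable)
    note \<phi>s = square_integrable_test_function[OF \<phi>]
    define \<psi> where "\<psi> = partial_deriv i \<phi>"
    have \<psi>: "test_function \<psi>" unfolding \<psi>_def by (rule test_function_partial_deriv[OF \<phi>])
    have [measurable]: "\<psi> \<in> borel_measurable borel" using \<psi> by (rule test_function_measurable)
    note \<psi>s = square_integrable_test_function[OF \<psi>]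
    have shift: "(LINT x|lborel. v (x + z) * \<phi> x) = (LINT x|lborel. v x * \<phi> (x - z))"
      if [measurable]: "v \<in> borel_measurable borel" for v :: "real ^ 'n \<Rightarrow> complex" and z
      using integral_translate[of "\<lambda>x. v x * \<phi> (x - z)" z] by simp
    have 1: "(LINT x|lborel. g (x + (t * h) *\<^sub>R ?e) * \<phi> x) = - (LINT x|lborel. \<psi> (x + (t * - h) *\<^sub>R ?e) * u x)" for t
    proof -
      have "(LINT x|lborel. g (x + (t * h) *\<^sub>R ?e) * \<phi> x) =
          (LINT x|lborel. g x * \<phi> (x + (t * - h) *\<^sub>R ?e))"
        by (subst shift) auto
      also have "\<dots> = - (LINT x|lborel. u x * partial_deriv i (\<lambda>x. \<phi> (x + (t * - h) *\<^sub>R ?e)) x)"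
        using weak[OF test_function_translate[OF \<phi>], of "(t * - h) *\<^sub>R ?e"] by (simp only: minus_minus)
      finally show ?thesis
        by (simp only: partial_deriv_translate[OF \<phi>] \<psi>_def mult.commute)
    qed
    \<comment> \<open>The average of the derivative of \<phi> over the backward segment, so that
      \<open>of_real h * B x\<close> is the increment of \<phi> from x - h e_i to x.\<close>
    define B where "B x = (LINT t|lborel. indicator {0..1} t *\<^sub>R \<psi> (x + (t * - h) *\<^sub>R ?e))" for x
    note B = line_average[OF \<psi>s, where h = "- h" and i = i, folded B_def]
    have Bx: "of_real h * B x = \<phi> x - \<phi> (x - h *\<^sub>R ?e)" for x
    proof -
      have "(LINT t|lborel. indicator {0..1} t *\<^sub>R (- h *\<^sub>R \<psi> (x + (t * - h) *\<^sub>R ?e))) =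
         \<phi> (x + (1 * - h) *\<^sub>R ?e) - \<phi> (x + (0 * - h) *\<^sub>R ?e)"
      proof (rule integral_FTC_Icc)
        show "((\<lambda>t. \<phi> (x + (t * - h) *\<^sub>R ?e)) has_vector_derivative - h *\<^sub>R \<psi> (x + (t * - h) *\<^sub>R ?e))
            (at t within {0..1})" for t
        proof -
          have "((\<lambda>t. t * - h) has_vector_derivative - h) (at t within {0..1})"
            by (auto intro!: derivative_eq_intros)
          from vector_diff_chain_within[OF this
            has_vector_derivative_at_within[OF test_function_vector_derivative[OF \<phi>, of x i "t * - h"]]]
          show ?thesis by (simp add: o_def \<psi>_def)
        qed
        show "continuous_on {0..1} (\<lambda>t. - h *\<^sub>R \<psi> (x + (t * - h) *\<^sub>R ?e))"
          by (intro continuous_intros continuous_on_compose2[OF test_function_continuous[OF \<psi>]]) auto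
      qed auto
      moreover have "(LINT t|lborel. indicator {0..1} t *\<^sub>R (- h *\<^sub>R \<psi> (x + (t * - h) *\<^sub>R ?e))) = - (of_real h * B x)"
      proof -
        have "(LINT t|lborel. indicator {0..1} t *\<^sub>R (- h *\<^sub>R \<psi> (x + (t * - h) *\<^sub>R ?e))) =
          (LINT t|lborel. (- h) *\<^sub>R (indicator {0..1} t *\<^sub>R \<psi> (x + (t * - h) *\<^sub>R ?e)))"
          by (intro Bochner_Integration.integral_cong) auto
        also have "\<dots> = (- h) *\<^sub>R B x" unfolding B_def by (rule integral_scaleR_right)
        finally show ?thesis by (simp add: scaleR_conv_of_real)
      qed
      ultimately have "- (of_real h * B x) = \<phi> (x - h *\<^sub>R ?e) - \<phi> x" by simp
      then show ?thesis by (metis minus_diff_eq minus_minus)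
    qed
    have iA: "integrable lborel (\<lambda>x. A x * \<phi> x)" by (intro integrable_mult_square_integrable A \<phi>s)
    have "(LINT x|lborel. A x * \<phi> x) =
        (LINT t|lborel. indicator {0..1} t *\<^sub>R (LINT x|lborel. g (x + (t * h) *\<^sub>R ?e) * \<phi> x))"
      by (rule A(3)[OF \<phi>s])
    also have "\<dots> = - (LINT t|lborel. indicator {0..1} t *\<^sub>R (LINT x|lborel. \<psi> (x + (t * - h) *\<^sub>R ?e) * u x))"
      unfolding 1 by simp
    also have "\<dots> = - (LINT x|lborel. B x * u x)" using B(3)[OF u] by simp
    finally have "of_real h * (LINT x|lborel. A x * \<phi> x) = - (LINT x|lborel. (of_real h * B x) * u x)"
      by (simp add: mult.assoc)
    also have "\<dots> = - (LINT x|lborel. u x * \<phi> x - u x * \<phi> (x - h *\<^sub>R ?e))"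
      unfolding Bx by (simp add: algebra_simps)
    also have "\<dots> = (LINT x|lborel. u x * \<phi> (x - h *\<^sub>R ?e)) - (LINT x|lborel. u x * \<phi> x)"
      using square_integrable_translate[OF \<phi>s, of "- h *\<^sub>R ?e"]
      by (subst Bochner_Integration.integral_diff) (auto intro!: integrable_mult_square_integrable u \<phi>s)
    also have "(LINT x|lborel. u x * \<phi> (x - h *\<^sub>R ?e)) = (LINT x|lborel. u (x + h *\<^sub>R ?e) * \<phi> x)"
      by (rule shift[symmetric]) simp
    finally have *: "of_real h * (LINT x|lborel. A x * \<phi> x) =
      (LINT x|lborel. u (x + h *\<^sub>R ?e) * \<phi> x) - (LINT x|lborel. u x * \<phi> x)" .
    have "(LINT x|lborel. f x * \<phi> x) = (LINT x|lborel. u (x + h *\<^sub>R ?e) * \<phi> x - u x * \<phi> x - of_real h * (A x * \<phi> x))"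
      by (simp add: f_def algebra_simps)
    also have "\<dots> = (LINT x|lborel. u (x + h *\<^sub>R ?e) * \<phi> x) - (LINT x|lborel. u x * \<phi> x) -
        of_real h * (LINT x|lborel. A x * \<phi> x)"
      using iA by (simp add: Bochner_Integration.integral_diff Bochner_Integration.integrable_diff
          integrable_mult_square_integrable square_integrable_translate u \<phi>s)
    finally show "(LINT x|lborel. f x * \<phi> x) = 0" using * by simp
  qed
  then have "diff2 i h u = sqnorm (\<lambda>x. of_real h * A x)"
    unfolding diff2_def sqnorm_def by (intro nn_integral_cong_AE) (auto simp: f_def elim!: eventually_mono)
  also have "\<dots> = ennreal (h\<^sup>2) * sqnorm A"
    using A(1) by (subst sqnorm_cmult) (auto simp: square_integrable_iff)
  also have "\<dots> \<le> ennreal (h\<^sup>2) * sqnorm g" by (intro mult_left_mono A) auto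
  finally show ?thesis .
qed

text \<open>Bounded difference quotients of u bound the functional that pairs u with minus the
  derivative of a test function; its Riesz representative is the weak derivative.\<close>

lemma weak_derivative_of_kin:
  fixes u :: "real ^ 'n \<Rightarrow> complex"
  assumes u: "square_integrable u" and kin: "kin i u \<le> ennreal S" and S: "S \<ge> 0"
  shows "\<exists>g. square_integrable g \<and> sqnorm g \<le> ennreal S \<and>
    (\<forall>\<phi>. test_function \<phi> \<longrightarrow> (LINT x|lborel. u x * partial_deriv i \<phi> x) = - (LINT x|lborel. g x * \<phi> x))"
proof -
  let ?e = "axis i 1 :: real ^ 'n"
  have [measurable]: "u \<in> borel_measurable borel" by (rule square_integrableD[OF u])
  define \<l> where "\<l> \<phi> = - (LINT x|lborel. u x * partial_deriv i \<phi> x)" for \<phi>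
  have int: "integrable lborel (\<lambda>x. u x * partial_deriv i \<phi> x)" if "test_function \<phi>" for \<phi>
    by (intro integrable_mult_square_integrable u square_integrable_test_function test_function_partial_deriv that)
  have bound: "2 * Re (\<l> \<phi>) \<le> S + (LINT x|lborel. (norm (\<phi> x))\<^sup>2)" if \<phi>: "test_function \<phi>" for \<phi>
  proof -
    have [measurable]: "\<phi> \<in> borel_measurable borel" using \<phi> by (rule test_function_measurable)
    note \<phi>s = square_integrable_test_function[OF \<phi>]
    define h where "h n = 1 / real (Suc n)" for n
    have h: "h n > 0" for n by (simp add: h_def)
    \<comment> \<open>The step is negative, so that moving the shift from \<phi> to u produces the
      forward quotient controlled by \<open>kin\<close>.\<close>
    have lim: "(\<lambda>n. LINT x|lborel. u x * ((\<phi> (x + (- h n) *\<^sub>R ?e) - \<phi> x) / of_real (- h n))) \<longlonglongrightarrow>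
       (LINT x|lborel. u x * partial_deriv i \<phi> x)"
    proof (rule difference_quotient_tendsto[OF square_integrable_imp_locally_integrable[OF u] \<phi>])
      have "h \<longlonglongrightarrow> 0" unfolding h_def by (rule LIMSEQ_Suc[OF lim_1_over_n])
      from tendsto_minus[OF this] show "(\<lambda>n. - h n) \<longlonglongrightarrow> 0" by simp
    qed (use h in \<open>auto simp: less_imp_neq[symmetric]\<close>)
    have "2 * Re (- (LINT x|lborel. u x * ((\<phi> (x + (- h n) *\<^sub>R ?e) - \<phi> x) / of_real (- h n)))) \<le>
       S + (LINT x|lborel. (norm (\<phi> x))\<^sup>2)" for n
    proof -
      define D where "D x = (of_real (1 / h n)) * (u (x + h n *\<^sub>R ?e) - u x)" for x
      have D: "square_integrable D"
        unfolding D_def by (intro square_integrable_cmult square_integrable_diff square_integrable_translate u)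
      have "sqnorm D = ennreal (1 / (h n)\<^sup>2) * diff2 i (h n) u"
        unfolding D_def diff2_def using h[of n]
        by (subst sqnorm_cmult) (auto simp: norm_divide power_divide)
      also have "\<dots> \<le> ennreal S" using quotient_le_kin[OF h] kin by (rule order_trans)
      finally have DS: "(LINT x|lborel. (norm (D x))\<^sup>2) \<le> S"
        using S by (simp add: sqnorm_eq_integral[OF D])
      have "(LINT x|lborel. u x * ((\<phi> (x + (- h n) *\<^sub>R ?e) - \<phi> x) / of_real (- h n))) =
        (LINT x|lborel. of_real (1 / h n) * (u x * \<phi> x - u x * \<phi> (x - h n *\<^sub>R ?e)))"
        using h[of n] by (intro Bochner_Integration.integral_cong) (auto simp: field_simps)
      also have "\<dots> = of_real (1 / h n) * ((LINT x|lborel. u x * \<phi> x) - (LINT x|lborel. u x * \<phi> (x - h n *\<^sub>R ?e)))"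
        using square_integrable_translate[OF \<phi>s, of "- h n *\<^sub>R ?e"]
        by (subst integral_mult_right_zero, subst Bochner_Integration.integral_diff)
           (auto intro!: integrable_mult_square_integrable u \<phi>s)
      also have "(LINT x|lborel. u x * \<phi> (x - h n *\<^sub>R ?e)) = (LINT x|lborel. u (x + h n *\<^sub>R ?e) * \<phi> x)"
        using integral_translate[of "\<lambda>x. u x * \<phi> (x - h n *\<^sub>R ?e)" "h n *\<^sub>R ?e"] by simp
      also have "of_real (1 / h n) * ((LINT x|lborel. u x * \<phi> x) - (LINT x|lborel. u (x + h n *\<^sub>R ?e) * \<phi> x)) =
         - (LINT x|lborel. D x * \<phi> x)"
      proof -
        have "(LINT x|lborel. D x * \<phi> x) = (LINT x|lborel. of_real (1 / h n) * (u (x + h n *\<^sub>R ?e) * \<phi> x - u x * \<phi> x))"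
          unfolding D_def by (simp add: algebra_simps)
        also have "\<dots> = of_real (1 / h n) * ((LINT x|lborel. u (x + h n *\<^sub>R ?e) * \<phi> x) - (LINT x|lborel. u x * \<phi> x))"
          by (subst integral_mult_right_zero, subst Bochner_Integration.integral_diff)
             (auto intro!: integrable_mult_square_integrable square_integrable_translate u \<phi>s)
        finally show ?thesis by (simp add: algebra_simps)
      qed
      finally have "2 * Re (- (LINT x|lborel. u x * ((\<phi> (x + (- h n) *\<^sub>R ?e) - \<phi> x) / of_real (- h n)))) =
        2 * Re (LINT x|lborel. D x * \<phi> x)" by simp
      also have "\<dots> \<le> 2 * norm (LINT x|lborel. D x * \<phi> x)" by (simp add: complex_Re_le_cmod)
      also have "\<dots> \<le> S + (LINT x|lborel. (norm (\<phi> x))\<^sup>2)"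
        using integral_mult_bound[OF D \<phi>s] DS by linarith
      finally show ?thesis .
    qed
    moreover have "(\<lambda>n. 2 * Re (- (LINT x|lborel. u x * ((\<phi> (x + (- h n) *\<^sub>R ?e) - \<phi> x) / of_real (- h n)))))
       \<longlonglongrightarrow> 2 * Re (\<l> \<phi>)"
      unfolding \<l>_def by (intro tendsto_intros lim)
    ultimately show ?thesis by (auto intro: LIMSEQ_le_const2)
  qed
  have "\<exists>g. square_integrable g \<and> (LINT x|lborel. (norm (g x))\<^sup>2) \<le> S \<and>
    (\<forall>\<psi>\<in>Collect test_function. \<l> \<psi> = (LINT x|lborel. g x * \<psi> x))"
  proof (rule riesz_representation)
    show "square_integrable f" if "f \<in> Collect test_function" for f :: "real ^ 'n \<Rightarrow> complex"
      using that by (simp add: square_integrable_test_function)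
    show "\<l> (\<lambda>x. \<phi> x + \<psi> x) = \<l> \<phi> + \<l> \<psi>" if "\<phi> \<in> Collect test_function" "\<psi> \<in> Collect test_function" for \<phi> \<psi>
      using that int unfolding \<l>_def by (simp add: partial_deriv_add distrib_left)
    show "\<l> (\<lambda>x. c * \<phi> x) = c * \<l> \<phi>" if "\<phi> \<in> Collect test_function" for c \<phi>
      using that unfolding \<l>_def by (simp add: partial_deriv_cmult mult.left_commute[of _ c])
    \<comment> \<open>Some test function is required as a witness that the subspace is
      nonempty.\<close>
    show "(\<lambda>x. complex_of_real (box_bump 0 0 0 x)) \<in> Collect test_function"
      by (simp add: test_function_box_bump)
  qed (auto intro: test_function_add test_function_cmult bound square_integrable_test_function)
  then obtain g where g: "square_integrable g" "(LINT x|lborel. (norm (g x))\<^sup>2) \<le> S"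
    "\<And>\<psi>. test_function \<psi> \<Longrightarrow> \<l> \<psi> = (LINT x|lborel. g x * \<psi> x)" by auto
  show ?thesis
    using g by (intro exI[of _ g]) (auto simp: sqnorm_eq_integral ennreal_leI \<l>_def minus_equation_iff)
qed

text \<open>Componentwise from the fundamental lemma. Both gradients are only locally integrable, so
  splitting the integral of the difference relies on the compact support of the test
  function.\<close>

lemma has_weak_gradient_unique:
  assumes "has_weak_gradient u G" "has_weak_gradient u G'"
  shows "AE x in lborel. G x = G' x"
proof -
  have "AE x in lborel. G x $ i - G' x $ i = 0" for i
  proof (rule fundamental_lemma)
    show "locally_integrable (\<lambda>x. G x $ i - G' x $ i)"
      using assms by (intro locally_integrable_diff locally_integrable_nth) (auto simp: has_weak_gradient_def)
    fix \<phi> :: "real ^ 'a \<Rightarrow> complex" assume \<phi>: "test_function \<phi>"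
    obtain R where R: "R > 0" "\<And>x. R \<le> norm x \<Longrightarrow> \<phi> x = 0" using test_function_support[OF \<phi>] by blast
    obtain B where B: "B > 0" "\<And>x. norm (\<phi> x) \<le> B" using test_function_bounded[OF \<phi>] by blast
    have int: "integrable lborel (\<lambda>x. f x * \<phi> x)" if f: "locally_integrable f" for f :: "real ^ 'a \<Rightarrow> complex"
    proof (rule Bochner_Integration.integrable_bound)
      have "integrable lborel (\<lambda>x. indicator (cball 0 R) x *\<^sub>R f x)"
        using f by (auto simp: locally_integrable_def set_integrable_def)
      then show "integrable lborel (\<lambda>x. B * norm (indicator (cball 0 R) x *\<^sub>R f x))"
        by (intro integrable_mult_right integrable_norm)
      show "(\<lambda>x. f x * \<phi> x) \<in> borel_measurable lborel"
        using f test_function_measurable[OF \<phi>] by (auto simp: locally_integrable_def)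
      show "AE x in lborel. norm (f x * \<phi> x) \<le> norm (B * norm (indicator (cball 0 R) x *\<^sub>R f x))"
      proof (intro AE_I2)
        fix x
        show "norm (f x * \<phi> x) \<le> norm (B * norm (indicator (cball 0 R) x *\<^sub>R f x))"
          using B(1) R(2)[of x] mult_left_mono[OF B(2), of "norm (f x)" x]
          by (cases "norm x \<le> R") (auto simp: norm_mult mult.commute)
      qed
    qed
    have "(LINT x|lborel. (G x $ i - G' x $ i) * \<phi> x) =
        (LINT x|lborel. G x $ i * \<phi> x) - (LINT x|lborel. G' x $ i * \<phi> x)"
      unfolding left_diff_distrib using assms
      by (intro Bochner_Integration.integral_diff int locally_integrable_nth) (auto simp: has_weak_gradient_def)
    also have "\<dots> = 0"
    proof -
      have "- (LINT x|lborel. G x $ i * \<phi> x) = - (LINT x|lborel. G' x $ i * \<phi> x)"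
        using assms \<phi> unfolding has_weak_gradient_def by (metis (no_types))
      then show ?thesis by simp
    qed
    finally show "(LINT x|lborel. (G x $ i - G' x $ i) * \<phi> x) = 0" .
  qed
  then have "AE x in lborel. \<forall>i. G x $ i - G' x $ i = 0" by (subst AE_all_countable) auto
  then show ?thesis by eventually_elim (simp add: vec_eq_iff)
qed

lemma sqnorm_vec:
  fixes G :: "real ^ 'n \<Rightarrow> complex ^ 'n"
  assumes [measurable]: "\<And>i. (\<lambda>x. G x $ i) \<in> borel_measurable borel"
  shows "sqnorm G = (\<Sum>i\<in>UNIV. sqnorm (\<lambda>x. G x $ i))"
proof -
  have "(norm (G x))\<^sup>2 = (\<Sum>i\<in>UNIV. (norm (G x $ i))\<^sup>2)" for x
    by (simp add: norm_vec_def L2_set_def sum_nonneg)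
  then show ?thesis unfolding sqnorm_def by (simp add: sum_ennreal[symmetric] nn_integral_sum del: sum_ennreal)
qed

lemma measurable_vec_nth [measurable]: "G \<in> borel_measurable M \<Longrightarrow> (\<lambda>x. (G x :: complex ^ 'n) $ i) \<in> borel_measurable M"
  by (rule measurable_compose[OF _ borel_measurable_continuous_onI]) (auto intro!: continuous_intros)

text \<open>The upper bound is the estimate by line averages. For the lower bound, the
  representative obtained from the difference quotients has squared norm at most
  \<open>kin i u\<close>, and by the fundamental lemma it coincides with the i-th component of
  G.\<close>

lemma kin_eq_sqnorm:
  fixes u :: "real ^ 'n \<Rightarrow> complex"
  assumes u: "square_integrable u" and G: "has_weak_gradient u G" "square_integrable G"
  shows "kin i u = sqnorm (\<lambda>x. G x $ i)"
proof (rule antisym)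
  have [measurable]: "G \<in> borel_measurable borel" by (rule square_integrableD[OF G(2)])
  have Gi: "square_integrable (\<lambda>x. G x $ i)" for i
  proof -
    have "sqnorm (\<lambda>x. G x $ i) \<le> sqnorm G"
      unfolding sqnorm_def by (intro nn_integral_mono ennreal_leI power_mono Finite_Cartesian_Product.norm_nth_le) auto
    then show ?thesis using le_less_trans[of "sqnorm (\<lambda>x. G x $ i)" "sqnorm G" \<infinity>] G(2)
      unfolding square_integrable_iff by auto
  qed
  have weak: "(LINT x|lborel. u x * partial_deriv i \<phi> x) = - (LINT x|lborel. G x $ i * \<phi> x)"
    if "test_function \<phi>" for \<phi> i using G(1) that by (auto simp: has_weak_gradient_def)
  show le: "kin i u \<le> sqnorm (\<lambda>x. G x $ i)"
    by (rule kin_leI) (rule diff2_le_weak_gradient[OF u Gi _ weak])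
  have "kin i u < \<infinity>" using le Gi[of i] by (auto simp: square_integrable_iff intro: le_less_trans)
  then obtain S where S: "kin i u = ennreal S" "S \<ge> 0" by (cases "kin i u") auto
  obtain g where g: "square_integrable g" "sqnorm g \<le> ennreal S"
    "\<And>\<phi>. test_function \<phi> \<Longrightarrow> (LINT x|lborel. u x * partial_deriv i \<phi> x) = - (LINT x|lborel. g x * \<phi> x)"
    using weak_derivative_of_kin[OF u eq_refl[OF S(1)] S(2)] by blast
  have "AE x in lborel. G x $ i - g x = 0"
  proof (rule fundamental_lemma)
    show "locally_integrable (\<lambda>x. G x $ i - g x)"
      by (intro square_integrable_imp_locally_integrable square_integrable_diff Gi g)
    fix \<phi> :: "real ^ 'n \<Rightarrow> complex" assume \<phi>: "test_function \<phi>"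
    have "(LINT x|lborel. (G x $ i - g x) * \<phi> x) = (LINT x|lborel. G x $ i * \<phi> x) - (LINT x|lborel. g x * \<phi> x)"
      unfolding left_diff_distrib
      by (intro Bochner_Integration.integral_diff integrable_mult_square_integrable Gi g square_integrable_test_function \<phi>)
    then show "(LINT x|lborel. (G x $ i - g x) * \<phi> x) = 0"
      using weak[OF \<phi>, of i] g(3)[OF \<phi>] by simp
  qed
  then have "sqnorm (\<lambda>x. G x $ i) = sqnorm g"
    unfolding sqnorm_def by (intro nn_integral_cong_AE) (auto elim!: eventually_mono)
  then show "sqnorm (\<lambda>x. G x $ i) \<le> kin i u" using g(2) S by simp
qed

lemma kinetic_less_top_iff: "kinetic u < \<infinity> \<longleftrightarrow> (\<forall>i. kin i u < \<infinity>)"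
  unfolding kinetic_def by (simp add: less_top)

lemma weak_gradient_of_kinetic:
  fixes u :: "real ^ 'n \<Rightarrow> complex"
  assumes u: "square_integrable u" and kin: "kinetic u < \<infinity>"
  shows "\<exists>G. has_weak_gradient u G \<and> square_integrable G"
proof -
  have "\<exists>g. square_integrable g \<and>
    (\<forall>\<phi>. test_function \<phi> \<longrightarrow> (LINT x|lborel. u x * partial_deriv i \<phi> x) = - (LINT x|lborel. g x * \<phi> x))" for i
  proof -
    obtain S where S: "kin i u = ennreal S" "S \<ge> 0"
      using spec[OF kin[unfolded kinetic_less_top_iff], of i] by (cases "kin i u") auto
    show ?thesis using weak_derivative_of_kin[OF u eq_refl[OF S(1)] S(2)] by blast
  qed
  then obtain g where g: "\<And>i. square_integrable (g i)"
    "\<And>i \<phi>. test_function \<phi> \<Longrightarrow> (LINT x|lborel. u x * partial_deriv i \<phi> x) = - (LINT x|lborel. g i x * \<phi> x)"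
    by metis
  have [measurable]: "g i \<in> borel_measurable borel" for i by (rule square_integrableD[OF g(1)])
  define G where "G x = (\<chi> i. g i x)" for x
  have [measurable]: "G \<in> borel_measurable borel"
  proof (subst borel_measurable_euclidean_space, intro ballI)
    fix b :: "complex ^ 'n" assume "b \<in> Basis"
    have "(\<lambda>x. G x \<bullet> b) = (\<lambda>x. \<Sum>i\<in>UNIV. g i x \<bullet> b $ i)" by (simp add: G_def inner_vec_def)
    then show "(\<lambda>x. G x \<bullet> b) \<in> borel_measurable borel" by simp
  qed
  have "sqnorm G < \<infinity>"
    using g(1) by (subst sqnorm_vec) (auto simp: G_def less_top square_integrable_iff)
  then have G: "square_integrable G" by (simp add: square_integrable_iff)
  have "has_weak_gradient u G"
    unfolding has_weak_gradient_def using g u G by (auto simp: G_def square_integrable_imp_locally_integrable)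
  then show ?thesis using G by blast
qed

text \<open>From here on membership is decided by difference quotients alone, so it is inherited by
  every function with smaller increments.\<close>

lemma sobolev_H1_iff:
  fixes u :: "real ^ 'n \<Rightarrow> complex"
  shows "u \<in> sobolev_H1 \<longleftrightarrow> square_integrable u \<and> kinetic u < \<infinity>"
proof -
  have "kinetic u < \<infinity>" if "square_integrable u" "has_weak_gradient u G" "square_integrable G" for G
    using that sqnorm_vec[of G] square_integrableD(1)[OF that(3)]
    unfolding kinetic_def by (simp add: kin_eq_sqnorm[OF that] square_integrable_iff)
  then show ?thesis using weak_gradient_of_kinetic[of u] unfolding sobolev_H1_def by blast
qed

lemma weak_gradient:
  assumes "u \<in> sobolev_H1"
  shows "has_weak_gradient u (weak_gradient u)" "square_integrable (weak_gradient u)"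
proof -
  obtain G where G: "has_weak_gradient u G" "square_integrable G"
    using assms by (auto simp: sobolev_H1_def)
  show w: "has_weak_gradient u (weak_gradient u)"
    unfolding weak_gradient_def by (rule someI[of "has_weak_gradient u", OF G(1)])
  have "weak_gradient u \<in> borel_measurable borel"
    using w by (auto simp: has_weak_gradient_def locally_integrable_def)
  moreover have "sqnorm (weak_gradient u) = sqnorm G"
    unfolding sqnorm_def using has_weak_gradient_unique[OF w G(1)]
    by (intro nn_integral_cong_AE) (auto elim!: eventually_mono)
  ultimately show "square_integrable (weak_gradient u)" using G(2) by (simp add: square_integrable_iff)
qed

lemma sqnorm_weak_gradient:
  assumes "u \<in> sobolev_H1"
  shows "sqnorm (weak_gradient u) = kinetic u"
proof -
  note w = weak_gradient[OF assms]
  have u: "square_integrable u" using assms by (simp add: sobolev_H1_iff)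
  show ?thesis unfolding kinetic_def kin_eq_sqnorm[OF u w]
    using square_integrableD(1)[OF w(2)] by (intro sqnorm_vec) measurable
qed

section \<open>Lower semicontinuity and comparison of kinetic energies\<close>

lemma liminf_add_le_ennreal:
  fixes f g :: "nat \<Rightarrow> ennreal"
  shows "liminf f + liminf g \<le> liminf (\<lambda>n. f n + g n)"
proof -
  have "liminf f + liminf g = (SUP n. (INF k\<in>{n..}. f k) + (INF k\<in>{n..}. g k))"
    unfolding liminf_SUP_INF
    by (subst ennreal_SUP_add) (auto simp: incseq_def intro!: INF_superset_mono)
  also have "\<dots> \<le> (SUP n. INF k\<in>{n..}. f k + g k)"
    by (intro SUP_mono INF_greatest bexI add_mono INF_lower) auto
  finally show ?thesis by (simp add: liminf_SUP_INF)
qed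

lemma liminf_sum_le_ennreal:
  fixes f :: "'i \<Rightarrow> nat \<Rightarrow> ennreal"
  assumes "finite I"
  shows "(\<Sum>i\<in>I. liminf (f i)) \<le> liminf (\<lambda>n. \<Sum>i\<in>I. f i n)"
  using assms
proof (induction I rule: finite_induct)
  case (insert i I)
  then have "(\<Sum>i\<in>insert i I. liminf (f i)) \<le> liminf (f i) + liminf (\<lambda>n. \<Sum>i\<in>I. f i n)"
    by (auto intro: add_left_mono)
  also have "\<dots> \<le> liminf (\<lambda>n. f i n + (\<Sum>i\<in>I. f i n))" by (rule liminf_add_le_ennreal)
  finally show ?case using insert by simp
qed simp

lemma nn_integral_AE_tendsto_le_liminf:
  fixes u :: "nat \<Rightarrow> 'a \<Rightarrow> ennreal"
  assumes [measurable]: "\<And>n. u n \<in> borel_measurable M"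
    and lim: "AE x in M. (\<lambda>n. u n x) \<longlonglongrightarrow> U x"
  shows "(\<integral>\<^sup>+x. U x \<partial>M) \<le> liminf (\<lambda>n. \<integral>\<^sup>+x. u n x \<partial>M)"
proof -
  have "(\<integral>\<^sup>+x. U x \<partial>M) = (\<integral>\<^sup>+x. liminf (\<lambda>n. u n x) \<partial>M)"
    using lim by (intro nn_integral_cong_AE) (auto elim!: eventually_mono simp: lim_imp_Liminf)
  also have "\<dots> \<le> liminf (\<lambda>n. \<integral>\<^sup>+x. u n x \<partial>M)" by (rule nn_integral_liminf) measurable
  finally show ?thesis .
qed

text \<open>For fixed h Fatou applies, since translation preserves convergence almost everywhere; a
  supremum of lower semicontinuous functionals is lower semicontinuous.\<close>

lemma kin_le_liminf:
  fixes u :: "nat \<Rightarrow> real ^ 'n \<Rightarrow> 'b::euclidean_space"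
  assumes [measurable]: "\<And>n. u n \<in> borel_measurable borel" "U \<in> borel_measurable borel"
    and lim: "AE x in lborel. (\<lambda>n. u n x) \<longlonglongrightarrow> U x"
  shows "kin i U \<le> liminf (\<lambda>n. kin i (u n))"
  unfolding kin_def[of _ U]
proof (rule SUP_least)
  fix h :: real assume "h \<in> {0<..}"
  then have h: "h > 0" by simp
  have "ennreal (1 / h\<^sup>2) * diff2 i h v =
    (\<integral>\<^sup>+x. ennreal (1 / h\<^sup>2) * ennreal ((norm (v (x + h *\<^sub>R axis i 1) - v x))\<^sup>2) \<partial>lborel)" if [measurable]: "v \<in> borel_measurable borel" for v :: "real ^ 'n \<Rightarrow> 'b"
    unfolding diff2_def sqnorm_def by (rule nn_integral_cmult[symmetric]) measurable
  note 1 = this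
  have "ennreal (1 / h\<^sup>2) * diff2 i h U =
      (\<integral>\<^sup>+x. ennreal (1 / h\<^sup>2) * ennreal ((norm (U (x + h *\<^sub>R axis i 1) - U x))\<^sup>2) \<partial>lborel)"
    by (rule 1) measurable
  also have "\<dots> \<le> liminf (\<lambda>n. \<integral>\<^sup>+x. ennreal (1 / h\<^sup>2) * ennreal ((norm (u n (x + h *\<^sub>R axis i 1) - u n x))\<^sup>2) \<partial>lborel)"
  proof (rule nn_integral_AE_tendsto_le_liminf)
    show "AE x in lborel. (\<lambda>n. ennreal (1 / h\<^sup>2) * ennreal ((norm (u n (x + h *\<^sub>R axis i 1) - u n x))\<^sup>2)) \<longlonglongrightarrow>
       ennreal (1 / h\<^sup>2) * ennreal ((norm (U (x + h *\<^sub>R axis i 1) - U x))\<^sup>2)"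
      using lim AE_translate[OF lim, of "h *\<^sub>R axis i 1"]
    proof eventually_elim
      case (elim x)
      show ?case by (intro ennreal_tendsto_cmult tendsto_intros elim) simp
    qed
  qed measurable
  also have "\<dots> = liminf (\<lambda>n. ennreal (1 / h\<^sup>2) * diff2 i h (u n))" by (simp add: 1)
  also have "\<dots> \<le> liminf (\<lambda>n. kin i (u n))"
    by (intro Liminf_mono always_eventually allI quotient_le_kin h)
  finally show "ennreal (1 / h\<^sup>2) * diff2 i h U \<le> liminf (\<lambda>n. kin i (u n))" .
qed

lemma kinetic_le_liminf:
  fixes u :: "nat \<Rightarrow> real ^ 'n \<Rightarrow> 'b::euclidean_space"
  assumes "\<And>n. u n \<in> borel_measurable borel" "U \<in> borel_measurable borel"
    and "AE x in lborel. (\<lambda>n. u n x) \<longlonglongrightarrow> U x"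
  shows "kinetic U \<le> liminf (\<lambda>n. kinetic (u n))"
proof -
  have "kinetic U \<le> (\<Sum>i\<in>UNIV. liminf (\<lambda>n. kin i (u n)))"
    unfolding kinetic_def by (intro sum_mono kin_le_liminf assms)
  also have "\<dots> \<le> liminf (\<lambda>n. \<Sum>i\<in>UNIV. kin i (u n))" by (rule liminf_sum_le_ennreal) simp
  finally show ?thesis by (simp add: kinetic_def)
qed

lemma diff2_mono2:
  fixes u :: "real ^ 'n \<Rightarrow> 'b::euclidean_space" and v :: "real ^ 'n \<Rightarrow> 'c::euclidean_space"
    and w :: "real ^ 'n \<Rightarrow> 'd::euclidean_space"
  assumes [measurable]: "u \<in> borel_measurable borel" "v \<in> borel_measurable borel"
    and ab: "a \<ge> 0" "b \<ge> 0"
    and le: "\<And>x y. (norm (w x - w y))\<^sup>2 \<le> a * (norm (u x - u y))\<^sup>2 + b * (norm (v x - v y))\<^sup>2"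
  shows "diff2 i h w \<le> ennreal a * diff2 i h u + ennreal b * diff2 i h v"
proof -
  have "diff2 i h w \<le> (\<integral>\<^sup>+x. ennreal a * ennreal ((norm (u (x + h *\<^sub>R axis i 1) - u x))\<^sup>2) +
      ennreal b * ennreal ((norm (v (x + h *\<^sub>R axis i 1) - v x))\<^sup>2) \<partial>lborel)"
    unfolding diff2_def sqnorm_def using ab
    by (intro nn_integral_mono) (simp add: le ennreal_leI flip: ennreal_mult ennreal_plus)
  also have "\<dots> = ennreal a * diff2 i h u + ennreal b * diff2 i h v"
    unfolding diff2_def sqnorm_def by (simp add: nn_integral_add nn_integral_cmult)
  finally show ?thesis .
qed

text \<open>The three functions may have different ranges, so that complex functions, their moduli
  and auxiliary vector-valued maps can be compared directly.\<close>

lemma kin_mono2: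
  fixes u :: "real ^ 'n \<Rightarrow> 'b::euclidean_space" and v :: "real ^ 'n \<Rightarrow> 'c::euclidean_space"
    and w :: "real ^ 'n \<Rightarrow> 'd::euclidean_space"
  assumes "u \<in> borel_measurable borel" "v \<in> borel_measurable borel"
    and ab: "a \<ge> 0" "b \<ge> 0"
    and le: "\<And>x y. (norm (w x - w y))\<^sup>2 \<le> a * (norm (u x - u y))\<^sup>2 + b * (norm (v x - v y))\<^sup>2"
  shows "kin i w \<le> ennreal a * kin i u + ennreal b * kin i v"
proof (rule kin_leI)
  fix h :: real assume h: "h > 0"
  have "diff2 i h w \<le> ennreal a * diff2 i h u + ennreal b * diff2 i h v"
    by (rule diff2_mono2[OF assms])
  also have "\<dots> \<le> ennreal a * (ennreal (h\<^sup>2) * kin i u) + ennreal b * (ennreal (h\<^sup>2) * kin i v)"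
    by (intro add_mono mult_left_mono diff2_le_kin h) auto
  also have "\<dots> = ennreal (h\<^sup>2) * (ennreal a * kin i u + ennreal b * kin i v)"
    by (simp add: distrib_left mult.left_commute)
  finally show "diff2 i h w \<le> ennreal (h\<^sup>2) * (ennreal a * kin i u + ennreal b * kin i v)" .
qed

lemma kinetic_mono2:
  fixes u :: "real ^ 'n \<Rightarrow> 'b::euclidean_space" and v :: "real ^ 'n \<Rightarrow> 'c::euclidean_space"
    and w :: "real ^ 'n \<Rightarrow> 'd::euclidean_space"
  assumes "u \<in> borel_measurable borel" "v \<in> borel_measurable borel" "a \<ge> 0" "b \<ge> 0"
    and "\<And>x y. (norm (w x - w y))\<^sup>2 \<le> a * (norm (u x - u y))\<^sup>2 + b * (norm (v x - v y))\<^sup>2"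
  shows "kinetic w \<le> ennreal a * kinetic u + ennreal b * kinetic v"
proof -
  have "kinetic w \<le> (\<Sum>i\<in>UNIV. ennreal a * kin i u + ennreal b * kin i v)"
    unfolding kinetic_def by (intro sum_mono kin_mono2 assms)
  then show ?thesis by (simp add: kinetic_def sum.distrib sum_distrib_left)
qed

lemma kinetic_mono:
  fixes u :: "real ^ 'n \<Rightarrow> 'b::euclidean_space" and w :: "real ^ 'n \<Rightarrow> 'd::euclidean_space"
  assumes "u \<in> borel_measurable borel" "\<And>x y. norm (w x - w y) \<le> norm (u x - u y)"
  shows "kinetic w \<le> kinetic u"
  using kinetic_mono2[of u u 1 0 w] assms by (simp add: power_mono)

text \<open>Young's inequality with a free parameter: the coefficient of the main term can be taken
  as close to 1 as desired, which serves as a triangle inequality for squared norms.\<close>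

lemma sqnorm_add_le_eps:
  fixes f g :: "real ^ 'n \<Rightarrow> 'b::euclidean_space"
  assumes [measurable]: "f \<in> borel_measurable borel" "g \<in> borel_measurable borel" and e: "\<epsilon> > 0"
  shows "sqnorm (\<lambda>x. f x + g x) \<le> ennreal (1 + \<epsilon>) * sqnorm f + ennreal (1 + 1 / \<epsilon>) * sqnorm g"
proof -
  have pw: "(norm (a + b))\<^sup>2 \<le> (1 + \<epsilon>) * (norm a)\<^sup>2 + (1 + 1 / \<epsilon>) * (norm b)\<^sup>2" for a b :: 'b
  proof -
    have "(norm (a + b))\<^sup>2 \<le> (norm a + norm b)\<^sup>2" by (intro power_mono norm_triangle_ineq) auto
    moreover have "0 \<le> (\<epsilon> * norm a - norm b)\<^sup>2 / \<epsilon>" using e by simp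
    moreover have "(\<epsilon> * norm a - norm b)\<^sup>2 / \<epsilon> = \<epsilon> * (norm a)\<^sup>2 - 2 * (norm a * norm b) + (norm b)\<^sup>2 / \<epsilon>"
      using e by (simp add: power2_eq_square field_simps)
    ultimately show ?thesis by (simp add: power2_eq_square algebra_simps)
  qed
  have "sqnorm (\<lambda>x. f x + g x) \<le> (\<integral>\<^sup>+x. ennreal (1 + \<epsilon>) * ennreal ((norm (f x))\<^sup>2) +
      ennreal (1 + 1 / \<epsilon>) * ennreal ((norm (g x))\<^sup>2) \<partial>lborel)"
    unfolding sqnorm_def using e pw
    by (intro nn_integral_mono) (simp add: ennreal_leI flip: ennreal_mult ennreal_plus)
  also have "\<dots> = ennreal (1 + \<epsilon>) * sqnorm f + ennreal (1 + 1 / \<epsilon>) * sqnorm g"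
    unfolding sqnorm_def by (simp add: nn_integral_add nn_integral_cmult)
  finally show ?thesis .
qed

lemma sqnorm_translate:
  fixes f :: "real ^ 'n \<Rightarrow> 'b::euclidean_space"
  assumes [measurable]: "f \<in> borel_measurable borel"
  shows "sqnorm (\<lambda>x. f (x + z)) = sqnorm f"
  unfolding sqnorm_def using nn_integral_translate[of "\<lambda>x. ennreal ((norm (f x))\<^sup>2)"] by simp

section \<open>Increments over multiples of a step\<close>

lemma norm_sum_square_le:
  fixes f :: "'i \<Rightarrow> 'b::real_normed_vector"
  shows "(norm (\<Sum>i\<in>I. f i))\<^sup>2 \<le> real (card I) * (\<Sum>i\<in>I. (norm (f i))\<^sup>2)"
proof -
  have "(norm (\<Sum>i\<in>I. f i))\<^sup>2 \<le> (\<Sum>i\<in>I. norm (f i))\<^sup>2" by (intro power_mono norm_sum) auto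
  also have "\<dots> \<le> (\<Sum>i\<in>I. 1\<^sup>2) * (\<Sum>i\<in>I. (norm (f i))\<^sup>2)"
    using Cauchy_Schwarz_ineq_sum[of "\<lambda>_. 1" "\<lambda>i. norm (f i)" I] by simp
  finally show ?thesis by simp
qed

text \<open>Cauchy-Schwarz for the telescoping sum over L steps of length h.\<close>

lemma telescope_shift:
  fixes u :: "real ^ 'n \<Rightarrow> 'b::real_normed_vector"
  shows "(norm (u (x + (real L * h) *\<^sub>R e) - u x))\<^sup>2 \<le>
    real L * (\<Sum>l<L. (norm (u (x + (real l * h) *\<^sub>R e + h *\<^sub>R e) - u (x + (real l * h) *\<^sub>R e)))\<^sup>2)"
proof -
  have eq: "x + (real (Suc l) * h) *\<^sub>R e = x + (real l * h) *\<^sub>R e + h *\<^sub>R e" for l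
    by (simp add: algebra_simps)
  have "u (x + (real L * h) *\<^sub>R e) - u x =
      (\<Sum>l<L. u (x + (real (Suc l) * h) *\<^sub>R e) - u (x + (real l * h) *\<^sub>R e))"
    by (subst sum_lessThan_telescope) simp
  then show ?thesis
    using norm_sum_square_le[of "\<lambda>l. u (x + (real (Suc l) * h) *\<^sub>R e) - u (x + (real l * h) *\<^sub>R e)" "{..<L}"]
    unfolding eq card_lessThan by (simp only:)
qed

lemma diff2_mult_le:
  fixes u :: "real ^ 'n \<Rightarrow> 'b::euclidean_space"
  assumes [measurable]: "u \<in> borel_measurable borel"
  shows "diff2 i (real L * h) u \<le> ennreal ((real L)\<^sup>2) * diff2 i h u"
proof -
  let ?e = "axis i 1 :: real ^ 'n"
  let ?d = "\<lambda>x. (norm (u (x + h *\<^sub>R ?e) - u x))\<^sup>2"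
  have "diff2 i (real L * h) u \<le> (\<integral>\<^sup>+x. ennreal (real L) * (\<Sum>l<L. ennreal (?d (x + (real l * h) *\<^sub>R ?e))) \<partial>lborel)"
    unfolding diff2_def sqnorm_def using telescope_shift[of u _ L h ?e]
    by (intro nn_integral_mono) (simp add: ennreal_leI sum_nonneg flip: ennreal_mult)
  also have "\<dots> = ennreal (real L) * (\<Sum>l<L. (\<integral>\<^sup>+x. ennreal (?d (x + (real l * h) *\<^sub>R ?e)) \<partial>lborel))"
    by (simp add: nn_integral_cmult nn_integral_sum del: sum_ennreal)
  also have "\<dots> = ennreal (real L) * (\<Sum>l<L. diff2 i h u)"
    unfolding diff2_def sqnorm_def by (subst nn_integral_translate[of "\<lambda>x. ennreal (?d x)"]) auto
  also have "\<dots> = ennreal ((real L)\<^sup>2) * diff2 i h u"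
    by (simp add: power2_eq_square ennreal_mult ennreal_of_nat_eq_real_of_nat mult.assoc)
  finally show ?thesis .
qed

lemma diff2_zero [simp]: "diff2 i 0 u = 0"
  by (simp add: diff2_def sqnorm_def)

lemma diff2_minus:
  fixes u :: "real ^ 'n \<Rightarrow> 'b::euclidean_space"
  assumes [measurable]: "u \<in> borel_measurable borel"
  shows "diff2 i (- h) u = diff2 i h u"
proof -
  have "diff2 i h u = sqnorm (\<lambda>x. u (x + - h *\<^sub>R axis i 1 + h *\<^sub>R axis i 1) - u (x + - h *\<^sub>R axis i 1))"
    unfolding diff2_def by (rule sqnorm_translate[symmetric]) measurable
  also have "\<dots> = diff2 i (- h) u" unfolding diff2_def sqnorm_def by (simp add: norm_minus_commute)
  finally show ?thesis by simp
qed

lemma diff2_le_kin':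
  fixes u :: "real ^ 'n \<Rightarrow> 'b::euclidean_space"
  assumes "u \<in> borel_measurable borel"
  shows "diff2 i h u \<le> ennreal (h\<^sup>2) * kin i u"
  using diff2_le_kin[of h i u] diff2_le_kin[of "- h" i u] diff2_minus[OF assms, of i h]
  by (cases "h = 0"; cases "h > 0") auto

text \<open>By the triangle inequality the \<open>L\<^sup>2\<close> norm of increments is subadditive in the step, so the
  supremum defining \<open>kin\<close> is approached by small steps.\<close>

lemma quotient_tendsto_kin:
  fixes u :: "real ^ 'n \<Rightarrow> 'b::euclidean_space"
  assumes [measurable]: "u \<in> borel_measurable borel" and fin: "kin i u < \<infinity>"
    and h: "\<And>n. h n > 0" "h \<longlonglongrightarrow> 0"
  shows "(\<lambda>n. ennreal (1 / (h n)\<^sup>2) * diff2 i (h n) u) \<longlonglongrightarrow> kin i u"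
proof (rule order_tendstoI)
  fix a assume "kin i u < a"
  then show "\<forall>\<^sub>F n in sequentially. ennreal (1 / (h n)\<^sup>2) * diff2 i (h n) u < a"
    by (intro always_eventually allI le_less_trans[OF quotient_le_kin[OF h(1)]])
next
  fix a assume a: "a < kin i u"
  then obtain s where s: "s > 0" "a < ennreal (1 / s\<^sup>2) * diff2 i s u"
    unfolding kin_def less_SUP_iff by auto
  obtain S where S: "kin i u = ennreal S" "S \<ge> 0" using fin by (cases "kin i u") auto
  have "\<exists>d. diff2 i t u = ennreal d \<and> d \<ge> 0" for t
  proof -
    have "diff2 i t u \<le> ennreal (t\<^sup>2) * ennreal S" using diff2_le_kin'[of u i t] S by simp
    also have "\<dots> < \<infinity>" by (simp add: ennreal_mult_less_top)
    finally show ?thesis by (cases "diff2 i t u") auto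
  qed
  then obtain d where d: "\<And>t. diff2 i t u = ennreal (d t)" "\<And>t. d t \<ge> 0" by metis
  have dle: "d t \<le> t\<^sup>2 * S" for t
    using diff2_le_kin'[of u i t] S(2) d by (simp add: S(1) flip: ennreal_mult)
  obtain c where c: "a = ennreal c" "c \<ge> 0" using a by (cases a) auto
  have cs: "c * s\<^sup>2 < d s"
    using s(2) d(2)[of s] \<open>s > 0\<close> c by (simp add: d(1) c(1) ennreal_less_iff field_simps flip: ennreal_mult)
  \<comment> \<open>Small enough that \<open>(1 + \<epsilon>) * (c * s\<^sup>2)\<close> is still
    below \<open>d s\<close>; the summand 1 in the denominator covers c = 0.\<close>
  define \<epsilon> where "\<epsilon> = (d s - c * s\<^sup>2) / (2 * (c * s\<^sup>2 + 1))"
  have pos: "c * s\<^sup>2 + 1 > 0" using c by (intro add_nonneg_pos) auto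
  have e: "\<epsilon> > 0" unfolding \<epsilon>_def using cs pos by (intro divide_pos_pos) auto
  have "\<epsilon> * (2 * (c * s\<^sup>2 + 1)) = d s - c * s\<^sup>2" using pos by (simp add: \<epsilon>_def)
  then have ce: "(1 + \<epsilon>) * (c * s\<^sup>2) < d s" using e cs c mult_nonneg_nonneg[of c "s\<^sup>2"]
    by (simp add: algebra_simps)
  \<comment> \<open>Write s = L t + r with 0 \<le> r \<le> t. The L full steps cost a factor L^2
    \<le> (s/t)^2, and the remainder contributes only a term of order t^2.\<close>
  have key: "d s \<le> (1 + \<epsilon>) * s\<^sup>2 * (d t / t\<^sup>2) + (1 + 1 / \<epsilon>) * t\<^sup>2 * S" if t: "t > 0" for t
  proof -
    define L where "L = nat \<lfloor>s / t\<rfloor>"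
    define r where "r = s - real L * t"
    have L: "real L = real_of_int \<lfloor>s / t\<rfloor>" using s t by (simp add: L_def)
    have "real L \<le> s / t" "s / t < real L + 1" unfolding L by linarith+
    then have Lt: "real L * t \<le> s" "0 \<le> r" "r \<le> t" using t by (auto simp: r_def field_simps)
    have "diff2 i s u \<le> ennreal (1 + \<epsilon>) * diff2 i (real L * t) u + ennreal (1 + 1 / \<epsilon>) * diff2 i r u"
    proof -
      have "diff2 i s u = sqnorm (\<lambda>x. (u (x + (real L * t) *\<^sub>R axis i 1) - u x) +
          (u (x + (real L * t) *\<^sub>R axis i 1 + r *\<^sub>R axis i 1) - u (x + (real L * t) *\<^sub>R axis i 1)))"
      proof -
        have eq: "x + (real L * t) *\<^sub>R axis i 1 + r *\<^sub>R axis i 1 = x + s *\<^sub>R axis i (1::real)" for x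
          by (simp add: r_def algebra_simps)
        show ?thesis unfolding diff2_def eq by simp
      qed
      also have "\<dots> \<le> ennreal (1 + \<epsilon>) * diff2 i (real L * t) u + ennreal (1 + 1 / \<epsilon>) *
        sqnorm (\<lambda>x. u (x + (real L * t) *\<^sub>R axis i 1 + r *\<^sub>R axis i 1) - u (x + (real L * t) *\<^sub>R axis i 1))"
        unfolding diff2_def by (rule sqnorm_add_le_eps) (use e in auto)
      also have "sqnorm (\<lambda>x. u (x + (real L * t) *\<^sub>R axis i 1 + r *\<^sub>R axis i 1) - u (x + (real L * t) *\<^sub>R axis i 1)) =
         diff2 i r u"
        unfolding diff2_def
        by (rule sqnorm_translate[of "\<lambda>x. u (x + r *\<^sub>R axis i 1) - u x"]) measurable
      finally show ?thesis .
    qed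
    also have "diff2 i (real L * t) u \<le> ennreal ((real L)\<^sup>2) * diff2 i t u" by (rule diff2_mult_le) measurable
    finally have "d s \<le> (1 + \<epsilon>) * ((real L)\<^sup>2 * d t) + (1 + 1 / \<epsilon>) * d r"
      using e d(2) by (simp add: d(1) mult_left_mono flip: ennreal_mult ennreal_plus)
    also have "(real L)\<^sup>2 * d t \<le> s\<^sup>2 * (d t / t\<^sup>2)"
    proof -
      have "(real L * t)\<^sup>2 \<le> s\<^sup>2" using Lt t by (intro power_mono) auto
      then have "(real L)\<^sup>2 \<le> s\<^sup>2 / t\<^sup>2" using t by (simp add: power_mult_distrib field_simps)
      then show ?thesis using d(2)[of t] mult_right_mono by fastforce
    qed
    also have "d r \<le> t\<^sup>2 * S"
      using dle[of r] S(2) Lt by (meson mult_right_mono order_trans power_mono)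
    finally show ?thesis using e by (simp add: mult.assoc mult_left_mono add_mono)
  qed
  have "(\<lambda>n. d s - (1 + 1 / \<epsilon>) * (h n)\<^sup>2 * S) \<longlonglongrightarrow> d s - (1 + 1 / \<epsilon>) * 0\<^sup>2 * S"
    by (intro tendsto_intros h)
  then have "(\<lambda>n. d s - (1 + 1 / \<epsilon>) * (h n)\<^sup>2 * S) \<longlonglongrightarrow> d s" by simp
  from order_tendstoD(1)[OF this ce]
  have "\<forall>\<^sub>F n in sequentially. c < d (h n) / (h n)\<^sup>2"
  proof eventually_elim
    case (elim n)
    then have "((1 + \<epsilon>) * s\<^sup>2) * c < ((1 + \<epsilon>) * s\<^sup>2) * (d (h n) / (h n)\<^sup>2)"
      using key[OF h(1)[of n]] by (simp add: mult.assoc mult.left_commute[of c] mult.commute[of c])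
    then show ?case using e s by (subst (asm) mult_less_cancel_left_pos) auto
  qed
  then show "\<forall>\<^sub>F n in sequentially. a < ennreal (1 / (h n)\<^sup>2) * diff2 i (h n) u"
    by eventually_elim (simp add: d(1) c ennreal_less_iff d(2) flip: ennreal_mult)
qed

text \<open>The coordinates are shifted one after the other, each at the price of a factor 2 from |a
  + b|^2 \<le> 2|a|^2 + 2|b|^2; this is the origin of the power of 2.\<close>

lemma sqnorm_translate_diff_le:
  fixes u :: "real ^ 'n \<Rightarrow> 'b::euclidean_space"
  assumes [measurable]: "u \<in> borel_measurable borel"
  shows "sqnorm (\<lambda>x. u (x + z) - u x) \<le> ennreal (2 ^ CARD('n) * (norm z)\<^sup>2) * kinetic u"
proof -
  have ind: "sqnorm (\<lambda>x. u (x + (\<Sum>i\<in>A. z $ i *\<^sub>R axis i 1)) - u x) \<le>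
      ennreal (2 ^ card A * (norm z)\<^sup>2) * (\<Sum>i\<in>A. kin i u)" if "finite A" for A :: "'n set"
    using that
  proof (induction A rule: finite_induct)
    case empty
    then show ?case by (simp add: sqnorm_def)
  next
    case (insert i A)
    define y where "y = (\<Sum>i\<in>A. z $ i *\<^sub>R axis i (1::real) :: real ^ 'n)"
    have "sqnorm (\<lambda>x. u (x + (\<Sum>i\<in>insert i A. z $ i *\<^sub>R axis i 1)) - u x) =
       sqnorm (\<lambda>x. (u (x + y + z $ i *\<^sub>R axis i 1) - u (x + y)) + (u (x + y) - u x))"
      using insert by (simp add: y_def add_ac)
    also have "\<dots> \<le> 2 * sqnorm (\<lambda>x. u (x + y + z $ i *\<^sub>R axis i 1) - u (x + y)) + 2 * sqnorm (\<lambda>x. u (x + y) - u x)"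
      by (rule sqnorm_add_le) measurable
    also have "sqnorm (\<lambda>x. u (x + y + z $ i *\<^sub>R axis i 1) - u (x + y)) = diff2 i (z $ i) u"
      unfolding diff2_def by (rule sqnorm_translate[of "\<lambda>x. u (x + z $ i *\<^sub>R axis i 1) - u x"]) measurable
    also have "diff2 i (z $ i) u \<le> ennreal ((z $ i)\<^sup>2) * kin i u" by (rule diff2_le_kin') measurable
    also have "\<dots> \<le> ennreal (2 ^ card A * (norm z)\<^sup>2) * kin i u"
    proof (intro mult_right_mono ennreal_leI)
      have "(z $ i)\<^sup>2 \<le> (norm z)\<^sup>2" using component_le_norm_cart[of z i] by (simp add: abs_le_square_iff[symmetric])
      also have "\<dots> \<le> 2 ^ card A * (norm z)\<^sup>2" using mult_right_mono[of 1 "2 ^ card A :: real" "(norm z)\<^sup>2"] by simp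
      finally show "(z $ i)\<^sup>2 \<le> 2 ^ card A * (norm z)\<^sup>2" .
    qed auto
    also have "sqnorm (\<lambda>x. u (x + y) - u x) \<le> ennreal (2 ^ card A * (norm z)\<^sup>2) * (\<Sum>i\<in>A. kin i u)"
      using insert.IH by (simp add: y_def)
    also have "2 * (ennreal (2 ^ card A * (norm z)\<^sup>2) * kin i u) + 2 * (ennreal (2 ^ card A * (norm z)\<^sup>2) * (\<Sum>i\<in>A. kin i u)) =
      ennreal (2 ^ card (insert i A) * (norm z)\<^sup>2) * (\<Sum>i\<in>insert i A. kin i u)"
      using insert by (simp add: ennreal_mult distrib_left mult.assoc)
    finally show ?case by (simp add: add_mono mult_left_mono)
  qed
  have "(\<Sum>i\<in>UNIV. z $ i *\<^sub>R axis i (1::real)) = z"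
    by (simp add: vec_eq_iff axis_def if_distrib cong: if_cong)
  then show ?thesis using ind[of UNIV] by (simp add: kinetic_def)
qed

section \<open>The Riesz potential as a superposition of Gaussians\<close>

text \<open>With s = (N - \<alpha>)/2, the power |x|^(\<alpha> - N) equals 1/Gamma(s) times the
  integral of t^(s-1) exp(-t|x|^2) over t > 0. The factor Gamma(s) cancels against the numerator of
  the Riesz potential, leaving this density.\<close>

definition heat_weight :: "real \<Rightarrow> real \<Rightarrow> real \<Rightarrow> ennreal" where
  "heat_weight \<alpha> N t = ennreal (indicator {0<..} t *
     (t powr ((N - \<alpha>) / 2 - 1) / (Gamma (\<alpha> / 2) * pi powr (N / 2) * 2 powr \<alpha>)))"

lemma heat_weight_measurable [measurable]: "heat_weight \<alpha> N \<in> borel_measurable borel"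
  unfolding heat_weight_def[abs_def] by measurable

lemma riesz_measurable [measurable]: "riesz_potential \<alpha> \<in> borel_measurable (borel :: (real ^ 'n) measure)"
  unfolding riesz_potential_def[abs_def] by measurable

lemma riesz_eq_heat:
  fixes x :: "real ^ 'n"
  assumes \<alpha>: "0 < \<alpha>" "\<alpha> < real CARD('n)" and x: "x \<noteq> 0"
  shows "ennreal (riesz_potential \<alpha> x) =
    (\<integral>\<^sup>+t. heat_weight \<alpha> (real CARD('n)) t * ennreal (exp (- t * (norm x)\<^sup>2)) \<partial>lborel)"
proof -
  define s where "s = (real CARD('n) - \<alpha>) / 2"
  define r where "r = norm x"
  define C where "C = Gamma (\<alpha> / 2) * pi powr (real CARD('n) / 2) * 2 powr \<alpha>"
  have s: "s > 0" and r: "r > 0" using \<alpha> x by (auto simp: s_def r_def)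
  have C: "C > 0" unfolding C_def using \<alpha> by (intro mult_pos_pos Gamma_real_pos) auto
  have "ennreal (Gamma s) = (\<integral>\<^sup>+t. ennreal (indicator {0..} t * t powr (s - 1) / exp t) \<partial>lborel)"
    by (rule Gamma_conv_nn_integral_real[OF s])
  also have "\<dots> = ennreal (r\<^sup>2) * (\<integral>\<^sup>+t. ennreal (indicator {0..} (r\<^sup>2 * t) * (r\<^sup>2 * t) powr (s - 1) / exp (r\<^sup>2 * t)) \<partial>lborel)"
    using r by (subst nn_integral_real_affine[where c = "r\<^sup>2" and t = 0]) auto
  also have "\<dots> = (\<integral>\<^sup>+t. ennreal (r\<^sup>2 * (indicator {0..} (r\<^sup>2 * t) * (r\<^sup>2 * t) powr (s - 1) / exp (r\<^sup>2 * t))) \<partial>lborel)"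
  proof -
    have "ennreal (r\<^sup>2 * X) = ennreal (r\<^sup>2) * ennreal X" for X by (rule ennreal_mult') simp
    then show ?thesis by (simp only:) (rule nn_integral_cmult[symmetric], measurable)
  qed
  also have "\<dots> = (\<integral>\<^sup>+t. ennreal (C * r powr (2 * s)) * (heat_weight \<alpha> (real CARD('n)) t * ennreal (exp (- t * r\<^sup>2))) \<partial>lborel)"
  proof (intro nn_integral_cong)
    fix t :: real
    consider "t < 0" | "t = 0" | "t > 0" by linarith
    then show "ennreal (r\<^sup>2 * (indicator {0..} (r\<^sup>2 * t) * (r\<^sup>2 * t) powr (s - 1) / exp (r\<^sup>2 * t))) =
      ennreal (C * r powr (2 * s)) * (heat_weight \<alpha> (real CARD('n)) t * ennreal (exp (- t * r\<^sup>2)))"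
    proof cases
      case 1
      then have "r\<^sup>2 * t < 0" using r by (simp add: mult_less_0_iff)
      then show ?thesis using 1 by (simp add: heat_weight_def)
    next
      case 3
      have "r\<^sup>2 * (r\<^sup>2 * t) powr (s - 1) = r powr (2 * s) * t powr (s - 1)"
      proof -
        have "(r\<^sup>2 * t) powr (s - 1) = r powr (2 * (s - 1)) * t powr (s - 1)"
          using r 3 by (simp add: powr_mult powr_powr flip: powr_numeral)
        moreover have "r\<^sup>2 * r powr (2 * (s - 1)) = r powr (2 * s)"
          using r by (simp add: algebra_simps flip: powr_numeral powr_add)
        ultimately show ?thesis by simp
      qed
      then have "r\<^sup>2 * ((r\<^sup>2 * t) powr (s - 1) / exp (r\<^sup>2 * t)) =
          (C * r powr (2 * s)) * ((t powr (s - 1) / C) * exp (- t * r\<^sup>2))"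
        using C by (simp add: exp_minus field_simps)
      moreover have "ennreal ((C * r powr (2 * s)) * ((t powr (s - 1) / C) * exp (- t * r\<^sup>2))) =
          ennreal (C * r powr (2 * s)) * (ennreal (t powr (s - 1) / C) * ennreal (exp (- t * r\<^sup>2)))"
      proof -
        have "ennreal (X * (Y * Z)) = ennreal X * (ennreal Y * ennreal Z)" if "X \<ge> 0" "Y \<ge> 0" for X Y Z
          using that by (simp add: ennreal_mult')
        then show ?thesis using C by (simp only: less_imp_le mult_nonneg_nonneg powr_ge_zero divide_nonneg_pos)
      qed
      moreover have "heat_weight \<alpha> (real CARD('n)) t = ennreal (t powr (s - 1) / C)"
        using 3 by (simp add: heat_weight_def s_def C_def)
      ultimately show ?thesis using 3 r by simp
    qed (simp add: heat_weight_def)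
  qed
  also have "\<dots> = ennreal (C * r powr (2 * s)) * (\<integral>\<^sup>+t. heat_weight \<alpha> (real CARD('n)) t * ennreal (exp (- t * r\<^sup>2)) \<partial>lborel)"
    by (rule nn_integral_cmult) measurable
  finally have *: "ennreal (Gamma s) =
     ennreal (C * r powr (2 * s)) * (\<integral>\<^sup>+t. heat_weight \<alpha> (real CARD('n)) t * ennreal (exp (- t * r\<^sup>2)) \<partial>lborel)" .
  have pos: "C * r powr (2 * s) > 0" using C r by simp
  have "riesz_potential \<alpha> x = Gamma s / (C * r powr (2 * s))"
  proof -
    have 2: "2 * s = real CARD('n) - \<alpha>" by (simp add: s_def)
    show ?thesis unfolding 2 by (simp add: riesz_potential_def C_def r_def s_def)
  qed
  then have "ennreal (riesz_potential \<alpha> x) = ennreal (1 / (C * r powr (2 * s))) * ennreal (Gamma s)"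
    using pos by (simp flip: ennreal_mult')
  also have "\<dots> = (ennreal (1 / (C * r powr (2 * s))) * ennreal (C * r powr (2 * s))) *
      (\<integral>\<^sup>+t. heat_weight \<alpha> (real CARD('n)) t * ennreal (exp (- t * r\<^sup>2)) \<partial>lborel)"
    unfolding * by (simp only: mult.assoc)
  also have "ennreal (1 / (C * r powr (2 * s))) * ennreal (C * r powr (2 * s)) = 1"
    using pos C r by (simp flip: ennreal_mult')
  finally show ?thesis by (simp add: r_def)
qed

text \<open>\<open>exp (- t |x - y|\<^sup>2)\<close> is, up to the factor \<open>gauss_mass t\<close>, the convolution of two kernels \<open>gauss_kernel t\<close>;
  this square root makes the nonlocal term an integral of squares.\<close>

definition gauss_kernel :: "real \<Rightarrow> real ^ 'n \<Rightarrow> real ^ 'n \<Rightarrow> ennreal" where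
  "gauss_kernel t x z = ennreal (exp (- 2 * t * (norm (x - z))\<^sup>2))"

definition gauss_mass :: "'n::finite itself \<Rightarrow> real \<Rightarrow> ennreal" where
  "gauss_mass _ t = (\<integral>\<^sup>+z. ennreal (exp (- 4 * t * (norm z)\<^sup>2)) \<partial>(lborel :: (real ^ 'n) measure))"

lemma gauss_kernel_measurable [measurable]:
  "(\<lambda>w. gauss_kernel (f w) (g w) (h w)) \<in> borel_measurable M"
  if [measurable]: "f \<in> borel_measurable M" "g \<in> borel_measurable M" "h \<in> borel_measurable M"
  unfolding gauss_kernel_def by measurable

lemma gauss_mass_measurable [measurable]: "gauss_mass TYPE('n::finite) \<in> borel_measurable borel"
  unfolding gauss_mass_def[abs_def] by measurable

lemma nn_integral_gaussian_finite:
  assumes "t > 0"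
  shows "(\<integral>\<^sup>+z. ennreal (exp (- t * (norm z)\<^sup>2)) \<partial>(lborel :: 'a::euclidean_space measure)) < \<infinity>"
proof -
  \<comment> \<open>Completing the square: t r^2 - r + 1/(4t) is (2 t r - 1)^2 / (4t).\<close>
  have pw: "- t * (norm z)\<^sup>2 \<le> 1 / (4 * t) + - 1 * norm z" for z :: 'a
  proof -
    have "0 \<le> (2 * t * norm z - 1)\<^sup>2 / (4 * t)" using assms by simp
    also have "\<dots> = t * (norm z)\<^sup>2 - norm z + 1 / (4 * t)"
      using assms by (simp add: power2_eq_square field_simps)
    finally show ?thesis by simp
  qed
  have "(\<integral>\<^sup>+z. ennreal (exp (- t * (norm z)\<^sup>2)) \<partial>(lborel :: 'a measure)) \<le>
    (\<integral>\<^sup>+z. ennreal (exp (1 / (4 * t))) * ennreal (exp (- 1 * norm z)) \<partial>(lborel :: 'a measure))"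
  proof (rule nn_integral_mono)
    fix z :: 'a
    have "exp (- t * (norm z)\<^sup>2) \<le> exp (1 / (4 * t)) * exp (- 1 * norm z)"
      unfolding exp_add[symmetric] exp_le_cancel_iff by (rule pw)
    then show "ennreal (exp (- t * (norm z)\<^sup>2)) \<le> ennreal (exp (1 / (4 * t))) * ennreal (exp (- 1 * norm z))"
      by (simp add: ennreal_leI flip: ennreal_mult)
  qed
  also have "\<dots> = ennreal (exp (1 / (4 * t))) * (\<integral>\<^sup>+z. ennreal (exp (- 1 * norm (z::'a))) \<partial>lborel)"
    by (rule nn_integral_cmult) measurable
  also have "\<dots> < \<infinity>"
    using nn_integral_exp_neg_norm[of 1, where 'a = 'a] by (simp add: ennreal_mult_less_top)
  finally show ?thesis .
qed

lemma nn_integral_lborel_pos: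
  fixes f :: "'a::euclidean_space \<Rightarrow> ennreal"
  assumes [measurable]: "f \<in> borel_measurable borel" and "\<And>x. f x > 0"
  shows "(\<integral>\<^sup>+x. f x \<partial>lborel) > 0"
proof (rule ccontr)
  assume "\<not> ?thesis"
  then have "(\<integral>\<^sup>+x. f x \<partial>lborel) = 0" by simp
  then have "AE x in lborel. f x = 0" by (subst (asm) nn_integral_0_iff_AE) auto
  then have "AE x in (lborel::'a measure). False"
    by eventually_elim (use assms(2) in \<open>metis less_irrefl\<close>)
  then obtain N :: "'a set" where "N \<in> null_sets lborel" "UNIV \<subseteq> N"
    by (auto simp: eventually_ae_filter)
  then have "emeasure lborel (UNIV :: 'a set) = 0" by (simp add: top_unique null_sets_def)
  then show False by simp
qed

lemma gauss_mass_bounds: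
  assumes "t > 0"
  shows "0 < gauss_mass TYPE('n::finite) t" "gauss_mass TYPE('n::finite) t < \<infinity>"
  unfolding gauss_mass_def using nn_integral_gaussian_finite[of "4 * t", where 'a = "real ^ 'n"] assms
  by (auto intro!: nn_integral_lborel_pos)

text \<open>The parallelogram law about the midpoint c of x and y, 2|x - z|^2 + 2|y - z|^2 = |x -
  y|^2 + 4|z - c|^2, dictates the exponents 2t in \<open>gauss_kernel\<close> and 4t in
  \<open>gauss_mass\<close>.\<close>

lemma gaussian_product:
  fixes x y :: "real ^ 'n"
  shows "(\<integral>\<^sup>+z. gauss_kernel t x z * gauss_kernel t y z \<partial>lborel) =
    ennreal (exp (- t * (norm (x - y))\<^sup>2)) * gauss_mass TYPE('n) t"
proof -
  define c where "c = (1 / 2) *\<^sub>R (x + y)"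
  have "gauss_kernel t x z * gauss_kernel t y z = ennreal (exp (- t * (norm (x - y))\<^sup>2)) * ennreal (exp (- 4 * t * (norm (z + - c))\<^sup>2))" for z
  proof -
    have "2 * (norm (x - z))\<^sup>2 + 2 * (norm (y - z))\<^sup>2 = (norm (x - y))\<^sup>2 + 4 * (norm (z + - c))\<^sup>2"
      unfolding c_def power2_norm_eq_inner
      by (simp add: inner_simps inner_commute algebra_simps)
    from arg_cong[OF this, of "\<lambda>v. - t * v"]
    have "- 2 * t * (norm (x - z))\<^sup>2 + - 2 * t * (norm (y - z))\<^sup>2 =
       - t * (norm (x - y))\<^sup>2 + - 4 * t * (norm (z + - c))\<^sup>2" by (simp add: algebra_simps)
    then show ?thesis unfolding gauss_kernel_def by (simp flip: ennreal_mult exp_add)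
  qed
  then have "(\<integral>\<^sup>+z. gauss_kernel t x z * gauss_kernel t y z \<partial>lborel) =
     ennreal (exp (- t * (norm (x - y))\<^sup>2)) * (\<integral>\<^sup>+z. ennreal (exp (- 4 * t * (norm (z + - c))\<^sup>2)) \<partial>lborel)"
    by (simp only:) (rule nn_integral_cmult, measurable)
  also have "(\<integral>\<^sup>+z. ennreal (exp (- 4 * t * (norm (z + - c))\<^sup>2)) \<partial>lborel) = gauss_mass TYPE('n) t"
    unfolding gauss_mass_def by (rule nn_integral_translate) measurable
  finally show ?thesis .
qed

definition gauss_kernel_weight :: "'n::finite itself \<Rightarrow> real \<Rightarrow> real \<Rightarrow> ennreal" where
  "gauss_kernel_weight T \<alpha> t = heat_weight \<alpha> (real CARD('n)) t / gauss_mass T t"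

lemma gauss_kernel_weight_measurable [measurable]: "gauss_kernel_weight TYPE('n::finite) \<alpha> \<in> borel_measurable borel"
  unfolding gauss_kernel_weight_def[abs_def] by measurable

lemma gauss_kernel_weight_pos:
  assumes "0 < \<alpha>" "t > 0"
  shows "0 < gauss_kernel_weight TYPE('n::finite) \<alpha> t" "gauss_kernel_weight TYPE('n) \<alpha> t < \<infinity>"
proof -
  have "heat_weight \<alpha> (real CARD('n)) t > 0"
    using assms by (auto simp: heat_weight_def intro!: divide_pos_pos mult_pos_pos Gamma_real_pos)
  then show "0 < gauss_kernel_weight TYPE('n) \<alpha> t"
    using gauss_mass_bounds[OF assms(2), where 'n = 'n] by (simp add: gauss_kernel_weight_def ennreal_zero_less_divide)
  show "gauss_kernel_weight TYPE('n) \<alpha> t < \<infinity>"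
  proof -
    obtain g where g: "gauss_mass TYPE('n) t = ennreal g" "g > 0"
      using gauss_mass_bounds[OF assms(2), where 'n = 'n] by (cases "gauss_mass TYPE('n) t") auto
    obtain w where w: "heat_weight \<alpha> (real CARD('n)) t = ennreal w" "w \<ge> 0"
      using \<open>heat_weight \<alpha> (real CARD('n)) t > 0\<close>
      by (cases "heat_weight \<alpha> (real CARD('n)) t") (auto simp: heat_weight_def)
    show ?thesis using g w by (simp add: gauss_kernel_weight_def divide_ennreal)
  qed
qed

text \<open>The case x = y is a true exception: the Riesz potential has the default value 0 at the
  origin, whereas the superposition of Gaussians is infinite there.\<close>

lemma riesz_eq_gk:
  fixes x y :: "real ^ 'n"
  assumes \<alpha>: "0 < \<alpha>" "\<alpha> < real CARD('n)" and xy: "x \<noteq> y"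
  shows "ennreal (riesz_potential \<alpha> (x - y)) =
    (\<integral>\<^sup>+t. (\<integral>\<^sup>+z. gauss_kernel_weight TYPE('n) \<alpha> t * (gauss_kernel t x z * gauss_kernel t y z) \<partial>lborel) \<partial>lborel)"
proof -
  have "heat_weight \<alpha> (real CARD('n)) t * ennreal (exp (- t * (norm (x - y))\<^sup>2)) =
     (\<integral>\<^sup>+z. gauss_kernel_weight TYPE('n) \<alpha> t * (gauss_kernel t x z * gauss_kernel t y z) \<partial>lborel)" for t
  proof (cases "t > 0")
    case True
    let ?G = "gauss_mass TYPE('n) t"
    have "(\<integral>\<^sup>+z. gauss_kernel_weight TYPE('n) \<alpha> t * (gauss_kernel t x z * gauss_kernel t y z) \<partial>lborel) =
       heat_weight \<alpha> (real CARD('n)) t / ?G * (ennreal (exp (- t * (norm (x - y))\<^sup>2)) * ?G)"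
      by (subst nn_integral_cmult) (auto simp: gaussian_product gauss_kernel_weight_def)
    also have "\<dots> = heat_weight \<alpha> (real CARD('n)) t * ennreal (exp (- t * (norm (x - y))\<^sup>2)) * (?G / ?G)"
      by (simp add: divide_ennreal_def mult_ac)
    also have "?G / ?G = 1" using gauss_mass_bounds[OF True, where 'n = 'n] by (simp add: ennreal_divide_self)
    finally show ?thesis by simp
  next
    case False
    then show ?thesis by (simp add: gauss_kernel_weight_def heat_weight_def)
  qed
  then show ?thesis using riesz_eq_heat[OF \<alpha>, of "x - y"] xy by simp
qed

section \<open>The nonlocal term as a positive definite form\<close>

definition gsmooth :: "real \<Rightarrow> real ^ 'n \<Rightarrow> (real ^ 'n \<Rightarrow> ennreal) \<Rightarrow> ennreal" where
  "gsmooth t z a = (\<integral>\<^sup>+x. a x * gauss_kernel t x z \<partial>lborel)"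

lemma gsmooth_measurable [measurable]:
  assumes [measurable]: "a \<in> borel_measurable borel" "f \<in> borel_measurable M" "g \<in> borel_measurable M"
  shows "(\<lambda>w. gsmooth (f w) (g w) a) \<in> borel_measurable M"
proof -
  have "(\<lambda>(t, z). gsmooth t z a) \<in> borel_measurable (borel \<Otimes>\<^sub>M borel)"
    unfolding gsmooth_def by measurable
  from measurable_compose[OF measurable_Pair[OF assms(2,3)] this] show ?thesis by simp
qed

definition hartree2 :: "real \<Rightarrow> (real ^ 'n \<Rightarrow> ennreal) \<Rightarrow> (real ^ 'n \<Rightarrow> ennreal) \<Rightarrow> ennreal" where
  "hartree2 \<alpha> a b = (\<integral>\<^sup>+x. nn_convolution (\<lambda>x. ennreal (riesz_potential \<alpha> x)) a x * b x \<partial>lborel)"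

lemma nn_convolution_measurable [measurable]:
  assumes [measurable]: "f \<in> borel_measurable borel" "g \<in> borel_measurable (borel :: (real ^ 'n) measure)"
  shows "nn_convolution f g \<in> borel_measurable borel"
  unfolding nn_convolution_def[abs_def] by measurable

text \<open>Tonelli moves t and z outside, after which the integrals over x and y factor into two
  smoothings. The diagonal, where the kernel identity fails, is a null set.\<close>

lemma hartree2_eq_gk:
  fixes a b :: "real ^ 'n \<Rightarrow> ennreal"
  assumes \<alpha>: "0 < \<alpha>" "\<alpha> < real CARD('n)"
    and [measurable]: "a \<in> borel_measurable borel" "b \<in> borel_measurable borel"
  shows "hartree2 \<alpha> a b =
    (\<integral>\<^sup>+t. (\<integral>\<^sup>+z. gauss_kernel_weight TYPE('n) \<alpha> t * (gsmooth t z a * gsmooth t z b) \<partial>lborel) \<partial>lborel)"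
proof -
  let ?w = "gauss_kernel_weight TYPE('n) \<alpha>"
  let ?F = "\<lambda>x y t z. ?w t * (gauss_kernel t x z * gauss_kernel t y z) * a y * b x"
  have 1: "nn_convolution (\<lambda>x. ennreal (riesz_potential \<alpha> x)) a x * b x =
     (\<integral>\<^sup>+y. (\<integral>\<^sup>+t. (\<integral>\<^sup>+z. ?F x y t z \<partial>lborel) \<partial>lborel) \<partial>lborel)" for x
  proof -
    have "nn_convolution (\<lambda>x. ennreal (riesz_potential \<alpha> x)) a x =
       (\<integral>\<^sup>+y. (\<integral>\<^sup>+t. (\<integral>\<^sup>+z. ?w t * (gauss_kernel t x z * gauss_kernel t y z) \<partial>lborel) \<partial>lborel) * a y \<partial>lborel)"
      unfolding nn_convolution_def
      using AE_lborel_singleton[of x]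
      by (intro nn_integral_cong_AE) (auto elim!: eventually_mono simp: riesz_eq_gk[OF \<alpha>])
    then show ?thesis
      by (simp add: nn_integral_multc[symmetric])
  qed
  have "hartree2 \<alpha> a b = (\<integral>\<^sup>+x. (\<integral>\<^sup>+y. (\<integral>\<^sup>+t. (\<integral>\<^sup>+z. ?F x y t z \<partial>lborel) \<partial>lborel) \<partial>lborel) \<partial>lborel)"
    unfolding hartree2_def 1 ..
  also have "\<dots> = (\<integral>\<^sup>+x. (\<integral>\<^sup>+t. (\<integral>\<^sup>+y. (\<integral>\<^sup>+z. ?F x y t z \<partial>lborel) \<partial>lborel) \<partial>lborel) \<partial>lborel)"
    by (intro nn_integral_cong lborel_pair.Fubini') measurable
  also have "\<dots> = (\<integral>\<^sup>+t. (\<integral>\<^sup>+x. (\<integral>\<^sup>+y. (\<integral>\<^sup>+z. ?F x y t z \<partial>lborel) \<partial>lborel) \<partial>lborel) \<partial>lborel)"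
    by (intro lborel_pair.Fubini') measurable
  also have "\<dots> = (\<integral>\<^sup>+t. (\<integral>\<^sup>+x. (\<integral>\<^sup>+z. (\<integral>\<^sup>+y. ?F x y t z \<partial>lborel) \<partial>lborel) \<partial>lborel) \<partial>lborel)"
    by (intro nn_integral_cong lborel_pair.Fubini'[symmetric]) measurable
  also have "\<dots> = (\<integral>\<^sup>+t. (\<integral>\<^sup>+z. (\<integral>\<^sup>+x. (\<integral>\<^sup>+y. ?F x y t z \<partial>lborel) \<partial>lborel) \<partial>lborel) \<partial>lborel)"
    by (intro nn_integral_cong lborel_pair.Fubini') measurable
  also have "\<dots> = (\<integral>\<^sup>+t. (\<integral>\<^sup>+z. ?w t * (gsmooth t z a * gsmooth t z b) \<partial>lborel) \<partial>lborel)"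
  proof (intro nn_integral_cong)
    fix t z
    have "(\<integral>\<^sup>+y. ?F x y t z \<partial>lborel) = (?w t * gsmooth t z a) * (b x * gauss_kernel t x z)" for x
    proof -
      have "(\<integral>\<^sup>+y. ?F x y t z \<partial>lborel) = (\<integral>\<^sup>+y. (?w t * gauss_kernel t x z * b x) * (a y * gauss_kernel t y z) \<partial>lborel)"
        by (intro nn_integral_cong) (simp add: mult_ac)
      also have "\<dots> = (?w t * gauss_kernel t x z * b x) * gsmooth t z a"
        unfolding gsmooth_def by (rule nn_integral_cmult) measurable
      finally show ?thesis by (simp add: mult_ac)
    qed
    then have "(\<integral>\<^sup>+x. (\<integral>\<^sup>+y. ?F x y t z \<partial>lborel) \<partial>lborel) = (\<integral>\<^sup>+x. (?w t * gsmooth t z a) * (b x * gauss_kernel t x z) \<partial>lborel)"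
      by simp
    also have "\<dots> = (?w t * gsmooth t z a) * gsmooth t z b"
      unfolding gsmooth_def[of t z b] by (rule nn_integral_cmult) measurable
    finally show "(\<integral>\<^sup>+x. (\<integral>\<^sup>+y. ?F x y t z \<partial>lborel) \<partial>lborel) = ?w t * (gsmooth t z a * gsmooth t z b)"
      by (simp add: mult.assoc)
  qed
  finally show ?thesis .
qed

lemma hartree2_commute:
  fixes a b :: "real ^ 'n \<Rightarrow> ennreal"
  assumes "0 < \<alpha>" "\<alpha> < real CARD('n)" "a \<in> borel_measurable borel" "b \<in> borel_measurable borel"
  shows "hartree2 \<alpha> a b = hartree2 \<alpha> b a"
  by (simp add: hartree2_eq_gk[OF assms] hartree2_eq_gk[OF assms(1,2,4,3)] mult.commute[of "gsmooth _ _ a"])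

lemma hartree2_mono:
  "(\<And>x. a x \<le> a' x) \<Longrightarrow> (\<And>x. b x \<le> b' x) \<Longrightarrow> hartree2 \<alpha> a b \<le> hartree2 \<alpha> a' b'"
  unfolding hartree2_def nn_convolution_def by (intro nn_integral_mono mult_mono) auto

lemma hartree2_add_right:
  fixes a b c :: "real ^ 'n \<Rightarrow> ennreal"
  assumes [measurable]: "a \<in> borel_measurable borel" "b \<in> borel_measurable borel" "c \<in> borel_measurable borel"
  shows "hartree2 \<alpha> a (\<lambda>x. b x + c x) = hartree2 \<alpha> a b + hartree2 \<alpha> a c"
  unfolding hartree2_def by (simp add: distrib_left nn_integral_add)

lemma hartree2_add_left:
  fixes a b c :: "real ^ 'n \<Rightarrow> ennreal"
  assumes [measurable]: "a \<in> borel_measurable borel" "b \<in> borel_measurable borel" "c \<in> borel_measurable borel"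
  shows "hartree2 \<alpha> (\<lambda>x. b x + c x) a = hartree2 \<alpha> b a + hartree2 \<alpha> c a"
  unfolding hartree2_def nn_convolution_def by (simp add: distrib_left distrib_right nn_integral_add)

lemma hartree2_cmult_right:
  fixes a b :: "real ^ 'n \<Rightarrow> ennreal"
  assumes [measurable]: "a \<in> borel_measurable borel" "b \<in> borel_measurable borel"
  shows "hartree2 \<alpha> a (\<lambda>x. c * b x) = c * hartree2 \<alpha> a b"
  unfolding hartree2_def by (simp add: mult.left_commute[of _ c] nn_integral_cmult)

lemma hartree2_cmult_left:
  fixes a b :: "real ^ 'n \<Rightarrow> ennreal"
  assumes [measurable]: "a \<in> borel_measurable borel" "b \<in> borel_measurable borel"
  shows "hartree2 \<alpha> (\<lambda>x. c * a x) b = c * hartree2 \<alpha> a b"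
  unfolding hartree2_def nn_convolution_def
  by (simp add: mult.left_commute[of _ c] mult.assoc nn_integral_cmult)

lemma ennreal_two_mult_le: "2 * (p * q) \<le> p * p + q * (q :: ennreal)"
proof (cases "p = top \<or> q = top")
  case True
  then show ?thesis by (auto simp: ennreal_top_mult ennreal_mult_top)
next
  case False
  then obtain x y where xy: "p = ennreal x" "q = ennreal y" "x \<ge> 0" "y \<ge> 0"
    by (cases p; cases q) auto
  have "2 * (x * y) \<le> x * x + y * y" using sum_squares_bound[of x y] by (simp add: power2_eq_square)
  then have "ennreal (2 * (x * y)) \<le> ennreal (x * x + y * y)" by (rule ennreal_leI)
  then show ?thesis using xy by (simp add: ennreal_mult)
qed

text \<open>Finiteness excludes an infinite p with a positive finite q, for which the first
  assumption also holds.\<close>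

lemma ennreal_two_mult_eq:
  fixes p q :: ennreal
  assumes "p * p + q * q \<le> 2 * (p * q)" "p * p + q * q < \<infinity>"
  shows "p = q"
proof -
  have "p \<noteq> top" "q \<noteq> top" using assms(2) by auto
  then obtain x y where xy: "p = ennreal x" "q = ennreal y" "x \<ge> 0" "y \<ge> 0"
    by (cases p; cases q) auto
  have "ennreal (x * x + y * y) = p * p + q * q" "ennreal (2 * (x * y)) = 2 * (p * q)"
    using xy by (simp_all add: ennreal_mult)
  then have "ennreal (x * x + y * y) \<le> ennreal (2 * (x * y))" using assms(1) by (simp only:)
  then have "x * x + y * y \<le> 2 * (x * y)" using xy by (subst (asm) ennreal_le_iff) auto
  then have "(x - y)\<^sup>2 \<le> 0" by (simp add: power2_eq_square algebra_simps)
  then show ?thesis using xy by simp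
qed

text \<open>Positive definiteness, D(a - b, a - b) \<ge> 0, expanded so that no subtraction occurs.
  Under the integral over t and z it is 2pq \<le> p^2 + q^2 for the smoothings p and q of a and
  b.\<close>

lemma hartree2_two_le:
  fixes a b :: "real ^ 'n \<Rightarrow> ennreal"
  assumes \<alpha>: "0 < \<alpha>" "\<alpha> < real CARD('n)"
    and [measurable]: "a \<in> borel_measurable borel" "b \<in> borel_measurable borel"
  shows "2 * hartree2 \<alpha> a b \<le> hartree2 \<alpha> a a + hartree2 \<alpha> b b"
proof -
  let ?w = "gauss_kernel_weight TYPE('n) \<alpha>"
  have "2 * hartree2 \<alpha> a b =
     (\<integral>\<^sup>+t. (\<integral>\<^sup>+z. ?w t * (2 * (gsmooth t z a * gsmooth t z b)) \<partial>lborel) \<partial>lborel)"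
    by (simp add: hartree2_eq_gk[OF \<alpha>] nn_integral_cmult[symmetric] mult.left_commute[of 2])
  also have "\<dots> \<le> (\<integral>\<^sup>+t. (\<integral>\<^sup>+z. ?w t * (gsmooth t z a * gsmooth t z a + gsmooth t z b * gsmooth t z b) \<partial>lborel) \<partial>lborel)"
    by (intro nn_integral_mono mult_left_mono ennreal_two_mult_le) auto
  also have "\<dots> = hartree2 \<alpha> a a + hartree2 \<alpha> b b"
    by (simp add: hartree2_eq_gk[OF \<alpha>] distrib_left nn_integral_add)
  finally show ?thesis .
qed

lemma hartree2_combination:
  fixes a b :: "real ^ 'n \<Rightarrow> ennreal"
  assumes \<alpha>: "0 < \<alpha>" "\<alpha> < real CARD('n)"
    and [measurable]: "a \<in> borel_measurable borel" "b \<in> borel_measurable borel"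
  shows "hartree2 \<alpha> (\<lambda>x. c * a x + d * b x) (\<lambda>x. c * a x + d * b x) =
    c * c * hartree2 \<alpha> a a + c * d * (2 * hartree2 \<alpha> a b) + d * d * hartree2 \<alpha> b b"
  by (simp add: hartree2_add_left hartree2_add_right hartree2_cmult_left hartree2_cmult_right
      hartree2_commute[OF \<alpha>, of b a] distrib_left mult_2 mult_ac add_ac)

text \<open>The cross term is bounded by the two squares, and then c c + c d = c and d d + c d = d
  because c + d = 1.\<close>

lemma hartree2_convex:
  fixes a b :: "real ^ 'n \<Rightarrow> ennreal"
  assumes \<alpha>: "0 < \<alpha>" "\<alpha> < real CARD('n)"
    and [measurable]: "a \<in> borel_measurable borel" "b \<in> borel_measurable borel"
    and cd: "c + d = 1"
  shows "hartree2 \<alpha> (\<lambda>x. c * a x + d * b x) (\<lambda>x. c * a x + d * b x) \<le>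
    c * hartree2 \<alpha> a a + d * hartree2 \<alpha> b b"
proof -
  have "c * c * hartree2 \<alpha> a a + c * d * (2 * hartree2 \<alpha> a b) + d * d * hartree2 \<alpha> b b \<le>
    c * c * hartree2 \<alpha> a a + c * d * (hartree2 \<alpha> a a + hartree2 \<alpha> b b) + d * d * hartree2 \<alpha> b b"
    by (intro add_mono mult_left_mono hartree2_two_le \<alpha>) auto
  also have "\<dots> = (c + d) * (c * hartree2 \<alpha> a a + d * hartree2 \<alpha> b b)"
    by (simp add: distrib_left distrib_right mult_ac add_ac)
  finally show ?thesis by (simp add: hartree2_combination[OF \<alpha>] cd)
qed

text \<open>The equality case of 2pq \<le> p^2 + q^2. The two integrands are ordered and their
  finite integrals agree, so they agree almost everywhere; for t > 0 the weight is positive and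
  finite and can be cancelled.\<close>

lemma AE_gsmooth_eq:
  fixes a b :: "real ^ 'n \<Rightarrow> ennreal"
  assumes \<alpha>: "0 < \<alpha>" "\<alpha> < real CARD('n)"
    and [measurable]: "a \<in> borel_measurable borel" "b \<in> borel_measurable borel"
    and fin: "hartree2 \<alpha> a a < \<infinity>" "hartree2 \<alpha> b b < \<infinity>"
    and ge: "hartree2 \<alpha> a a + hartree2 \<alpha> b b \<le> 2 * hartree2 \<alpha> a b"
  shows "AE t in lborel. t > 0 \<longrightarrow> (AE z in lborel. gsmooth t z a = gsmooth t z b)"
proof -
  let ?w = "gauss_kernel_weight TYPE('n) \<alpha>"
  let ?p = "\<lambda>t z. gsmooth t z a" and ?q = "\<lambda>t z. gsmooth t z b"
  let ?P = "lborel \<Otimes>\<^sub>M lborel :: (real \<times> (real ^ 'n)) measure"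
  define X where "X = (\<lambda>(t, z). ?w t * (2 * (?p t z * ?q t z)))"
  define Y where "Y = (\<lambda>(t, z). ?w t * (?p t z * ?p t z + ?q t z * ?q t z))"
  have [measurable]: "X \<in> borel_measurable ?P" "Y \<in> borel_measurable ?P"
    unfolding X_def Y_def by measurable
  have iX: "integral\<^sup>N ?P X = 2 * hartree2 \<alpha> a b"
    by (subst lborel.nn_integral_fst[symmetric])
       (auto simp: X_def hartree2_eq_gk[OF \<alpha>] nn_integral_cmult[symmetric] mult.left_commute[of 2])
  have iY: "integral\<^sup>N ?P Y = hartree2 \<alpha> a a + hartree2 \<alpha> b b"
    by (subst lborel.nn_integral_fst[symmetric])
       (auto simp: Y_def hartree2_eq_gk[OF \<alpha>] distrib_left nn_integral_add)
  have XY: "X v \<le> Y v" for v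
    by (cases v) (auto simp: X_def Y_def intro!: mult_left_mono ennreal_two_mult_le)
  have finY: "integral\<^sup>N ?P Y < \<infinity>" using fin by (simp add: iY)
  have finX: "integral\<^sup>N ?P X < \<infinity>"
    by (rule le_less_trans[OF nn_integral_mono finY]) (rule XY)
  have "integral\<^sup>N ?P (\<lambda>v. Y v - X v) = integral\<^sup>N ?P Y - integral\<^sup>N ?P X"
    using finX XY by (intro nn_integral_diff) auto
  also have "\<dots> = 0" using ge finX fin by (simp add: iX iY diff_eq_0_iff_ennreal)
  finally have "AE v in ?P. Y v - X v = 0" by (subst (asm) nn_integral_0_iff_AE) auto
  moreover have "AE v in ?P. Y v \<noteq> \<infinity>" using finY by (intro nn_integral_PInf_AE) auto
  ultimately have "AE v in ?P. Y v \<le> X v \<and> Y v < \<infinity>"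
    by eventually_elim (auto simp: diff_eq_0_iff_ennreal less_top)
  then have "AE t in lborel. AE z in lborel. Y (t, z) \<le> X (t, z) \<and> Y (t, z) < \<infinity>"
    by (rule lborel_pair.AE_pair)
  then show ?thesis
  proof (rule eventually_mono, intro impI)
    fix t :: real assume t: "t > 0" and *: "AE z in lborel. Y (t, z) \<le> X (t, z) \<and> Y (t, z) < \<infinity>"
    note w = gauss_kernel_weight_pos[OF \<alpha>(1) t, where 'n = 'n]
    from * show "AE z in lborel. ?p t z = ?q t z"
    proof (rule eventually_mono)
      fix z assume "Y (t, z) \<le> X (t, z) \<and> Y (t, z) < \<infinity>"
      then show "?p t z = ?q t z"
        using w by (intro ennreal_two_mult_eq)
          (auto simp: X_def Y_def ennreal_mult_le_mult_iff ennreal_mult_less_top)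
    qed
  qed
qed

section \<open>Gaussian smoothing determines the function\<close>

lemma nn_integral_lborel_scale:
  fixes f :: "'a::euclidean_space \<Rightarrow> ennreal"
  assumes [measurable]: "f \<in> borel_measurable borel" and c: "c > 0"
  shows "(\<integral>\<^sup>+z. f z \<partial>lborel) = ennreal (c ^ DIM('a)) * (\<integral>\<^sup>+w. f (x + c *\<^sub>R w) \<partial>lborel)"
proof -
  have "(\<integral>\<^sup>+z. f z \<partial>lborel) = (\<integral>\<^sup>+z. f z \<partial>density (distr lborel borel (\<lambda>w. x + c *\<^sub>R w)) (\<lambda>_. ennreal (\<bar>c\<bar> ^ DIM('a))))"
    using lborel_affine[of c x] c by simp
  also have "\<dots> = ennreal (c ^ DIM('a)) * (\<integral>\<^sup>+w. f (x + c *\<^sub>R w) \<partial>lborel)"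
    using c by (simp add: nn_integral_density nn_integral_cmult nn_integral_distr)
  finally show ?thesis .
qed

text \<open>Extracts arbitrarily large scales t from a statement that holds for almost every
  t.\<close>

lemma AE_lborel_unbounded:
  fixes P :: "real \<Rightarrow> bool"
  assumes "AE t in lborel. P t"
  shows "\<exists>t>T. P t"
proof (rule ccontr)
  assume no: "\<not> ?thesis"
  obtain N :: "real set" where N: "N \<in> null_sets lborel" "{t. \<not> P t} \<subseteq> N"
    using assms by (auto simp: eventually_ae_filter)
  then have "{T..T + 1} \<subseteq> insert T N" using no by force
  moreover have "insert T N \<in> null_sets lborel"
    using null_sets.Un[of "{T}" lborel N] N(1) by (simp add: null_sets_def)
  ultimately have "{T..T + 1} \<in> null_sets lborel" by (rule null_sets_subset[rotated 2]) auto
  then show False by (simp add: null_sets_def)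
qed

lemma ennreal_mult_right_cancel_finite:
  fixes a b c :: ennreal
  assumes "a * c = b * c" "c > 0" "c < \<infinity>"
  shows "a = b"
  using arg_cong[OF assms(1), of "\<lambda>x. x / c"] assms(2,3) by (simp add: mult_divide_eq_ennreal)

text \<open>Let the Gaussian kernel concentrate.\<close>

lemma AE_eq_of_gsmooth_eq:
  fixes f g :: "real ^ 'n \<Rightarrow> real"
  assumes int: "integrable lborel f" "integrable lborel g"
    and pos: "\<And>x. f x \<ge> 0" "\<And>x. g x \<ge> 0"
    and eq: "AE t in lborel. t > 0 \<longrightarrow> (AE z in lborel. gsmooth t z (\<lambda>x. ennreal (f x)) = gsmooth t z (\<lambda>x. ennreal (g x)))"
  shows "AE x in lborel. f x = g x"
proof -
  have [measurable]: "f \<in> borel_measurable borel" "g \<in> borel_measurable borel"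
    using int by (auto dest: borel_measurable_integrable)
  obtain t where t: "\<And>k::nat. t k > real (Suc k)"
    "\<And>k. AE z in lborel. gsmooth (t k) z (\<lambda>x. ennreal (f x)) = gsmooth (t k) z (\<lambda>x. ennreal (g x))"
  proof -
    have "\<exists>t>real (Suc k). t > 0 \<longrightarrow> (AE z in lborel. gsmooth t z (\<lambda>x. ennreal (f x)) = gsmooth t z (\<lambda>x. ennreal (g x)))" for k
      by (rule AE_lborel_unbounded[OF eq])
    then have "\<exists>t>real (Suc k). (AE z in lborel. gsmooth t z (\<lambda>x. ennreal (f x)) = gsmooth t z (\<lambda>x. ennreal (g x)))" for k
      by (meson less_trans of_nat_0_less_iff zero_less_Suc)
    then show ?thesis using that by metis
  qed
  have tpos: "t k > 0" for k using t(1)[of k] by (meson less_trans of_nat_0_less_iff zero_less_Suc)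
  \<comment> \<open>The length scale of the kernel: the substitution z = x + c w turns it into the
    fixed Gaussian exp(-2|w|^2).\<close>
  define c where "c k = 1 / sqrt (t k)" for k
  have c: "c k > 0" for k using tpos by (simp add: c_def)
  have c0: "c \<longlonglongrightarrow> 0"
  proof -
    have "filterlim (\<lambda>k. real (Suc k)) at_top sequentially"
      by (rule filterlim_compose[OF filterlim_real_sequentially filterlim_Suc])
    then have "filterlim t at_top sequentially"
      by (rule filterlim_at_top_mono) (use t(1) in \<open>auto intro!: always_eventually less_imp_le\<close>)
    then have "filterlim (\<lambda>k. sqrt (t k)) at_top sequentially"
      by (rule filterlim_compose[OF sqrt_at_top])
    then show ?thesis unfolding c_def by (rule real_tendsto_divide_at_top[OF tendsto_const])
  qed
  define G where "G = (\<integral>\<^sup>+w. ennreal (exp (- 2 * (norm w)\<^sup>2)) \<partial>(lborel :: (real ^ 'n) measure))"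
  have G: "0 < G" "G < \<infinity>" unfolding G_def
    using nn_integral_gaussian_finite[of 2, where 'a = "real ^ 'n"] by (auto intro!: nn_integral_lborel_pos)
  \<comment> \<open>The smoothing is transferred to the continuous function \<psi>. By Tonelli the
    equality of the smoothings becomes equality of the integrals of f and g against local averages
    \<open>A k\<close> of \<psi>, which tend to \<psi> times the constant G.\<close>
  have bump: "(\<integral>\<^sup>+x. ennreal (f x) * ennreal (\<psi> x) \<partial>lborel) = (\<integral>\<^sup>+x. ennreal (g x) * ennreal (\<psi> x) \<partial>lborel)"
    if \<psi>: "continuous_on UNIV \<psi>" "\<And>x. 0 \<le> \<psi> x" "\<And>x. \<psi> x \<le> 1" for \<psi> :: "real ^ 'n \<Rightarrow> real"
  proof -
    have [measurable]: "\<psi> \<in> borel_measurable borel" using \<psi>(1) by (rule borel_measurable_continuous_onI)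
    define A where "A k x = (\<integral>\<^sup>+w. ennreal (\<psi> (x + c k *\<^sub>R w)) * ennreal (exp (- 2 * (norm w)\<^sup>2)) \<partial>lborel)" for k x
    have [measurable]: "A k \<in> borel_measurable borel" for k unfolding A_def by measurable
    have Aeq: "(\<integral>\<^sup>+z. ennreal (\<psi> z) * gauss_kernel (t k) x z \<partial>lborel) = ennreal (c k ^ CARD('n)) * A k x" for k x
    proof -
      have "(\<integral>\<^sup>+z. ennreal (\<psi> z) * gauss_kernel (t k) x z \<partial>lborel) =
        ennreal (c k ^ CARD('n)) * (\<integral>\<^sup>+w. ennreal (\<psi> (x + c k *\<^sub>R w)) * gauss_kernel (t k) x (x + c k *\<^sub>R w) \<partial>lborel)"
        using nn_integral_lborel_scale[OF _ c, of "\<lambda>z. ennreal (\<psi> z) * gauss_kernel (t k) x z" k x] by simp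
      moreover have "gauss_kernel (t k) x (x + c k *\<^sub>R w) = ennreal (exp (- 2 * (norm w)\<^sup>2))" for w
        using tpos[of k] by (simp add: gauss_kernel_def c_def power_mult_distrib power_divide)
      ultimately show ?thesis by (simp add: A_def)
    qed
    have Aint: "(\<integral>\<^sup>+x. ennreal (f' x) * A k x \<partial>lborel) * ennreal (c k ^ CARD('n)) =
        (\<integral>\<^sup>+z. ennreal (\<psi> z) * gsmooth (t k) z (\<lambda>x. ennreal (f' x)) \<partial>lborel)"
      if [measurable]: "f' \<in> borel_measurable borel" for f' k
    proof -
      have "(\<integral>\<^sup>+z. ennreal (\<psi> z) * gsmooth (t k) z (\<lambda>x. ennreal (f' x)) \<partial>lborel) =
         (\<integral>\<^sup>+z. (\<integral>\<^sup>+x. ennreal (\<psi> z) * (ennreal (f' x) * gauss_kernel (t k) x z) \<partial>lborel) \<partial>lborel)"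
        unfolding gsmooth_def by (simp add: nn_integral_cmult)
      also have "\<dots> = (\<integral>\<^sup>+x. (\<integral>\<^sup>+z. ennreal (\<psi> z) * (ennreal (f' x) * gauss_kernel (t k) x z) \<partial>lborel) \<partial>lborel)"
        by (rule lborel_pair.Fubini') measurable
      also have "\<dots> = (\<integral>\<^sup>+x. ennreal (f' x) * (\<integral>\<^sup>+z. ennreal (\<psi> z) * gauss_kernel (t k) x z \<partial>lborel) \<partial>lborel)"
        by (simp add: mult.left_commute[of "ennreal (\<psi> _)"] nn_integral_cmult)
      also have "\<dots> = (\<integral>\<^sup>+x. (ennreal (f' x) * A k x) * ennreal (c k ^ CARD('n)) \<partial>lborel)"
        unfolding Aeq by (simp add: mult_ac)
      finally show ?thesis by (simp add: nn_integral_multc)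
    qed
    have "(\<integral>\<^sup>+x. ennreal (f x) * A k x \<partial>lborel) * ennreal (c k ^ CARD('n)) =
       (\<integral>\<^sup>+x. ennreal (g x) * A k x \<partial>lborel) * ennreal (c k ^ CARD('n))" for k
    proof -
      have "(\<integral>\<^sup>+z. ennreal (\<psi> z) * gsmooth (t k) z (\<lambda>x. ennreal (f x)) \<partial>lborel) =
        (\<integral>\<^sup>+z. ennreal (\<psi> z) * gsmooth (t k) z (\<lambda>x. ennreal (g x)) \<partial>lborel)"
        using t(2)[of k] by (intro nn_integral_cong_AE) (auto elim!: eventually_mono)
      then show ?thesis using Aint[of f k] Aint[of g k] by simp
    qed
    then have Ak: "(\<integral>\<^sup>+x. ennreal (f x) * A k x \<partial>lborel) = (\<integral>\<^sup>+x. ennreal (g x) * A k x \<partial>lborel)" for k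
      by (rule ennreal_mult_right_cancel_finite) (use c[of k] in auto)
    have Alim: "(\<lambda>k. A k x) \<longlonglongrightarrow> ennreal (\<psi> x) * G" for x
    proof -
      have "(\<lambda>k. A k x) \<longlonglongrightarrow> (\<integral>\<^sup>+w. ennreal (\<psi> x) * ennreal (exp (- 2 * (norm w)\<^sup>2)) \<partial>(lborel :: (real ^ 'n) measure))"
        unfolding A_def
      proof (rule nn_integral_dominated_convergence[where w = "\<lambda>w. ennreal (exp (- 2 * (norm w)\<^sup>2))"])
        show "AE w in lborel. ennreal (\<psi> (x + c k *\<^sub>R w)) * ennreal (exp (- 2 * (norm w)\<^sup>2)) \<le>
           ennreal (exp (- 2 * (norm w)\<^sup>2))" for k
          using \<psi>(2,3) by (intro AE_I2) (auto simp: mult_left_le_one_le ennreal_leI simp flip: ennreal_mult)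
        have "(\<lambda>k. \<psi> (x + c k *\<^sub>R w)) \<longlonglongrightarrow> \<psi> (x + 0 *\<^sub>R w)" for w
          using \<psi>(1) by (intro continuous_on_tendsto_compose[OF \<psi>(1)] tendsto_intros c0) auto
        then have "(\<lambda>k. ennreal (\<psi> (x + c k *\<^sub>R w) * exp (- 2 * (norm w)\<^sup>2))) \<longlonglongrightarrow> ennreal (\<psi> x * exp (- 2 * (norm w)\<^sup>2))" for w
          by (intro tendsto_intros) simp
        then show "AE w in lborel. (\<lambda>k. ennreal (\<psi> (x + c k *\<^sub>R w)) * ennreal (exp (- 2 * (norm w)\<^sup>2))) \<longlonglongrightarrow>
           ennreal (\<psi> x) * ennreal (exp (- 2 * (norm w)\<^sup>2))"
          using \<psi>(2) by (simp add: ennreal_mult)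
      qed (use G in \<open>auto simp: G_def\<close>)
      then show ?thesis by (simp add: nn_integral_cmult G_def)
    qed
    have AG: "A k x \<le> G" for k x
      unfolding A_def G_def using \<psi>(2,3)
      by (intro nn_integral_mono) (auto simp: mult_left_le_one_le ennreal_leI simp flip: ennreal_mult)
    have lim: "(\<lambda>k. \<integral>\<^sup>+x. ennreal (f' x) * A k x \<partial>lborel) \<longlonglongrightarrow> (\<integral>\<^sup>+x. ennreal (f' x) * ennreal (\<psi> x) \<partial>lborel) * G"
      if f': "integrable lborel f'" "\<And>x. f' x \<ge> 0" for f'
    proof -
      have [measurable]: "f' \<in> borel_measurable borel" using f' by (auto dest: borel_measurable_integrable)
      have "(\<lambda>k. \<integral>\<^sup>+x. ennreal (f' x) * A k x \<partial>lborel) \<longlonglongrightarrow> (\<integral>\<^sup>+x. ennreal (f' x) * (ennreal (\<psi> x) * G) \<partial>lborel)"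
      proof (rule nn_integral_dominated_convergence[where w = "\<lambda>x. ennreal (f' x) * G"])
        show "AE x in lborel. ennreal (f' x) * A k x \<le> ennreal (f' x) * G" for k
          by (intro AE_I2 mult_left_mono AG) auto
        have "(\<integral>\<^sup>+x. ennreal (f' x) \<partial>lborel) < \<infinity>"
          using f' by (subst nn_integral_eq_integral) auto
        then show "(\<integral>\<^sup>+x. ennreal (f' x) * G \<partial>lborel) < \<infinity>"
          using G by (simp add: nn_integral_multc ennreal_mult_less_top)
        show "AE x in lborel. (\<lambda>k. ennreal (f' x) * A k x) \<longlonglongrightarrow> ennreal (f' x) * (ennreal (\<psi> x) * G)"
          by (intro AE_I2 ennreal_tendsto_cmult Alim) simp
      qed auto
      then show ?thesis by (simp add: nn_integral_multc mult.assoc[symmetric])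
    qed
    have "(\<integral>\<^sup>+x. ennreal (f x) * ennreal (\<psi> x) \<partial>lborel) * G = (\<integral>\<^sup>+x. ennreal (g x) * ennreal (\<psi> x) \<partial>lborel) * G"
      using LIMSEQ_unique[OF lim[OF int(1) pos(1)]] lim[OF int(2) pos(2)] by (simp add: Ak)
    then show ?thesis using G by (rule ennreal_mult_right_cancel_finite)
  qed
  have sq: "locally_integrable (\<lambda>x. complex_of_real (f x - g x))"
    unfolding locally_integrable_def set_integrable_def using int
    by (auto intro!: integrable_mult_indicator borel_compact integrable_of_real)
  have "AE x in lborel. complex_of_real (f x - g x) = 0"
  proof (rule AE_zero_if_bump_integrals_zero[OF sq])
    fix a b :: "real ^ 'n" and n :: nat
    let ?\<psi> = "box_bump a b n"
    have cont: "continuous_on UNIV ?\<psi>"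
      using continuous_on_Re[OF test_function_continuous[OF test_function_box_bump[of a b n]]] by simp
    have [measurable]: "?\<psi> \<in> borel_measurable borel" using cont by (rule borel_measurable_continuous_onI)
    have i: "integrable lborel (\<lambda>x. f' x * ?\<psi> x)" if f': "integrable lborel f'" for f'
    proof (rule Bochner_Integration.integrable_bound[OF f'])
      have [measurable]: "f' \<in> borel_measurable borel" using f' by (auto dest: borel_measurable_integrable)
      show "(\<lambda>x. f' x * ?\<psi> x) \<in> borel_measurable lborel" by measurable
      show "AE x in lborel. norm (f' x * ?\<psi> x) \<le> norm (f' x)"
        using box_bump_bounds[of a b n] by (intro AE_I2) (auto simp: abs_mult mult_left_le)
    qed
    have "(\<integral>\<^sup>+x. ennreal (f x * ?\<psi> x) \<partial>lborel) = (\<integral>\<^sup>+x. ennreal (g x * ?\<psi> x) \<partial>lborel)"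
      using bump[OF cont box_bump_bounds] pos box_bump_bounds[of a b n] by (simp add: ennreal_mult)
    then have "(LINT x|lborel. f x * ?\<psi> x) = (LINT x|lborel. g x * ?\<psi> x)"
      using pos box_bump_bounds[of a b n] by (subst (1 2) integral_eq_nn_integral) auto
    then have "(LINT x|lborel. (f x - g x) * ?\<psi> x) = 0"
      by (simp add: left_diff_distrib i int)
    then show "(LINT x|lborel. complex_of_real (f x - g x) * complex_of_real (?\<psi> x)) = 0"
      by (simp only: of_real_mult[symmetric] integral_complex_of_real of_real_0)
  qed
  then show ?thesis by eventually_elim (metis eq_iff_diff_eq_0 of_real_eq_0_iff)
qed

section \<open>Finiteness of the nonlocal energy\<close>

lemma riesz_minus: "riesz_potential \<alpha> (x - y) = riesz_potential \<alpha> (y - x)"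
  by (simp add: riesz_potential_def norm_minus_commute)

text \<open>Where 2^(-k-1) \<le> |z| < 2^(-k) the kernel is at most C 2^((k+1)s) with s = N -
  \<alpha>, and the ball of radius 2^(-k) has volume proportional to 2^(-kN). Summing over balls
  instead of shells loses nothing of importance: the series is geometric with ratio 2^(s-N) <
  1.\<close>

lemma nn_integral_riesz_ball:
  assumes \<alpha>: "0 < \<alpha>" "\<alpha> < real CARD('n::finite)"
  shows "(\<integral>\<^sup>+z. ennreal (riesz_potential \<alpha> z) * indicator (ball 0 1) z \<partial>(lborel :: (real ^ 'n) measure)) < \<infinity>"
proof -
  define N where "N = real CARD('n)"
  define s where "s = N - \<alpha>"
  have s: "s > 0" "s < N" using \<alpha> by (auto simp: s_def N_def)
  define C where "C = Gamma ((N - \<alpha>) / 2) / (Gamma (\<alpha> / 2) * pi powr (N / 2) * 2 powr \<alpha>)"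
  have C: "C \<ge> 0" unfolding C_def using \<alpha> s
    by (intro divide_nonneg_nonneg mult_nonneg_nonneg) (auto simp: s_def N_def intro!: less_imp_le[OF Gamma_real_pos])
  have riesz: "riesz_potential \<alpha> z = C * (1 / norm z powr s)" for z :: "real ^ 'n"
    by (simp add: riesz_potential_def C_def s_def N_def)
  have "ennreal (riesz_potential \<alpha> z) * indicator (ball 0 1) z \<le>
     (\<Sum>n. ennreal (C * 2 powr (real (Suc n) * s)) * indicator (ball 0 (1 / 2 ^ n)) z)" for z :: "real ^ 'n"
  proof (cases "z \<in> ball 0 1 \<and> z \<noteq> 0")
    case True
    define P where "P n \<longleftrightarrow> norm z \<ge> 1 / 2 ^ n" for n :: nat
    have "\<exists>n. P n"
    proof -
      obtain n where "(1 / 2) ^ n < norm z"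
        using real_arch_pow_inv[of "norm z" "1 / 2"] True by auto
      then show ?thesis by (auto simp: P_def power_divide intro!: exI[of _ n])
    qed
    \<comment> \<open>Locates the dyadic shell of z; n = 0 is impossible in the open unit ball, so a
      predecessor k exists, and minimality puts z into the ball of radius 2^(-k).\<close>
    define n where "n = (LEAST n. P n)"
    have Pn: "P n" unfolding n_def by (rule LeastI_ex[OF \<open>\<exists>n. P n\<close>])
    have "n \<noteq> 0"
    proof
      assume "n = 0"
      then show False using Pn True by (simp add: P_def)
    qed
    then obtain k where k: "n = Suc k" by (cases n) auto
    have "\<not> P k" using not_less_Least[of k P] k n_def by auto
    then have zk: "z \<in> ball 0 (1 / 2 ^ k)" by (simp add: P_def)
    have "1 / norm z powr s \<le> 1 / (1 / 2 ^ n) powr s"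
      using Pn s True by (intro divide_left_mono powr_mono2) (auto simp: P_def intro!: mult_pos_pos)
    also have "\<dots> = 2 powr (real (Suc k) * s)"
    proof -
      have "1 / (1 / 2 ^ n) powr s = ((2::real) ^ n) powr s" by (simp add: powr_divide)
      also have "\<dots> = 2 powr (real n * s)"
        by (simp only: powr_realpow[symmetric] zero_less_numeral powr_powr)
      finally show ?thesis by (simp only: k)
    qed
    finally have "riesz_potential \<alpha> z \<le> C * 2 powr (real (Suc k) * s)"
      unfolding riesz using C by (intro mult_left_mono) auto
    then have "ennreal (riesz_potential \<alpha> z) * indicator (ball 0 1) z \<le>
       ennreal (C * 2 powr (real (Suc k) * s)) * indicator (ball 0 (1 / 2 ^ k)) z"
      using True zk by (simp add: ennreal_leI)
    also have "\<dots> \<le> (\<Sum>n. ennreal (C * 2 powr (real (Suc n) * s)) * indicator (ball 0 (1 / 2 ^ n)) z)"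
    proof -
      have "f k \<le> (\<Sum>n. f n)" for f :: "nat \<Rightarrow> ennreal"
        using sum_le_suminf[of f "{k}"] by (simp add: summableI)
      then show ?thesis .
    qed
    finally show ?thesis .
  next
    case False
    \<comment> \<open>At the origin the kernel takes its default value 0, and outside the ball the
      indicator vanishes.\<close>
    then have eq: "ennreal (riesz_potential \<alpha> z) * indicator (ball 0 1) z = 0"
      using s by (auto simp: riesz)
    show ?thesis unfolding eq by (rule zero_le)
  qed
  then have "(\<integral>\<^sup>+z. ennreal (riesz_potential \<alpha> z) * indicator (ball 0 1) z \<partial>(lborel :: (real ^ 'n) measure)) \<le>
    (\<integral>\<^sup>+z. (\<Sum>n. ennreal (C * 2 powr (real (Suc n) * s)) * indicator (ball 0 (1 / 2 ^ n)) z) \<partial>(lborel :: (real ^ 'n) measure))"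
    by (rule nn_integral_mono)
  also have "\<dots> = (\<Sum>n. ennreal (C * 2 powr (real (Suc n) * s)) * emeasure lborel (ball (0 :: real ^ 'n) (1 / 2 ^ n)))"
  proof -
    have "(\<lambda>z::real ^ 'n. ennreal (C * 2 powr (real (Suc n) * s)) * indicator (ball 0 (1 / 2 ^ n)) z)
        \<in> borel_measurable lborel" for n
      by (intro borel_measurable_times_ennreal borel_measurable_const borel_measurable_indicator) simp
    from nn_integral_suminf[OF this] show ?thesis
      by (simp only: nn_integral_cmult_indicator sets_lborel borel_open open_ball)
  qed
  also have "\<dots> = (\<Sum>n. ennreal ((C * 2 powr s * unit_ball_vol N) * (2 powr (s - N)) ^ n))"
  proof (intro suminf_cong)
    fix n
    have e1: "emeasure lborel (ball (0 :: real ^ 'n) (1 / 2 ^ n)) = ennreal (unit_ball_vol N * (1 / 2 ^ n) ^ CARD('n))"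
      by (subst emeasure_ball) (auto simp: N_def)
    have e2: "C * 2 powr (real (Suc n) * s) * (unit_ball_vol N * (1 / 2 ^ n) ^ CARD('n)) =
       (C * 2 powr s * unit_ball_vol N) * (2 powr (s - N)) ^ n"
    proof -
      have "(1 / 2 ^ n) ^ CARD('n) = (2::real) powr (- (real n * N))"
      proof -
        have "real n * N = real (n * CARD('n))" by (simp add: N_def)
        then have "(2::real) powr (- (real n * N)) = 1 / 2 ^ (n * CARD('n))"
          by (simp only: powr_minus_divide powr_realpow zero_less_numeral)
        then show ?thesis by (simp add: power_divide power_mult)
      qed
      moreover have "(2::real) powr (real (Suc n) * s) = 2 powr s * 2 powr (real n * s)"
        by (simp add: distrib_right flip: powr_add)
      moreover have "((2::real) powr (s - N)) ^ n = 2 powr (real n * s) * 2 powr (- (real n * N))"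
        by (simp add: powr_power algebra_simps flip: powr_add)
      ultimately show ?thesis by simp
    qed
    show "ennreal (C * 2 powr (real (Suc n) * s)) * emeasure lborel (ball (0 :: real ^ 'n) (1 / 2 ^ n)) =
       ennreal ((C * 2 powr s * unit_ball_vol N) * (2 powr (s - N)) ^ n)"
      unfolding e1 e2[symmetric] by (rule ennreal_mult'[symmetric]) (use C in simp)
  qed
  also have "\<dots> < \<infinity>"
  proof -
    have "(2::real) powr (s - N) < 1" using s by (simp add: powr_less_one)
    then have "summable (\<lambda>n. (C * 2 powr s * unit_ball_vol N) * (2 powr (s - N)) ^ n)"
      by (intro summable_mult summable_geometric) auto
    then show ?thesis using C s
      by (subst suminf_ennreal2) (auto intro!: mult_nonneg_nonneg simp: N_def)
  qed
  finally show ?thesis .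
qed

text \<open>Positive everywhere, bounded below on balls, and of finite mass and energy. It serves as
  competitor, as weight for convergence almost everywhere, and as comparison function in the proof
  of positivity.\<close>

definition ref :: "real ^ 'n \<Rightarrow> real" where
  "ref x = exp (- norm x)"

lemma ref_measurable [measurable]: "ref \<in> borel_measurable borel"
  unfolding ref_def[abs_def] by measurable

lemma ref_pos: "ref x > 0" "ref x \<le> 1"
  by (auto simp: ref_def)

lemma ref_square: "(ref x)\<^sup>2 = exp (- 2 * norm x)"
  unfolding ref_def by (simp add: exp_of_nat_mult[symmetric])

lemma nn_integral_ref_square: "(\<integral>\<^sup>+x. ennreal ((ref x)\<^sup>2) \<partial>(lborel :: (real ^ 'n) measure)) < \<infinity>"
  unfolding ref_square using nn_integral_exp_neg_norm[of 2, where 'a = "real ^ 'n"] by simp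

text \<open>At distance below 1 the density is at most 1 and the kernel is integrable; at distance
  at least 1 the kernel is at most C and the density is integrable. So the potential of the density
  is bounded.\<close>

lemma hartree2_ref_finite:
  assumes \<alpha>: "0 < \<alpha>" "\<alpha> < real CARD('n::finite)"
  shows "hartree2 \<alpha> (\<lambda>x::real ^ 'n. ennreal ((ref x)\<^sup>2)) (\<lambda>x. ennreal ((ref x)\<^sup>2)) < \<infinity>"
proof -
  define R where "R = (\<integral>\<^sup>+x. ennreal ((ref x)\<^sup>2) \<partial>(lborel :: (real ^ 'n) measure))"
  define B where "B = (\<integral>\<^sup>+z. ennreal (riesz_potential \<alpha> z) * indicator (ball 0 1) z \<partial>(lborel :: (real ^ 'n) measure))"
  define C where "C = Gamma ((real CARD('n) - \<alpha>) / 2) / (Gamma (\<alpha> / 2) * pi powr (real CARD('n) / 2) * 2 powr \<alpha>)"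
  have C: "C \<ge> 0" unfolding C_def using \<alpha>
    by (intro divide_nonneg_nonneg mult_nonneg_nonneg) (auto intro!: less_imp_le[OF Gamma_real_pos])
  have far: "riesz_potential \<alpha> z \<le> C" if "norm z \<ge> 1" for z :: "real ^ 'n"
  proof -
    have "1 powr (real CARD('n) - \<alpha>) \<le> norm z powr (real CARD('n) - \<alpha>)"
      using \<alpha> that by (intro powr_mono2) auto
    then have "C / norm z powr (real CARD('n) - \<alpha>) \<le> C / 1" using C by (intro divide_left_mono) auto
    then show ?thesis by (simp add: riesz_potential_def C_def)
  qed
  define F where "F z = ennreal (riesz_potential \<alpha> z) * indicator (ball 0 1) z" for z :: "real ^ 'n"
  have [measurable]: "F \<in> borel_measurable borel"
    unfolding F_def by (intro borel_measurable_times_ennreal borel_measurable_indicator) auto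
  have V: "nn_convolution (\<lambda>x. ennreal (riesz_potential \<alpha> x)) (\<lambda>x. ennreal ((ref x)\<^sup>2)) x \<le> B + ennreal C * R" for x :: "real ^ 'n"
  proof -
    have "nn_convolution (\<lambda>x. ennreal (riesz_potential \<alpha> x)) (\<lambda>x. ennreal ((ref x)\<^sup>2)) x \<le>
      (\<integral>\<^sup>+y. F (y + - x) + ennreal C * ennreal ((ref y)\<^sup>2) \<partial>lborel)"
      unfolding nn_convolution_def
    proof (intro nn_integral_mono)
      fix y
      show "ennreal (riesz_potential \<alpha> (x - y)) * ennreal ((ref y)\<^sup>2) \<le>
        F (y + - x) + ennreal C * ennreal ((ref y)\<^sup>2)"
      proof (cases "norm (x - y) < 1")
        case True
        have "ennreal ((ref y)\<^sup>2) \<le> 1" using ref_pos[of y] by (simp add: power_le_one)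
        then have "ennreal (riesz_potential \<alpha> (x - y)) * ennreal ((ref y)\<^sup>2) \<le> ennreal (riesz_potential \<alpha> (x - y)) * 1"
          by (intro mult_left_mono) auto
        then show ?thesis using True riesz_minus[of \<alpha> x y]
          by (simp add: F_def norm_minus_commute add_increasing2)
      next
        case False
        then have "ennreal (riesz_potential \<alpha> (x - y)) * ennreal ((ref y)\<^sup>2) \<le> ennreal C * ennreal ((ref y)\<^sup>2)"
          by (intro mult_right_mono ennreal_leI far) auto
        then show ?thesis by (simp add: add_increasing)
      qed
    qed
    also have "\<dots> = (\<integral>\<^sup>+y. F (y + - x) \<partial>lborel) + ennreal C * R"
      unfolding R_def by (subst nn_integral_add) (auto simp: nn_integral_cmult)
    also have "(\<integral>\<^sup>+y. F (y + - x) \<partial>lborel) = B"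
      unfolding B_def F_def[symmetric] by (rule nn_integral_translate) measurable
    finally show ?thesis .
  qed
  have "hartree2 \<alpha> (\<lambda>x::real ^ 'n. ennreal ((ref x)\<^sup>2)) (\<lambda>x. ennreal ((ref x)\<^sup>2)) \<le>
    (\<integral>\<^sup>+x. (B + ennreal C * R) * ennreal ((ref x)\<^sup>2) \<partial>(lborel :: (real ^ 'n) measure))"
    unfolding hartree2_def by (intro nn_integral_mono mult_right_mono V) auto
  also have "\<dots> = (B + ennreal C * R) * R" unfolding R_def by (rule nn_integral_cmult) measurable
  also have "\<dots> < \<infinity>"
    using nn_integral_riesz_ball[OF \<alpha>] nn_integral_ref_square[where 'n = 'n]
    by (simp add: B_def R_def ennreal_mult_less_top)
  finally show ?thesis .
qed

text \<open>Fatou twice, in y for fixed x and then in x.\<close>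

lemma hartree2_le_liminf:
  fixes a :: "nat \<Rightarrow> real ^ 'n \<Rightarrow> ennreal"
  assumes [measurable]: "\<And>n. a n \<in> borel_measurable borel" "b \<in> borel_measurable borel"
    and lim: "AE x in lborel. (\<lambda>n. a n x) \<longlonglongrightarrow> b x"
    and fin: "\<And>n x. a n x < \<infinity>" "\<And>x. b x < \<infinity>"
  shows "hartree2 \<alpha> b b \<le> liminf (\<lambda>n. hartree2 \<alpha> (a n) (a n))"
proof -
  let ?k = "\<lambda>x. ennreal (riesz_potential \<alpha> x)"
  have eq: "hartree2 \<alpha> c c = (\<integral>\<^sup>+x. (\<integral>\<^sup>+y. ?k (x - y) * c y * c x \<partial>lborel) \<partial>lborel)"
    if [measurable]: "c \<in> borel_measurable borel" for c :: "real ^ 'n \<Rightarrow> ennreal"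
    unfolding hartree2_def nn_convolution_def by (simp add: nn_integral_multc)
  have "(\<integral>\<^sup>+x. (\<integral>\<^sup>+y. ?k (x - y) * b y * b x \<partial>lborel) \<partial>lborel) \<le>
     (\<integral>\<^sup>+x. liminf (\<lambda>n. \<integral>\<^sup>+y. ?k (x - y) * a n y * a n x \<partial>lborel) \<partial>lborel)"
  proof (rule nn_integral_mono_AE, rule eventually_mono[OF lim])
    fix x assume x: "(\<lambda>n. a n x) \<longlonglongrightarrow> b x"
    show "(\<integral>\<^sup>+y. ?k (x - y) * b y * b x \<partial>lborel) \<le> liminf (\<lambda>n. \<integral>\<^sup>+y. ?k (x - y) * a n y * a n x \<partial>lborel)"
    proof (rule nn_integral_AE_tendsto_le_liminf)
      show "AE y in lborel. (\<lambda>n. ?k (x - y) * a n y * a n x) \<longlonglongrightarrow> ?k (x - y) * b y * b x"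
        using lim
      proof eventually_elim
        case (elim y)
        \<comment> \<open>Finite values are required for the products to converge, because
          multiplication in \<open>ennreal\<close> is discontinuous at (0, \<infinity>).\<close>
        obtain f where f: "\<And>n z. a n z = ennreal (f n z)" "\<And>n z. f n z \<ge> 0"
          using that[of "\<lambda>n z. enn2real (a n z)"] fin(1) by (simp add: less_top)
        obtain g where g: "\<And>z. b z = ennreal (g z)" "\<And>z. g z \<ge> 0"
          using that[of "\<lambda>z. enn2real (b z)"] fin(2) by (simp add: less_top)
        have "(\<lambda>n. f n x) \<longlonglongrightarrow> g x" "(\<lambda>n. f n y) \<longlonglongrightarrow> g y"
          using x elim f g by (simp_all add: tendsto_ennreal_iff)
        then have "(\<lambda>n. ennreal (f n y * f n x)) \<longlonglongrightarrow> ennreal (g y * g x)"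
          by (intro tendsto_intros)
        then have "(\<lambda>n. ?k (x - y) * ennreal (f n y * f n x)) \<longlonglongrightarrow> ?k (x - y) * ennreal (g y * g x)"
          by (intro ennreal_tendsto_cmult) simp_all
        then show ?case by (simp add: f g ennreal_mult mult.assoc)
      qed
    qed measurable
  qed
  also have "\<dots> \<le> liminf (\<lambda>n. \<integral>\<^sup>+x. (\<integral>\<^sup>+y. ?k (x - y) * a n y * a n x \<partial>lborel) \<partial>lborel)"
    by (rule nn_integral_liminf) measurable
  finally show ?thesis by (simp add: eq)
qed

section \<open>The energy functional\<close>

definition pot :: "(real ^ 'n \<Rightarrow> 'b::euclidean_space) \<Rightarrow> ennreal" where
  "pot u = (\<integral>\<^sup>+x. ennreal ((norm x)\<^sup>2 * (norm (u x))\<^sup>2) \<partial>lborel)"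

definition dens :: "(real ^ 'n \<Rightarrow> 'b::euclidean_space) \<Rightarrow> real ^ 'n \<Rightarrow> ennreal" where
  "dens u x = ennreal ((norm (u x))\<^sup>2)"

text \<open>Twice the energy, with difference quotients in place of the weak gradient. It is thereby
  defined for functions with values in any Euclidean space, in particular for the real-valued
  interpolations.\<close>

definition total_energy :: "real \<Rightarrow> (real ^ 'n \<Rightarrow> 'b::euclidean_space) \<Rightarrow> ennreal" where
  "total_energy \<alpha> u = kinetic u + pot u + 1 / 2 * hartree2 \<alpha> (dens u) (dens u)"

lemma dens_measurable [measurable]: "u \<in> borel_measurable borel \<Longrightarrow> dens u \<in> borel_measurable borel"
  unfolding dens_def[abs_def] by measurable

lemma energy_space_iff:
  fixes u :: "real ^ 'n \<Rightarrow> complex"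
  shows "u \<in> energy_space \<longleftrightarrow> square_integrable u \<and> kinetic u < \<infinity> \<and> pot u < \<infinity>"
proof -
  have "integrable lborel (\<lambda>x. (norm x)\<^sup>2 * (norm (u x))\<^sup>2) \<longleftrightarrow> pot u < \<infinity>" if "square_integrable u"
  proof -
    have [measurable]: "u \<in> borel_measurable borel" by (rule square_integrableD[OF that])
    show ?thesis unfolding pot_def by (simp add: integrable_iff_bounded)
  qed
  then show ?thesis by (auto simp: energy_space_def sobolev_H1_iff)
qed

lemma energy_eq:
  fixes u :: "real ^ 'n \<Rightarrow> complex"
  assumes "u \<in> energy_space"
  shows "energy \<alpha> u = 1 / 2 * total_energy \<alpha> u"
proof -
  have H1: "u \<in> sobolev_H1" using assms by (simp add: energy_space_def)
  have [measurable]: "u \<in> borel_measurable borel"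
    using assms square_integrableD(1) by (auto simp: energy_space_iff)
  have [measurable]: "weak_gradient u \<in> borel_measurable borel"
    using weak_gradient(2)[OF H1] square_integrableD(1) by blast
  have [measurable]: "hartree_potential \<alpha> u \<in> borel_measurable borel"
    unfolding hartree_potential_def by measurable
  have h: "hartree_potential \<alpha> u = nn_convolution (\<lambda>x. ennreal (riesz_potential \<alpha> x)) (dens u)"
    by (simp add: hartree_potential_def dens_def[abs_def])
  have "energy \<alpha> u = 1 / 2 * ((sqnorm (weak_gradient u) + pot u) +
      (\<integral>\<^sup>+x. 1 / 2 * (hartree_potential \<alpha> u x * ennreal ((norm (u x))\<^sup>2)) \<partial>lborel))"
    unfolding energy_def sqnorm_def pot_def by (subst nn_integral_add, measurable, subst nn_integral_add) auto
  also have "(\<integral>\<^sup>+x. 1 / 2 * (hartree_potential \<alpha> u x * ennreal ((norm (u x))\<^sup>2)) \<partial>lborel) =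
      1 / 2 * hartree2 \<alpha> (dens u) (dens u)"
    unfolding hartree2_def h dens_def[symmetric] by (subst nn_integral_cmult) auto
  finally show ?thesis by (simp add: total_energy_def sqnorm_weak_gradient[OF H1])
qed

lemma sqnorm_eq_mass: "square_integrable u \<Longrightarrow> sqnorm u = ennreal (mass u)"
  by (simp add: sqnorm_eq_integral mass_def)

lemma mass_nonneg: "mass u \<ge> 0"
  unfolding mass_def by (intro integral_nonneg_AE) auto

text \<open>Covers the modulus of u against u as well as a real function against its complex
  embedding, in both directions.\<close>

lemma total_energy_mono:
  fixes u :: "real ^ 'n \<Rightarrow> 'b::euclidean_space" and w :: "real ^ 'n \<Rightarrow> 'd::euclidean_space"
  assumes "u \<in> borel_measurable borel" "\<And>x y. norm (w x - w y) \<le> norm (u x - u y)" "\<And>x. norm (w x) \<le> norm (u x)"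
  shows "total_energy \<alpha> w \<le> total_energy \<alpha> u"
  unfolding total_energy_def pot_def dens_def using assms(3)
  by (intro add_mono mult_left_mono hartree2_mono kinetic_mono nn_integral_mono ennreal_leI assms(1,2))
     (auto intro!: mult_left_mono power_mono)

lemma total_energy_norm_le:
  fixes u :: "real ^ 'n \<Rightarrow> complex"
  assumes "u \<in> borel_measurable borel"
  shows "total_energy \<alpha> (\<lambda>x. norm (u x)) \<le> total_energy \<alpha> u"
  by (rule total_energy_mono[OF assms]) (auto simp: norm_triangle_ineq3)

lemma total_energy_of_real:
  fixes w :: "real ^ 'n \<Rightarrow> real"
  assumes [measurable]: "w \<in> borel_measurable borel"
  shows "total_energy \<alpha> (\<lambda>x. complex_of_real (w x)) = total_energy \<alpha> w"
  by (intro antisym total_energy_mono) (auto simp: norm_of_real simp flip: of_real_diff)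

lemma sqnorm_of_real: "sqnorm (\<lambda>x. complex_of_real (w x)) = sqnorm w"
  by (simp add: sqnorm_def)

section \<open>Interpolation of densities\<close>

text \<open>A segment in the variable |u|^2. Mass and potential energy are affine along it, so the
  mass constraint is preserved.\<close>

definition blend :: "real \<Rightarrow> (real ^ 'n \<Rightarrow> 'b::euclidean_space) \<Rightarrow> (real ^ 'n \<Rightarrow> 'c::euclidean_space) \<Rightarrow> real ^ 'n \<Rightarrow> real" where
  "blend t u v x = sqrt ((1 - t) * (norm (u x))\<^sup>2 + t * (norm (v x))\<^sup>2)"

lemma blend_nonneg: "0 \<le> t \<Longrightarrow> t \<le> 1 \<Longrightarrow> blend t u v x \<ge> 0"
  by (simp add: blend_def)

lemma blend_square: "0 \<le> t \<Longrightarrow> t \<le> 1 \<Longrightarrow> (blend t u v x)\<^sup>2 = (1 - t) * (norm (u x))\<^sup>2 + t * (norm (v x))\<^sup>2"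
  by (simp add: blend_def)

lemma blend_measurable [measurable]:
  assumes [measurable]: "u \<in> borel_measurable borel" "v \<in> borel_measurable borel"
  shows "blend t u v \<in> borel_measurable borel"
  unfolding blend_def[abs_def] by measurable

text \<open>\<open>blend t u v\<close> is the norm of the vector \<open>(sqrt (1 - t) u, sqrt t v)\<close>.\<close>

lemma blend_diff_le:
  assumes t: "0 \<le> t" "t \<le> 1"
  shows "(norm (blend t u v x - blend t u v y))\<^sup>2 \<le> (1 - t) * (norm (u x - u y))\<^sup>2 + t * (norm (v x - v y))\<^sup>2"
proof -
  define p where "p x = (sqrt (1 - t) *\<^sub>R u x, sqrt t *\<^sub>R v x)" for x
  have "blend t u v x = norm (p x)" for x
    using t by (simp add: blend_def p_def norm_Pair power_mult_distrib)
  then have "\<bar>blend t u v x - blend t u v y\<bar> \<le> norm (p x - p y)"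
    by (simp add: norm_triangle_ineq3)
  then have "\<bar>blend t u v x - blend t u v y\<bar>\<^sup>2 \<le> (norm (p x - p y))\<^sup>2" by (intro power_mono) auto
  also have "\<dots> = (1 - t) * (norm (u x - u y))\<^sup>2 + t * (norm (v x - v y))\<^sup>2"
    using t by (simp add: p_def norm_Pair power_mult_distrib flip: scaleR_diff_right)
  finally show ?thesis by simp
qed

lemma kin_blend:
  assumes "u \<in> borel_measurable borel" "v \<in> borel_measurable borel" "0 \<le> t" "t \<le> 1"
  shows "kin i (blend t u v) \<le> ennreal (1 - t) * kin i u + ennreal t * kin i v"
  using assms by (intro kin_mono2 blend_diff_le) auto

lemma kinetic_blend:
  assumes "u \<in> borel_measurable borel" "v \<in> borel_measurable borel" "0 \<le> t" "t \<le> 1"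
  shows "kinetic (blend t u v) \<le> ennreal (1 - t) * kinetic u + ennreal t * kinetic v"
  using assms by (intro kinetic_mono2 blend_diff_le) auto

lemma dens_blend:
  assumes t: "0 \<le> t" "t \<le> 1"
  shows "dens (blend t u v) = (\<lambda>x. ennreal (1 - t) * dens u x + ennreal t * dens v x)"
  using t by (auto simp: dens_def blend_square fun_eq_iff simp flip: ennreal_mult ennreal_plus)

lemma pot_blend:
  assumes [measurable]: "u \<in> borel_measurable borel" "v \<in> borel_measurable borel" and t: "0 \<le> t" "t \<le> 1"
  shows "pot (blend t u v) = ennreal (1 - t) * pot u + ennreal t * pot v"
proof -
  have "pot (blend t u v) = (\<integral>\<^sup>+x. ennreal (1 - t) * ennreal ((norm x)\<^sup>2 * (norm (u x))\<^sup>2) +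
      ennreal t * ennreal ((norm x)\<^sup>2 * (norm (v x))\<^sup>2) \<partial>lborel)"
    unfolding pot_def
  proof (intro nn_integral_cong)
    fix x
    have "(norm x)\<^sup>2 * (norm (blend t u v x))\<^sup>2 = (1 - t) * ((norm x)\<^sup>2 * (norm (u x))\<^sup>2) + t * ((norm x)\<^sup>2 * (norm (v x))\<^sup>2)"
      using t by (simp add: blend_square algebra_simps)
    then show "ennreal ((norm x)\<^sup>2 * (norm (blend t u v x))\<^sup>2) =
      ennreal (1 - t) * ennreal ((norm x)\<^sup>2 * (norm (u x))\<^sup>2) + ennreal t * ennreal ((norm x)\<^sup>2 * (norm (v x))\<^sup>2)"
      using t by (simp flip: ennreal_mult ennreal_plus)
  qed
  then show ?thesis unfolding pot_def by (simp add: nn_integral_add nn_integral_cmult)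
qed

lemma sqnorm_blend:
  assumes [measurable]: "u \<in> borel_measurable borel" "v \<in> borel_measurable borel" and t: "0 \<le> t" "t \<le> 1"
  shows "sqnorm (blend t u v) = ennreal (1 - t) * sqnorm u + ennreal t * sqnorm v"
proof -
  have "sqnorm (blend t u v) = (\<integral>\<^sup>+x. ennreal (1 - t) * ennreal ((norm (u x))\<^sup>2) +
      ennreal t * ennreal ((norm (v x))\<^sup>2) \<partial>lborel)"
    unfolding sqnorm_def using t
    by (intro nn_integral_cong) (simp add: blend_square flip: ennreal_mult ennreal_plus)
  then show ?thesis unfolding sqnorm_def by (simp add: nn_integral_add nn_integral_cmult)
qed

lemma hartree2_blend:
  fixes u :: "real ^ 'n \<Rightarrow> 'b::euclidean_space" and v :: "real ^ 'n \<Rightarrow> 'c::euclidean_space"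
  assumes \<alpha>: "0 < \<alpha>" "\<alpha> < real CARD('n)"
    and [measurable]: "u \<in> borel_measurable borel" "v \<in> borel_measurable borel" and t: "0 \<le> t" "t \<le> 1"
  shows "hartree2 \<alpha> (dens (blend t u v)) (dens (blend t u v)) \<le>
    ennreal (1 - t) * hartree2 \<alpha> (dens u) (dens u) + ennreal t * hartree2 \<alpha> (dens v) (dens v)"
  unfolding dens_blend[OF t] using t by (intro hartree2_convex \<alpha>) (auto simp flip: ennreal_plus)

lemma total_energy_blend:
  fixes u :: "real ^ 'n \<Rightarrow> 'b::euclidean_space" and v :: "real ^ 'n \<Rightarrow> 'c::euclidean_space"
  assumes \<alpha>: "0 < \<alpha>" "\<alpha> < real CARD('n)"
    and m: "u \<in> borel_measurable borel" "v \<in> borel_measurable borel" and t: "0 \<le> t" "t \<le> 1"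
  shows "total_energy \<alpha> (blend t u v) \<le> ennreal (1 - t) * total_energy \<alpha> u + ennreal t * total_energy \<alpha> v"
proof -
  have "total_energy \<alpha> (blend t u v) \<le> (ennreal (1 - t) * kinetic u + ennreal t * kinetic v) +
    (ennreal (1 - t) * pot u + ennreal t * pot v) +
    1 / 2 * (ennreal (1 - t) * hartree2 \<alpha> (dens u) (dens u) + ennreal t * hartree2 \<alpha> (dens v) (dens v))"
    unfolding total_energy_def pot_blend[OF m t]
    by (intro add_mono mult_left_mono kinetic_blend hartree2_blend \<alpha> m t order_refl) auto
  also have "\<dots> = ennreal (1 - t) * total_energy \<alpha> u + ennreal t * total_energy \<alpha> v"
    by (simp add: total_energy_def distrib_left mult_ac add_ac)
  finally show ?thesis .
qed

lemma sqnorm_scale: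
  fixes u :: "real ^ 'n \<Rightarrow> 'b::euclidean_space"
  assumes [measurable]: "u \<in> borel_measurable borel"
  shows "sqnorm (\<lambda>x. c *\<^sub>R u x) = ennreal (c\<^sup>2) * sqnorm u"
  unfolding sqnorm_def by (simp add: nn_integral_cmult[symmetric] power_mult_distrib ennreal_mult)

lemma total_energy_scale_le:
  fixes u :: "real ^ 'n \<Rightarrow> 'b::euclidean_space"
  assumes [measurable]: "u \<in> borel_measurable borel"
  shows "total_energy \<alpha> (\<lambda>x. c *\<^sub>R u x) \<le> ennreal (c\<^sup>2) * (kinetic u + pot u) +
    1 / 2 * (ennreal (c\<^sup>2) * ennreal (c\<^sup>2) * hartree2 \<alpha> (dens u) (dens u))"
proof -
  have "kinetic (\<lambda>x. c *\<^sub>R u x) \<le> ennreal (c\<^sup>2) * kinetic u + ennreal 0 * kinetic u"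
    by (intro kinetic_mono2) (auto simp: power_mult_distrib simp flip: scaleR_diff_right)
  moreover have "pot (\<lambda>x. c *\<^sub>R u x) = ennreal (c\<^sup>2) * pot u"
    unfolding pot_def by (simp add: nn_integral_cmult[symmetric] power_mult_distrib ennreal_mult mult_ac)
  moreover have "dens (\<lambda>x. c *\<^sub>R u x) = (\<lambda>x. ennreal (c\<^sup>2) * dens u x)"
    by (simp add: dens_def fun_eq_iff power_mult_distrib ennreal_mult)
  ultimately show ?thesis unfolding total_energy_def
    by (simp add: hartree2_cmult_left hartree2_cmult_right distrib_left add_mono mult.assoc)
qed

lemma half_ennreal: "(1 / 2 :: ennreal) = ennreal (1 / 2)"
  by (simp add: divide_ennreal flip: ennreal_1 ennreal_numeral)

lemma half_less_top: "inverse 2 < (top :: ennreal)"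
proof -
  have "(1 / 2 :: ennreal) < top" unfolding half_ennreal by (rule ennreal_less_top)
  then show ?thesis by (simp add: divide_ennreal_def)
qed

section \<open>A competitor of finite energy and prescribed mass\<close>

text \<open>The increment of exp(-|x|) is at most |x - y| times the larger of the two values, hence
  times their sum. After squaring, translation invariance gives the constant 4.\<close>

lemma kinetic_ref_finite: "kinetic (ref :: real ^ 'n \<Rightarrow> real) < \<infinity>"
proof -
  let ?r = "ref :: real ^ 'n \<Rightarrow> real"
  have R: "sqnorm ?r < \<infinity>" using nn_integral_ref_square[where 'n = 'n] by (simp add: sqnorm_def)
  have pw: "(norm (ref x - ref y))\<^sup>2 \<le> 2 * (norm (x - y))\<^sup>2 * ((ref x)\<^sup>2 + (ref y)\<^sup>2)" for x y :: "real ^ 'n"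
  proof -
    have e: "exp (- a) - exp (- b) \<le> (b - a) * exp (- a)" for a b :: real
      using exp_ge_add_one_self[of "a - b"] mult_left_mono[of "1 + (a - b)" "exp (a - b)" "exp (- a)"]
      by (simp add: algebra_simps flip: exp_add)
    have "\<bar>ref x - ref y\<bar> \<le> \<bar>norm x - norm y\<bar> * (ref x + ref y)"
    proof (cases "norm x \<le> norm y")
      case True
      then have "ref x - ref y \<ge> 0" by (simp add: ref_def)
      moreover have "ref x - ref y \<le> (norm y - norm x) * ref x" using e unfolding ref_def .
      moreover have "(norm y - norm x) * ref x \<le> (norm y - norm x) * (ref x + ref y)"
        using True ref_pos[of y] by (intro mult_left_mono) auto
      ultimately show ?thesis using True by simp
    next
      case False
      then have "ref y - ref x \<ge> 0" by (simp add: ref_def)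
      moreover have "ref y - ref x \<le> (norm x - norm y) * ref y" using e unfolding ref_def .
      moreover have "(norm x - norm y) * ref y \<le> \<bar>norm x - norm y\<bar> * (ref x + ref y)"
        using False ref_pos[of x] ref_pos[of y] by (intro mult_mono) auto
      ultimately show ?thesis by linarith
    qed
    also have "\<dots> \<le> norm (x - y) * (ref x + ref y)"
      using ref_pos[of x] ref_pos[of y] by (intro mult_right_mono norm_triangle_ineq3) auto
    finally have "\<bar>ref x - ref y\<bar>\<^sup>2 \<le> (norm (x - y) * (ref x + ref y))\<^sup>2" by (rule power_mono) auto
    also have "\<dots> \<le> (norm (x - y))\<^sup>2 * (2 * (ref x)\<^sup>2 + 2 * (ref y)\<^sup>2)"
      unfolding power_mult_distrib using norm_add_square_le[of "ref x" "ref y"]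
      by (intro mult_left_mono) auto
    finally show ?thesis by (simp add: algebra_simps)
  qed
  have "kin i ?r \<le> ennreal 4 * sqnorm ?r" for i
  proof (rule kin_leI)
    fix h :: real assume h: "h > 0"
    let ?e = "axis i 1 :: real ^ 'n"
    have "diff2 i h ?r \<le> (\<integral>\<^sup>+x. ennreal (2 * h\<^sup>2) * (ennreal ((norm (ref (x + h *\<^sub>R ?e)))\<^sup>2) + ennreal ((norm (ref x))\<^sup>2)) \<partial>lborel)"
      unfolding diff2_def sqnorm_def
    proof (intro nn_integral_mono)
      fix x :: "real ^ 'n"
      have "(norm (ref (x + h *\<^sub>R ?e) - ref x))\<^sup>2 \<le> 2 * h\<^sup>2 * ((norm (ref (x + h *\<^sub>R ?e)))\<^sup>2 + (norm (ref x))\<^sup>2)"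
        using pw[of "x + h *\<^sub>R ?e" x] h by simp
      from ennreal_leI[OF this] show "ennreal ((norm (ref (x + h *\<^sub>R ?e) - ref x))\<^sup>2) \<le>
         ennreal (2 * h\<^sup>2) * (ennreal ((norm (ref (x + h *\<^sub>R ?e)))\<^sup>2) + ennreal ((norm (ref x))\<^sup>2))"
        by (simp only: ennreal_mult' ennreal_plus zero_le_power2 zero_le_mult_iff zero_le_numeral simp_thms)
    qed
    also have "\<dots> = ennreal (2 * h\<^sup>2) * (sqnorm (\<lambda>x. ?r (x + h *\<^sub>R ?e)) + sqnorm ?r)"
      unfolding sqnorm_def by (subst nn_integral_cmult, measurable, subst nn_integral_add) auto
    also have "sqnorm (\<lambda>x. ?r (x + h *\<^sub>R ?e)) = sqnorm ?r" by (rule sqnorm_translate) measurable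
    also have "ennreal (2 * h\<^sup>2) * (sqnorm ?r + sqnorm ?r) = ennreal (h\<^sup>2) * (ennreal 4 * sqnorm ?r)"
    proof -
      have "sqnorm ?r + sqnorm ?r = ennreal 2 * sqnorm ?r" by (simp add: mult_2)
      moreover have "ennreal (2 * h\<^sup>2) * ennreal 2 = ennreal (h\<^sup>2) * ennreal 4"
        by (subst (1 2) ennreal_mult[symmetric]) (auto simp: mult.commute)
      ultimately show ?thesis by (metis mult.assoc)
    qed
    finally show "diff2 i h ?r \<le> ennreal (h\<^sup>2) * (ennreal 4 * sqnorm ?r)" .
  qed
  then have "kin i ?r < \<infinity>" for i
    using R by (metis ennreal_less_top ennreal_mult_less_top le_less_trans infinity_ennreal_def)
  then show ?thesis unfolding kinetic_less_top_iff by blast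
qed

lemma pot_ref_finite: "pot (ref :: real ^ 'n \<Rightarrow> real) < \<infinity>"
proof -
  have "(norm x)\<^sup>2 * (norm (ref x))\<^sup>2 \<le> 2 * exp (- 1 * norm x)" for x :: "real ^ 'n"
  proof -
    have "(norm x)\<^sup>2 \<le> 2 * exp (norm x)"
      using exp_lower_Taylor_quadratic[of "norm x"] norm_ge_zero[of x] by linarith
    then have "(norm x)\<^sup>2 * exp (- 2 * norm x) \<le> 2 * exp (norm x) * exp (- 2 * norm x)"
      by (intro mult_right_mono) auto
    also have "\<dots> = 2 * exp (- 1 * norm x)" by (simp flip: exp_add)
    finally show ?thesis using ref_square[of x] by simp
  qed
  note pw = this
  have "pot (ref :: real ^ 'n \<Rightarrow> real) \<le> (\<integral>\<^sup>+x. ennreal 2 * ennreal (exp (- 1 * norm x)) \<partial>(lborel :: (real ^ 'n) measure))"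
    unfolding pot_def
  proof (intro nn_integral_mono)
    fix x :: "real ^ 'n"
    have "ennreal (2 * exp (- 1 * norm x)) = ennreal 2 * ennreal (exp (- 1 * norm x))" by (rule ennreal_mult) auto
    with ennreal_leI[OF pw[of x]]
    show "ennreal ((norm x)\<^sup>2 * (norm (ref x))\<^sup>2) \<le> ennreal 2 * ennreal (exp (- 1 * norm x))" by (simp only:)
  qed
  also have "\<dots> = ennreal 2 * (\<integral>\<^sup>+x. ennreal (exp (- 1 * norm x)) \<partial>(lborel :: (real ^ 'n) measure))"
    by (rule nn_integral_cmult) measurable
  also have "\<dots> < \<infinity>" using nn_integral_exp_neg_norm[of 1, where 'a = "real ^ 'n"]
    by (simp add: ennreal_mult_less_top)
  finally show ?thesis .
qed

lemma exists_finite_total_energy: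
  assumes \<alpha>: "0 < \<alpha>" "\<alpha> < real CARD('n::finite)" and m: "m > 0"
  shows "\<exists>c>0. sqnorm (\<lambda>x::real ^ 'n. c * ref x) = ennreal m \<and> total_energy \<alpha> (\<lambda>x::real ^ 'n. c * ref x) < \<infinity>"
proof -
  let ?r = "ref :: real ^ 'n \<Rightarrow> real"
  have "sqnorm ?r < \<infinity>" using nn_integral_ref_square[where 'n = 'n] by (simp add: sqnorm_def)
  moreover have "sqnorm ?r > 0"
  proof -
    have "?r x \<noteq> 0" for x using ref_pos(1)[of x] by simp
    then show ?thesis unfolding sqnorm_def by (intro nn_integral_lborel_pos) auto
  qed
  ultimately obtain R where R: "sqnorm ?r = ennreal R" "R > 0" by (cases "sqnorm ?r") auto
  define c where "c = sqrt (m / R)"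
  have c: "c > 0" "c\<^sup>2 = m / R" using m R by (auto simp: c_def)
  have "sqnorm (\<lambda>x. c * ?r x) = ennreal m"
    using sqnorm_scale[of ?r c] R m c by (simp flip: ennreal_mult)
  moreover have "total_energy \<alpha> (\<lambda>x. c * ?r x) < \<infinity>"
  proof -
    have "hartree2 \<alpha> (dens ?r) (dens ?r) < \<infinity>"
      using hartree2_ref_finite[OF \<alpha>] by (simp add: dens_def[abs_def])
    then have "ennreal (c\<^sup>2) * (kinetic ?r + pot ?r) +
      1 / 2 * (ennreal (c\<^sup>2) * ennreal (c\<^sup>2) * hartree2 \<alpha> (dens ?r) (dens ?r)) < \<infinity>"
      using kinetic_ref_finite[where 'n = 'n] pot_ref_finite[where 'n = 'n]
      by (simp add: half_less_top divide_ennreal_def ennreal_mult_less_top)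
    from le_less_trans[OF total_energy_scale_le this] show ?thesis by simp
  qed
  ultimately show ?thesis using c by blast
qed

section \<open>Existence of a minimizer\<close>

text \<open>With bounded kinetic energy, a small set of large values cannot carry much mass. For x
  in the ball, at least half of the shifts z with |z| < h lead to a point where |f| \<le> \<eta>,
  and for these |f x|^2 \<le> 2|f(x + z) - f x|^2 + 2 \<eta>^2. It remains to integrate over x and z
  and to apply the estimate for translates.\<close>

lemma ball_average_le:
  fixes f :: "real ^ 'n \<Rightarrow> real"
  assumes [measurable]: "f \<in> borel_measurable borel"
    and pos: "R > 0" "h > 0" "\<eta> > 0"
    and small: "2 * emeasure lborel {y \<in> ball 0 (R + h). \<eta> < \<bar>f y\<bar>} \<le> emeasure lborel (ball (0::real ^ 'n) h)"
  shows "(\<integral>\<^sup>+x. indicator (ball 0 R) x * ennreal ((f x)\<^sup>2) \<partial>lborel) \<le>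
    ennreal (4 * 2 ^ CARD('n) * h\<^sup>2) * kinetic f + ennreal (4 * \<eta>\<^sup>2) * emeasure lborel (ball (0::real ^ 'n) R)"
proof -
  define E where "E = {y \<in> ball 0 (R + h). \<eta> < \<bar>f y\<bar>}"
  define Q where "Q = ball (0::real ^ 'n) h"
  define B where "B = ball (0::real ^ 'n) R"
  have [measurable]: "Q \<in> sets borel" "B \<in> sets borel" by (auto simp: Q_def B_def)
  have [measurable]: "E \<in> sets borel"
  proof -
    have "E = ball 0 (R + h) \<inter> {y \<in> space borel. \<eta> < \<bar>f y\<bar>}" by (auto simp: E_def)
    then show ?thesis by simp
  qed
  obtain v where v: "emeasure lborel Q = ennreal v" "v > 0"
  proof -
    have "emeasure lborel Q < \<infinity>" unfolding Q_def by (rule emeasure_lborel_ball_finite)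
    moreover have "emeasure lborel Q > 0"
      unfolding Q_def using pos by (simp add: emeasure_ball unit_ball_vol_pos)
    ultimately show ?thesis using that by (cases "emeasure lborel Q") auto
  qed
  have half: "ennreal (v / 2) * (indicator B x * ennreal ((f x)\<^sup>2)) \<le>
    (\<integral>\<^sup>+z. indicator Q z * (indicator B x * (ennreal (2 * (norm (f (x + z) - f x))\<^sup>2) + ennreal (2 * \<eta>\<^sup>2))) \<partial>lborel)" for x
  proof (cases "x \<in> B")
    case True
    have sE: "emeasure lborel {z. z + x \<in> E} = emeasure lborel E"
    proof -
      have "emeasure lborel {z. z + x \<in> E} = (\<integral>\<^sup>+z. indicator E (z + x) \<partial>lborel)"
      proof -
        have [measurable]: "{z. z + x \<in> E} \<in> sets borel"
          using measurable_sets[of "\<lambda>z. z + x" borel borel E] by (simp add: vimage_def)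
        have "(\<integral>\<^sup>+z. indicator E (z + x) \<partial>lborel) = (\<integral>\<^sup>+z. indicator {z. z + x \<in> E} z \<partial>lborel)"
          by (intro nn_integral_cong) (auto simp: indicator_def)
        then show ?thesis by simp
      qed
      also have "\<dots> = emeasure lborel E" by (subst nn_integral_translate) auto
      finally show ?thesis .
    qed
    have [measurable]: "{z. z + x \<in> E} \<in> sets borel"
      using measurable_sets[of "\<lambda>z. z + x" borel borel E] by (simp add: vimage_def)
    define G where "G = Q - {z. z + x \<in> E}"
    have [measurable]: "G \<in> sets borel" by (simp add: G_def)
    have "emeasure lborel Q \<le> emeasure lborel (G \<union> {z. z + x \<in> E})"
      by (intro emeasure_mono) (auto simp: G_def)
    also have "\<dots> \<le> emeasure lborel G + emeasure lborel E"
      unfolding sE[symmetric] by (intro emeasure_subadditive) auto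
    finally have Qle: "ennreal v \<le> emeasure lborel G + emeasure lborel E" by (simp add: v)
    have "2 * emeasure lborel E \<le> ennreal v" using small by (simp add: E_def Q_def[symmetric] v)
    then have "emeasure lborel E \<le> ennreal (v / 2)"
      using v(2) by (cases "emeasure lborel E")
        (auto simp: ennreal_le_iff top_unique ennreal_mult_top simp flip: ennreal_numeral ennreal_mult)
    then have "ennreal v \<le> emeasure lborel G + ennreal (v / 2)"
      using Qle by (meson add_left_mono order_trans)
    \<comment> \<open>The good shifts, those leading outside E, fill at least half of Q.\<close>
    then have Gv: "ennreal (v / 2) \<le> emeasure lborel G"
      using v(2) by (cases "emeasure lborel G") (auto simp: ennreal_le_iff simp flip: ennreal_plus)
    have "ennreal (v / 2) * ennreal ((f x)\<^sup>2) \<le> emeasure lborel G * ennreal ((f x)\<^sup>2)"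
      by (intro mult_right_mono Gv) auto
    also have "\<dots> = (\<integral>\<^sup>+z. indicator G z * ennreal ((f x)\<^sup>2) \<partial>lborel)"
      by (simp add: nn_integral_multc)
    also have "\<dots> \<le> (\<integral>\<^sup>+z. indicator Q z * (ennreal (2 * (norm (f (x + z) - f x))\<^sup>2) + ennreal (2 * \<eta>\<^sup>2)) \<partial>lborel)"
    proof (intro nn_integral_mono)
      fix z
      show "indicator G z * ennreal ((f x)\<^sup>2) \<le> indicator Q z * (ennreal (2 * (norm (f (x + z) - f x))\<^sup>2) + ennreal (2 * \<eta>\<^sup>2))"
      proof (cases "z \<in> G")
        case zG: True
        then have z: "z \<in> Q" "z + x \<notin> E" by (auto simp: G_def)
        have "norm (z + x) < R + h"
          using z(1) True norm_triangle_ineq[of z x] by (simp add: Q_def B_def)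
        then have "\<bar>f (x + z)\<bar> \<le> \<eta>" using z(2) by (auto simp: E_def add.commute)
        then have "(f (x + z))\<^sup>2 \<le> \<eta>\<^sup>2" using pos by (simp add: abs_le_square_iff[symmetric])
        moreover have "(f x)\<^sup>2 \<le> 2 * (norm (f (x + z) - f x))\<^sup>2 + 2 * (f (x + z))\<^sup>2"
          using norm_add_square_le[of "f (x + z) - f x" "- f (x + z)"] by simp
        ultimately have "(f x)\<^sup>2 \<le> 2 * (norm (f (x + z) - f x))\<^sup>2 + 2 * \<eta>\<^sup>2" by linarith
        then have "ennreal ((f x)\<^sup>2) \<le> ennreal (2 * (norm (f (x + z) - f x))\<^sup>2 + 2 * \<eta>\<^sup>2)" by (rule ennreal_leI)
        then show ?thesis using z zG by (simp add: ennreal_plus)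
      qed simp
    qed
    finally show ?thesis using True by simp
  qed simp
  have "ennreal (v / 2) * (\<integral>\<^sup>+x. indicator B x * ennreal ((f x)\<^sup>2) \<partial>lborel) =
      (\<integral>\<^sup>+x. ennreal (v / 2) * (indicator B x * ennreal ((f x)\<^sup>2)) \<partial>lborel)"
    by (rule nn_integral_cmult[symmetric]) measurable
  also have "\<dots> \<le> (\<integral>\<^sup>+x. (\<integral>\<^sup>+z. indicator Q z * (indicator B x * (ennreal (2 * (norm (f (x + z) - f x))\<^sup>2) + ennreal (2 * \<eta>\<^sup>2))) \<partial>lborel) \<partial>lborel)"
    by (intro nn_integral_mono half)
  also have "\<dots> = (\<integral>\<^sup>+z. (\<integral>\<^sup>+x. indicator Q z * (indicator B x * (ennreal (2 * (norm (f (x + z) - f x))\<^sup>2) + ennreal (2 * \<eta>\<^sup>2))) \<partial>lborel) \<partial>lborel)"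
    by (rule lborel_pair.Fubini') measurable
  also have "\<dots> \<le> (\<integral>\<^sup>+z. indicator Q z * (ennreal (2 * 2 ^ CARD('n) * h\<^sup>2) * kinetic f + ennreal (2 * \<eta>\<^sup>2) * emeasure lborel B) \<partial>(lborel :: (real ^ 'n) measure))"
  proof (intro nn_integral_mono)
    fix z :: "real ^ 'n"
    show "(\<integral>\<^sup>+x. indicator Q z * (indicator B x * (ennreal (2 * (norm (f (x + z) - f x))\<^sup>2) + ennreal (2 * \<eta>\<^sup>2))) \<partial>lborel) \<le>
       indicator Q z * (ennreal (2 * 2 ^ CARD('n) * h\<^sup>2) * kinetic f + ennreal (2 * \<eta>\<^sup>2) * emeasure lborel B)"
    proof (cases "z \<in> Q")
      case True
      have "(\<integral>\<^sup>+x. indicator B x * (ennreal (2 * (norm (f (x + z) - f x))\<^sup>2) + ennreal (2 * \<eta>\<^sup>2)) \<partial>lborel) \<le>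
        (\<integral>\<^sup>+x. ennreal 2 * ennreal ((norm (f (x + z) - f x))\<^sup>2) + ennreal (2 * \<eta>\<^sup>2) * indicator B x \<partial>lborel)"
        by (intro nn_integral_mono) (auto simp: indicator_def ennreal_mult)
      also have "\<dots> = ennreal 2 * sqnorm (\<lambda>x. f (x + z) - f x) + ennreal (2 * \<eta>\<^sup>2) * emeasure lborel B"
        unfolding sqnorm_def by (subst nn_integral_add) (auto simp: nn_integral_cmult nn_integral_cmult_indicator)
      also have "sqnorm (\<lambda>x. f (x + z) - f x) \<le> ennreal (2 ^ CARD('n) * h\<^sup>2) * kinetic f"
      proof (rule order_trans[OF sqnorm_translate_diff_le])
        have "norm z \<le> h" using True by (simp add: Q_def)
        then have "(norm z)\<^sup>2 \<le> h\<^sup>2" by (intro power_mono) auto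
        then show "ennreal (2 ^ CARD('n) * (norm z)\<^sup>2) * kinetic f \<le> ennreal (2 ^ CARD('n) * h\<^sup>2) * kinetic f"
          by (intro mult_right_mono ennreal_leI mult_left_mono) auto
      qed measurable
      also have "ennreal 2 * (ennreal (2 ^ CARD('n) * h\<^sup>2) * kinetic f) = ennreal (2 * 2 ^ CARD('n) * h\<^sup>2) * kinetic f"
        by (simp add: ennreal_mult mult.assoc)
      finally show ?thesis using True by (simp add: mult_left_mono add_mono)
    qed simp
  qed
  also have "\<dots> = ennreal v * (ennreal (2 * 2 ^ CARD('n) * h\<^sup>2) * kinetic f + ennreal (2 * \<eta>\<^sup>2) * emeasure lborel B)"
    by (simp add: nn_integral_multc v)
  also have "\<dots> = ennreal (v / 2) * (ennreal (4 * 2 ^ CARD('n) * h\<^sup>2) * kinetic f + ennreal (4 * \<eta>\<^sup>2) * emeasure lborel B)"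
  proof -
    have "ennreal v * ennreal (2 * c) = ennreal (v / 2) * ennreal (4 * c)" if "c \<ge> 0" for c
      using that v(2) by (simp flip: ennreal_mult)
    from this[of "2 ^ CARD('n) * h\<^sup>2"] this[of "\<eta>\<^sup>2"] show ?thesis
      by (simp add: distrib_left mult.assoc[symmetric])
  qed
  finally show ?thesis using v(2)
    by (subst (asm) ennreal_mult_le_mult_iff) (auto simp: B_def)
qed

text \<open>Outside the ball |x|^2 / R^2 is at least 1: the trap provides tightness.\<close>

lemma tail_le_pot:
  fixes f :: "real ^ 'n \<Rightarrow> real"
  assumes [measurable]: "f \<in> borel_measurable borel" and R: "R > 0"
  shows "sqnorm f \<le> (\<integral>\<^sup>+x. indicator (ball 0 R) x * ennreal ((f x)\<^sup>2) \<partial>lborel) + ennreal (1 / R\<^sup>2) * pot f"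
proof -
  have [measurable]: "ball 0 R \<in> sets (borel :: (real ^ 'n) measure)" by simp
  have "sqnorm f \<le> (\<integral>\<^sup>+x. indicator (ball 0 R) x * ennreal ((f x)\<^sup>2) +
      ennreal (1 / R\<^sup>2) * ennreal ((norm x)\<^sup>2 * (norm (f x))\<^sup>2) \<partial>lborel)"
    unfolding sqnorm_def
  proof (intro nn_integral_mono)
    fix x :: "real ^ 'n"
    show "ennreal ((norm (f x))\<^sup>2) \<le> indicator (ball 0 R) x * ennreal ((f x)\<^sup>2) +
      ennreal (1 / R\<^sup>2) * ennreal ((norm x)\<^sup>2 * (norm (f x))\<^sup>2)"
    proof (cases "x \<in> ball 0 R")
      case False
      then have "R\<^sup>2 \<le> (norm x)\<^sup>2" using R by (intro power_mono) auto
      then have "R\<^sup>2 * (f x)\<^sup>2 \<le> (norm x)\<^sup>2 * (f x)\<^sup>2" by (rule mult_right_mono) simp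
      then have "(norm (f x))\<^sup>2 \<le> 1 / R\<^sup>2 * ((norm x)\<^sup>2 * (norm (f x))\<^sup>2)"
        using R by (simp add: field_simps)
      from ennreal_leI[OF this] show ?thesis using False R by (subst (asm) ennreal_mult) auto
    qed simp
  qed
  also have "\<dots> = (\<integral>\<^sup>+x. indicator (ball 0 R) x * ennreal ((f x)\<^sup>2) \<partial>lborel) + ennreal (1 / R\<^sup>2) * pot f"
    unfolding pot_def
    by (subst nn_integral_add)
       (auto simp: nn_integral_cmult intro!: borel_measurable_times_ennreal borel_measurable_indicator)
  finally show ?thesis .
qed

text \<open>A compact embedding in which convergence almost everywhere replaces weak convergence.
  The trap makes the tails small, and inside a ball the measure of the set of large values tends to
  0 by dominated convergence.\<close>

lemma sqnorm_tendsto_zero: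
  fixes f :: "nat \<Rightarrow> real ^ 'n \<Rightarrow> real"
  assumes [measurable]: "\<And>k. f k \<in> borel_measurable borel"
    and lim: "AE x in lborel. (\<lambda>k. f k x) \<longlonglongrightarrow> 0"
    and kin: "\<And>k. kinetic (f k) \<le> ennreal C" and pot: "\<And>k. pot (f k) \<le> ennreal C" and C: "C > 0"
  shows "(\<lambda>k. sqnorm (f k)) \<longlonglongrightarrow> 0"
proof (rule order_tendstoI)
  fix a :: ennreal assume a: "0 < a"
  obtain \<epsilon> where e: "\<epsilon> > 0" "ennreal \<epsilon> < a"
  proof -
    obtain b where "0 < b" "b < a" using dense[OF a] by blast
    then show ?thesis using that[of "enn2real b"]
      by (cases b) (auto simp: top.not_eq_extremum)
  qed
  \<comment> \<open>R, h and \<eta> are chosen so that the tail, the oscillation and the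
    contribution of small values are \<epsilon>/3 each.\<close>
  define R where "R = sqrt (3 * C / \<epsilon>)"
  have R: "R > 0" "1 / R\<^sup>2 * C = \<epsilon> / 3" using e C by (simp_all add: R_def)
  define h where "h = sqrt (\<epsilon> / (3 * (4 * 2 ^ CARD('n)) * C))"
  have h: "h > 0" "4 * 2 ^ CARD('n) * h\<^sup>2 * C = \<epsilon> / 3" using e C by (simp_all add: h_def)
  obtain B where B: "emeasure lborel (ball (0::real ^ 'n) R) = ennreal B" "B > 0"
    using R emeasure_lborel_ball_finite[of "0::real ^ 'n" R]
    by (cases "emeasure lborel (ball (0::real ^ 'n) R)") (auto simp: emeasure_ball unit_ball_vol_pos)
  define \<eta> where "\<eta> = sqrt (\<epsilon> / (3 * 4 * B))"
  have eta: "\<eta> > 0" "4 * \<eta>\<^sup>2 * B = \<epsilon> / 3" using e B by (simp_all add: \<eta>_def)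
  define E where "E k = {y \<in> ball 0 (R + h). \<eta> < \<bar>f k y\<bar>}" for k
  have [measurable]: "E k \<in> sets borel" for k
  proof -
    have "E k = ball 0 (R + h) \<inter> {y \<in> space borel. \<eta> < \<bar>f k y\<bar>}" by (auto simp: E_def)
    then show ?thesis by simp
  qed
  have "(\<lambda>k. \<integral>\<^sup>+x. indicator (E k) x \<partial>lborel) \<longlonglongrightarrow> (\<integral>\<^sup>+x. 0 \<partial>(lborel :: (real ^ 'n) measure))"
  proof (rule nn_integral_dominated_convergence[where w = "indicator (ball 0 (R + h))"])
    show "(\<integral>\<^sup>+x. indicator (ball 0 (R + h)) x \<partial>(lborel :: (real ^ 'n) measure)) < \<infinity>"
      using emeasure_lborel_ball_finite[of "0::real ^ 'n" "R + h"] by simp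
    show "AE x in lborel. (\<lambda>k. indicator (E k) x :: ennreal) \<longlonglongrightarrow> 0"
      using lim
    proof eventually_elim
      case (elim x)
      from tendsto_rabs[OF this] have "(\<lambda>k. \<bar>f k x\<bar>) \<longlonglongrightarrow> 0" by simp
      from order_tendstoD(2)[OF this eta(1)]
      have "\<forall>\<^sub>F k in sequentially. indicator (E k) x = (0 :: ennreal)"
        by eventually_elim (auto simp: E_def indicator_def)
      then show ?case by (rule tendsto_eventually)
    qed
  qed (auto simp: E_def indicator_def intro!: borel_measurable_indicator)
  then have "(\<lambda>k. 2 * emeasure lborel (E k)) \<longlonglongrightarrow> 2 * 0"
    by (intro ennreal_tendsto_cmult) auto
  moreover have "2 * 0 < emeasure lborel (ball (0::real ^ 'n) h)"
    using h by (simp add: emeasure_ball unit_ball_vol_pos)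
  ultimately have "\<forall>\<^sub>F k in sequentially. 2 * emeasure lborel (E k) < emeasure lborel (ball (0::real ^ 'n) h)"
    by (rule order_tendstoD(2))
  then show "\<forall>\<^sub>F k in sequentially. sqnorm (f k) < a"
  proof eventually_elim
    case (elim k)
    have "sqnorm (f k) \<le> (\<integral>\<^sup>+x. indicator (ball 0 R) x * ennreal ((f k x)\<^sup>2) \<partial>lborel) + ennreal (1 / R\<^sup>2) * pot (f k)"
      by (rule tail_le_pot) (use R in auto)
    also have "\<dots> \<le> (ennreal (4 * 2 ^ CARD('n) * h\<^sup>2) * kinetic (f k) + ennreal (4 * \<eta>\<^sup>2) * emeasure lborel (ball (0::real ^ 'n) R))
        + ennreal (1 / R\<^sup>2) * pot (f k)"
      using elim by (intro add_right_mono ball_average_le R h eta) (auto simp: E_def)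
    also have "\<dots> \<le> (ennreal (4 * 2 ^ CARD('n) * h\<^sup>2) * ennreal C + ennreal (4 * \<eta>\<^sup>2) * ennreal B)
        + ennreal (1 / R\<^sup>2) * ennreal C"
      unfolding B(1) by (intro add_mono mult_left_mono kin pot) auto
    also have "\<dots> = ennreal (\<epsilon> / 3) + ennreal (\<epsilon> / 3) + ennreal (\<epsilon> / 3)"
    proof -
      have "ennreal (4 * 2 ^ CARD('n) * h\<^sup>2) * ennreal C = ennreal (\<epsilon> / 3)"
        unfolding h(2)[symmetric] using C by (intro ennreal_mult[symmetric]) auto
      moreover have "ennreal (4 * \<eta>\<^sup>2) * ennreal B = ennreal (\<epsilon> / 3)"
        unfolding eta(2)[symmetric] using B by (intro ennreal_mult[symmetric]) auto
      moreover have "ennreal (1 / R\<^sup>2) * ennreal C = ennreal (\<epsilon> / 3)"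
        unfolding R(2)[symmetric] using C by (intro ennreal_mult[symmetric]) auto
      ultimately show ?thesis by simp
    qed
    also have "\<dots> = ennreal \<epsilon>" using e by (simp flip: ennreal_plus)
    finally show ?case using e(2) by (rule le_less_trans)
  qed
qed simp

lemma pot_diff_le:
  fixes u v :: "real ^ 'n \<Rightarrow> real"
  assumes [measurable]: "u \<in> borel_measurable borel" "v \<in> borel_measurable borel"
  shows "pot (\<lambda>x. u x - v x) \<le> 2 * pot u + 2 * pot v"
proof -
  have "pot (\<lambda>x. u x - v x) \<le> (\<integral>\<^sup>+x. 2 * ennreal ((norm x)\<^sup>2 * (norm (u x))\<^sup>2) + 2 * ennreal ((norm x)\<^sup>2 * (norm (v x))\<^sup>2) \<partial>lborel)"
    unfolding pot_def
  proof (intro nn_integral_mono)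
    fix x :: "real ^ 'n"
    have "(norm (u x - v x))\<^sup>2 \<le> 2 * (norm (u x))\<^sup>2 + 2 * (norm (v x))\<^sup>2"
      using norm_add_square_le[of "u x" "- v x"] by simp
    from mult_left_mono[OF this zero_le_power2[of "norm x"]]
    have "(norm x)\<^sup>2 * (norm (u x - v x))\<^sup>2 \<le> 2 * ((norm x)\<^sup>2 * (norm (u x))\<^sup>2) + 2 * ((norm x)\<^sup>2 * (norm (v x))\<^sup>2)"
      by (simp only: distrib_left mult.left_commute[of "(norm x)\<^sup>2" 2])
    from ennreal_leI[OF this]
    show "ennreal ((norm x)\<^sup>2 * (norm (u x - v x))\<^sup>2) \<le>
       2 * ennreal ((norm x)\<^sup>2 * (norm (u x))\<^sup>2) + 2 * ennreal ((norm x)\<^sup>2 * (norm (v x))\<^sup>2)"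
      by (simp add: ennreal_mult)
  qed
  also have "\<dots> = 2 * pot u + 2 * pot v" unfolding pot_def by (simp add: nn_integral_add nn_integral_cmult)
  finally show ?thesis .
qed

lemma pot_le_liminf:
  fixes u :: "nat \<Rightarrow> real ^ 'n \<Rightarrow> real"
  assumes [measurable]: "\<And>n. u n \<in> borel_measurable borel"
    and lim: "AE x in lborel. (\<lambda>n. u n x) \<longlonglongrightarrow> U x"
  shows "pot U \<le> liminf (\<lambda>n. pot (u n))"
  unfolding pot_def
proof (rule nn_integral_AE_tendsto_le_liminf)
  show "AE x in lborel. (\<lambda>n. ennreal ((norm x)\<^sup>2 * (norm (u n x))\<^sup>2)) \<longlonglongrightarrow> ennreal ((norm x)\<^sup>2 * (norm (U x))\<^sup>2)"
    using lim by eventually_elim (intro tendsto_intros)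
qed measurable

lemma total_energy_le_liminf:
  fixes u :: "nat \<Rightarrow> real ^ 'n \<Rightarrow> real"
  assumes m[measurable]: "\<And>n. u n \<in> borel_measurable borel" "U \<in> borel_measurable borel"
    and lim: "AE x in lborel. (\<lambda>n. u n x) \<longlonglongrightarrow> U x"
  shows "total_energy \<alpha> U \<le> liminf (\<lambda>n. total_energy \<alpha> (u n))"
proof -
  have D: "hartree2 \<alpha> (dens U) (dens U) \<le> liminf (\<lambda>n. hartree2 \<alpha> (dens (u n)) (dens (u n)))"
  proof (rule hartree2_le_liminf)
    show "AE x in lborel. (\<lambda>n. dens (u n) x) \<longlonglongrightarrow> dens U x"
      using lim unfolding dens_def by eventually_elim (intro tendsto_intros)
  qed (auto simp: dens_def)
  have "1 / 2 * hartree2 \<alpha> (dens U) (dens U) \<le> 1 / 2 * liminf (\<lambda>n. hartree2 \<alpha> (dens (u n)) (dens (u n)))"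
    by (intro mult_left_mono D) auto
  also have "\<dots> \<le> liminf (\<lambda>n. 1 / 2 * hartree2 \<alpha> (dens (u n)) (dens (u n)))"
    unfolding liminf_SUP_INF SUP_mult_left_ennreal
    by (rule SUP_subset_mono[OF order_refl], intro INF_greatest mult_left_mono INF_lower) auto
  finally have "total_energy \<alpha> U \<le> liminf (\<lambda>n. kinetic (u n)) + liminf (\<lambda>n. pot (u n)) +
     liminf (\<lambda>n. 1 / 2 * hartree2 \<alpha> (dens (u n)) (dens (u n)))"
    unfolding total_energy_def by (intro add_mono kinetic_le_liminf pot_le_liminf m lim)
  also have "\<dots> \<le> liminf (\<lambda>n. kinetic (u n) + pot (u n)) + liminf (\<lambda>n. 1 / 2 * hartree2 \<alpha> (dens (u n)) (dens (u n)))"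
    by (intro add_right_mono liminf_add_le_ennreal)
  also have "\<dots> \<le> liminf (\<lambda>n. total_energy \<alpha> (u n))"
    unfolding total_energy_def by (rule liminf_add_le_ennreal)
  finally show ?thesis .
qed

text \<open>Fatou gives one inequality. For the other, the differences from the limit have bounded
  kinetic and potential energy and tend to 0 almost everywhere, hence in L^2.\<close>

lemma sqnorm_limit:
  fixes u :: "nat \<Rightarrow> real ^ 'n \<Rightarrow> real"
  assumes m[measurable]: "\<And>n. u n \<in> borel_measurable borel" "U \<in> borel_measurable borel"
    and lim: "AE x in lborel. (\<lambda>n. u n x) \<longlonglongrightarrow> U x"
    and bound: "\<And>n. total_energy \<alpha> (u n) \<le> ennreal C" "total_energy \<alpha> U \<le> ennreal C" and C: "C > 0"
    and mass: "\<And>n. sqnorm (u n) = ennreal M"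
  shows "sqnorm U = ennreal M"
proof (rule antisym)
  show "sqnorm U \<le> ennreal M"
    unfolding sqnorm_def
  proof (rule nn_integral_le_of_AE_tendsto[where u = "\<lambda>n x. ennreal ((norm (u n x))\<^sup>2)"])
    show "AE x in lborel. (\<lambda>n. ennreal ((norm (u n x))\<^sup>2)) \<longlonglongrightarrow> ennreal ((norm (U x))\<^sup>2)"
      using lim by eventually_elim (intro tendsto_intros)
    show "(\<integral>\<^sup>+x. ennreal ((norm (u n x))\<^sup>2) \<partial>lborel) \<le> ennreal M" for n
      using mass[of n] by (simp add: sqnorm_def)
  qed auto
  have kp: "kinetic v \<le> ennreal C \<and> pot v \<le> ennreal C" if "total_energy \<alpha> v \<le> ennreal C" for v :: "real ^ 'n \<Rightarrow> real"
  proof -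
    have "kinetic v \<le> total_energy \<alpha> v" "pot v \<le> total_energy \<alpha> v"
      unfolding total_energy_def by (simp_all add: add_increasing2 add.assoc add_increasing)
    then show ?thesis using that by (auto intro: order_trans)
  qed
  have four: "2 * ennreal C + 2 * ennreal C = ennreal (4 * C)"
    using C by (simp add: ennreal_mult flip: distrib_right)
  define f where "f k x = u k x - U x" for k x
  have "(\<lambda>k. sqnorm (f k)) \<longlonglongrightarrow> 0"
  proof (rule sqnorm_tendsto_zero[where C = "4 * C"])
    show "f k \<in> borel_measurable borel" for k unfolding f_def by measurable
    show "AE x in lborel. (\<lambda>k. f k x) \<longlonglongrightarrow> 0"
      using lim unfolding f_def by eventually_elim (simp add: LIM_zero)
    show "kinetic (f k) \<le> ennreal (4 * C)" for k
    proof -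
      have "kinetic (f k) \<le> ennreal 2 * kinetic (u k) + ennreal 2 * kinetic U"
      proof (rule kinetic_mono2)
        fix x y
        show "(norm (f k x - f k y))\<^sup>2 \<le> 2 * (norm (u k x - u k y))\<^sup>2 + 2 * (norm (U x - U y))\<^sup>2"
          using norm_add_square_le[of "u k x - u k y" "- (U x - U y)"]
          by (simp add: f_def algebra_simps power2_commute[of "U y"])
      qed auto
      also have "\<dots> \<le> 2 * ennreal C + 2 * ennreal C"
        using kp[OF bound(1)[of k]] kp[OF bound(2)] by (auto intro!: add_mono mult_left_mono)
      finally show ?thesis unfolding four .
    qed
    show "pot (f k) \<le> ennreal (4 * C)" for k
    proof -
      have "pot (f k) \<le> 2 * pot (u k) + 2 * pot U" unfolding f_def[abs_def] by (rule pot_diff_le) measurable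
      also have "\<dots> \<le> 2 * ennreal C + 2 * ennreal C"
        using kp[OF bound(1)[of k]] kp[OF bound(2)] by (auto intro!: add_mono mult_left_mono)
      finally show ?thesis unfolding four .
    qed
  qed (use C in auto)
  then have f0: "(\<lambda>k. sqnorm (f k)) \<longlonglongrightarrow> 0" .
  have key: "ennreal M \<le> ennreal (1 + \<epsilon>) * sqnorm U" if e: "\<epsilon> > 0" for \<epsilon> :: real
  proof -
    have "ennreal M \<le> ennreal (1 + \<epsilon>) * sqnorm U + ennreal (1 + 1 / \<epsilon>) * sqnorm (f k)" for k
    proof -
      have "sqnorm (u k) = sqnorm (\<lambda>x. U x + f k x)" by (simp add: f_def)
      also have "\<dots> \<le> ennreal (1 + \<epsilon>) * sqnorm U + ennreal (1 + 1 / \<epsilon>) * sqnorm (f k)"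
        by (rule sqnorm_add_le_eps) (use e in \<open>auto simp: f_def[abs_def]\<close>)
      finally show ?thesis by (simp add: mass)
    qed
    moreover have "(\<lambda>k. ennreal (1 + \<epsilon>) * sqnorm U + ennreal (1 + 1 / \<epsilon>) * sqnorm (f k)) \<longlonglongrightarrow>
        ennreal (1 + \<epsilon>) * sqnorm U + ennreal (1 + 1 / \<epsilon>) * 0"
      by (intro tendsto_add tendsto_const ennreal_tendsto_cmult f0) simp
    ultimately show ?thesis by (auto intro: LIMSEQ_le_const)
  qed
  show "ennreal M \<le> sqnorm U"
  proof (cases "sqnorm U")
    case (real r)
    show ?thesis
    proof (rule ccontr)
      assume "\<not> ?thesis"
      then have rM: "r < M" using real by (simp add: not_le ennreal_less_iff)
      \<comment> \<open>Half of the gap between r and M: this \<epsilon> keeps (1 + \<epsilon>) r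
        below M, against \<open>key\<close>.\<close>
      define \<epsilon> where "\<epsilon> = (M - r) / (2 * (r + 1))"
      have e: "\<epsilon> > 0" using rM real by (simp add: \<epsilon>_def)
      have "ennreal M \<le> ennreal ((1 + \<epsilon>) * r)"
        using key[OF e] real e by (subst ennreal_mult) auto
      then have "M \<le> (1 + \<epsilon>) * r" using real e by (subst (asm) ennreal_le_iff) auto
      moreover have "\<epsilon> * (r + 1) = (M - r) / 2"
      proof -
        have "r + 1 \<noteq> 0" using real by auto
        moreover have "a / (2 * b) * b = a / 2" if "b \<noteq> 0" for a b :: real using that by simp
        ultimately show ?thesis unfolding \<epsilon>_def by blast
      qed
      ultimately show False using rM e real by (simp add: algebra_simps)
    qed
  qed simp
qed

lemma ennreal_convex_same:
  "0 \<le> t \<Longrightarrow> t \<le> 1 \<Longrightarrow> ennreal (1 - t) * x + ennreal t * x = x"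
  by (simp flip: distrib_right ennreal_plus)

section \<open>Selection of a convergent minimizing sequence\<close>

definition admissible :: "real \<Rightarrow> (real ^ 'n \<Rightarrow> real) set" where
  "admissible m = {w. w \<in> borel_measurable borel \<and> (\<forall>x. 0 \<le> w x) \<and> sqnorm w = ennreal m}"

text \<open>Strict concavity of the square root, quantified. If g is the gap between quadratic and
  arithmetic mean, then (a - b)^2 \<le> 8 g v, and 8 g v \<le> (2 \<eta> v + g/\<eta>)^2. The
  resulting bound is linear in v and g, so it can be integrated when only the integrals of v and g
  are controlled.\<close>

lemma blend_gap:
  fixes a b \<eta> :: real
  assumes ab: "a \<ge> 0" "b \<ge> 0" and \<eta>: "\<eta> > 0"
  defines "v \<equiv> sqrt ((a\<^sup>2 + b\<^sup>2) / 2)"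
  shows "(a + b) / 2 \<le> v" "\<bar>a - b\<bar> \<le> 2 * \<eta> * v + (1 / \<eta>) * (v - (a + b) / 2)"
proof -
  have v0: "v \<ge> 0" by (simp add: v_def)
  have v2: "v\<^sup>2 = (a\<^sup>2 + b\<^sup>2) / 2" by (simp add: v_def)
  have "((a + b) / 2)\<^sup>2 \<le> v\<^sup>2"
    unfolding v2 using zero_le_power2[of "a - b"] by (simp add: power2_eq_square field_simps)
  then show le: "(a + b) / 2 \<le> v" using v0 by (rule power2_le_imp_le)
  define g where "g = v - (a + b) / 2"
  have g: "g \<ge> 0" using le by (simp add: g_def)
  have "(a - b)\<^sup>2 / 4 = v\<^sup>2 - ((a + b) / 2)\<^sup>2"
    unfolding v2 by (simp add: power2_eq_square field_simps)
  also have "\<dots> = g * (v + (a + b) / 2)" by (simp add: g_def power2_eq_square algebra_simps)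
  also have "\<dots> \<le> g * (2 * v)" using le g by (intro mult_left_mono) auto
  finally have "\<bar>a - b\<bar>\<^sup>2 \<le> 8 * (g * v)" by simp
  also have "\<dots> \<le> (2 * \<eta> * v + (1 / \<eta>) * g)\<^sup>2"
  proof -
    have "0 \<le> (2 * \<eta> * v - (1 / \<eta>) * g)\<^sup>2" by simp
    moreover have "(2 * \<eta> * v + (1 / \<eta>) * g)\<^sup>2 = (2 * \<eta> * v - (1 / \<eta>) * g)\<^sup>2 + 8 * (g * v)"
      using \<eta> by (simp add: power2_eq_square field_simps)
    ultimately show ?thesis by simp
  qed
  finally have "\<bar>a - b\<bar> \<le> 2 * \<eta> * v + (1 / \<eta>) * g"
    by (rule power2_le_imp_le) (use v0 g \<eta> in auto)
  then show "\<bar>a - b\<bar> \<le> 2 * \<eta> * v + (1 / \<eta>) * (v - (a + b) / 2)" by (simp add: g_def)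
qed

lemma integrable_ref_mult:
  fixes w :: "real ^ 'n \<Rightarrow> real"
  assumes [measurable]: "w \<in> borel_measurable borel" and fin: "sqnorm w < \<infinity>"
  shows "integrable lborel (\<lambda>x. ref x * w x)"
proof (rule Bochner_Integration.integrable_bound)
  show "integrable lborel (\<lambda>x. (ref x)\<^sup>2 + (w x)\<^sup>2)"
    using fin nn_integral_ref_square[where 'n = 'n]
    by (intro Bochner_Integration.integrable_add) (auto simp: integrable_iff_bounded sqnorm_def)
  show "AE x in lborel. norm (ref x * w x) \<le> norm ((ref x)\<^sup>2 + (w x)\<^sup>2)"
  proof (intro AE_I2)
    fix x :: "real ^ 'n"
    have "2 * (\<bar>ref x\<bar> * \<bar>w x\<bar>) \<le> (ref x)\<^sup>2 + (w x)\<^sup>2"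
      using sum_squares_bound[of "\<bar>ref x\<bar>" "\<bar>w x\<bar>"] by simp
    moreover have "0 \<le> \<bar>ref x\<bar> * \<bar>w x\<bar>" by simp
    ultimately show "norm (ref x * w x) \<le> norm ((ref x)\<^sup>2 + (w x)\<^sup>2)"
      unfolding real_norm_def abs_mult by linarith
  qed
qed measurable

lemma integral_ref_mult_le:
  fixes w :: "real ^ 'n \<Rightarrow> real"
  assumes m[measurable]: "w \<in> borel_measurable borel" and M: "sqnorm w = ennreal M" "M \<ge> 0"
  shows "(LINT x|lborel. ref x * w x) \<le> (LINT x|lborel. (ref (x :: real ^ 'n))\<^sup>2) + M"
proof -
  have i: "integrable lborel (\<lambda>x. (w x)\<^sup>2)" "integrable lborel (\<lambda>x::real ^ 'n. (ref x)\<^sup>2)"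
    using M nn_integral_ref_square[where 'n = 'n] by (auto simp: integrable_iff_bounded sqnorm_def)
  have "ennreal (LINT x|lborel. (w x)\<^sup>2) = ennreal M"
    using nn_integral_eq_integral[OF i(1)] M by (simp add: sqnorm_def)
  then have "(LINT x|lborel. (w x)\<^sup>2) = M" using M by simp
  have "(LINT x|lborel. ref x * w x) \<le> (LINT x|lborel. (ref x)\<^sup>2 + (w x)\<^sup>2)"
  proof (intro integral_mono integrable_ref_mult m)
    fix x :: "real ^ 'n"
    have "2 * (ref x * w x) \<le> (ref x)\<^sup>2 + (w x)\<^sup>2" using sum_squares_bound[of "ref x" "w x"] by simp
    moreover have "0 \<le> (ref x)\<^sup>2 + (w x)\<^sup>2" by simp
    ultimately show "ref x * w x \<le> (ref x)\<^sup>2 + (w x)\<^sup>2" by linarith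
  qed (use i M in auto)
  also have "\<dots> = (LINT x|lborel. (ref (x :: real ^ 'n))\<^sup>2) + M"
    using i \<open>(LINT x|lborel. (w x)\<^sup>2) = M\<close> by simp
  finally show ?thesis .
qed

text \<open>Among almost minimizers, which form a convex set in terms of \<open>w\<^sup>2\<close>, choose almost maximizers
  of the strictly concave functional \<open>\<integral> ref * w\<close>; these automatically form a Cauchy sequence.\<close>

lemma exists_minimizer:
  assumes \<alpha>: "0 < \<alpha>" "\<alpha> < real CARD('n::finite)" and m: "m > 0"
  shows "\<exists>w \<in> (admissible m :: (real ^ 'n \<Rightarrow> real) set). total_energy \<alpha> w < \<infinity> \<and>
    (\<forall>v \<in> (admissible m :: (real ^ 'n \<Rightarrow> real) set). total_energy \<alpha> w \<le> total_energy \<alpha> v)"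
proof -
  let ?A = "admissible m :: (real ^ 'n \<Rightarrow> real) set"
  have Am: "w \<in> borel_measurable borel" "\<And>x. 0 \<le> w x" "sqnorm w = ennreal m" if "w \<in> ?A" for w
    using that by (auto simp: admissible_def)
  define d where "d = (INF w\<in>?A. total_energy \<alpha> w)"
  obtain c where c: "c > 0" "sqnorm (\<lambda>x::real ^ 'n. c * ref x) = ennreal m" "total_energy \<alpha> (\<lambda>x::real ^ 'n. c * ref x) < \<infinity>"
    using exists_finite_total_energy[OF \<alpha> m] by blast
  have cA: "(\<lambda>x. c * ref x) \<in> ?A"
    using c by (auto simp: admissible_def intro!: mult_nonneg_nonneg less_imp_le[OF ref_pos(1)])
  have "d < \<infinity>" unfolding d_def using INF_lower[OF cA, of "total_energy \<alpha>"] c(3) by (rule le_less_trans)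
  then obtain d0 where d0: "d = ennreal d0" "d0 \<ge> 0" by (cases d) auto
  define S where "S \<delta> = {w\<in>?A. total_energy \<alpha> w \<le> ennreal (d0 + \<delta>)}" for \<delta> :: real
  define J where "J w = (LINT x|lborel. ref x * w x)" for w :: "real ^ 'n \<Rightarrow> real"
  define js where "js \<delta> = Sup (J ` S \<delta>)" for \<delta>
  define JB where "JB = (LINT x|lborel. (ref (x :: real ^ 'n))\<^sup>2) + m"
  have JB: "J w \<le> JB" if "w \<in> ?A" for w
    unfolding J_def JB_def using Am[OF that] m by (intro integral_ref_mult_le) auto
  have J0: "0 \<le> J w" if "w \<in> ?A" for w
    unfolding J_def using Am[OF that] ref_pos
    by (intro integral_nonneg_AE AE_I2 mult_nonneg_nonneg) (auto intro: less_imp_le)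
  have SA: "S \<delta> \<subseteq> ?A" for \<delta> by (auto simp: S_def)
  have Smono: "S \<delta> \<subseteq> S \<delta>'" if "\<delta> \<le> \<delta>'" for \<delta> \<delta>'
    using that by (auto simp: S_def intro!: order_trans[OF _ ennreal_leI[of "d0 + \<delta>"]])
  have bdd: "bdd_above (J ` S \<delta>)" for \<delta>
    using JB SA by (intro bdd_aboveI[of _ JB]) blast
  have Sne: "S \<delta> \<noteq> {}" if "\<delta> > 0" for \<delta>
  proof -
    have "d < ennreal (d0 + \<delta>)" using that d0 by (simp add: ennreal_less_iff)
    then obtain w where "w \<in> ?A" "total_energy \<alpha> w < ennreal (d0 + \<delta>)" unfolding d_def INF_less_iff by blast
    then show ?thesis by (auto simp: S_def)
  qed
  have Jjs: "J w \<le> js \<delta>" if "w \<in> S \<delta>" for w \<delta>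
    unfolding js_def using that bdd by (intro cSup_upper) auto
  have js0: "0 \<le> js \<delta>" if "\<delta> > 0" for \<delta>
    using Sne[OF that] Jjs J0 SA by (meson all_not_in_conv order_trans subsetD)
  have jsmono: "js \<delta> \<le> js \<delta>'" if "\<delta> > 0" "\<delta> \<le> \<delta>'" for \<delta> \<delta>'
    unfolding js_def using Sne[OF that(1)] Smono[OF that(2)] bdd by (intro cSup_subset_mono) auto
  \<comment> \<open>\<open>js\<close> is monotone in \<delta>, so this is its limit as \<delta>
    tends to 0. Both \<open>js\<close> at the k-th tolerance and J at the k-th function can
    therefore be kept within 4^(-k) of j.\<close>
  define j where "j = Inf (js ` {0<..})"
  have bddj: "bdd_below (js ` {0<..})" using js0 by (intro bdd_belowI[of _ 0]) auto
  have jle: "j \<le> js \<delta>" if "\<delta> > 0" for \<delta>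
    unfolding j_def using that bddj by (intro cInf_lower) auto
  have "\<exists>\<delta> w. 0 < \<delta> \<and> \<delta> \<le> 1 / real (Suc k) \<and> js \<delta> \<le> j + 1 / 4 ^ k \<and> w \<in> S \<delta> \<and> j - 1 / 4 ^ k \<le> J w" for k :: nat
  proof -
    have "Inf (js ` {0<..}) < j + 1 / 4 ^ k" by (simp add: j_def)
    then obtain \<delta>' where \<delta>': "\<delta>' > 0" "js \<delta>' < j + 1 / 4 ^ k"
      using bddj by (subst (asm) cInf_less_iff) auto
    define \<delta> where "\<delta> = min \<delta>' (1 / real (Suc k))"
    have \<delta>: "\<delta> > 0" "\<delta> \<le> 1 / real (Suc k)" "\<delta> \<le> \<delta>'" using \<delta>' by (auto simp: \<delta>_def)
    have "js \<delta> - 1 / 4 ^ k < Sup (J ` S \<delta>)" by (simp add: js_def)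
    then obtain w where "w \<in> S \<delta>" "js \<delta> - 1 / 4 ^ k < J w"
      using Sne[OF \<delta>(1)] bdd by (subst (asm) less_cSup_iff) auto
    then show ?thesis using \<delta> \<delta>' jsmono[OF \<delta>(1,3)] jle[OF \<delta>(1)]
      by (intro exI[of _ \<delta>] exI[of _ w]) auto
  qed
  then obtain \<delta> w where dw: "\<And>k::nat. 0 < \<delta> k" "\<And>k. \<delta> k \<le> 1 / real (Suc k)" "\<And>k. js (\<delta> k) \<le> j + 1 / 4 ^ k"
    "\<And>k. w k \<in> S (\<delta> k)" "\<And>k. j - 1 / 4 ^ k \<le> J (w k)" by metis
  have wA: "w k \<in> ?A" for k using dw(4)[of k] SA by blast
  note wAm = Am[OF wA]
  have [measurable]: "w k \<in> borel_measurable borel" for k by (rule wAm(1))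
  have step: "(\<integral>\<^sup>+x. ennreal (ref x * norm (w (Suc k) x - w k x)) \<partial>lborel) \<le> ennreal ((2 * JB + 2) * (1 / 2) ^ k)" for k
  proof -
    \<comment> \<open>The interpolated function is still an almost minimizer, so J v exceeds the
      mean of J at the two endpoints by at most 2 / 4^k. With \<eta> = 2^(-k) in
      \<open>blend_gap\<close> the weighted increments are summable.\<close>
    define v where "v = blend (1 / 2) (w k) (w (Suc k))"
    define \<eta> :: real where "\<eta> = (1 / 2) ^ k"
    have \<eta>: "\<eta> > 0" "1 / \<eta> * (2 / 4 ^ k) = 2 * \<eta>"
    proof -
      have "(4::real) ^ k = 2 ^ k * 2 ^ k" by (simp flip: power_mult_distrib)
      then show "1 / \<eta> * (2 / 4 ^ k) = 2 * \<eta>" by (simp add: \<eta>_def power_divide)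
    qed (simp add: \<eta>_def)
    have [measurable]: "v \<in> borel_measurable borel" unfolding v_def by measurable
    have vx: "v x = sqrt (((w k x)\<^sup>2 + (w (Suc k) x)\<^sup>2) / 2)" for x
      by (simp add: v_def blend_def add_divide_distrib)
    \<comment> \<open>The tolerances \<delta> k are not chosen monotone in k, hence the
      maximum.\<close>
    define D where "D = max (\<delta> k) (\<delta> (Suc k))"
    have vA: "v \<in> ?A"
    proof -
      have "sqnorm v = ennreal (1 - 1 / 2) * ennreal m + ennreal (1 / 2) * ennreal m"
        unfolding v_def using sqnorm_blend[of "w k" "w (Suc k)" "1 / 2"] wAm(3) by simp
      also have "\<dots> = ennreal m" by (rule ennreal_convex_same) auto
      finally show ?thesis by (auto simp: admissible_def v_def blend_nonneg)
    qed
    have vS: "v \<in> S D"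
    proof -
      have le: "total_energy \<alpha> (w k) \<le> ennreal (d0 + D)" "total_energy \<alpha> (w (Suc k)) \<le> ennreal (d0 + D)"
      proof -
        have "w k \<in> S D" "w (Suc k) \<in> S D"
          using dw(4)[of k] dw(4)[of "Suc k"] Smono[of "\<delta> k" D] Smono[of "\<delta> (Suc k)" D]
          by (auto simp: D_def)
        then show "total_energy \<alpha> (w k) \<le> ennreal (d0 + D)" "total_energy \<alpha> (w (Suc k)) \<le> ennreal (d0 + D)"
          by (simp_all add: S_def)
      qed
      have "total_energy \<alpha> v \<le> ennreal (1 - 1 / 2) * total_energy \<alpha> (w k) + ennreal (1 / 2) * total_energy \<alpha> (w (Suc k))"
        unfolding v_def by (intro total_energy_blend \<alpha>) auto
      also have "\<dots> \<le> ennreal (1 - 1 / 2) * ennreal (d0 + D) + ennreal (1 / 2) * ennreal (d0 + D)"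
        by (intro add_mono mult_left_mono le) auto
      also have "\<dots> = ennreal (d0 + D)"
        by (rule ennreal_convex_same) auto
      finally show ?thesis using vA by (simp add: S_def)
    qed
    have "J v \<le> j + 1 / 4 ^ k"
    proof -
      have "J v \<le> js D" by (rule Jjs[OF vS])
      also have "\<dots> \<le> j + 1 / 4 ^ k"
      proof (cases "D = \<delta> k")
        case True then show ?thesis using dw(3)[of k] by simp
      next
        case False
        then have D: "D = \<delta> (Suc k)" unfolding D_def max_def by presburger
        have "(1::real) / 4 ^ Suc k \<le> 1 / 4 ^ k" by (simp add: field_simps)
        then show ?thesis unfolding D using dw(3)[of "Suc k"] by linarith
      qed
      finally show ?thesis .
    qed
    moreover have "j - 1 / 4 ^ k \<le> J (w (Suc k))"
    proof -
      have "(1::real) / 4 ^ Suc k \<le> 1 / 4 ^ k" by (simp add: field_simps)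
      then show ?thesis using dw(5)[of "Suc k"] by linarith
    qed
    moreover have "X - (Y + Z) / 2 \<le> 2 * q" if "X \<le> j + q" "j - q \<le> Y" "j - q \<le> Z" for X Y Z q
      using that by (simp add: field_simps)
    ultimately have "J v - (J (w k) + J (w (Suc k))) / 2 \<le> 2 * (1 / 4 ^ k)"
      using dw(5)[of k] by blast
    then have gap: "J v - (J (w k) + J (w (Suc k))) / 2 \<le> 2 / 4 ^ k" by simp
    have i: "integrable lborel (\<lambda>x. ref x * w k x)" for k
      by (rule integrable_ref_mult) (auto simp: wAm(3))
    have iv: "integrable lborel (\<lambda>x. ref x * v x)"
      by (rule integrable_ref_mult) (auto simp: Am(3)[OF vA])
    have pw: "ref x * norm (w (Suc k) x - w k x) \<le>
      2 * \<eta> * (ref x * v x) + (1 / \<eta>) * (ref x * v x - (ref x * w k x + ref x * w (Suc k) x) / 2)" for x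
    proof -
      have "\<bar>w k x - w (Suc k) x\<bar> \<le> 2 * \<eta> * v x + (1 / \<eta>) * (v x - (w k x + w (Suc k) x) / 2)"
        unfolding vx by (rule blend_gap(2)[OF wAm(2) wAm(2) \<eta>(1)])
      from mult_left_mono[OF this less_imp_le[OF ref_pos(1)[of x]]]
      show ?thesis by (simp add: abs_minus_commute algebra_simps)
    qed
    have I: "integrable lborel (\<lambda>x. 2 * \<eta> * (ref x * v x) + (1 / \<eta>) * (ref x * v x - (ref x * w k x + ref x * w (Suc k) x) / 2))"
      by (intro Bochner_Integration.integrable_add Bochner_Integration.integrable_diff integrable_mult_right
          integrable_divide i iv)
    have nn: "0 \<le> 2 * \<eta> * (ref x * v x) + (1 / \<eta>) * (ref x * v x - (ref x * w k x + ref x * w (Suc k) x) / 2)" for x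
      by (rule order_trans[OF _ pw]) (use ref_pos(1)[of x] in auto)
    have "(\<integral>\<^sup>+x. ennreal (ref x * norm (w (Suc k) x - w k x)) \<partial>lborel) \<le>
      (\<integral>\<^sup>+x. ennreal (2 * \<eta> * (ref x * v x) + (1 / \<eta>) * (ref x * v x - (ref x * w k x + ref x * w (Suc k) x) / 2)) \<partial>lborel)"
      by (intro nn_integral_mono ennreal_leI pw)
    also have "\<dots> = ennreal (LINT x|lborel. 2 * \<eta> * (ref x * v x) + (1 / \<eta>) * (ref x * v x - (ref x * w k x + ref x * w (Suc k) x) / 2))"
      by (intro nn_integral_eq_integral I AE_I2 nn)
    also have "(LINT x|lborel. 2 * \<eta> * (ref x * v x) + (1 / \<eta>) * (ref x * v x - (ref x * w k x + ref x * w (Suc k) x) / 2)) =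
      2 * \<eta> * J v + (1 / \<eta>) * (J v - (J (w k) + J (w (Suc k))) / 2)"
      unfolding J_def using i[of k] i[of "Suc k"] iv by simp
    also have "\<dots> \<le> 2 * \<eta> * JB + (1 / \<eta>) * (2 / 4 ^ k)"
      using \<eta> by (intro add_mono mult_left_mono gap JB vA) auto
    also have "\<dots> = (2 * JB + 2) * (1 / 2) ^ k" using \<eta> by (simp add: \<eta>_def algebra_simps)
    finally show ?thesis by (simp add: ennreal_leI)
  qed
  have JB0: "JB \<ge> 0" using JB[OF cA] J0[OF cA] by linarith
  have "AE x in lborel. convergent (\<lambda>k. w k x)"
  proof (rule AE_convergent_if_summable_differences[where \<gamma> = ref])
    have "(\<Sum>k. \<integral>\<^sup>+x. ennreal (ref x * norm (w (Suc k) x - w k x)) \<partial>lborel) \<le> (\<Sum>k. ennreal ((2 * JB + 2) * (1 / 2) ^ k))"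
      by (intro suminf_le step) auto
    also have "\<dots> = ennreal (\<Sum>k. (2 * JB + 2) * (1 / 2) ^ k)"
      using JB0 by (intro suminf_ennreal2) (auto intro!: summable_mult summable_geometric)
    also have "\<dots> < \<infinity>" by simp
    finally show "(\<Sum>k. \<integral>\<^sup>+x. ennreal (ref x * norm (w (Suc k) x - w k x)) \<partial>lborel) < \<infinity>" .
  qed (auto simp: ref_pos)
  then have lim0: "AE x in lborel. (\<lambda>k. w k x) \<longlonglongrightarrow> lim (\<lambda>k. w k x)"
    by eventually_elim (simp add: convergent_LIMSEQ_iff)
  \<comment> \<open>The absolute value makes W nonnegative also on the null set where the sequence
    does not converge.\<close>
  define W where "W x = \<bar>lim (\<lambda>k. w k x)\<bar>" for x
  have [measurable]: "W \<in> borel_measurable borel" unfolding W_def by measurable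
  have lim: "AE x in lborel. (\<lambda>k. w k x) \<longlonglongrightarrow> W x"
    using lim0
  proof eventually_elim
    case (elim x)
    then have "0 \<le> lim (\<lambda>k. w k x)" by (rule LIMSEQ_le_const) (use wAm(2) in auto)
    then show ?case using elim by (simp add: W_def)
  qed
  have WE: "total_energy \<alpha> W \<le> ennreal d0"
  proof -
    have "total_energy \<alpha> W \<le> liminf (\<lambda>k. total_energy \<alpha> (w k))" by (rule total_energy_le_liminf) (use lim in auto)
    also have "\<dots> \<le> liminf (\<lambda>k. ennreal (d0 + 1 / real (Suc k)))"
    proof (intro Liminf_mono always_eventually allI)
      fix k
      have "total_energy \<alpha> (w k) \<le> ennreal (d0 + \<delta> k)" using dw(4)[of k] by (simp add: S_def)
      also have "\<dots> \<le> ennreal (d0 + 1 / real (Suc k))" using dw(2)[of k] by (intro ennreal_leI) simp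
      finally show "total_energy \<alpha> (w k) \<le> ennreal (d0 + 1 / real (Suc k))" .
    qed
    also have "\<dots> = ennreal d0"
    proof (rule lim_imp_Liminf)
      have "(\<lambda>k. ennreal (d0 + 1 / real (Suc k))) \<longlonglongrightarrow> ennreal (d0 + 0)"
        by (intro tendsto_intros LIMSEQ_Suc[OF lim_1_over_n])
      then show "(\<lambda>k. ennreal (d0 + 1 / real (Suc k))) \<longlonglongrightarrow> ennreal d0" by simp
    qed simp
    finally show ?thesis .
  qed
  have "sqnorm W = ennreal m"
  proof (rule sqnorm_limit[where u = w and C = "d0 + 1" and \<alpha> = \<alpha>])
    show "total_energy \<alpha> (w k) \<le> ennreal (d0 + 1)" for k
    proof -
      have "total_energy \<alpha> (w k) \<le> ennreal (d0 + \<delta> k)" using dw(4)[of k] by (simp add: S_def)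
      also have "1 / real (Suc k) \<le> 1" by simp
      then have "ennreal (d0 + \<delta> k) \<le> ennreal (d0 + 1)" using dw(2)[of k] by (intro ennreal_leI) linarith
      finally show ?thesis .
    qed
    show "total_energy \<alpha> W \<le> ennreal (d0 + 1)" using WE by (rule order_trans) (simp add: ennreal_leI)
  qed (use lim wAm(3) d0 in auto)
  then have "W \<in> ?A" by (auto simp: admissible_def W_def)
  moreover have "total_energy \<alpha> W \<le> total_energy \<alpha> v" if "v \<in> ?A" for v
    using WE INF_lower[OF that, of "total_energy \<alpha>"] d0 by (simp add: d_def)
  moreover have "total_energy \<alpha> W < \<infinity>" using WE by (rule le_less_trans) simp
  ultimately show ?thesis by blast
qed

section \<open>Strict positivity\<close>

text \<open>The geometric mean is at most the logarithmic mean. With y half the difference of the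
  logarithms this is the inequality y \<le> sinh y for y \<ge> 0.\<close>

lemma ln_diff_square_le:
  fixes a b :: real
  assumes "a > 0" "b > 0"
  shows "a * b * (ln a - ln b)\<^sup>2 \<le> (a - b)\<^sup>2"
proof -
  have sinh: "2 * y \<le> exp y - exp (- y)" if "y \<ge> 0" for y :: real
  proof -
    have "(\<lambda>y. exp y - exp (- y) - 2 * y) 0 \<le> (\<lambda>y. exp y - exp (- y) - 2 * y) y"
    proof (rule DERIV_nonneg_imp_nondecreasing[OF that])
      fix x :: real
      have "0 \<le> (exp (x / 2) - exp (- (x / 2)))\<^sup>2" by simp
      also have "\<dots> = exp x + exp (- x) - 2"
        by (simp add: power2_eq_square algebra_simps flip: exp_add)
      finally show "\<exists>y. ((\<lambda>y. exp y - exp (- y) - 2 * y) has_real_derivative y) (at x) \<and> 0 \<le> y"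
        by (intro exI[of _ "exp x + exp (- x) - 2"]) (auto intro!: derivative_eq_intros)
    qed
    then show ?thesis by simp
  qed
  have main: "p * q * (ln p - ln q)\<^sup>2 \<le> (p - q)\<^sup>2" if pq: "p > 0" "q > 0" "q \<le> p" for p q :: real
  proof -
    define y where "y = (ln p - ln q) / 2"
    have y: "y \<ge> 0" using pq by (simp add: y_def)
    define c where "c = exp ((ln p + ln q) / 2)"
    have "c * exp y = exp (ln p)" "c * exp (- y) = exp (ln q)"
      by (simp_all only: c_def y_def exp_add[symmetric]) (simp_all add: field_simps)
    then have p: "p = c * exp y" and q: "q = c * exp (- y)" using pq by simp_all
    have y2: "2 * y = ln p - ln q" by (simp add: y_def)
    have "c * (2 * y) \<le> c * (exp y - exp (- y))" using sinh[OF y] by (intro mult_left_mono) (auto simp: c_def)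
    then have "c * (2 * y) \<le> c * exp y - c * exp (- y)" by (simp only: right_diff_distrib)
    then have "c * (ln p - ln q) \<le> p - q" by (simp only: y2 p[symmetric] q[symmetric])
    then have "(c * (ln p - ln q))\<^sup>2 \<le> (p - q)\<^sup>2" using pq by (intro power_mono) (auto simp: c_def)
    moreover have "c\<^sup>2 = p * q"
    proof -
      have "p * q = c * c * (exp y * exp (- y))" by (subst p, subst q) (simp add: mult_ac)
      then show ?thesis by (simp add: power2_eq_square flip: exp_add)
    qed
    ultimately show ?thesis by (simp add: power_mult_distrib)
  qed
  show ?thesis
    using main[of a b] main[of b a] assms by (cases "b \<le> a") (auto simp: power2_commute mult.commute)
qed

text \<open>The defect in the convexity inequality \<open>blend_diff_le\<close> controls the increments of a logarithm.\<close>

lemma blend_gap_log: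
  fixes f g :: "real ^ 'n \<Rightarrow> real"
  assumes t: "0 < t" "t \<le> 1" and f: "\<And>x. f x \<ge> 0" and g: "\<And>x. g x > 0"
  defines "v \<equiv> (\<lambda>x. ln (sqrt ((1 - t) * (f x / g x)\<^sup>2 + t)))"
  shows "(blend t f g x - blend t f g y)\<^sup>2 + t * (g x * g y * (v x - v y)\<^sup>2) \<le>
    (1 - t) * (f x - f y)\<^sup>2 + t * (g x - g y)\<^sup>2"
proof -
  \<comment> \<open>Factor out g: the blend is g times a, where a is the norm of the plane vector
    (sqrt (1 - t) r, sqrt t).\<close>
  define r where "r x = f x / g x" for x
  define a where "a x = sqrt ((1 - t) * (r x)\<^sup>2 + t)" for x
  have r0: "r x \<ge> 0" for x using f[of x] g[of x] by (simp add: r_def)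
  have a2: "(a x)\<^sup>2 = (1 - t) * (r x)\<^sup>2 + t" for x using t by (simp add: a_def)
  have a0: "a x > 0" for x unfolding a_def using t by (simp add: add_nonneg_pos)
  have fr: "f x = g x * r x" for x using g[of x] by (simp add: r_def)
  have b: "blend t f g x = g x * a x" for x
  proof -
    have "(1 - t) * (norm (f x))\<^sup>2 + t * (norm (g x))\<^sup>2 = (g x)\<^sup>2 * ((1 - t) * (r x)\<^sup>2 + t)"
      by (simp add: fr power_mult_distrib algebra_simps)
    then show ?thesis using g[of x] by (simp add: blend_def a_def real_sqrt_mult)
  qed
  \<comment> \<open>P is the product of the norms of the vectors at x and y, and Q is their inner
    product. P^2 - Q^2 is then Lagrange's identity, and the convexity defect equals 2 g(x) g(y) (P -
    Q).\<close>
  define P where "P = a x * a y"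
  define Q where "Q = (1 - t) * (r x * r y) + t"
  have P0: "P > 0" using a0 by (simp add: P_def)
  have PQ: "P\<^sup>2 - Q\<^sup>2 = t * (1 - t) * (r x - r y)\<^sup>2"
    unfolding P_def power_mult_distrib a2 Q_def by (simp add: power2_eq_square algebra_simps)
  moreover have "0 \<le> t * (1 - t) * (r x - r y)\<^sup>2" using t by simp
  ultimately have "Q\<^sup>2 \<le> P\<^sup>2" by linarith
  then have QP: "Q \<le> P" using P0 by (auto intro: power2_le_imp_le)
  have "(a x - a y)\<^sup>2 \<le> (1 - t) * (r x - r y)\<^sup>2"
  proof -
    have "(a x - a y)\<^sup>2 = (1 - t) * (r x)\<^sup>2 + t + ((1 - t) * (r y)\<^sup>2 + t) - 2 * P"
      by (simp add: P_def power2_diff a2)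
    also have "\<dots> \<le> (1 - t) * (r x)\<^sup>2 + t + ((1 - t) * (r y)\<^sup>2 + t) - 2 * Q" using QP by simp
    also have "\<dots> = (1 - t) * (r x - r y)\<^sup>2" by (simp add: Q_def power2_eq_square algebra_simps)
    finally show ?thesis .
  qed
  then have "t * (a x - a y)\<^sup>2 \<le> P\<^sup>2 - Q\<^sup>2"
    unfolding PQ using t by (simp add: mult.assoc mult_left_mono)
  also have "\<dots> = (P - Q) * (P + Q)" by (simp add: power2_eq_square algebra_simps)
  also have "\<dots> \<le> (P - Q) * (2 * P)" using QP by (intro mult_left_mono) auto
  finally have 1: "t * (a x - a y)\<^sup>2 \<le> P * (2 * (P - Q))" by (simp add: mult_ac)
  have "P * (v x - v y)\<^sup>2 \<le> (a x - a y)\<^sup>2"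
    unfolding P_def v_def r_def[symmetric] a_def[symmetric] by (rule ln_diff_square_le[OF a0 a0])
  then have "t * (P * (v x - v y)\<^sup>2) \<le> t * (a x - a y)\<^sup>2" using t by (intro mult_left_mono) auto
  with 1 have "P * (t * (v x - v y)\<^sup>2) \<le> P * (2 * (P - Q))" by (simp add: mult_ac)
  then have "t * (v x - v y)\<^sup>2 \<le> 2 * (P - Q)" using P0 by (simp add: mult_le_cancel_left_pos)
  then have "g x * g y * (t * (v x - v y)\<^sup>2) \<le> g x * g y * (2 * (P - Q))"
    using g[of x] g[of y] by (intro mult_left_mono) auto
  also have "g x * g y * (2 * (P - Q)) = (1 - t) * (f x - f y)\<^sup>2 + t * (g x - g y)\<^sup>2 - (blend t f g x - blend t f g y)\<^sup>2"
  proof -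
    have "(blend t f g x - blend t f g y)\<^sup>2 = (g x)\<^sup>2 * (a x)\<^sup>2 + (g y)\<^sup>2 * (a y)\<^sup>2 - 2 * (g x * g y * P)"
      unfolding b by (simp add: P_def power2_eq_square algebra_simps)
    then show ?thesis unfolding a2 by (simp add: fr Q_def power2_eq_square algebra_simps)
  qed
  finally show ?thesis by (simp add: mult_ac)
qed

text \<open>Blending in a fraction t of the positive function saves kinetic energy at most of order
  t, by the hypothesis \<open>min\<close>. So the convexity defect is at most of order t, and after
  division by t the weighted increments of v are bounded uniformly in t. The bound is obtained for a
  small step H and then summed up to s, because difference quotients come close to
  \<open>kin\<close> only for small steps.\<close>

lemma log_increment_bound:
  fixes f :: "real ^ 'n \<Rightarrow> real" and c :: real
  assumes [measurable]: "f \<in> borel_measurable borel" and f: "\<And>x. f x \<ge> 0" and c: "c > 0"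
    and t: "0 < t" "t \<le> 1 / 2" and s: "s > 0" and R: "R > 0" and C: "C \<ge> 0"
    and K: "kin i (ref :: real ^ 'n \<Rightarrow> real) \<le> ennreal K" "K \<ge> 0" and fin: "kin i f < \<infinity>"
    and min: "ennreal (1 - t) * kin i f \<le> kin i (blend t f (\<lambda>x. c * ref x)) + ennreal (t * C)"
  defines "v \<equiv> (\<lambda>x. ln (sqrt ((1 - t) * (f x / (c * ref x))\<^sup>2 + t)))"
  shows "(\<integral>\<^sup>+x. indicator (ball 0 R) x * ennreal ((v (x + s *\<^sub>R axis i 1) - v x)\<^sup>2) \<partial>lborel) \<le>
    ennreal (s\<^sup>2 * ((C + c\<^sup>2 * K + 1) / (c\<^sup>2 * exp (- 2 * (R + 2 * s)))))"
proof -
  let ?e = "axis i 1 :: real ^ 'n"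
  define g where "g x = c * ref x" for x :: "real ^ 'n"
  have g: "g x > 0" for x using c ref_pos(1)[of x] by (simp add: g_def)
  have [measurable]: "g \<in> borel_measurable borel" unfolding g_def[abs_def] by measurable
  have [measurable]: "v \<in> borel_measurable borel" unfolding v_def by measurable
  define b where "b = blend t f g"
  have [measurable]: "b \<in> borel_measurable borel" unfolding b_def by measurable
  have kg: "kin i g \<le> ennreal (c\<^sup>2 * K)"
  proof -
    have "kin i g \<le> ennreal (c\<^sup>2) * kin i (ref :: real ^ 'n \<Rightarrow> real) + ennreal 0 * kin i (ref :: real ^ 'n \<Rightarrow> real)"
      by (rule kin_mono2) (auto simp: g_def power_mult_distrib simp flip: right_diff_distrib)
    also have "\<dots> \<le> ennreal (c\<^sup>2) * ennreal K" using K by (simp add: mult_left_mono)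
    finally show ?thesis by (simp add: ennreal_mult')
  qed
  have kb: "kin i b < \<infinity>"
  proof (rule le_less_trans)
    show "kin i b \<le> ennreal (1 - t) * kin i f + ennreal t * kin i g"
      unfolding b_def using t by (intro kin_blend) auto
    show "ennreal (1 - t) * kin i f + ennreal t * kin i g < \<infinity>"
      using fin le_less_trans[OF kg] by (simp add: ennreal_mult_less_top)
  qed
  define W where "W h = (\<integral>\<^sup>+x. ennreal (g (x + h *\<^sub>R ?e) * g x * (v (x + h *\<^sub>R ?e) - v x)\<^sup>2) \<partial>lborel)" for h
  have gap: "diff2 i h b + ennreal t * W h \<le> ennreal (1 - t) * diff2 i h f + ennreal t * diff2 i h g" for h
  proof -
    have "diff2 i h b + ennreal t * W h = (\<integral>\<^sup>+x. ennreal ((norm (b (x + h *\<^sub>R ?e) - b x))\<^sup>2) +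
       ennreal t * ennreal (g (x + h *\<^sub>R ?e) * g x * (v (x + h *\<^sub>R ?e) - v x)\<^sup>2) \<partial>lborel)"
      unfolding diff2_def sqnorm_def W_def by (simp add: nn_integral_add nn_integral_cmult)
    also have "\<dots> \<le> (\<integral>\<^sup>+x. ennreal (1 - t) * ennreal ((norm (f (x + h *\<^sub>R ?e) - f x))\<^sup>2) +
       ennreal t * ennreal ((norm (g (x + h *\<^sub>R ?e) - g x))\<^sup>2) \<partial>lborel)"
    proof (intro nn_integral_mono)
      fix x
      have "(norm (b (x + h *\<^sub>R ?e) - b x))\<^sup>2 + t * (g (x + h *\<^sub>R ?e) * g x * (v (x + h *\<^sub>R ?e) - v x)\<^sup>2) \<le>
         (1 - t) * (norm (f (x + h *\<^sub>R ?e) - f x))\<^sup>2 + t * (norm (g (x + h *\<^sub>R ?e) - g x))\<^sup>2"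
        using blend_gap_log[of t f g "x + h *\<^sub>R ?e" x] t f g
        unfolding b_def v_def g_def[symmetric] by simp
      from ennreal_leI[OF this] show "ennreal ((norm (b (x + h *\<^sub>R ?e) - b x))\<^sup>2) +
         ennreal t * ennreal (g (x + h *\<^sub>R ?e) * g x * (v (x + h *\<^sub>R ?e) - v x)\<^sup>2) \<le>
         ennreal (1 - t) * ennreal ((norm (f (x + h *\<^sub>R ?e) - f x))\<^sup>2) +
         ennreal t * ennreal ((norm (g (x + h *\<^sub>R ?e) - g x))\<^sup>2)"
        using t g[of x] g[of "x + h *\<^sub>R ?e"] by (simp add: ennreal_mult ennreal_plus del: norm_power)
    qed
    also have "\<dots> = ennreal (1 - t) * diff2 i h f + ennreal t * diff2 i h g"
      unfolding diff2_def sqnorm_def by (simp add: nn_integral_add nn_integral_cmult)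
    finally show ?thesis .
  qed
  define h where "h n = s / real (Suc n)" for n
  have h: "h n > 0" for n using s by (simp add: h_def)
  have h0: "h \<longlonglongrightarrow> 0"
    using LIMSEQ_Suc[OF lim_const_over_n[of s]] unfolding h_def .
  \<comment> \<open>For f and g the quotients lie below \<open>kin\<close>, but for b a lower bound
    is required. Along the steps s/(n+1) the quotient comes within t of \<open>kin i b\<close>, an
    error of the admissible order.\<close>
  have "(\<lambda>n. ennreal (1 / (h n)\<^sup>2) * diff2 i (h n) b + ennreal t) \<longlonglongrightarrow> kin i b + ennreal t"
    by (intro tendsto_add tendsto_const quotient_tendsto_kin kb h h0) measurable
  moreover have "kin i b < kin i b + ennreal t"
    using kb t by (cases "kin i b") (auto simp: ennreal_less_iff simp flip: ennreal_plus)
  ultimately have "\<forall>\<^sub>F n in sequentially. kin i b < ennreal (1 / (h n)\<^sup>2) * diff2 i (h n) b + ennreal t"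
    by (rule order_tendstoD(1))
  then obtain n where n: "kin i b \<le> ennreal (1 / (h n)\<^sup>2) * diff2 i (h n) b + ennreal t"
    by (auto simp: eventually_sequentially intro: less_imp_le)
  define H where "H = h n"
  define L where "L = Suc n"
  have H: "H > 0" "real L * H = s" using h[of n] by (auto simp: H_def L_def h_def)
  have WH: "W H \<le> ennreal (H\<^sup>2 * (C + c\<^sup>2 * K + 1))"
  proof -
    let ?q = "ennreal (1 / H\<^sup>2)"
    have "?q * diff2 i H b + ?q * (ennreal t * W H) \<le> ?q * (ennreal (1 - t) * diff2 i H f + ennreal t * diff2 i H g)"
      using gap[of H] by (simp add: mult_left_mono flip: distrib_left)
    also have "\<dots> = ennreal (1 - t) * (?q * diff2 i H f) + ennreal t * (?q * diff2 i H g)"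
      by (simp add: distrib_left mult_ac)
    also have "\<dots> \<le> ennreal (1 - t) * kin i f + ennreal t * kin i g"
      by (intro add_mono mult_left_mono quotient_le_kin H) auto
    also have "\<dots> \<le> (kin i b + ennreal (t * C)) + ennreal t * ennreal (c\<^sup>2 * K)"
      using min kg by (intro add_mono mult_left_mono) (auto simp: b_def g_def[abs_def])
    also have "\<dots> \<le> ((?q * diff2 i H b + ennreal t) + ennreal (t * C)) + ennreal t * ennreal (c\<^sup>2 * K)"
      using n by (intro add_right_mono) (simp add: H_def)
    also have "\<dots> = ?q * diff2 i H b + ennreal (t * (C + c\<^sup>2 * K + 1))"
      using t C K by (simp add: distrib_left add_ac flip: ennreal_mult ennreal_plus)
    finally have *: "?q * diff2 i H b + ?q * (ennreal t * W H) \<le> ?q * diff2 i H b + ennreal (t * (C + c\<^sup>2 * K + 1))" .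
    \<comment> \<open>Finiteness is what permits cancelling this term on both sides.\<close>
    have "?q * diff2 i H b < \<infinity>" using quotient_le_kin[OF H(1), of i b] kb by (rule le_less_trans)
    then have "?q * (ennreal t * W H) \<le> ennreal (t * (C + c\<^sup>2 * K + 1))"
      using * by (auto simp: ennreal_add_left_cancel_le)
    then have "ennreal (H\<^sup>2 / t) * (?q * (ennreal t * W H)) \<le> ennreal (H\<^sup>2 / t) * ennreal (t * (C + c\<^sup>2 * K + 1))"
      by (rule mult_left_mono) simp
    moreover have "ennreal (H\<^sup>2 / t) * (?q * (ennreal t * W H)) = W H"
      using H t by (simp add: mult.assoc[symmetric] ennreal_mult[symmetric])
    moreover have "ennreal (H\<^sup>2 / t) * ennreal (t * (C + c\<^sup>2 * K + 1)) = ennreal (H\<^sup>2 * (C + c\<^sup>2 * K + 1))"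
      using H t C K by (simp flip: ennreal_mult)
    ultimately show ?thesis by simp
  qed
  \<comment> \<open>Lower bound for g(y + H e_i) g(y): along the chain from x to x + s e_i all
    points that occur have norm at most R + 2 s.\<close>
  define \<kappa> where "\<kappa> = c\<^sup>2 * exp (- 2 * (R + 2 * s))"
  have \<kappa>: "\<kappa> > 0" using c by (simp add: \<kappa>_def)
  define G where "G y = g (y + H *\<^sub>R ?e) * g y * (v (y + H *\<^sub>R ?e) - v y)\<^sup>2" for y
  have G0: "G y \<ge> 0" for y using g[of y] g[of "y + H *\<^sub>R ?e"] by (simp add: G_def)
  have [measurable]: "G \<in> borel_measurable borel" unfolding G_def[abs_def] by measurable
  have pw: "indicator (ball 0 R) x * ennreal ((v (x + s *\<^sub>R ?e) - v x)\<^sup>2) \<le>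
      ennreal (real L / \<kappa>) * (\<Sum>l<L. ennreal (G (x + (real l * H) *\<^sub>R ?e)))" for x
  proof (cases "x \<in> ball 0 R")
    case True
    have "(v (x + s *\<^sub>R ?e) - v x)\<^sup>2 \<le> real L * (\<Sum>l<L. (v (x + (real l * H) *\<^sub>R ?e + H *\<^sub>R ?e) - v (x + (real l * H) *\<^sub>R ?e))\<^sup>2)"
      using telescope_shift[of v x L H ?e] H by simp
    also have "\<dots> \<le> real L * (\<Sum>l<L. G (x + (real l * H) *\<^sub>R ?e) / \<kappa>)"
    proof (intro mult_left_mono sum_mono)
      fix l assume "l \<in> {..<L}"
      then have l: "real (Suc l) \<le> real L" by simp
      define y where "y = x + (real l * H) *\<^sub>R ?e"
      have lH: "real (Suc l) * H \<le> s" using l H by (metis less_imp_le mult_right_mono)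
      then have "real l * H + H \<le> s" by (simp add: algebra_simps)
      then have y1: "norm y \<le> R + s"
        unfolding y_def using True H norm_triangle_ineq[of x "(real l * H) *\<^sub>R ?e"] by simp
      have "H \<le> s" using \<open>real l * H + H \<le> s\<close> H by (smt (verit) mult_nonneg_nonneg of_nat_0_le_iff)
      then have y2: "norm (y + H *\<^sub>R ?e) \<le> R + 2 * s"
        using y1 H norm_triangle_ineq[of y "H *\<^sub>R ?e"] by simp
      have "\<kappa> \<le> g (y + H *\<^sub>R ?e) * g y"
      proof -
        have "exp (- (R + 2 * s)) \<le> ref (y + H *\<^sub>R ?e)" "exp (- (R + 2 * s)) \<le> ref y"
          using y1 y2 s by (auto simp: ref_def)
        then have "exp (- (R + 2 * s)) * exp (- (R + 2 * s)) \<le> ref (y + H *\<^sub>R ?e) * ref y"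
          by (intro mult_mono) (auto simp: less_imp_le[OF ref_pos(1)])
        then have "c\<^sup>2 * (exp (- (R + 2 * s)) * exp (- (R + 2 * s))) \<le> c\<^sup>2 * (ref (y + H *\<^sub>R ?e) * ref y)"
          by (rule mult_left_mono) simp
        then show ?thesis by (simp add: \<kappa>_def g_def power2_eq_square mult_ac flip: exp_add)
      qed
      then have "\<kappa> * (v (y + H *\<^sub>R ?e) - v y)\<^sup>2 \<le> G y" unfolding G_def by (intro mult_right_mono) auto
      then show "(v (x + (real l * H) *\<^sub>R ?e + H *\<^sub>R ?e) - v (x + (real l * H) *\<^sub>R ?e))\<^sup>2 \<le> G (x + (real l * H) *\<^sub>R ?e) / \<kappa>"
        using \<kappa> by (simp add: y_def field_simps)
    qed simp
    also have "\<dots> = (real L / \<kappa>) * (\<Sum>l<L. G (x + (real l * H) *\<^sub>R ?e))"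
      by (simp add: sum_divide_distrib[symmetric])
    finally have "ennreal ((v (x + s *\<^sub>R ?e) - v x)\<^sup>2) \<le> ennreal ((real L / \<kappa>) * (\<Sum>l<L. G (x + (real l * H) *\<^sub>R ?e)))"
      by (rule ennreal_leI)
    also have "\<dots> = ennreal (real L / \<kappa>) * (\<Sum>l<L. ennreal (G (x + (real l * H) *\<^sub>R ?e)))"
      using \<kappa> G0 by (subst ennreal_mult) (auto intro!: sum_nonneg)
    finally show ?thesis using True by simp
  qed simp
  have "(\<integral>\<^sup>+x. indicator (ball 0 R) x * ennreal ((v (x + s *\<^sub>R ?e) - v x)\<^sup>2) \<partial>lborel) \<le>
     (\<integral>\<^sup>+x. ennreal (real L / \<kappa>) * (\<Sum>l<L. ennreal (G (x + (real l * H) *\<^sub>R ?e))) \<partial>lborel)"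
    by (intro nn_integral_mono pw)
  also have "\<dots> = ennreal (real L / \<kappa>) * (\<Sum>l<L. (\<integral>\<^sup>+x. ennreal (G (x + (real l * H) *\<^sub>R ?e)) \<partial>lborel))"
    by (simp add: nn_integral_cmult nn_integral_sum del: sum_ennreal)
  also have "\<dots> = ennreal (real L / \<kappa>) * (\<Sum>l<L. W H)"
    unfolding W_def G_def[symmetric] by (subst nn_integral_translate[of "\<lambda>x. ennreal (G x)"]) auto
  also have "\<dots> = ennreal (real L / \<kappa>) * (ennreal (real L) * W H)"
    by (simp add: ennreal_of_nat_eq_real_of_nat)
  also have "\<dots> \<le> ennreal (real L / \<kappa>) * (ennreal (real L) * ennreal (H\<^sup>2 * (C + c\<^sup>2 * K + 1)))"
    by (intro mult_left_mono WH) auto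
  also have "\<dots> = ennreal (real L / \<kappa> * (real L * (H\<^sup>2 * (C + c\<^sup>2 * K + 1))))"
    using \<kappa> C K by (simp flip: ennreal_mult)
  also have "real L / \<kappa> * (real L * (H\<^sup>2 * (C + c\<^sup>2 * K + 1))) = (real L * H)\<^sup>2 * ((C + c\<^sup>2 * K + 1) / \<kappa>)"
    by (simp add: power2_eq_square)
  finally show ?thesis unfolding H(2) \<kappa>_def .
qed

text \<open>By Tonelli the measure of Z times the measure of its complement is the double integral
  over x and z of the indicator that x lies in Z and x + z does not; invariance makes it 0.\<close>

lemma translation_invariant_null_or_conull:
  fixes Z :: "'a::euclidean_space set"
  assumes [measurable]: "Z \<in> sets borel"
    and inv: "\<And>z. AE x in lborel. x \<in> Z \<longrightarrow> x + z \<in> Z"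
  shows "(AE x in lborel. x \<in> Z) \<or> (AE x in lborel. x \<notin> Z)"
proof -
  have "(\<integral>\<^sup>+z. (\<integral>\<^sup>+x. indicator Z x * indicator (- Z) (x + z) \<partial>lborel) \<partial>lborel) = (0 :: ennreal)"
  proof -
    have "(\<integral>\<^sup>+x. indicator Z x * indicator (- Z) (x + z) \<partial>lborel) = (0 :: ennreal)" for z
      using inv[of z] by (subst nn_integral_0_iff_AE) (auto simp: indicator_def elim!: eventually_mono)
    then show ?thesis by simp
  qed
  also have "(\<integral>\<^sup>+z. (\<integral>\<^sup>+x. indicator Z x * indicator (- Z) (x + z) \<partial>lborel) \<partial>lborel) =
    (\<integral>\<^sup>+x. (\<integral>\<^sup>+z. indicator Z x * indicator (- Z) (x + z) \<partial>lborel) \<partial>(lborel :: 'a measure) :: ennreal)"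
    by (rule lborel_pair.Fubini') measurable
  also have "\<dots> = (\<integral>\<^sup>+x. indicator Z x * emeasure lborel (- Z) \<partial>lborel)"
  proof (intro nn_integral_cong)
    fix x :: 'a
    have "(\<integral>\<^sup>+z. indicator (- Z) (x + z) \<partial>lborel) = (\<integral>\<^sup>+z. indicator (- Z) (z + x) \<partial>(lborel :: 'a measure) :: ennreal)"
      by (simp add: add.commute)
    also have "\<dots> = emeasure lborel (- Z)" by (subst nn_integral_translate) auto
    finally show "(\<integral>\<^sup>+z. indicator Z x * indicator (- Z) (x + z) \<partial>lborel) = indicator Z x * emeasure lborel (- Z)"
      by (simp add: nn_integral_cmult)
  qed
  also have "\<dots> = emeasure lborel Z * emeasure lborel (- Z)" by (simp add: nn_integral_multc)
  finally have "emeasure lborel Z = 0 \<or> emeasure lborel (- Z) = 0" by simp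
  then show ?thesis
    using AE_not_in[of Z lborel] AE_not_in[of "- Z" lborel] by (auto simp: null_sets_def)
qed

lemma AE_ball_imp_AE:
  fixes P :: "'a::euclidean_space \<Rightarrow> bool"
  assumes "\<And>n::nat. AE x in lborel. x \<in> ball 0 (real (Suc n)) \<longrightarrow> P x"
  shows "AE x in lborel. P x"
proof -
  have "AE x in lborel. \<forall>n::nat. x \<in> ball 0 (real (Suc n)) \<longrightarrow> P x"
    unfolding AE_all_countable using assms by blast
  then show ?thesis
  proof eventually_elim
    case (elim x)
    obtain n where "norm x < real n" using reals_Archimedean2 by blast
    then show ?case using elim by (auto dest!: spec[of _ n])
  qed
qed

text \<open>As \<open>t\<close> tends to zero the logarithm in \<open>log_increment_bound\<close> blows up exactly on the zero set
  of \<open>f\<close>, which is therefore invariant under translations.\<close>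

lemma zero_or_positive:
  fixes f :: "real ^ 'n \<Rightarrow> real" and c :: real
  assumes [measurable]: "f \<in> borel_measurable borel" and f: "\<And>x. f x \<ge> 0" and c: "c > 0" and C: "C \<ge> 0"
    and fin: "\<And>i. kin i f < \<infinity>"
    and min: "\<And>i t. 0 < t \<Longrightarrow> t \<le> 1 / 2 \<Longrightarrow>
      ennreal (1 - t) * kin i f \<le> kin i (blend t f (\<lambda>x. c * ref x)) + ennreal (t * C)"
  shows "(AE x in lborel. f x = 0) \<or> (AE x in lborel. f x > 0)"
proof -
  have step: "AE x in lborel. f x = 0 \<longleftrightarrow> f (x + s *\<^sub>R axis i 1) = 0" if s: "s > 0" for s i
  proof (rule AE_ball_imp_AE)
    fix k :: nat
    let ?e = "axis i 1 :: real ^ 'n"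
    define R where "R = real (Suc k)"
    obtain K where K: "kin i (ref :: real ^ 'n \<Rightarrow> real) = ennreal K" "K \<ge> 0"
      using kinetic_ref_finite[where 'n = 'n] unfolding kinetic_less_top_iff
      by (metis ennreal_cases infinity_ennreal_def less_irrefl)
    define t where "t n = 1 / real (n + 2)" for n :: nat
    have t: "0 < t n" "t n \<le> 1 / 2" for n by (auto simp: t_def field_simps)
    define v where "v n x = ln (sqrt ((1 - t n) * (f x / (c * ref x))\<^sup>2 + t n))" for n x
    have [measurable]: "v n \<in> borel_measurable borel" for n unfolding v_def by measurable
    define B where "B = s\<^sup>2 * ((C + c\<^sup>2 * K + 1) / (c\<^sup>2 * exp (- 2 * (R + 2 * s))))"
    have bound: "(\<integral>\<^sup>+x. indicator (ball 0 R) x * ennreal ((v n (x + s *\<^sub>R ?e) - v n x)\<^sup>2) \<partial>lborel) \<le> ennreal B" for n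
      unfolding v_def B_def
      by (rule log_increment_bound[OF _ f c t s _ C eq_refl[OF K(1)] K(2) fin min[OF t]]) (auto simp: R_def)
    have [measurable]: "indicator (ball 0 R) \<in> borel_measurable (borel :: (real ^ 'n) measure)"
      by (intro borel_measurable_indicator) simp
    have meas: "(\<lambda>x. indicator (ball 0 R) x * ennreal ((v n (x + s *\<^sub>R ?e) - v n x)\<^sup>2)) \<in> borel_measurable lborel" for n
      by (intro borel_measurable_times_ennreal borel_measurable_indicator) auto
    have "(\<integral>\<^sup>+x. liminf (\<lambda>n. indicator (ball 0 R) x * ennreal ((v n (x + s *\<^sub>R ?e) - v n x)\<^sup>2)) \<partial>lborel) \<le>
      liminf (\<lambda>n. \<integral>\<^sup>+x. indicator (ball 0 R) x * ennreal ((v n (x + s *\<^sub>R ?e) - v n x)\<^sup>2) \<partial>lborel)"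
      by (rule nn_integral_liminf[OF meas])
    also have "\<dots> \<le> liminf (\<lambda>n. ennreal B)"
      by (intro Liminf_mono always_eventually allI bound)
    also have "\<dots> = ennreal B" by (intro lim_imp_Liminf) auto
    finally have "(\<integral>\<^sup>+x. liminf (\<lambda>n. indicator (ball 0 R) x * ennreal ((v n (x + s *\<^sub>R ?e) - v n x)\<^sup>2)) \<partial>lborel) \<le> ennreal B" .
    also have "\<dots> < \<infinity>" by simp
    finally have "(\<integral>\<^sup>+x. liminf (\<lambda>n. indicator (ball 0 R) x * ennreal ((v n (x + s *\<^sub>R ?e) - v n x)\<^sup>2)) \<partial>lborel) < \<infinity>" .
    then have "AE x in lborel. liminf (\<lambda>n. indicator (ball 0 R) x * ennreal ((v n (x + s *\<^sub>R ?e) - v n x)\<^sup>2)) \<noteq> \<infinity>"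
      using meas by (intro nn_integral_PInf_AE borel_measurable_liminf) auto
    moreover have "(f x = 0) = (f (x + s *\<^sub>R axis i 1) = 0)"
      if ne: "liminf (\<lambda>n. indicator (ball 0 R) x * ennreal ((v n (x + s *\<^sub>R ?e) - v n x)\<^sup>2)) \<noteq> \<infinity>"
        and x: "x \<in> ball 0 (real (Suc k))" for x
    proof (rule ccontr)
      \<comment> \<open>At a zero of f, \<open>v n\<close> is the logarithm of sqrt (t n) and tends
        to -\<infinity>; elsewhere it converges. The squared increments would then tend to
        \<infinity>, against the finite limit inferior.\<close>
      assume neq: "(f x = 0) \<noteq> (f (x + s *\<^sub>R axis i 1) = 0)"
      have t0: "t \<longlonglongrightarrow> 0"
        using LIMSEQ_ignore_initial_segment[OF lim_1_over_n, of 2] unfolding t_def by simp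
      have zero: "filterlim (\<lambda>n. v n y) at_bot sequentially" if "f y = 0" for y
      proof -
        have "filterlim (\<lambda>n. sqrt (t n)) (at_right 0) sequentially"
          unfolding filterlim_at using tendsto_real_sqrt[OF t0] t(1) by (auto intro!: always_eventually simp: less_imp_neq[symmetric])
        from filterlim_compose[OF ln_at_0 this] show ?thesis by (simp add: v_def that)
      qed
      have pos: "\<exists>l. (\<lambda>n. v n y) \<longlonglongrightarrow> l" if "f y \<noteq> 0" for y
      proof -
        have r: "f y / (c * ref y) > 0" using that f[of y] c ref_pos(1)[of y] by (simp add: less_le)
        have "(\<lambda>n. v n y) \<longlonglongrightarrow> ln (sqrt ((1 - 0) * (f y / (c * ref y))\<^sup>2 + 0))"
          unfolding v_def using r by (intro tendsto_intros t0) auto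
        then show ?thesis by blast
      qed
      have sq: "filterlim (\<lambda>n. (v n y - v n z)\<^sup>2) at_top sequentially" if y: "f y = 0" and z: "f z \<noteq> 0" for y z
      proof -
        obtain l where "(\<lambda>n. v n z) \<longlonglongrightarrow> l" using pos[OF z] by blast
        from filterlim_tendsto_add_at_top[OF this filterlim_compose[OF filterlim_uminus_at_top_at_bot zero[OF y]]]
        have *: "filterlim (\<lambda>n. v n z - v n y) at_top sequentially" by simp
        have "filterlim (\<lambda>n. (v n z - v n y)\<^sup>2) at_top sequentially"
          by (rule filterlim_pow_at_top[OF _ *]) simp
        then show ?thesis by (simp add: power2_commute)
      qed
      have "filterlim (\<lambda>n. (v n (x + s *\<^sub>R ?e) - v n x)\<^sup>2) at_top sequentially"
        using sq[of x "x + s *\<^sub>R ?e"] sq[of "x + s *\<^sub>R ?e" x] neq by (auto simp: power2_commute)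
      then have "(\<lambda>n. ennreal ((v n (x + s *\<^sub>R ?e) - v n x)\<^sup>2)) \<longlonglongrightarrow> top"
        by (simp add: ennreal_tendsto_top_eq_at_top)
      then have "liminf (\<lambda>n. ennreal ((v n (x + s *\<^sub>R ?e) - v n x)\<^sup>2)) = top" by (intro lim_imp_Liminf) auto
      then show False using ne x by (simp add: R_def)
    qed
    ultimately show "AE x in lborel. x \<in> ball 0 (real (Suc k)) \<longrightarrow> (f x = 0 \<longleftrightarrow> f (x + s *\<^sub>R axis i 1) = 0)"
      by (auto elim!: eventually_mono)
  qed
  have step': "AE x in lborel. f x = 0 \<longleftrightarrow> f (x + s *\<^sub>R axis i 1) = 0" for s i
  proof -
    consider "s > 0" | "s = 0" | "s < 0" by linarith
    then show ?thesis
    proof cases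
      case 3
      from AE_translate[OF step[of "- s" i], of "s *\<^sub>R axis i 1"] 3
      have "AE x in lborel. f (x + s *\<^sub>R axis i 1) = 0 \<longleftrightarrow> f (x + s *\<^sub>R axis i 1 + (- s) *\<^sub>R axis i 1) = 0" by simp
      then show ?thesis by eventually_elim auto
    qed (use step in auto)
  qed
  have inv: "AE x in lborel. f x = 0 \<longleftrightarrow> f (x + z) = 0" for z
  proof -
    have "AE x in lborel. f x = 0 \<longleftrightarrow> f (x + (\<Sum>i\<in>A. z $ i *\<^sub>R axis i 1)) = 0" if "finite A" for A
      using that
    proof (induction A rule: finite_induct)
      case (insert i A)
      define y where "y = (\<Sum>i\<in>A. z $ i *\<^sub>R axis i (1::real) :: real ^ 'n)"
      from insert.IH AE_translate[OF step'[of "z $ i" i], of y]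
      have "AE x in lborel. f x = 0 \<longleftrightarrow> f (x + y + z $ i *\<^sub>R axis i 1) = 0"
        unfolding y_def[symmetric] by eventually_elim auto
      then show ?case using insert.hyps by (simp add: y_def add_ac)
    qed simp
    note gen = this
    have eq: "(\<Sum>i\<in>UNIV. z $ i *\<^sub>R axis i (1::real)) = z"
      by (simp add: vec_eq_iff axis_def if_distrib cong: if_cong)
    show ?thesis using gen[of UNIV] by (simp only: eq finite)
  qed
  have [measurable]: "{x. f x = 0} \<in> sets borel"
    using measurable_sets[of f borel borel "{0}"] by (simp add: vimage_def)
  have "(AE x in lborel. x \<in> {x. f x = 0}) \<or> (AE x in lborel. x \<notin> {x. f x = 0})"
  proof (rule translation_invariant_null_or_conull)
    show "AE x in lborel. x \<in> {x. f x = 0} \<longrightarrow> x + z \<in> {x. f x = 0}" for z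
      using inv[of z] by eventually_elim auto
  qed measurable
  then show ?thesis using f by (auto simp: less_le elim!: eventually_mono)
qed

section \<open>Minimizers and the sign of their real parts\<close>

text \<open>Comparison with nonnegative functions suffices, as passing to the modulus does not increase the
  energy.\<close>

definition is_min :: "real \<Rightarrow> real \<Rightarrow> (real ^ 'n \<Rightarrow> complex) \<Rightarrow> bool" where
  "is_min \<alpha> m u \<longleftrightarrow> u \<in> borel_measurable borel \<and> sqnorm u = ennreal m \<and> total_energy \<alpha> u < \<infinity> \<and>
    (\<forall>w \<in> (admissible m :: (real ^ 'n \<Rightarrow> real) set). total_energy \<alpha> u \<le> total_energy \<alpha> w)"

lemma is_min_unimodular:
  fixes u :: "real ^ 'n \<Rightarrow> complex"
  assumes u: "is_min \<alpha> m u" and c: "norm c = 1"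
  shows "is_min \<alpha> m (\<lambda>x. c * u x)"
proof -
  have [measurable]: "u \<in> borel_measurable borel" using u by (simp add: is_min_def)
  have "total_energy \<alpha> (\<lambda>x. c * u x) \<le> total_energy \<alpha> u"
    by (rule total_energy_mono) (auto simp: norm_mult c simp flip: right_diff_distrib)
  moreover have "sqnorm (\<lambda>x. c * u x) = sqnorm u" by (simp add: sqnorm_def norm_mult c)
  ultimately show ?thesis using u unfolding is_min_def by (auto intro: le_less_trans order_trans)
qed

lemma is_min_norm:
  fixes u :: "real ^ 'n \<Rightarrow> complex"
  assumes u: "is_min \<alpha> m u"
  shows "is_min \<alpha> m (\<lambda>x. complex_of_real (norm (u x)))"
proof -
  have m[measurable]: "u \<in> borel_measurable borel" using u by (simp add: is_min_def)
  have "total_energy \<alpha> (\<lambda>x. complex_of_real (norm (u x))) \<le> total_energy \<alpha> u"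
    using total_energy_norm_le[OF m] by (simp add: total_energy_of_real)
  moreover have "sqnorm (\<lambda>x. complex_of_real (norm (u x))) = sqnorm u" by (simp add: sqnorm_def)
  ultimately show ?thesis using u unfolding is_min_def by (auto intro: le_less_trans order_trans)
qed

text \<open>A sum of suprema may exceed the supremum of the sums. Finiteness allows replacing the
  suprema by limits along small steps, and limits are additive.\<close>

lemma kin_add_le:
  fixes u :: "real ^ 'n \<Rightarrow> 'a::euclidean_space" and f :: "real ^ 'n \<Rightarrow> 'b::euclidean_space"
    and p :: "real ^ 'n \<Rightarrow> 'c::euclidean_space"
  assumes [measurable]: "u \<in> borel_measurable borel" "f \<in> borel_measurable borel" "p \<in> borel_measurable borel"
    and fin: "kin i u < \<infinity>"
    and le: "\<And>x y. (norm (f x - f y))\<^sup>2 + (norm (p x - p y))\<^sup>2 \<le> (norm (u x - u y))\<^sup>2"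
  shows "kin i f + kin i p \<le> kin i u"
proof -
  have "(norm (f x - f y))\<^sup>2 \<le> 1 * (norm (u x - u y))\<^sup>2 + 0 * (norm (u x - u y))\<^sup>2"
       "(norm (p x - p y))\<^sup>2 \<le> 1 * (norm (u x - u y))\<^sup>2 + 0 * (norm (u x - u y))\<^sup>2" for x y
    using le[of x y] zero_le_power2[of "norm (f x - f y)"] zero_le_power2[of "norm (p x - p y)"] by linarith+
  from kin_mono2[OF _ _ _ _ this(1), where i = i] kin_mono2[OF _ _ _ _ this(2), where i = i]
  have "kin i f \<le> kin i u" "kin i p \<le> kin i u" by simp_all
  then have fin': "kin i f < \<infinity>" "kin i p < \<infinity>" using fin by (auto intro: le_less_trans)
  define h where "h n = 1 / real (Suc n)" for n
  have h: "h n > 0" for n by (simp add: h_def)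
  have h0: "h \<longlonglongrightarrow> 0" unfolding h_def by (rule LIMSEQ_Suc[OF lim_1_over_n])
  have "(\<lambda>n. ennreal (1 / (h n)\<^sup>2) * diff2 i (h n) f + ennreal (1 / (h n)\<^sup>2) * diff2 i (h n) p) \<longlonglongrightarrow> kin i f + kin i p"
    by (intro tendsto_add quotient_tendsto_kin fin' h h0) measurable
  moreover have "ennreal (1 / (h n)\<^sup>2) * diff2 i (h n) f + ennreal (1 / (h n)\<^sup>2) * diff2 i (h n) p \<le> kin i u" for n
  proof -
    have "diff2 i (h n) f + diff2 i (h n) p = (\<integral>\<^sup>+x. ennreal ((norm (f (x + h n *\<^sub>R axis i 1) - f x))\<^sup>2) +
       ennreal ((norm (p (x + h n *\<^sub>R axis i 1) - p x))\<^sup>2) \<partial>lborel)"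
      unfolding diff2_def sqnorm_def by (rule nn_integral_add[symmetric]) measurable
    also have "\<dots> \<le> diff2 i (h n) u"
      unfolding diff2_def sqnorm_def using le
      by (intro nn_integral_mono) (simp add: ennreal_leI flip: ennreal_plus)
    finally have "ennreal (1 / (h n)\<^sup>2) * (diff2 i (h n) f + diff2 i (h n) p) \<le> ennreal (1 / (h n)\<^sup>2) * diff2 i (h n) u"
      by (rule mult_left_mono) simp
    also have "\<dots> \<le> kin i u" by (rule quotient_le_kin[OF h])
    finally show ?thesis by (simp add: distrib_left)
  qed
  ultimately show ?thesis by (auto intro: LIMSEQ_le_const2)
qed

text \<open>Splitting a minimizer \<open>u\<close> into the positive part of \<open>Re u\<close> and the rest, and perturbing only
  the former, shows that this positive part vanishes or is positive almost everywhere.\<close>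

lemma minimizer_Re_sign:
  fixes u :: "real ^ 'n \<Rightarrow> complex"
  assumes \<alpha>: "0 < \<alpha>" "\<alpha> < real CARD('n)" and m: "m > 0" and u: "is_min \<alpha> m u"
  shows "(AE x in lborel. Re (u x) \<le> 0) \<or> (AE x in lborel. Re (u x) > 0)"
proof -
  have [measurable]: "u \<in> borel_measurable borel" using u by (simp add: is_min_def)
  obtain c where c: "c > 0" "sqnorm (\<lambda>x::real ^ 'n. c * ref x) = ennreal m" "total_energy \<alpha> (\<lambda>x::real ^ 'n. c * ref x) < \<infinity>"
    using exists_finite_total_energy[OF \<alpha> m] by blast
  define g where "g x = c * ref x" for x :: "real ^ 'n"
  have [measurable]: "g \<in> borel_measurable borel" unfolding g_def[abs_def] by measurable
  define f where "f x = max 0 (Re (u x))" for x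
  \<comment> \<open>What remains of u when the positive part f of Re u is removed: |u|^2 = |f|^2 +
    |p|^2, and increments satisfy the corresponding inequality.\<close>
  define p where "p x = Complex (max 0 (- Re (u x))) (Im (u x))" for x
  have [measurable]: "f \<in> borel_measurable borel" unfolding f_def by measurable
  have [measurable]: "p \<in> borel_measurable borel" unfolding p_def[abs_def] borel_measurable_complex_iff by simp
  have up: "(norm (u x))\<^sup>2 = (norm (f x))\<^sup>2 + (norm (p x))\<^sup>2" for x
    by (auto simp: f_def p_def cmod_power2 max_def)
  have split: "(norm (f x - f y))\<^sup>2 + (norm (p x - p y))\<^sup>2 \<le> (norm (u x - u y))\<^sup>2" for x y
  proof -
    have key: "(max 0 a - max 0 b)\<^sup>2 + (max 0 (- a) - max 0 (- b))\<^sup>2 \<le> (a - b)\<^sup>2" for a b :: real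
    proof -
      have ge: "0 \<le> max 0 a * max 0 (- b) + max 0 b * max 0 (- a)" by (intro add_nonneg_nonneg mult_nonneg_nonneg) auto
      have eqs: "a = max 0 a - max 0 (- a)" "b = max 0 b - max 0 (- b)" "max 0 a * max 0 (- a) = 0" "max 0 b * max 0 (- b) = 0"
        by (auto simp: max_def)
      have "(a - b)\<^sup>2 = (max 0 a - max 0 b)\<^sup>2 + (max 0 (- a) - max 0 (- b))\<^sup>2
          + 2 * (max 0 a * max 0 (- b) + max 0 b * max 0 (- a)) - 2 * (max 0 a * max 0 (- a)) - 2 * (max 0 b * max 0 (- b))"
        by (subst eqs(1), subst eqs(2)) (simp add: power2_eq_square algebra_simps)
      then show ?thesis using ge unfolding eqs(3,4) by simp
    qed
    show ?thesis using key[of "Re (u x)" "Re (u y)"] by (simp add: f_def p_def cmod_power2)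
  qed
  have fu: "total_energy \<alpha> u < \<infinity>" using u by (simp add: is_min_def)
  then have ku: "kin i u < \<infinity>" for i
  proof -
    have "kinetic u \<le> total_energy \<alpha> u" by (simp add: total_energy_def add.assoc)
    then have "kinetic u < \<infinity>" using fu by (rule le_less_trans)
    then show ?thesis unfolding kinetic_less_top_iff by blast
  qed
  have kfp: "kin i f + kin i p \<le> kin i u" for i
    by (rule kin_add_le[OF _ _ _ ku split]) measurable
  have fin: "kin i f < \<infinity>" "kin i p < \<infinity>" for i
    using le_less_trans[OF kfp ku, of i] by auto
  define T where "T = pot g + 1 / 2 * hartree2 \<alpha> (dens g) (dens g)"
  have tg: "total_energy \<alpha> g = kinetic g + T" by (simp add: total_energy_def T_def add.assoc)
  have Tg: "kinetic g < \<infinity>" "T < \<infinity>" using c(3) unfolding g_def[abs_def, symmetric] tg by auto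
  \<comment> \<open>The total energy of g, which bounds the first-order cost of moving towards
    g.\<close>
  define C where "C = enn2real (kinetic g + T)"
  have C: "C \<ge> 0" "ennreal C = kinetic g + T" using Tg by (auto simp: C_def less_top)
  have "(AE x in lborel. f x = 0) \<or> (AE x in lborel. f x > 0)"
  proof (rule zero_or_positive[OF _ _ c(1) C(1) fin(1)])
    fix i and t :: real assume t: "0 < t" "t \<le> 1 / 2"
    define b where "b = blend t f g"
    have [measurable]: "b \<in> borel_measurable borel" unfolding b_def by measurable
    \<comment> \<open>The competitor blends the density of all of u, which keeps its mass equal to
      m. It is also the norm of the vector (b, sqrt (1 - t) p), which separates the perturbed part
      from p.\<close>
    define W where "W = blend t u g"
    have [measurable]: "W \<in> borel_measurable borel" unfolding W_def by measurable
    have WA: "W \<in> admissible m"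
    proof -
      have "sqnorm W = ennreal (1 - t) * ennreal m + ennreal t * ennreal m"
        unfolding W_def using u c(2) t by (subst sqnorm_blend) (auto simp: is_min_def g_def[abs_def])
      also have "\<dots> = ennreal m" by (rule ennreal_convex_same) (use t in auto)
      finally show ?thesis using t by (auto simp: admissible_def W_def blend_nonneg)
    qed
    define V where "V = pot u + 1 / 2 * hartree2 \<alpha> (dens u) (dens u)"
    have tu: "total_energy \<alpha> u = kinetic u + V" by (simp add: total_energy_def V_def add.assoc)
    have V: "V < \<infinity>" using fu unfolding tu by auto
    have kW: "kin i W \<le> ennreal 1 * kin i b + ennreal (1 - t) * kin i p" for i
    proof (rule kin_mono2)
      fix x y
      define q where "q x = (b x, sqrt (1 - t) *\<^sub>R p x)" for x
      have "W x = norm (q x)" for x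
      proof -
        have b2: "(b x)\<^sup>2 = (1 - t) * (norm (f x))\<^sup>2 + t * (norm (g x))\<^sup>2" unfolding b_def using t by (simp add: blend_square)
        have "(1 - t) * (norm (u x))\<^sup>2 + t * (norm (g x))\<^sup>2 = (norm (b x))\<^sup>2 + (norm (sqrt (1 - t) *\<^sub>R p x))\<^sup>2"
          using t by (simp add: up b2 power_mult_distrib algebra_simps)
        then show ?thesis unfolding W_def q_def norm_Pair blend_def by simp
      qed
      then have "\<bar>W x - W y\<bar> \<le> norm (q x - q y)" by (simp add: norm_triangle_ineq3)
      then have "\<bar>W x - W y\<bar>\<^sup>2 \<le> (norm (q x - q y))\<^sup>2" by (intro power_mono) auto
      also have "\<dots> = (norm (b x - b y))\<^sup>2 + (1 - t) * (norm (p x - p y))\<^sup>2"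
        using t by (simp add: q_def norm_Pair power_mult_distrib flip: scaleR_diff_right)
      finally show "(norm (W x - W y))\<^sup>2 \<le> 1 * (norm (b x - b y))\<^sup>2 + (1 - t) * (norm (p x - p y))\<^sup>2" by simp
    qed (use t in auto)
    have kb: "kin i b \<le> ennreal (1 - t) * kin i f + ennreal t * kin i g" for i
      unfolding b_def using t by (intro kin_blend) auto
    have kg: "kin i g < \<infinity>" for i using Tg(1) unfolding kinetic_less_top_iff by blast
    have kbfin: "kin i b < \<infinity>" for i
      using le_less_trans[OF kb] fin(1)[of i] kg[of i] by (simp add: ennreal_mult_less_top)
    have "kinetic u + V \<le> total_energy \<alpha> W" using u WA unfolding tu[symmetric] by (simp add: is_min_def)
    also have "\<dots> \<le> (\<Sum>i\<in>UNIV. ennreal 1 * kin i b + ennreal (1 - t) * kin i p) + (ennreal (1 - t) * V + ennreal t * T)"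
    proof -
      have "kinetic W \<le> (\<Sum>i\<in>UNIV. ennreal 1 * kin i b + ennreal (1 - t) * kin i p)"
        unfolding kinetic_def by (intro sum_mono kW)
      moreover have "pot W + 1 / 2 * hartree2 \<alpha> (dens W) (dens W) \<le> ennreal (1 - t) * V + ennreal t * T"
      proof -
        have "1 / 2 * hartree2 \<alpha> (dens W) (dens W) \<le>
          1 / 2 * (ennreal (1 - t) * hartree2 \<alpha> (dens u) (dens u) + ennreal t * hartree2 \<alpha> (dens g) (dens g))"
          unfolding W_def using t by (intro mult_left_mono hartree2_blend \<alpha>) auto
        moreover have "pot W = ennreal (1 - t) * pot u + ennreal t * pot g"
          unfolding W_def using t by (intro pot_blend) auto
        ultimately have "pot W + 1 / 2 * hartree2 \<alpha> (dens W) (dens W) \<le> ennreal (1 - t) * pot u + ennreal t * pot g +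
          1 / 2 * (ennreal (1 - t) * hartree2 \<alpha> (dens u) (dens u) + ennreal t * hartree2 \<alpha> (dens g) (dens g))"
          by (intro add_mono) auto
        also have "\<dots> = ennreal (1 - t) * V + ennreal t * T"
          unfolding V_def T_def by (simp only: distrib_left mult.left_commute[of "1 / 2"] add_ac)
        finally show ?thesis .
      qed
      ultimately show ?thesis unfolding total_energy_def add.assoc[of "kinetic W"] by (rule add_mono)
    qed
    finally have main: "kinetic u + V \<le>
      (\<Sum>i\<in>UNIV. ennreal 1 * kin i b + ennreal (1 - t) * kin i p) + (ennreal (1 - t) * V + ennreal t * T)" .
    \<comment> \<open>All quantities are finite, so the comparison continues in real numbers, where
      terms can be cancelled.\<close>
    obtain F where F: "\<And>i. kin i f = ennreal (F i)" "\<And>i. F i \<ge> 0"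
      using that[of "\<lambda>i. enn2real (kin i f)"] fin(1) by (simp add: less_top)
    obtain P where P: "\<And>i. kin i p = ennreal (P i)" "\<And>i. P i \<ge> 0"
      using that[of "\<lambda>i. enn2real (kin i p)"] fin(2) by (simp add: less_top)
    obtain B where B: "\<And>i. kin i b = ennreal (B i)" "\<And>i. B i \<ge> 0"
      using that[of "\<lambda>i. enn2real (kin i b)"] kbfin by (simp add: less_top)
    obtain G where G: "\<And>i. kin i g = ennreal (G i)" "\<And>i. G i \<ge> 0"
      using that[of "\<lambda>i. enn2real (kin i g)"] kg by (simp add: less_top)
    obtain U where U: "\<And>i. kin i u = ennreal (U i)" "\<And>i. U i \<ge> 0"
      using that[of "\<lambda>i. enn2real (kin i u)"] ku by (simp add: less_top)
    obtain V' where V': "V = ennreal V'" "V' \<ge> 0" using V by (cases V) auto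
    obtain T' where T': "T = ennreal T'" "T' \<ge> 0" using Tg(2) by (cases T) auto
    have FPU: "F i + P i \<le> U i" for i
      using kfp[of i] F(2)[of i] P(2)[of i] U(2)[of i] by (simp add: F(1) P(1) U(1) flip: ennreal_plus)
    have BFG: "B i \<le> (1 - t) * F i + t * G i" for i
    proof -
      have "ennreal (B i) \<le> ennreal ((1 - t) * F i + t * G i)"
        using kb[of i] t F(2)[of i] G(2)[of i] by (simp add: F(1) B(1) G(1) ennreal_mult ennreal_plus)
      then show ?thesis using t F(2)[of i] G(2)[of i] by (subst (asm) ennreal_le_iff) auto
    qed
    have "(\<Sum>i\<in>UNIV. U i) + V' \<le> (\<Sum>i\<in>UNIV. B i + (1 - t) * P i) + ((1 - t) * V' + t * T')"
    proof -
      have "ennreal ((\<Sum>i\<in>UNIV. U i) + V') = kinetic u + V"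
        using U V' by (simp add: kinetic_def sum_ennreal sum_nonneg)
      moreover have "ennreal ((\<Sum>i\<in>UNIV. B i + (1 - t) * P i) + ((1 - t) * V' + t * T')) =
        (\<Sum>i\<in>UNIV. ennreal 1 * kin i b + ennreal (1 - t) * kin i p) + (ennreal (1 - t) * V + ennreal t * T)"
      proof -
        have "ennreal 1 * kin i b + ennreal (1 - t) * kin i p = ennreal (B i + (1 - t) * P i)" for i
          using t B(2)[of i] P(2)[of i] by (simp add: B(1) P(1) ennreal_mult ennreal_plus)
        moreover have "ennreal (1 - t) * V + ennreal t * T = ennreal ((1 - t) * V' + t * T')"
          using t V' T' by (simp add: ennreal_mult ennreal_plus)
        moreover have "0 \<le> B i + (1 - t) * P i" for i using t B(2)[of i] P(2)[of i] by simp
        ultimately show ?thesis using t V' T' by (simp add: sum_ennreal sum_nonneg ennreal_plus)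
      qed
      ultimately have "ennreal ((\<Sum>i\<in>UNIV. U i) + V') \<le> ennreal ((\<Sum>i\<in>UNIV. B i + (1 - t) * P i) + ((1 - t) * V' + t * T'))"
        using main by (simp only:)
      moreover have "0 \<le> (\<Sum>i\<in>UNIV. B i + (1 - t) * P i) + ((1 - t) * V' + t * T')"
        using t B(2) P(2) V' T' by (intro add_nonneg_nonneg sum_nonneg mult_nonneg_nonneg) auto
      ultimately show ?thesis by (subst (asm) ennreal_le_iff) auto
    qed
    moreover have "(\<Sum>i\<in>UNIV. F i + P i) \<le> (\<Sum>i\<in>UNIV. U i)" by (intro sum_mono FPU)
    moreover have "(\<Sum>i\<in>UNIV. (1 - t) * P i) \<le> (\<Sum>i\<in>UNIV. P i)"
      using t P(2) by (intro sum_mono) (simp add: mult_left_le_one_le)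
    moreover have "(1 - t) * V' \<le> V'" using t V' by (simp add: mult_left_le_one_le)
    ultimately have S: "(\<Sum>i\<in>UNIV. F i) \<le> (\<Sum>i\<in>UNIV. B i) + t * T'" by (simp add: sum.distrib)
    \<comment> \<open>Minimality controls only the sum over all directions. In the directions other
      than i, convexity bounds the energy of b from above, which isolates direction i.\<close>
    have "(\<Sum>j\<in>UNIV - {i}. B j) \<le> (\<Sum>j\<in>UNIV - {i}. F j + t * G j)"
    proof (intro sum_mono)
      fix j
      have "(1 - t) * F j \<le> F j" using t F(2) by (simp add: mult_left_le_one_le)
      then show "B j \<le> F j + t * G j" using BFG[of j] by linarith
    qed
    also have "\<dots> = (\<Sum>j\<in>UNIV - {i}. F j) + t * (\<Sum>j\<in>UNIV - {i}. G j)"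
      by (simp add: sum.distrib sum_distrib_left)
    also have "t * (\<Sum>j\<in>UNIV - {i}. G j) \<le> t * (\<Sum>j\<in>UNIV. G j)"
      using t G(2) by (intro mult_left_mono sum_mono2) auto
    finally have "F i \<le> B i + t * ((\<Sum>j\<in>UNIV. G j) + T')"
      using S sum.remove[of UNIV i F] sum.remove[of UNIV i B] by (simp add: distrib_left)
    moreover have "(1 - t) * F i \<le> F i" using t F(2) by (simp add: mult_left_le_one_le)
    moreover have "C = (\<Sum>j\<in>UNIV. G j) + T'"
    proof -
      have "ennreal C = ennreal ((\<Sum>j\<in>UNIV. G j) + T')"
        using C(2) G T' by (simp add: kinetic_def sum_ennreal sum_nonneg ennreal_plus)
      then show ?thesis using C(1) G(2) T' by (subst (asm) ennreal_inj) (auto intro!: add_nonneg_nonneg sum_nonneg)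
    qed
    ultimately have "(1 - t) * F i \<le> B i + t * C" by simp
    from ennreal_leI[OF this]
    show "ennreal (1 - t) * kin i f \<le> kin i (blend t f (\<lambda>x. c * ref x)) + ennreal (t * C)"
      using t C(1) F(2) B(2)[of i]
      by (simp add: F(1) B(1)[unfolded b_def g_def[abs_def]] ennreal_mult ennreal_plus)
  qed (auto simp: f_def)
  then show ?thesis
  proof
    assume "AE x in lborel. f x = 0"
    then have "AE x in lborel. Re (u x) \<le> 0" by eventually_elim (simp add: f_def max_def split: if_splits)
    then show ?thesis ..
  next
    assume "AE x in lborel. f x > 0"
    then have "AE x in lborel. Re (u x) > 0" by eventually_elim (simp add: f_def max_def split: if_splits)
    then show ?thesis ..
  qed
qed

section \<open>Uniqueness of the modulus and of the phase\<close>

text \<open>The dichotomy is applied to |u|, which is again a minimizer; vanishing almost everywhere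
  contradicts m > 0.\<close>

lemma minimizer_norm_pos:
  fixes u :: "real ^ 'n \<Rightarrow> complex"
  assumes \<alpha>: "0 < \<alpha>" "\<alpha> < real CARD('n)" and m: "m > 0" and u: "is_min \<alpha> m u"
  shows "AE x in lborel. norm (u x) > 0"
proof -
  have "\<not> (AE x in lborel. Re (complex_of_real (norm (u x))) \<le> 0)"
  proof
    assume "AE x in lborel. Re (complex_of_real (norm (u x))) \<le> 0"
    then have "AE x in lborel. ennreal ((norm (u x))\<^sup>2) = 0" by eventually_elim auto
    then have "sqnorm u = (\<integral>\<^sup>+x. 0 \<partial>(lborel :: (real ^ 'n) measure))"
      unfolding sqnorm_def by (rule nn_integral_cong_AE)
    then show False using u m by (simp add: is_min_def)
  qed
  then have "AE x in lborel. Re (complex_of_real (norm (u x))) > 0"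
    using minimizer_Re_sign[OF \<alpha> m is_min_norm[OF u]] by blast
  then show ?thesis by simp
qed

text \<open>The blend with t = 1/2 is a competitor whose kinetic and potential parts are at most the
  mean values. Minimality of u and v therefore forces D(a,a) + D(b,b) \<le> 2 D(a,b) for the two
  densities, the equality case of positive definiteness.\<close>

lemma minimizer_norm_unique:
  fixes u v :: "real ^ 'n \<Rightarrow> complex"
  assumes \<alpha>: "0 < \<alpha>" "\<alpha> < real CARD('n)" and m: "m > 0" and u: "is_min \<alpha> m u" and v: "is_min \<alpha> m v"
  shows "AE x in lborel. norm (u x) = norm (v x)"
proof -
  have [measurable]: "u \<in> borel_measurable borel" "v \<in> borel_measurable borel" using u v by (simp_all add: is_min_def)
  define w where "w = blend (1 / 2) u v"
  let ?a = "hartree2 \<alpha> (dens u) (dens u)" and ?b = "hartree2 \<alpha> (dens v) (dens v)" and ?ab = "hartree2 \<alpha> (dens u) (dens v)"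
  let ?h = "ennreal (1 / 2)"
  have wA: "w \<in> admissible m"
  proof -
    have "sqnorm w = ennreal (1 - 1 / 2) * ennreal m + ennreal (1 / 2) * ennreal m"
      unfolding w_def using u v by (subst sqnorm_blend) (auto simp: is_min_def)
    also have "\<dots> = ennreal m" by (rule ennreal_convex_same) auto
    finally show ?thesis by (auto simp: admissible_def w_def blend_nonneg)
  qed
  have fin: "kinetic u < \<infinity>" "pot u < \<infinity>" "?a < \<infinity>" "kinetic v < \<infinity>" "pot v < \<infinity>" "?b < \<infinity>"
    using u v by (auto simp: is_min_def total_energy_def ennreal_mult_less_top ennreal_mult_eq_top_iff less_top[symmetric])
  have "2 * ?ab < \<infinity>"
    using hartree2_two_le[OF \<alpha>, of "dens u" "dens v"] fin(3,6) by (auto intro: le_less_trans)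
  then have fab: "?ab < \<infinity>" by (auto simp: ennreal_mult_less_top)
  have hw: "hartree2 \<alpha> (dens w) (dens w) = ?h * ?h * ?a + ?h * ?h * (2 * ?ab) + ?h * ?h * ?b"
  proof -
    have d: "dens w = (\<lambda>x. ?h * dens u x + ?h * dens v x)"
      unfolding w_def using dens_blend[of "1 / 2" u v] by simp
    show ?thesis unfolding d by (rule hartree2_combination[OF \<alpha>]) measurable
  qed
  have tw: "total_energy \<alpha> w \<le> (?h * kinetic u + ?h * kinetic v) + (?h * pot u + ?h * pot v) +
     ?h * (?h * ?h * ?a + ?h * ?h * (2 * ?ab) + ?h * ?h * ?b)"
    unfolding total_energy_def hw half_ennreal
    using kinetic_blend[of u v "1 / 2"] pot_blend[of u v "1 / 2"]
    by (intro add_mono) (simp_all add: w_def)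
  obtain A B X k1 k2 p1 p2 where r: "?a = ennreal A" "?b = ennreal B" "?ab = ennreal X" "kinetic u = ennreal k1"
     "kinetic v = ennreal k2" "pot u = ennreal p1" "pot v = ennreal p2"
     "A \<ge> 0" "B \<ge> 0" "X \<ge> 0" "k1 \<ge> 0" "k2 \<ge> 0" "p1 \<ge> 0" "p2 \<ge> 0"
    using fin fab that[of "enn2real ?a" "enn2real ?b" "enn2real ?ab" "enn2real (kinetic u)" "enn2real (kinetic v)"
       "enn2real (pot u)" "enn2real (pot v)"] by (simp add: less_top)
  define Z where "Z = (1 / 2 * k1 + 1 / 2 * k2) + (1 / 2 * p1 + 1 / 2 * p2) +
     1 / 2 * (1 / 2 * (1 / 2) * A + 1 / 2 * (1 / 2) * (2 * X) + 1 / 2 * (1 / 2) * B)"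
  have Z: "(?h * kinetic u + ?h * kinetic v) + (?h * pot u + ?h * pot v) +
     ?h * (?h * ?h * ?a + ?h * ?h * (2 * ?ab) + ?h * ?h * ?b) = ennreal Z" "Z \<ge> 0"
  proof -
    have "(?h * kinetic u + ?h * kinetic v) + (?h * pot u + ?h * pot v) +
       ?h * (?h * ?h * ?a + ?h * ?h * (ennreal 2 * ?ab) + ?h * ?h * ?b) = ennreal Z"
      unfolding r Z_def using r(8-)
      by (simp only: ennreal_mult ennreal_plus add_nonneg_nonneg mult_nonneg_nonneg zero_le_divide_1_iff zero_le_numeral)
    then show "(?h * kinetic u + ?h * kinetic v) + (?h * pot u + ?h * pot v) +
     ?h * (?h * ?h * ?a + ?h * ?h * (2 * ?ab) + ?h * ?h * ?b) = ennreal Z" by (simp only: ennreal_numeral zero_le_numeral)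
    show "Z \<ge> 0" using r(8-) by (simp add: Z_def)
  qed
  have tu: "total_energy \<alpha> u = ennreal (k1 + p1 + 1 / 2 * A)" "total_energy \<alpha> v = ennreal (k2 + p2 + 1 / 2 * B)"
    unfolding total_energy_def r half_ennreal using r(8-)
    by (simp_all only: ennreal_mult ennreal_plus add_nonneg_nonneg mult_nonneg_nonneg zero_le_divide_1_iff zero_le_numeral)
  have "total_energy \<alpha> u \<le> ennreal Z" "total_energy \<alpha> v \<le> ennreal Z"
    using u v wA tw unfolding Z(1) is_min_def by (auto intro: order_trans)
  then have "k1 + p1 + 1 / 2 * A \<le> Z" "k2 + p2 + 1 / 2 * B \<le> Z"
    unfolding tu using Z(2) by (simp_all only: ennreal_le_iff)
  then have "A + B \<le> 2 * X" unfolding Z_def by argo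
  then have "ennreal (A + B) \<le> ennreal (2 * X)" by (rule ennreal_leI)
  then have "?a + ?b \<le> 2 * ?ab" using r by (simp add: ennreal_mult)
  then have sm: "AE t in lborel. t > 0 \<longrightarrow> (AE z in lborel. gsmooth t z (dens u) = gsmooth t z (dens v))"
    by (intro AE_gsmooth_eq[OF \<alpha>] fin) measurable
  have "AE x in lborel. (norm (u x))\<^sup>2 = (norm (v x))\<^sup>2"
  proof (rule AE_eq_of_gsmooth_eq)
    show "integrable lborel (\<lambda>x. (norm (u x))\<^sup>2)" "integrable lborel (\<lambda>x. (norm (v x))\<^sup>2)"
      using u v by (auto simp: integrable_iff_bounded is_min_def sqnorm_def)
  qed (use sm in \<open>auto simp: dens_def[abs_def]\<close>)
  then show ?thesis by eventually_elim (auto simp: power2_eq_iff_nonneg)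
qed

text \<open>A rotation makes the integral of Re v |u| equal to 0. The dichotomy gives Re v a sign,
  so Re v = 0. Then Im v, the real part of another rotation, has a sign as well, and v is a constant
  multiple of |u|.\<close>

lemma minimizer_phase:
  fixes u :: "real ^ 'n \<Rightarrow> complex"
  assumes \<alpha>: "0 < \<alpha>" "\<alpha> < real CARD('n)" and m: "m > 0" and u: "is_min \<alpha> m u"
  shows "\<exists>\<theta>::real. AE x in lborel. u x = complex_of_real (norm (u x)) * exp (\<i> * of_real \<theta>)"
proof -
  have [measurable]: "u \<in> borel_measurable borel" using u by (simp add: is_min_def)
  have sq: "square_integrable u" "square_integrable (\<lambda>x. complex_of_real (norm (u x)))"
    using u by (auto simp: square_integrable_iff is_min_def sqnorm_def)
  define z where "z = (LINT x|lborel. u x * complex_of_real (norm (u x)))"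
  \<comment> \<open>For nonzero z the rotation sends z to \<i> |z|, on the imaginary axis.\<close>
  define c where "c = (if z = 0 then 1 else \<i> * cnj z / norm z)"
  have c1: "norm c = 1" by (simp add: c_def norm_mult norm_divide)
  have cz: "Re (c * z) = 0"
  proof (cases "z = 0")
    case False
    have "c * z = \<i> * (z * cnj z) / norm z" using False by (simp add: c_def mult_ac)
    also have "\<dots> = \<i> * of_real ((norm z)\<^sup>2 / norm z)" by (simp add: complex_norm_square[symmetric])
    finally show ?thesis by simp
  qed simp
  define v where "v x = c * u x" for x
  have v: "is_min \<alpha> m v" unfolding v_def[abs_def] by (rule is_min_unimodular[OF u c1])
  have nv: "norm (v x) = norm (u x)" for x by (simp add: v_def norm_mult c1)
  have pos: "AE x in lborel. norm (u x) > 0" by (rule minimizer_norm_pos[OF \<alpha> m u])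
  have i: "integrable lborel (\<lambda>x. v x * complex_of_real (norm (u x)))"
    unfolding v_def by (intro integrable_mult_square_integrable square_integrable_cmult sq)
  have i0: "(LINT x|lborel. Re (v x) * norm (u x)) = 0"
  proof -
    have "(LINT x|lborel. Re (v x) * norm (u x)) = (LINT x|lborel. Re (v x * complex_of_real (norm (u x))))" by simp
    also have "\<dots> = Re (LINT x|lborel. v x * complex_of_real (norm (u x)))" by (rule integral_Re[OF i])
    also have "\<dots> = Re (c * z)" by (simp add: v_def z_def mult.assoc)
    finally show ?thesis by (simp only: cz)
  qed
  have ir: "integrable lborel (\<lambda>x. Re (v x) * norm (u x))" using integrable_Re[OF i] by simp
  have int0: "AE x in lborel. Re (v x) * norm (u x) = 0"
    if "(AE x in lborel. 0 \<le> Re (v x) * norm (u x)) \<or> (AE x in lborel. 0 \<le> - (Re (v x) * norm (u x)))"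
    using that
  proof
    assume "AE x in lborel. 0 \<le> Re (v x) * norm (u x)"
    from iffD1[OF integral_nonneg_eq_0_iff_AE[OF ir this] i0] show ?thesis .
  next
    assume nn: "AE x in lborel. 0 \<le> - (Re (v x) * norm (u x))"
    have "(LINT x|lborel. - (Re (v x) * norm (u x))) = 0" using i0 by simp
    from iffD1[OF integral_nonneg_eq_0_iff_AE[OF integrable_minus[OF ir] nn] this]
    show ?thesis by eventually_elim simp
  qed
  have re0: "AE x in lborel. Re (v x) = 0"
  proof -
    have "AE x in lborel. Re (v x) * norm (u x) = 0"
    proof (rule int0)
      show "(AE x in lborel. 0 \<le> Re (v x) * norm (u x)) \<or> (AE x in lborel. 0 \<le> - (Re (v x) * norm (u x)))"
        using minimizer_Re_sign[OF \<alpha> m v]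
      proof
        assume "AE x in lborel. Re (v x) \<le> 0"
        then have "AE x in lborel. 0 \<le> - (Re (v x) * norm (u x))"
          by eventually_elim (simp add: mult_nonpos_nonneg)
        then show ?thesis ..
      next
        assume "AE x in lborel. Re (v x) > 0"
        then have "AE x in lborel. 0 \<le> Re (v x) * norm (u x)" by eventually_elim simp
        then show ?thesis ..
      qed
    qed
    then show ?thesis using pos by eventually_elim auto
  qed
  have im: "(AE x in lborel. Im (v x) \<le> 0) \<or> (AE x in lborel. Im (v x) > 0)"
    using minimizer_Re_sign[OF \<alpha> m is_min_unimodular[OF v, of "- \<i>"]] by simp
  have "\<exists>d. norm d = 1 \<and> (AE x in lborel. v x = d * complex_of_real (norm (u x)))"
    using im
  proof
    assume "AE x in lborel. Im (v x) \<le> 0"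
    then have "AE x in lborel. v x = - \<i> * complex_of_real (norm (u x))"
      using re0
    proof eventually_elim
      case (elim x)
      then have "norm (u x) = - Im (v x)" using nv[of x] by (simp add: cmod_def)
      then show ?case using elim by (simp add: complex_eq_iff)
    qed
    then show ?thesis by (intro exI[of _ "- \<i>"]) simp
  next
    assume "AE x in lborel. Im (v x) > 0"
    then have "AE x in lborel. v x = \<i> * complex_of_real (norm (u x))"
      using re0
    proof eventually_elim
      case (elim x)
      then have "norm (u x) = Im (v x)" using nv[of x] by (simp add: cmod_def)
      then show ?case using elim by (simp add: complex_eq_iff)
    qed
    then show ?thesis by (intro exI[of _ "\<i>"]) simp
  qed
  then obtain d where d: "norm d = 1" "AE x in lborel. v x = d * complex_of_real (norm (u x))" by blast
  have "norm (d / c) = 1" using d c1 by (simp add: norm_divide)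
  then obtain \<theta> where \<theta>: "d / c = exp (\<i> * of_real \<theta>)"
    using that[of "Arg2pi (d / c)"] complex_norm_eq_1_exp[of "d / c"] by simp
  have "c \<noteq> 0" using c1 by auto
  from d(2) have "AE x in lborel. u x = complex_of_real (norm (u x)) * exp (\<i> * of_real \<theta>)"
  proof eventually_elim
    case (elim x)
    then have "u x = (d / c) * complex_of_real (norm (u x))" using \<open>c \<noteq> 0\<close> by (simp add: v_def field_simps)
    then show ?case by (simp add: \<theta> mult.commute)
  qed
  then show ?thesis by blast
qed

section \<open>Equivalence with minimization over the energy space\<close>

lemma of_real_energy_space:
  fixes w :: "real ^ 'n \<Rightarrow> real"
  assumes w: "w \<in> admissible m" and m: "m > 0" and fin: "total_energy \<alpha> w < \<infinity>"
  shows "(\<lambda>x. complex_of_real (w x)) \<in> energy_space" "mass (\<lambda>x. complex_of_real (w x)) = m"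
    "energy \<alpha> (\<lambda>x. complex_of_real (w x)) = 1 / 2 * total_energy \<alpha> w"
proof -
  have wm[measurable]: "w \<in> borel_measurable borel" using w by (simp add: admissible_def)
  have sq: "square_integrable (\<lambda>x. complex_of_real (w x))"
    using w by (auto simp: square_integrable_iff sqnorm_of_real admissible_def)
  have t: "total_energy \<alpha> (\<lambda>x. complex_of_real (w x)) < \<infinity>" using fin by (simp add: total_energy_of_real)
  show es: "(\<lambda>x. complex_of_real (w x)) \<in> energy_space"
    using sq t by (auto simp: energy_space_iff total_energy_def)
  show "mass (\<lambda>x. complex_of_real (w x)) = m"
    using sqnorm_eq_mass[OF sq] w m mass_nonneg[of "\<lambda>x. complex_of_real (w x)"]
    by (auto simp: sqnorm_of_real admissible_def)
  show "energy \<alpha> (\<lambda>x. complex_of_real (w x)) = 1 / 2 * total_energy \<alpha> w"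
    by (simp add: energy_eq[OF es] total_energy_of_real)
qed

lemma half_mult_le_iff: "(1 / 2 :: ennreal) * a \<le> 1 / 2 * b \<longleftrightarrow> a \<le> b"
  by (rule ennreal_mult_le_mult_iff) (auto simp: half_ennreal)

text \<open>Existence enters already here: it shows that the infimum is finite, so that a minimizer
  has finite total energy. Conversely, an arbitrary competitor is replaced by its modulus.\<close>

lemma is_minimizer_iff:
  fixes u :: "real ^ 'n \<Rightarrow> complex"
  assumes \<alpha>: "0 < \<alpha>" "\<alpha> < real CARD('n)" and m: "m > 0"
  shows "is_minimizer \<alpha> m u \<longleftrightarrow> is_min \<alpha> m u"
proof
  assume u: "is_minimizer \<alpha> m u"
  then have es: "u \<in> energy_space" and mu: "mass u = m" and eu: "energy \<alpha> u = min_energy TYPE('n) \<alpha> m"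
    by (auto simp: is_minimizer_def)
  have sq: "square_integrable u" using es by (simp add: energy_space_iff)
  have le: "total_energy \<alpha> u \<le> total_energy \<alpha> w" if w: "w \<in> admissible m" for w :: "real ^ 'n \<Rightarrow> real"
  proof (cases "total_energy \<alpha> w < \<infinity>")
    case True
    note ww = of_real_energy_space[OF w m True]
    have "min_energy TYPE('n) \<alpha> m \<le> energy \<alpha> (\<lambda>x. complex_of_real (w x))"
      unfolding min_energy_def using ww by (intro INF_lower) auto
    then have "1 / 2 * total_energy \<alpha> u \<le> 1 / 2 * total_energy \<alpha> w"
      unfolding eu[symmetric] energy_eq[OF es] ww(3) .
    then show ?thesis by (simp only: half_mult_le_iff)
  qed (simp add: not_less top_unique)
  obtain w :: "real ^ 'n \<Rightarrow> real" where "w \<in> admissible m" "total_energy \<alpha> w < \<infinity>"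
    using exists_minimizer[OF \<alpha> m] by blast
  then have "total_energy \<alpha> u < \<infinity>" using le le_less_trans by blast
  then show "is_min \<alpha> m u"
    unfolding is_min_def using le square_integrableD(1)[OF sq] sqnorm_eq_mass[OF sq] mu by auto
next
  assume u: "is_min \<alpha> m u"
  have fin: "total_energy \<alpha> u < \<infinity>" using u by (auto simp: is_min_def)
  have sq: "square_integrable u" using u by (auto simp: is_min_def square_integrable_iff)
  have es: "u \<in> energy_space" using sq fin by (auto simp: energy_space_iff total_energy_def)
  have mu: "mass u = m" using sqnorm_eq_mass[OF sq] u m mass_nonneg[of u] by (auto simp: is_min_def)
  have "energy \<alpha> u \<le> energy \<alpha> v" if v: "v \<in> energy_space" "mass v = m" for v :: "real ^ 'n \<Rightarrow> complex"
  proof -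
    have vq: "square_integrable v" using v by (simp add: energy_space_iff)
    note vm = square_integrableD(1)[OF vq]
    have "(\<lambda>x. norm (v x)) \<in> admissible m"
      using sqnorm_eq_mass[OF vq] v(2) vm by (auto simp: admissible_def sqnorm_def)
    then have "total_energy \<alpha> u \<le> total_energy \<alpha> (\<lambda>x. norm (v x))" using u by (auto simp: is_min_def)
    also have "\<dots> \<le> total_energy \<alpha> v" by (rule total_energy_norm_le[OF vm])
    finally show ?thesis unfolding energy_eq[OF es] energy_eq[OF v(1)] by (simp only: half_mult_le_iff)
  qed
  then have "energy \<alpha> u = min_energy TYPE('n) \<alpha> m"
    unfolding min_energy_def using es mu by (intro antisym INF_greatest INF_lower) auto
  then show "is_minimizer \<alpha> m u" using es mu by (simp add: is_minimizer_def)
qed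

section \<open>The Euler-Lagrange equation\<close>

text \<open>A polynomial in t that vanishes at 0 and is nonnegative on (0,1] has a nonnegative
  linear coefficient. The polynomial is the comparison of u with the rescaled curve, multiplied by
  the square of the mass m + 2 t m1 + t^2 m2 of the curve to clear denominators.\<close>

lemma first_variation_nonneg:
  fixes m m1 m2 a0 a1 a2 D0 \<delta> C :: real
  assumes nn: "\<And>t. 0 < t \<Longrightarrow> t \<le> 1 \<Longrightarrow> 0 \<le> m * (m + 2 * t * m1 + t\<^sup>2 * m2) * (a0 + 2 * t * a1 + t\<^sup>2 * a2) +
      1 / 2 * m\<^sup>2 * (D0 + 2 * t * \<delta> + C * t\<^sup>2) - (a0 + 1 / 2 * D0) * (m + 2 * t * m1 + t\<^sup>2 * m2)\<^sup>2"
  shows "0 \<le> 2 * m\<^sup>2 * a1 + m\<^sup>2 * \<delta> - 2 * m * m1 * (a0 + D0)"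
proof -
  define d where "d = a0 + 1 / 2 * D0"
  define g1 where "g1 = 2 * m\<^sup>2 * a1 + m\<^sup>2 * \<delta> - 2 * m * m1 * (a0 + D0)"
  define P where "P t = (m * (m * a2 + 4 * m1 * a1 + m2 * a0) - d * (4 * m1\<^sup>2 + 2 * m * m2) + 1 / 2 * m\<^sup>2 * C) +
    t * (m * (2 * m1 * a2 + 2 * m2 * a1) - 4 * d * m1 * m2) + t\<^sup>2 * (m * m2 * a2 - d * m2\<^sup>2)" for t :: real
  have "0 \<le> g1 + t * P t" if t: "0 < t" "t \<le> 1" for t
  proof -
    have "m * (m + 2 * t * m1 + t\<^sup>2 * m2) * (a0 + 2 * t * a1 + t\<^sup>2 * a2) +
      1 / 2 * m\<^sup>2 * (D0 + 2 * t * \<delta> + C * t\<^sup>2) - (a0 + 1 / 2 * D0) * (m + 2 * t * m1 + t\<^sup>2 * m2)\<^sup>2 = t * (g1 + t * P t)"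
      unfolding g1_def P_def d_def by (simp add: power2_eq_square field_simps)
    then have "0 \<le> t * (g1 + t * P t)" using nn[OF t] by simp
    then show ?thesis using t by (simp add: zero_le_mult_iff)
  qed
  then have ev: "\<forall>\<^sub>F t in at_right 0. 0 \<le> g1 + t * P t"
    by (auto simp: eventually_at_right_field intro!: exI[of _ 1])
  have "((\<lambda>t. g1 + t * P t) \<longlongrightarrow> g1 + 0 * P 0) (at_right 0)"
    unfolding P_def by (intro tendsto_intros)
  then have "0 \<le> g1 + 0 * P 0" using ev by (intro tendsto_lowerbound[where F = "at_right 0"]) auto
  then show ?thesis by (simp add: g1_def)
qed

text \<open>Expansion to second order for the density r = o' + t (p - n) + t^2 c of a curve, where p
  and n stand for the positive and negative part of the first-order term; the hypothesis
  \<open>eq\<close> moves t n to the other side to avoid subtraction. An upper bound for D(r,r) is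
  the direction that a comparison of energies uses.\<close>

lemma hartree2_expand_le:
  fixes r o' p n c :: "real ^ 'n \<Rightarrow> ennreal" and t :: real
  assumes \<alpha>: "0 < \<alpha>" "\<alpha> < real CARD('n)"
    and meas[measurable]: "r \<in> borel_measurable borel" "o' \<in> borel_measurable borel" "p \<in> borel_measurable borel"
      "n \<in> borel_measurable borel" "c \<in> borel_measurable borel"
    and t: "0 < t" "t \<le> 1"
    and eq: "\<And>x. r x + ennreal t * n x = o' x + ennreal t * (p x + ennreal t * c x)"
    and le: "\<And>x. p x \<le> o' x + c x" "\<And>x. n x \<le> o' x + c x"
    and fin: "hartree2 \<alpha> o' o' < \<infinity>" "hartree2 \<alpha> c c < \<infinity>"
  shows "hartree2 \<alpha> r r < \<infinity>" "hartree2 \<alpha> o' p < \<infinity>" "hartree2 \<alpha> o' n < \<infinity>"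
    "enn2real (hartree2 \<alpha> r r) \<le> enn2real (hartree2 \<alpha> o' o') + 2 * t * (enn2real (hartree2 \<alpha> o' p) - enn2real (hartree2 \<alpha> o' n)) +
      (2 * enn2real (hartree2 \<alpha> o' c) + enn2real (hartree2 \<alpha> (\<lambda>x. p x + c x) (\<lambda>x. p x + c x)) + 2 * enn2real (hartree2 \<alpha> n n)) * t\<^sup>2"
proof -
  let ?D = "hartree2 \<alpha>"
  define A where "A x = o' x + ennreal t * (p x + ennreal t * c x)" for x
  define q where "q x = p x + ennreal t * c x" for x
  define S where "S x = o' x + c x" for x
  have [measurable]: "A \<in> borel_measurable borel" "q \<in> borel_measurable borel" "S \<in> borel_measurable borel"
    unfolding A_def[abs_def] q_def[abs_def] S_def[abs_def] by measurable
  have t1: "ennreal t \<le> 1" using t by simp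
  have "2 * ?D o' c < \<infinity>" using hartree2_two_le[OF \<alpha>, of o' c] fin by (auto intro: le_less_trans)
  then have oc: "?D o' c < \<infinity>" by (auto simp: ennreal_mult_less_top)
  have SS: "?D S S < \<infinity>"
    unfolding S_def[abs_def] using fin oc
    by (simp add: hartree2_add_left hartree2_add_right hartree2_commute[OF \<alpha>, of c o'])
  have fS: "?D a b < \<infinity>" if "\<And>x. a x \<le> ennreal k * S x" "\<And>x. b x \<le> ennreal k * S x" for a b k
  proof (rule le_less_trans)
    show "?D a b \<le> ?D (\<lambda>x. ennreal k * S x) (\<lambda>x. ennreal k * S x)" using that by (rule hartree2_mono)
    show "?D (\<lambda>x. ennreal k * S x) (\<lambda>x. ennreal k * S x) < \<infinity>"
      using SS by (simp add: hartree2_cmult_left hartree2_cmult_right ennreal_mult_less_top)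
  qed
  \<comment> \<open>All functions involved are dominated by 3 S, whose energy is finite, so all
    their pairings are finite. The factor 3 comes from A \<le> S + (S + S), as t \<le> 1.\<close>
  have o3: "o' x \<le> ennreal 3 * S x" and p3: "p x \<le> ennreal 3 * S x" and n3: "n x \<le> ennreal 3 * S x"
    and c3: "c x \<le> ennreal 3 * S x" and pc3: "p x + c x \<le> ennreal 3 * S x" and A3: "A x \<le> ennreal 3 * S x" for x
  proof -
    have S1: "S x \<le> ennreal 3 * S x" using mult_right_mono[of 1 "ennreal 3" "S x"] by simp
    have oS: "o' x \<le> S x" "c x \<le> S x" by (auto simp: S_def)
    have pS: "p x \<le> S x" "n x \<le> S x" using le by (auto simp: S_def)
    show "o' x \<le> ennreal 3 * S x" "p x \<le> ennreal 3 * S x" "n x \<le> ennreal 3 * S x" "c x \<le> ennreal 3 * S x"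
      using S1 oS pS by (auto intro: order_trans)
    have "ennreal 3 * S x = S x + (S x + S x)"
    proof -
      have "ennreal 3 = 1 + (1 + 1)" by simp
      then show ?thesis by (simp only: distrib_right mult_1_left)
    qed
    moreover have "p x + c x \<le> S x + S x" using oS pS by (intro add_mono) auto
    moreover have "A x \<le> S x + (S x + S x)"
    proof -
      have "ennreal t * c x \<le> 1 * S x" using t1 oS by (intro mult_mono) auto
      then have "p x + ennreal t * c x \<le> S x + S x" using pS by (intro add_mono) auto
      then have "ennreal t * (p x + ennreal t * c x) \<le> 1 * (S x + S x)" using t1 by (intro mult_mono) auto
      then show ?thesis unfolding A_def using oS by (intro add_mono) auto
    qed
    ultimately show "p x + c x \<le> ennreal 3 * S x" "A x \<le> ennreal 3 * S x"
      by (auto intro: order_trans add_increasing)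
  qed
  have rA: "r x \<le> A x" for x
    using eq[of x] unfolding A_def by (metis add.right_neutral add_left_mono zero_le)
  have r3: "r x \<le> ennreal 3 * S x" for x using rA A3 by (rule order_trans)
  show frr: "?D r r < \<infinity>" and fop: "?D o' p < \<infinity>" and fon: "?D o' n < \<infinity>"
    by (rule fS[OF r3 r3], rule fS[OF o3 p3], rule fS[OF o3 n3])
  have AA: "A = (\<lambda>x. r x + ennreal t * n x)" by (simp add: A_def eq fun_eq_iff)
  have 1: "?D A A = ?D r r + ennreal t * ?D r n + ennreal t * ?D A n"
    by (subst (2) AA) (simp add: hartree2_add_right hartree2_cmult_right, subst AA,
        simp add: hartree2_add_left hartree2_cmult_left hartree2_commute[OF \<alpha>, of n r])
  have 2: "?D A n = ?D r n + ennreal t * ?D n n"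
    unfolding AA by (simp add: hartree2_add_left hartree2_cmult_left)
  have 3: "?D o' n \<le> ?D A n" by (rule hartree2_mono) (auto simp: A_def)
  have Aq: "A = (\<lambda>x. o' x + ennreal t * q x)" by (simp add: A_def q_def fun_eq_iff)
  have 4: "?D A A = ?D o' o' + ennreal t * (2 * ?D o' q) + ennreal t * (ennreal t * ?D q q)"
    unfolding Aq by (simp add: hartree2_add_left hartree2_add_right hartree2_cmult_left hartree2_cmult_right
        hartree2_commute[OF \<alpha>, of q o'] mult_2 distrib_left add_ac)
  have 5: "?D o' q = ?D o' p + ennreal t * ?D o' c"
    unfolding q_def[abs_def] by (simp add: hartree2_add_right hartree2_cmult_right)
  have 6: "?D q q \<le> ?D (\<lambda>x. p x + c x) (\<lambda>x. p x + c x)"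
    unfolding q_def[abs_def] using mult_right_mono[OF t1] by (intro hartree2_mono add_left_mono) auto
  have q3: "q x \<le> ennreal 3 * S x" for x
    using pc3[of x] mult_right_mono[OF t1, of "c x"] unfolding q_def by (auto intro: order_trans add_left_mono)
  have reals: "\<exists>v. h = ennreal v \<and> 0 \<le> v" if "h < \<infinity>" for h using that by (cases h) auto
  obtain vrr where vrr: "?D r r = ennreal vrr" "0 \<le> vrr" using reals[OF frr] by blast
  obtain vrn where vrn: "?D r n = ennreal vrn" "0 \<le> vrn" using reals[OF fS[OF r3 n3]] by blast
  obtain vAn where vAn: "?D A n = ennreal vAn" "0 \<le> vAn" using reals[OF fS[OF A3 n3]] by blast
  obtain vnn where vnn: "?D n n = ennreal vnn" "0 \<le> vnn" using reals[OF fS[OF n3 n3]] by blast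
  obtain vow where vow: "?D o' n = ennreal vow" "0 \<le> vow" using reals[OF fon] by blast
  obtain voz where voz: "?D o' p = ennreal voz" "0 \<le> voz" using reals[OF fop] by blast
  obtain voo where voo: "?D o' o' = ennreal voo" "0 \<le> voo" using reals[OF fin(1)] by blast
  obtain voq where voq: "?D o' q = ennreal voq" "0 \<le> voq" using reals[OF fS[OF o3 q3]] by blast
  obtain voc where voc: "?D o' c = ennreal voc" "0 \<le> voc" using reals[OF oc] by blast
  obtain vqq where vqq: "?D q q = ennreal vqq" "0 \<le> vqq" using reals[OF fS[OF q3 q3]] by blast
  obtain vpc where vpc: "?D (\<lambda>x. p x + c x) (\<lambda>x. p x + c x) = ennreal vpc" "0 \<le> vpc" using reals[OF fS[OF pc3 pc3]] by blast
  obtain vaa where vaa: "?D A A = ennreal vaa" "0 \<le> vaa" using reals[OF fS[OF A3 A3]] by blast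
  note z = vrr vrn vAn vnn vow voz voo voq voc vqq vpc vaa
  have "ennreal vaa = ennreal (vrr + t * vrn + t * vAn)"
    using 1 z t by (simp add: ennreal_plus ennreal_mult)
  then have e1: "vaa = vrr + t * vrn + t * vAn" using z t by (subst (asm) ennreal_inj) auto
  have "ennreal vAn = ennreal (vrn + t * vnn)" using 2 z t by (simp add: ennreal_plus ennreal_mult)
  then have e2: "vAn = vrn + t * vnn" using z t by (subst (asm) ennreal_inj) auto
  have e3: "vow \<le> vAn" using 3 z by simp
  have "ennreal vaa = ennreal (voo + t * (2 * voq) + t * (t * vqq))"
    using 4 z t by (simp add: ennreal_plus ennreal_mult)
  then have e4: "vaa = voo + t * (2 * voq) + t * (t * vqq)" using z t by (subst (asm) ennreal_inj) auto
  have "ennreal voq = ennreal (voz + t * voc)" using 5 z t by (simp add: ennreal_plus ennreal_mult)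
  then have e5: "voq = voz + t * voc" using z t by (subst (asm) ennreal_inj) auto
  have e6: "vqq \<le> vpc" using 6 z by simp
  \<comment> \<open>D(r,r) equals D(A,A) - t D(r,n) - t D(A,n); replacing D(r,n) by D(A,n) - t
    D(n,n) produces only a term of second order.\<close>
  have "vrr = vaa - t * vrn - t * vAn" using e1 by simp
  also have "\<dots> = voo + 2 * t * voz + 2 * t\<^sup>2 * voc + t\<^sup>2 * vqq - 2 * t * vAn + t\<^sup>2 * vnn"
    using e2 by (simp add: e4 e5 power2_eq_square algebra_simps)
  also have "\<dots> \<le> voo + 2 * t * voz + 2 * t\<^sup>2 * voc + t\<^sup>2 * vpc - 2 * t * vow + 2 * t\<^sup>2 * vnn"
  proof -
    have "t\<^sup>2 * vqq \<le> t\<^sup>2 * vpc" using e6 by (intro mult_left_mono) auto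
    moreover have "2 * t * vow \<le> 2 * t * vAn" using e3 t by (intro mult_left_mono) auto
    moreover have "t\<^sup>2 * vnn \<le> 2 * t\<^sup>2 * vnn" using z by simp
    ultimately show ?thesis by linarith
  qed
  finally show "enn2real (?D r r) \<le> enn2real (?D o' o') + 2 * t * (enn2real (?D o' p) - enn2real (?D o' n)) +
      (2 * enn2real (?D o' c) + enn2real (?D (\<lambda>x. p x + c x) (\<lambda>x. p x + c x)) + 2 * enn2real (?D n n)) * t\<^sup>2"
    using z by (simp add: algebra_simps)
qed

lemma minimizer_finite:
  fixes u :: "real ^ 'n \<Rightarrow> complex"
  assumes "is_min \<alpha> m u"
  shows "u \<in> borel_measurable borel" "square_integrable u" "kinetic u < \<infinity>" "pot u < \<infinity>"
    "hartree2 \<alpha> (dens u) (dens u) < \<infinity>" "u \<in> energy_space"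
proof -
  show "u \<in> borel_measurable borel" "square_integrable u"
    using assms by (auto simp: is_min_def square_integrable_iff)
  show "kinetic u < \<infinity>" "pot u < \<infinity>" "hartree2 \<alpha> (dens u) (dens u) < \<infinity>"
    using assms by (auto simp: is_min_def total_energy_def ennreal_mult_less_top ennreal_mult_eq_top_iff less_top[symmetric])
  then show "u \<in> energy_space" using \<open>square_integrable u\<close> by (simp add: energy_space_iff)
qed

lemma hartree_potential_eq: "hartree_potential \<alpha> u = nn_convolution (\<lambda>x. ennreal (riesz_potential \<alpha> x)) (dens u)"
  by (simp add: hartree_potential_def dens_def[abs_def])

lemma hartree_potential_measurable [measurable]:
  "u \<in> borel_measurable borel \<Longrightarrow> hartree_potential \<alpha> u \<in> borel_measurable borel"
  unfolding hartree_potential_eq by measurable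

text \<open>Two finite energies bound the mutual energy through 2 D(a,b) \<le> D(a,a) + D(b,b). This
  covers every bounded function of compact support.\<close>

lemma hartree2_ref_bounded:
  fixes u :: "real ^ 'n \<Rightarrow> complex" and b :: "real ^ 'n \<Rightarrow> ennreal"
  assumes \<alpha>: "0 < \<alpha>" "\<alpha> < real CARD('n)" and u: "is_min \<alpha> m u"
    and b: "\<And>x. b x \<le> ennreal k * ennreal ((ref x)\<^sup>2)"
  shows "hartree2 \<alpha> (dens u) b < \<infinity>" "hartree2 \<alpha> b b < \<infinity>"
proof -
  note [measurable] = minimizer_finite(1)[OF u]
  define g where "g x = ennreal k * ennreal ((ref x)\<^sup>2)" for x :: "real ^ 'n"
  have [measurable]: "g \<in> borel_measurable borel" unfolding g_def[abs_def] by measurable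
  have gg: "hartree2 \<alpha> g g < \<infinity>"
    unfolding g_def[abs_def] using hartree2_ref_finite[OF \<alpha>]
    by (simp add: hartree2_cmult_left hartree2_cmult_right ennreal_mult_less_top)
  have "2 * hartree2 \<alpha> (dens u) g < \<infinity>"
    using hartree2_two_le[OF \<alpha>, of "dens u" g] minimizer_finite(5)[OF u] gg by (auto intro: le_less_trans)
  then have ug: "hartree2 \<alpha> (dens u) g < \<infinity>" by (auto simp: ennreal_mult_less_top)
  have "hartree2 \<alpha> (dens u) b \<le> hartree2 \<alpha> (dens u) g" "hartree2 \<alpha> b b \<le> hartree2 \<alpha> g g"
    using b by (auto intro!: hartree2_mono simp: g_def)
  then show "hartree2 \<alpha> (dens u) b < \<infinity>" "hartree2 \<alpha> b b < \<infinity>"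
    using ug gg by (auto intro: le_less_trans)
qed

lemma indicator_le_ref:
  assumes "\<And>x. x \<in> K \<Longrightarrow> norm x \<le> R"
  shows "(indicator K x :: ennreal) \<le> ennreal (exp (2 * R)) * ennreal ((ref x)\<^sup>2)"
proof (cases "x \<in> K")
  case True
  have "1 \<le> exp (2 * R) * (ref x)\<^sup>2"
    unfolding ref_square using assms[OF True] by (simp flip: exp_add)
  from ennreal_leI[OF this] show ?thesis using True by (simp add: ennreal_mult)
qed simp

text \<open>The integral of the potential over a ball is the mutual energy of the density with an
  indicator, hence finite.\<close>

lemma hartree_potential_AE_finite:
  fixes u :: "real ^ 'n \<Rightarrow> complex"
  assumes \<alpha>: "0 < \<alpha>" "\<alpha> < real CARD('n)" and u: "is_min \<alpha> m u"
  shows "AE x in lborel. hartree_potential \<alpha> u x < \<infinity>"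
proof (rule AE_ball_imp_AE)
  fix n :: nat
  note [measurable] = minimizer_finite(1)[OF u]
  let ?B = "ball (0::real ^ 'n) (real (Suc n))"
  have "hartree2 \<alpha> (dens u) (indicator ?B) < \<infinity>"
    by (rule hartree2_ref_bounded(1)[OF \<alpha> u indicator_le_ref[of _ "real (Suc n)"]]) auto
  then have "(\<integral>\<^sup>+x. hartree_potential \<alpha> u x * indicator ?B x \<partial>lborel) \<noteq> \<infinity>"
    unfolding hartree2_def hartree_potential_eq by simp
  then have "AE x in lborel. hartree_potential \<alpha> u x * indicator ?B x \<noteq> \<infinity>"
    by (intro nn_integral_PInf_AE borel_measurable_times_ennreal borel_measurable_indicator) auto
  then show "AE x in lborel. x \<in> ?B \<longrightarrow> hartree_potential \<alpha> u x < \<infinity>"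
    by (auto elim!: eventually_mono simp: less_top[symmetric])
qed

lemma integrable_hartree:
  fixes u f :: "real ^ 'n \<Rightarrow> complex" and b :: "real ^ 'n \<Rightarrow> real"
  assumes \<alpha>: "0 < \<alpha>" "\<alpha> < real CARD('n)" and u: "is_min \<alpha> m u"
    and [measurable]: "f \<in> borel_measurable borel" "b \<in> borel_measurable borel"
    and fb: "\<And>x. norm (f x) \<le> b x" and fin: "hartree2 \<alpha> (dens u) (\<lambda>x. ennreal (b x)) < \<infinity>"
  shows "integrable lborel (\<lambda>x. complex_of_real (enn2real (hartree_potential \<alpha> u x)) * f x)"
proof (rule integrableI_bounded)
  note [measurable] = minimizer_finite(1)[OF u]
  show "(\<lambda>x. complex_of_real (enn2real (hartree_potential \<alpha> u x)) * f x) \<in> borel_measurable lborel" by measurable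
  have "(\<integral>\<^sup>+x. ennreal (norm (complex_of_real (enn2real (hartree_potential \<alpha> u x)) * f x)) \<partial>lborel) \<le>
     (\<integral>\<^sup>+x. hartree_potential \<alpha> u x * ennreal (b x) \<partial>lborel)"
  proof (intro nn_integral_mono)
    fix x
    have "ennreal (norm (complex_of_real (enn2real (hartree_potential \<alpha> u x)) * f x)) =
       ennreal (enn2real (hartree_potential \<alpha> u x)) * ennreal (norm (f x))"
      by (simp add: norm_mult ennreal_mult)
    also have "\<dots> \<le> hartree_potential \<alpha> u x * ennreal (b x)"
      using fb by (intro mult_mono ennreal_leI) (auto simp: ennreal_enn2real_if)
    finally show "ennreal (norm (complex_of_real (enn2real (hartree_potential \<alpha> u x)) * f x)) \<le>
       hartree_potential \<alpha> u x * ennreal (b x)" .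
  qed
  also have "\<dots> < \<infinity>" using fin by (simp add: hartree2_def hartree_potential_eq)
  finally show "(\<integral>\<^sup>+x. ennreal (norm (complex_of_real (enn2real (hartree_potential \<alpha> u x)) * f x)) \<partial>lborel) < \<infinity>" .
qed

lemma enn2real_hartree2:
  fixes u :: "real ^ 'n \<Rightarrow> complex" and b :: "real ^ 'n \<Rightarrow> real"
  assumes \<alpha>: "0 < \<alpha>" "\<alpha> < real CARD('n)" and u: "is_min \<alpha> m u"
    and [measurable]: "b \<in> borel_measurable borel" and b: "\<And>x. 0 \<le> b x"
  shows "enn2real (hartree2 \<alpha> (dens u) (\<lambda>x. ennreal (b x))) =
    (LINT x|lborel. enn2real (hartree_potential \<alpha> u x) * b x)"
proof -
  note [measurable] = minimizer_finite(1)[OF u]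
  have "hartree2 \<alpha> (dens u) (\<lambda>x. ennreal (b x)) = (\<integral>\<^sup>+x. ennreal (enn2real (hartree_potential \<alpha> u x) * b x) \<partial>lborel)"
    unfolding hartree2_def hartree_potential_eq[symmetric]
    using hartree_potential_AE_finite[OF \<alpha> u] b
    by (intro nn_integral_cong_AE) (auto elim!: eventually_mono simp: ennreal_mult)
  then show ?thesis using b by (subst integral_eq_nn_integral) auto
qed

text \<open>Along a test function the weak gradient varies affinely, so the kinetic energy of the
  curve is an exact quadratic polynomial in t.\<close>

lemma weak_gradient_variation:
  fixes u \<phi> :: "real ^ 'n \<Rightarrow> complex" and t :: real
  assumes u: "u \<in> sobolev_H1" and \<phi>: "test_function \<phi>"
  shows "kin i (\<lambda>x. u x + of_real t * \<phi> x) = sqnorm (\<lambda>x. weak_gradient u x $ i + of_real t * partial_deriv i \<phi> x)"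
proof -
  let ?G = "weak_gradient u"
  note w = weak_gradient[OF u]
  have us: "square_integrable u" using u by (simp add: sobolev_H1_iff)
  note ps = square_integrable_test_function
  have [measurable]: "?G \<in> borel_measurable borel" by (rule square_integrableD[OF w(2)])
  have dm[measurable]: "partial_deriv j \<phi> \<in> borel_measurable borel" for j
    using square_integrableD(1)[OF ps[OF test_function_partial_deriv[OF \<phi>]]] .
  have Gs: "square_integrable (\<lambda>x. ?G x $ j)" for j
  proof -
    have "sqnorm (\<lambda>x. ?G x $ j) \<le> sqnorm ?G"
      unfolding sqnorm_def by (intro nn_integral_mono ennreal_leI power_mono Finite_Cartesian_Product.norm_nth_le) auto
    then show ?thesis using w(2) le_less_trans[of "sqnorm (\<lambda>x. ?G x $ j)" "sqnorm ?G" \<infinity>]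
      by (auto simp: square_integrable_iff)
  qed
  define H where "H x = (\<chi> j. ?G x $ j + of_real t * partial_deriv j \<phi> x)" for x
  have Hj: "square_integrable (\<lambda>x. H x $ j)" for j
    unfolding H_def vec_lambda_beta
    by (rule square_integrable_add[OF Gs square_integrable_cmult[OF ps[OF test_function_partial_deriv[OF \<phi>]]]])
  have [measurable]: "H \<in> borel_measurable borel"
  proof (subst borel_measurable_euclidean_space, intro ballI)
    fix b :: "complex ^ 'n" assume "b \<in> Basis"
    have "(\<lambda>x. H x \<bullet> b) = (\<lambda>x. \<Sum>j\<in>UNIV. (?G x $ j + of_real t * partial_deriv j \<phi> x) \<bullet> b $ j)"
      by (simp add: H_def inner_vec_def)
    then show "(\<lambda>x. H x \<bullet> b) \<in> borel_measurable borel" by simp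
  qed
  have "sqnorm H = (\<Sum>j\<in>UNIV. sqnorm (\<lambda>x. H x $ j))" by (rule sqnorm_vec) measurable
  also have "\<dots> < \<infinity>" using Hj by (simp add: square_integrable_iff)
  finally have Hs: "square_integrable H" by (simp add: square_integrable_iff)
  define v where "v x = u x + of_real t * \<phi> x" for x
  have vs: "square_integrable v"
    unfolding v_def by (intro square_integrable_add square_integrable_cmult us ps \<phi>)
  have "has_weak_gradient v H"
    unfolding has_weak_gradient_def
  proof (intro conjI allI impI square_integrable_imp_locally_integrable vs Hs)
    fix \<psi> :: "real ^ 'n \<Rightarrow> complex" and j assume \<psi>: "test_function \<psi>"
    have "(LINT x|lborel. v x * partial_deriv j \<psi> x) = (LINT x|lborel. u x * partial_deriv j \<psi> x) + of_real t * (LINT x|lborel. \<phi> x * partial_deriv j \<psi> x)"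
      unfolding v_def distrib_right mult.assoc
      by (subst Bochner_Integration.integral_add)
         (auto intro!: integrable_mult_square_integrable integrable_mult_right us ps test_function_partial_deriv \<phi> \<psi>)
    also have "(LINT x|lborel. u x * partial_deriv j \<psi> x) = - (LINT x|lborel. ?G x $ j * \<psi> x)"
      using w(1) \<psi> by (simp add: has_weak_gradient_def)
    also have "(LINT x|lborel. \<phi> x * partial_deriv j \<psi> x) = - (LINT x|lborel. partial_deriv j \<phi> x * \<psi> x)"
      by (rule test_function_integral_by_parts[OF \<phi> \<psi>])
    also have "- (LINT x|lborel. ?G x $ j * \<psi> x) + of_real t * - (LINT x|lborel. partial_deriv j \<phi> x * \<psi> x) =
      - (LINT x|lborel. H x $ j * \<psi> x)"
    proof -
      have "(LINT x|lborel. H x $ j * \<psi> x) = (LINT x|lborel. ?G x $ j * \<psi> x + of_real t * (partial_deriv j \<phi> x * \<psi> x))"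
        by (simp add: H_def distrib_right mult.assoc)
      also have "\<dots> = (LINT x|lborel. ?G x $ j * \<psi> x) + of_real t * (LINT x|lborel. partial_deriv j \<phi> x * \<psi> x)"
        by (subst Bochner_Integration.integral_add)
           (auto intro!: integrable_mult_square_integrable integrable_mult_right Gs ps test_function_partial_deriv \<phi> \<psi>)
      finally show ?thesis by simp
    qed
    finally show "(LINT x|lborel. v x * partial_deriv j \<psi> x) = - (LINT x|lborel. H x $ j * \<psi> x)" .
  qed
  from kin_eq_sqnorm[OF vs this Hs, of i] show ?thesis unfolding v_def[abs_def] H_def by simp
qed

lemma pot_eq_sqnorm:
  fixes v :: "real ^ 'n \<Rightarrow> complex"
  shows "pot v = sqnorm (\<lambda>x. of_real (norm x) * v x)"
  by (simp add: pot_def sqnorm_def norm_mult power_mult_distrib)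

text \<open>The value of \<omega> forced by formally testing the equation with the conjugate of u:
  kinetic, potential and full nonlocal term add up to -\<omega> m.\<close>

definition multiplier :: "real \<Rightarrow> real \<Rightarrow> (real ^ 'n \<Rightarrow> complex) \<Rightarrow> real" where
  "multiplier \<alpha> m u = - ((enn2real (kinetic u) + enn2real (pot u) + enn2real (hartree2 \<alpha> (dens u) (dens u))) / m)"

text \<open>The curve \<open>u + t \<phi>\<close> is rescaled to mass \<open>m\<close>. A lower bound on the one-sided derivative is enough,
  since \<open>\<phi>\<close> may be multiplied by any complex constant.\<close>

lemma first_variation_Re:
  fixes u \<phi> :: "real ^ 'n \<Rightarrow> complex"
  assumes \<alpha>: "0 < \<alpha>" "\<alpha> < real CARD('n)" and m: "m > 0" and u: "is_min \<alpha> m u" and \<phi>: "test_function \<phi>"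
  defines "V \<equiv> \<lambda>x. enn2real (hartree_potential \<alpha> u x)"
  shows "integrable lborel (\<lambda>x. (\<Sum>i\<in>UNIV. cnj (weak_gradient u x $ i) * partial_deriv i \<phi> x)
        + of_real (multiplier \<alpha> m u) * (cnj (u x) * \<phi> x)
        + of_real ((norm x)\<^sup>2) * (cnj (u x) * \<phi> x) + of_real (V x) * (cnj (u x) * \<phi> x))" (is ?int)
    and "0 \<le> Re (LINT x|lborel. (\<Sum>i\<in>UNIV. cnj (weak_gradient u x $ i) * partial_deriv i \<phi> x)
        + of_real (multiplier \<alpha> m u) * (cnj (u x) * \<phi> x)
        + of_real ((norm x)\<^sup>2) * (cnj (u x) * \<phi> x) + of_real (V x) * (cnj (u x) * \<phi> x))" (is ?ge)
proof -
  let ?G = "weak_gradient u"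
  note uf = minimizer_finite[OF u]
  note [measurable] = uf(1)
  have H1: "u \<in> sobolev_H1" using uf(6) by (simp add: energy_space_def)
  note ps = square_integrable_test_function[OF \<phi>]
  have [measurable]: "\<phi> \<in> borel_measurable borel" by (rule square_integrableD[OF ps])
  note ds = square_integrable_test_function[OF test_function_partial_deriv[OF \<phi>]]
  have Gs: "square_integrable (\<lambda>x. ?G x $ i)" for i
  proof -
    have [measurable]: "?G \<in> borel_measurable borel" by (rule square_integrableD[OF weak_gradient(2)[OF H1]])
    have "sqnorm (\<lambda>x. ?G x $ i) = kin i u"
      using weak_gradient_variation[OF H1 \<phi>, of i 0] by simp
    then show ?thesis using uf(3) unfolding kinetic_less_top_iff square_integrable_iff by simp
  qed
  have xu: "square_integrable (\<lambda>x. of_real (norm x) * u x)"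
    using uf(4) by (simp add: square_integrable_iff pot_eq_sqnorm)
  obtain R where R: "R > 0" "\<And>x. R \<le> norm x \<Longrightarrow> \<phi> x = 0" using test_function_support[OF \<phi>] by blast
  obtain B where B: "B > 0" "\<And>x. norm (\<phi> x) \<le> B" using test_function_bounded[OF \<phi>] by blast
  have xp: "square_integrable (\<lambda>x. of_real (norm x) * \<phi> x)"
  proof -
    have "integrable lborel (\<lambda>x. (norm (of_real (norm x) * \<phi> x))\<^sup>2)"
      using R by (intro integrable_compact_support[of _ R] continuous_intros test_function_continuous \<phi>) auto
    then show ?thesis by (auto simp: square_integrable_def)
  qed
  \<comment> \<open>A test function is bounded with compact support, hence dominated by a multiple
    of \<open>ref\<close>, which makes its nonlocal energy finite.\<close>
  have cref: "dens \<phi> x \<le> ennreal (B\<^sup>2 * exp (2 * R)) * ennreal ((ref x)\<^sup>2)" for x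
  proof (cases "norm x \<le> R")
    case True
    have "1 \<le> exp (2 * R) * (ref x)\<^sup>2" unfolding ref_square using True by (simp flip: exp_add)
    then have "B\<^sup>2 * 1 \<le> B\<^sup>2 * (exp (2 * R) * (ref x)\<^sup>2)" by (intro mult_left_mono) auto
    moreover have "(norm (\<phi> x))\<^sup>2 \<le> B\<^sup>2" using B by (intro power_mono) auto
    ultimately have "(norm (\<phi> x))\<^sup>2 \<le> (B\<^sup>2 * exp (2 * R)) * (ref x)\<^sup>2" by (simp add: mult.assoc)
    from ennreal_leI[OF this] show ?thesis by (subst (asm) ennreal_mult) (auto simp: dens_def)
  qed (use R in \<open>simp add: dens_def\<close>)
  note cfin = hartree2_ref_bounded[OF \<alpha> u cref]
  \<comment> \<open>The first-order coefficient of |u + t \<phi>|^2 in t.\<close>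
  define \<beta> where "\<beta> x = 2 * Re (cnj (u x) * \<phi> x)" for x
  have [measurable]: "\<beta> \<in> borel_measurable borel" unfolding \<beta>_def[abs_def]
    by (intro borel_measurable_times borel_measurable_const borel_measurable_Re measurable_compose[OF uf(1) borel_measurable_continuous_onI]) (auto intro: continuous_intros)
  have ab: "norm (cnj (u x) * \<phi> x) \<le> (norm (u x))\<^sup>2 + (norm (\<phi> x))\<^sup>2" for x
  proof -
    have "2 * (norm (u x) * norm (\<phi> x)) \<le> (norm (u x))\<^sup>2 + (norm (\<phi> x))\<^sup>2"
      using sum_squares_bound[of "norm (u x)" "norm (\<phi> x)"] by simp
    moreover have "0 \<le> norm (u x) * norm (\<phi> x)" by simp
    ultimately show ?thesis unfolding norm_mult complex_mod_cnj by linarith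
  qed
  have bb: "\<bar>\<beta> x\<bar> \<le> (norm (u x))\<^sup>2 + (norm (\<phi> x))\<^sup>2" for x
  proof -
    have "\<bar>\<beta> x\<bar> \<le> 2 * norm (cnj (u x) * \<phi> x)" unfolding \<beta>_def using abs_Re_le_cmod[of "cnj (u x) * \<phi> x"] by simp
    also have "\<dots> \<le> (norm (u x))\<^sup>2 + (norm (\<phi> x))\<^sup>2"
      using sum_squares_bound[of "norm (u x)" "norm (\<phi> x)"] by (simp add: norm_mult)
    finally show ?thesis .
  qed
  have iV: "integrable lborel (\<lambda>x. of_real (V x) * (cnj (u x) * \<phi> x))"
    unfolding V_def
  proof (rule integrable_hartree[OF \<alpha> u _ _ ab])
    have "hartree2 \<alpha> (dens u) (\<lambda>x. dens u x + dens \<phi> x) < \<infinity>"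
      using uf(5) cfin(1) by (simp add: hartree2_add_right)
    then show "hartree2 \<alpha> (dens u) (\<lambda>x. ennreal ((norm (u x))\<^sup>2 + (norm (\<phi> x))\<^sup>2)) < \<infinity>"
      by (simp add: dens_def)
    show "(\<lambda>x. cnj (u x) * \<phi> x) \<in> borel_measurable borel"
      using square_integrableD(1)[OF square_integrable_cnj[OF uf(2)]] by measurable
  qed measurable
  have iG: "integrable lborel (\<lambda>x. cnj (?G x $ i) * partial_deriv i \<phi> x)" for i
    by (intro integrable_mult_square_integrable square_integrable_cnj Gs ds)
  have iu: "integrable lborel (\<lambda>x. cnj (u x) * \<phi> x)"
    by (intro integrable_mult_square_integrable square_integrable_cnj uf ps)
  have ix: "integrable lborel (\<lambda>x. cnj (of_real (norm x) * u x) * (of_real (norm x) * \<phi> x))"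
    by (intro integrable_mult_square_integrable square_integrable_cnj xu xp)
  have xeq: "cnj (of_real (norm x) * u x) * (of_real (norm x) * \<phi> x) = of_real ((norm x)\<^sup>2) * (cnj (u x) * \<phi> x)" for x
    by (simp add: power2_eq_square mult_ac)
  note ix' = ix[unfolded xeq]
  show ?int
    by (intro Bochner_Integration.integrable_add Bochner_Integration.integrable_sum integrable_mult_right iG iu ix' iV)
  define N where "N f = (LINT x|lborel. (norm (f x))\<^sup>2)" for f :: "real ^ 'n \<Rightarrow> complex"
  have N0: "N f \<ge> 0" for f unfolding N_def by (intro integral_nonneg_AE) auto
  have sqN: "sqnorm f = ennreal (N f)" if "square_integrable f" for f
    unfolding N_def by (rule sqnorm_eq_integral[OF that])
  define B' where "B' i = Re (LINT x|lborel. cnj (?G x $ i) * partial_deriv i \<phi> x)" for i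
  define m1 where "m1 = Re (LINT x|lborel. cnj (u x) * \<phi> x)"
  define pb where "pb = Re (LINT x|lborel. of_real ((norm x)\<^sup>2) * (cnj (u x) * \<phi> x))"
  define v where "v t x = u x + of_real t * \<phi> x" for t x
  have vs: "square_integrable (v t)" for t
    unfolding v_def[abs_def] by (intro square_integrable_add square_integrable_cmult uf ps)
  have [measurable]: "v t \<in> borel_measurable borel" for t by (rule square_integrableD[OF vs])
  define M where "M t = m + 2 * t * m1 + t\<^sup>2 * N \<phi>" for t
  have Nu: "N u = m" using sqN[OF uf(2)] u m N0 by (simp add: is_min_def)
  have vM: "sqnorm (v t) = ennreal (M t)" "M t = N (v t)" for t
  proof -
    show "M t = N (v t)"
      unfolding M_def v_def N_def using integral_norm_square_add[OF uf(2) ps, of t] Nu by (simp add: N_def m1_def)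
    then show "sqnorm (v t) = ennreal (M t)" by (simp add: sqN[OF vs])
  qed
  define a1 where "a1 = (\<Sum>i\<in>UNIV. B' i) + pb"
  define a2 where "a2 = (\<Sum>i\<in>UNIV. N (partial_deriv i \<phi>)) + N (\<lambda>x. of_real (norm x) * \<phi> x)"
  define k0 where "k0 = (\<Sum>i\<in>UNIV. N (\<lambda>x. ?G x $ i))"
  define p0 where "p0 = N (\<lambda>x. of_real (norm x) * u x)"
  define E where "E t = (k0 + p0) + 2 * t * a1 + t\<^sup>2 * a2" for t
  have kv: "kinetic (v t) + pot (v t) = ennreal (E t)" "E t \<ge> 0" for t
  proof -
    have ki: "kin i (v t) = ennreal (N (\<lambda>x. ?G x $ i) + 2 * t * B' i + t\<^sup>2 * N (partial_deriv i \<phi>))"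
      "N (\<lambda>x. ?G x $ i) + 2 * t * B' i + t\<^sup>2 * N (partial_deriv i \<phi>) \<ge> 0" for i
    proof -
      have e: "N (\<lambda>x. ?G x $ i) + 2 * t * B' i + t\<^sup>2 * N (partial_deriv i \<phi>) = N (\<lambda>x. ?G x $ i + of_real t * partial_deriv i \<phi> x)"
        unfolding N_def B'_def using integral_norm_square_add[OF Gs ds, of i t i] by simp
      show "N (\<lambda>x. ?G x $ i) + 2 * t * B' i + t\<^sup>2 * N (partial_deriv i \<phi>) \<ge> 0" unfolding e by (rule N0)
      have "kin i (v t) = sqnorm (\<lambda>x. ?G x $ i + of_real t * partial_deriv i \<phi> x)"
        unfolding v_def[abs_def] by (rule weak_gradient_variation[OF H1 \<phi>])
      also have "\<dots> = ennreal (N (\<lambda>x. ?G x $ i + of_real t * partial_deriv i \<phi> x))"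
        by (intro sqN square_integrable_add square_integrable_cmult Gs ds)
      finally show "kin i (v t) = ennreal (N (\<lambda>x. ?G x $ i) + 2 * t * B' i + t\<^sup>2 * N (partial_deriv i \<phi>))"
        unfolding e .
    qed
    have kt: "kinetic (v t) = ennreal (\<Sum>i\<in>UNIV. N (\<lambda>x. ?G x $ i) + 2 * t * B' i + t\<^sup>2 * N (partial_deriv i \<phi>))"
      unfolding kinetic_def ki(1) using ki(2) by (intro sum_ennreal) auto
    have pe: "p0 + 2 * t * pb + t\<^sup>2 * N (\<lambda>x. of_real (norm x) * \<phi> x) = N (\<lambda>x. of_real (norm x) * u x + of_real t * (of_real (norm x) * \<phi> x))"
      unfolding N_def p0_def pb_def using integral_norm_square_add[OF xu xp, of t] unfolding xeq by simp
    have "pot (v t) = sqnorm (\<lambda>x. of_real (norm x) * u x + of_real t * (of_real (norm x) * \<phi> x))"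
      unfolding pot_eq_sqnorm v_def by (simp add: distrib_left mult.left_commute)
    also have "\<dots> = ennreal (p0 + 2 * t * pb + t\<^sup>2 * N (\<lambda>x. of_real (norm x) * \<phi> x))"
      unfolding pe by (intro sqN square_integrable_add square_integrable_cmult xu xp)
    finally have pt: "pot (v t) = ennreal (p0 + 2 * t * pb + t\<^sup>2 * N (\<lambda>x. of_real (norm x) * \<phi> x))" .
    have pt0: "p0 + 2 * t * pb + t\<^sup>2 * N (\<lambda>x. of_real (norm x) * \<phi> x) \<ge> 0" unfolding pe by (rule N0)
    have Eeq: "E t = (\<Sum>i\<in>UNIV. N (\<lambda>x. ?G x $ i) + 2 * t * B' i + t\<^sup>2 * N (partial_deriv i \<phi>)) +
       (p0 + 2 * t * pb + t\<^sup>2 * N (\<lambda>x. of_real (norm x) * \<phi> x))"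
      by (simp add: E_def k0_def a1_def a2_def sum.distrib sum_distrib_left distrib_left)
    have S0: "(\<Sum>i\<in>UNIV. N (\<lambda>x. ?G x $ i) + 2 * t * B' i + t\<^sup>2 * N (partial_deriv i \<phi>)) \<ge> 0"
      by (rule sum_nonneg) (rule ki(2))
    show "kinetic (v t) + pot (v t) = ennreal (E t)"
      unfolding Eeq kt pt by (rule ennreal_plus[symmetric, OF S0 pt0])
    show "E t \<ge> 0" unfolding Eeq by (rule add_nonneg_nonneg[OF S0 pt0])
  qed
  have v0: "v 0 = u" by (simp add: v_def fun_eq_iff)
  define D0 where "D0 = enn2real (hartree2 \<alpha> (dens u) (dens u))"
  have D0: "hartree2 \<alpha> (dens u) (dens u) = ennreal D0" "D0 \<ge> 0" using uf(5) by (auto simp: D0_def less_top)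
  have tu: "total_energy \<alpha> u = ennreal (k0 + p0 + 1 / 2 * D0)"
  proof -
    have "kinetic u + pot u = ennreal (k0 + p0)" "k0 + p0 \<ge> 0" using kv[of 0] by (simp_all add: v0 E_def)
    moreover have "1 / 2 * ennreal D0 = ennreal (1 / 2 * D0)" unfolding half_ennreal by (rule ennreal_mult[symmetric]) (use D0 in auto)
    ultimately show ?thesis unfolding total_energy_def D0 using D0(2) by (simp only: ennreal_plus mult_nonneg_nonneg zero_le_divide_1_iff zero_le_numeral)
  qed
  define p where "p x = ennreal (max 0 (\<beta> x))" for x
  define n where "n x = ennreal (max 0 (- \<beta> x))" for x
  have pm[measurable]: "p \<in> borel_measurable borel" "n \<in> borel_measurable borel"
    unfolding p_def[abs_def] n_def[abs_def] by measurable
  define C where "C = 2 * enn2real (hartree2 \<alpha> (dens u) (dens \<phi>)) +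
    enn2real (hartree2 \<alpha> (\<lambda>x. p x + dens \<phi> x) (\<lambda>x. p x + dens \<phi> x)) + 2 * enn2real (hartree2 \<alpha> n n)"
  define \<delta> where "\<delta> = enn2real (hartree2 \<alpha> (dens u) p) - enn2real (hartree2 \<alpha> (dens u) n)"
  have hx: "hartree2 \<alpha> (dens (v t)) (dens (v t)) < \<infinity> \<and> hartree2 \<alpha> (dens u) p < \<infinity> \<and> hartree2 \<alpha> (dens u) n < \<infinity> \<and>
    enn2real (hartree2 \<alpha> (dens (v t)) (dens (v t))) \<le> D0 + 2 * t * \<delta> + C * t\<^sup>2" if t: "0 < t" "t \<le> 1" for t
  proof -
    have eq: "dens (v t) x + ennreal t * n x = dens u x + ennreal t * (p x + ennreal t * dens \<phi> x)" for x
    proof -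
      have "(norm (v t x))\<^sup>2 = (norm (u x))\<^sup>2 + t * \<beta> x + t\<^sup>2 * (norm (\<phi> x))\<^sup>2"
        unfolding v_def \<beta>_def by (simp add: cmod_power2) (simp add: power2_eq_square algebra_simps)
      moreover have "\<beta> x = max 0 (\<beta> x) - max 0 (- \<beta> x)" by (simp add: max_def)
      ultimately have "(norm (v t x))\<^sup>2 + t * max 0 (- \<beta> x) = (norm (u x))\<^sup>2 + t * (max 0 (\<beta> x) + t * (norm (\<phi> x))\<^sup>2)"
        by (simp add: power2_eq_square algebra_simps) (metis distrib_left diff_add_cancel add.commute)
      from arg_cong[OF this, of ennreal] show ?thesis using t by (simp add: dens_def p_def n_def ennreal_plus ennreal_mult)
    qed
    have le: "p x \<le> dens u x + dens \<phi> x" "n x \<le> dens u x + dens \<phi> x" for x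
      using bb[of x] by (auto simp: p_def n_def dens_def abs_le_iff intro!: ennreal_leI simp flip: ennreal_plus)
    show ?thesis
      using hartree2_expand_le[OF \<alpha> _ _ pm(1) pm(2) _ t eq le uf(5) cfin(2)]
      by (simp add: D0_def \<delta>_def C_def)
  qed
  have "0 \<le> 2 * m\<^sup>2 * a1 + m\<^sup>2 * \<delta> - 2 * m * m1 * ((k0 + p0) + D0)"
  proof (rule first_variation_nonneg)
    fix t :: real assume t: "0 < t" "t \<le> 1"
    obtain Dt where Dt: "hartree2 \<alpha> (dens (v t)) (dens (v t)) = ennreal Dt" "Dt \<ge> 0" "Dt \<le> D0 + 2 * t * \<delta> + C * t\<^sup>2"
      using hx[OF t] by (cases "hartree2 \<alpha> (dens (v t)) (dens (v t))") auto
    have M0: "M t \<ge> 0" unfolding vM(2) by (rule N0)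
    have main: "(k0 + p0 + 1 / 2 * D0) * (M t)\<^sup>2 \<le> m * M t * E t + 1 / 2 * m\<^sup>2 * Dt"
    \<comment> \<open>A curve point of mass 0 cannot be rescaled, but the left-hand side is then
      0.\<close>
    proof (cases "M t = 0")
      case True
      then show ?thesis using Dt by simp
    next
      case False
      then have Mp: "M t > 0" using M0 by simp
      \<comment> \<open>Restores mass m: kinetic and potential energy acquire the factor m / M t,
        the nonlocal term its square.\<close>
      define lam where "lam = sqrt (m / M t)"
      have l2: "lam\<^sup>2 = m / M t" using m Mp by (simp add: lam_def)
      have "sqnorm (\<lambda>x. lam *\<^sub>R v t x) = ennreal m"
        using Mp m by (subst sqnorm_scale) (auto simp: vM l2 simp flip: ennreal_mult)
      then have "(\<lambda>x. norm (lam *\<^sub>R v t x)) \<in> admissible m"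
        by (auto simp: admissible_def sqnorm_def)
      then have "total_energy \<alpha> u \<le> total_energy \<alpha> (\<lambda>x. norm (lam *\<^sub>R v t x))" using u by (simp add: is_min_def)
      also have "\<dots> \<le> total_energy \<alpha> (\<lambda>x. lam *\<^sub>R v t x)" by (rule total_energy_norm_le) measurable
      also have "\<dots> \<le> ennreal (lam\<^sup>2) * (kinetic (v t) + pot (v t)) +
         1 / 2 * (ennreal (lam\<^sup>2) * ennreal (lam\<^sup>2) * hartree2 \<alpha> (dens (v t)) (dens (v t)))"
        by (rule total_energy_scale_le) measurable
      also have "\<dots> = ennreal (lam\<^sup>2 * E t + 1 / 2 * (lam\<^sup>2 * lam\<^sup>2 * Dt))"
      proof -
        have "ennreal (a * e + 1 / 2 * (a * a * d)) = ennreal a * ennreal e + ennreal (1 / 2) * (ennreal a * ennreal a * ennreal d)"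
          if "a \<ge> 0" "e \<ge> 0" "d \<ge> 0" for a e d
          using that by (simp only: ennreal_plus ennreal_mult mult_nonneg_nonneg zero_le_divide_1_iff zero_le_numeral)
        from this[OF zero_le_power2 kv(2) Dt(2), of lam t] show ?thesis unfolding kv Dt half_ennreal by simp
      qed
      finally have "k0 + p0 + 1 / 2 * D0 \<le> lam\<^sup>2 * E t + 1 / 2 * (lam\<^sup>2 * lam\<^sup>2 * Dt)"
        unfolding tu using kv(2)[of t] Dt(2) by (subst (asm) ennreal_le_iff) auto
      then have "(k0 + p0 + 1 / 2 * D0) * (M t)\<^sup>2 \<le> (lam\<^sup>2 * E t + 1 / 2 * (lam\<^sup>2 * lam\<^sup>2 * Dt)) * (M t)\<^sup>2"
        by (rule mult_right_mono) simp
      also have "\<dots> = m * M t * E t + 1 / 2 * m\<^sup>2 * Dt"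
        unfolding l2 using Mp by (simp add: power2_eq_square field_simps)
      finally show ?thesis .
    qed
    have "1 / 2 * m\<^sup>2 * Dt \<le> 1 / 2 * m\<^sup>2 * (D0 + 2 * t * \<delta> + C * t\<^sup>2)" using Dt by (intro mult_left_mono) auto
    with main show "0 \<le> m * (m + 2 * t * m1 + t\<^sup>2 * N \<phi>) * ((k0 + p0) + 2 * t * a1 + t\<^sup>2 * a2) +
      1 / 2 * m\<^sup>2 * (D0 + 2 * t * \<delta> + C * t\<^sup>2) - ((k0 + p0) + 1 / 2 * D0) * (m + 2 * t * m1 + t\<^sup>2 * N \<phi>)\<^sup>2"
      unfolding M_def E_def by linarith
  qed
  also have "\<dots> = (2 * m\<^sup>2) * (a1 + \<delta> / 2 - (k0 + p0 + D0) / m * m1)"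
    using m by (simp add: power2_eq_square field_simps)
  finally have fin: "0 \<le> a1 + \<delta> / 2 - (k0 + p0 + D0) / m * m1" using m by (simp add: zero_le_mult_iff)
  have mult: "multiplier \<alpha> m u = - ((k0 + p0 + D0) / m)"
  proof -
    have "kinetic u = ennreal k0" "pot u = ennreal p0"
    proof -
      show "pot u = ennreal p0" unfolding pot_eq_sqnorm p0_def by (rule sqN[OF xu])
      have "kin i u = ennreal (N (\<lambda>x. ?G x $ i))" for i
        using weak_gradient_variation[OF H1 \<phi>, of i 0] sqN[OF Gs, of i] by simp
      then show "kinetic u = ennreal k0" unfolding kinetic_def k0_def using N0 by simp
    qed
    moreover have "k0 \<ge> 0" "p0 \<ge> 0" unfolding k0_def p0_def by (auto intro!: sum_nonneg N0)
    ultimately show ?thesis by (simp add: multiplier_def D0_def)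
  qed
  \<comment> \<open>The two signed parts of \<beta> are recombined once both are integrable against
    the potential.\<close>
  have d2: "\<delta> / 2 = Re (LINT x|lborel. of_real (V x) * (cnj (u x) * \<phi> x))"
  proof -
    have "enn2real (hartree2 \<alpha> (dens u) p) = (LINT x|lborel. V x * max 0 (\<beta> x))"
      unfolding p_def[abs_def] V_def by (rule enn2real_hartree2[OF \<alpha> u]) auto
    moreover have "enn2real (hartree2 \<alpha> (dens u) n) = (LINT x|lborel. V x * max 0 (- \<beta> x))"
      unfolding n_def[abs_def] V_def by (rule enn2real_hartree2[OF \<alpha> u]) auto
    moreover have "integrable lborel (\<lambda>x. V x * max 0 (\<beta> x))" "integrable lborel (\<lambda>x. V x * max 0 (- \<beta> x))"
    proof -
      have hf: "hartree2 \<alpha> (dens u) (\<lambda>x. ennreal (max 0 (\<beta> x))) < \<infinity>" "hartree2 \<alpha> (dens u) (\<lambda>x. ennreal (max 0 (- \<beta> x))) < \<infinity>"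
        using hx[of 1] by (auto simp: p_def[abs_def] n_def[abs_def])
      have "integrable lborel (\<lambda>x. complex_of_real (V x) * complex_of_real (max 0 (\<beta> x)))"
        unfolding V_def by (rule integrable_hartree[OF \<alpha> u _ _ _ hf(1)]) auto
      from integrable_Re[OF this] show "integrable lborel (\<lambda>x. V x * max 0 (\<beta> x))" by simp
      have "integrable lborel (\<lambda>x. complex_of_real (V x) * complex_of_real (max 0 (- \<beta> x)))"
        unfolding V_def by (rule integrable_hartree[OF \<alpha> u _ _ _ hf(2)]) auto
      from integrable_Re[OF this] show "integrable lborel (\<lambda>x. V x * max 0 (- \<beta> x))" by simp
    qed
    ultimately have "\<delta> = (LINT x|lborel. V x * max 0 (\<beta> x) - V x * max 0 (- \<beta> x))" by (simp add: \<delta>_def)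
    also have "\<dots> = (LINT x|lborel. 2 * Re (of_real (V x) * (cnj (u x) * \<phi> x)))"
    proof (intro Bochner_Integration.integral_cong refl)
      fix x
      have "V x * max 0 (\<beta> x) - V x * max 0 (- \<beta> x) = V x * \<beta> x" by (simp add: max_def)
      also have "\<dots> = 2 * Re (of_real (V x) * (cnj (u x) * \<phi> x))" by (simp add: \<beta>_def algebra_simps)
      finally show "V x * max 0 (\<beta> x) - V x * max 0 (- \<beta> x) = 2 * Re (of_real (V x) * (cnj (u x) * \<phi> x))" .
    qed
    also have "\<dots> = 2 * Re (LINT x|lborel. of_real (V x) * (cnj (u x) * \<phi> x))"
      by (simp only: integral_mult_right_zero integral_Re[OF iV])
    finally show ?thesis by simp
  qed
  have "Re (LINT x|lborel. (\<Sum>i\<in>UNIV. cnj (?G x $ i) * partial_deriv i \<phi> x)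
        + of_real (multiplier \<alpha> m u) * (cnj (u x) * \<phi> x)
        + of_real ((norm x)\<^sup>2) * (cnj (u x) * \<phi> x) + of_real (V x) * (cnj (u x) * \<phi> x)) =
      (\<Sum>i\<in>UNIV. B' i) + multiplier \<alpha> m u * m1 + pb + \<delta> / 2"
  proof -
    have iS: "integrable lborel (\<lambda>x. \<Sum>i\<in>UNIV. cnj (?G x $ i) * partial_deriv i \<phi> x)"
      by (intro Bochner_Integration.integrable_sum iG)
    have iM: "integrable lborel (\<lambda>x. of_real (multiplier \<alpha> m u) * (cnj (u x) * \<phi> x))"
      by (intro integrable_mult_right iu)
    have "(LINT x|lborel. (\<Sum>i\<in>UNIV. cnj (?G x $ i) * partial_deriv i \<phi> x)
        + of_real (multiplier \<alpha> m u) * (cnj (u x) * \<phi> x)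
        + of_real ((norm x)\<^sup>2) * (cnj (u x) * \<phi> x) + of_real (V x) * (cnj (u x) * \<phi> x)) =
      (\<Sum>i\<in>UNIV. (LINT x|lborel. cnj (?G x $ i) * partial_deriv i \<phi> x)) + of_real (multiplier \<alpha> m u) * (LINT x|lborel. cnj (u x) * \<phi> x)
       + (LINT x|lborel. of_real ((norm x)\<^sup>2) * (cnj (u x) * \<phi> x)) + (LINT x|lborel. of_real (V x) * (cnj (u x) * \<phi> x))"
      by (simp only: Bochner_Integration.integral_add Bochner_Integration.integrable_add iS iM ix' iV
          Bochner_Integration.integral_sum[OF iG] integral_mult_right_zero)
    then show ?thesis by (simp add: Re_sum B'_def m1_def pb_def d2)
  qed
  also have "\<dots> = a1 + \<delta> / 2 - (k0 + p0 + D0) / m * m1" unfolding mult a1_def by (simp add: minus_divide_left[symmetric])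
  finally show ?ge using fin by simp
qed

text \<open>The one-sided inequality for c \<phi> with c = 1, -1, \<i>, -\<i> makes the linear
  functional I vanish. I involves the conjugate of Q whereas the weak form is bilinear; testing with
  the conjugate of \<phi> and conjugating the result reconciles them.\<close>

lemma real_minimizer_weak_solution:
  fixes w :: "real ^ 'n \<Rightarrow> real"
  assumes \<alpha>: "0 < \<alpha>" "\<alpha> < real CARD('n)" and m: "m > 0"
    and u: "is_min \<alpha> m (\<lambda>x. complex_of_real (w x))"
  defines "Q \<equiv> \<lambda>x. complex_of_real (w x)"
  shows "weak_solution \<alpha> (multiplier \<alpha> m Q) Q"
proof -
  note uf = minimizer_finite[OF u, folded Q_def]
  note u = u[folded Q_def]
  note [measurable] = uf(1)
  let ?G = "weak_gradient Q"
  define V where "V x = enn2real (hartree_potential \<alpha> Q x)" for x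
  define \<omega> where "\<omega> = multiplier \<alpha> m Q"
  define I where "I \<phi> = (LINT x|lborel. (\<Sum>i\<in>UNIV. cnj (?G x $ i) * partial_deriv i \<phi> x)
        + of_real \<omega> * (cnj (Q x) * \<phi> x)
        + of_real ((norm x)\<^sup>2) * (cnj (Q x) * \<phi> x) + of_real (V x) * (cnj (Q x) * \<phi> x))" for \<phi>
  have ge: "0 \<le> Re (I \<phi>)" if "test_function \<phi>" for \<phi>
    unfolding I_def \<omega>_def V_def by (rule first_variation_Re(2)[OF \<alpha> m u that])
  have Ic: "I (\<lambda>x. c * \<phi> x) = c * I \<phi>" if "test_function \<phi>" for c \<phi>
  proof -
    have "(\<Sum>i\<in>UNIV. cnj (?G x $ i) * partial_deriv i (\<lambda>x. c * \<phi> x) x)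
        + of_real \<omega> * (cnj (Q x) * (c * \<phi> x))
        + of_real ((norm x)\<^sup>2) * (cnj (Q x) * (c * \<phi> x)) + of_real (V x) * (cnj (Q x) * (c * \<phi> x)) =
        c * ((\<Sum>i\<in>UNIV. cnj (?G x $ i) * partial_deriv i \<phi> x)
        + of_real \<omega> * (cnj (Q x) * \<phi> x)
        + of_real ((norm x)\<^sup>2) * (cnj (Q x) * \<phi> x) + of_real (V x) * (cnj (Q x) * \<phi> x))" for x
      by (simp add: partial_deriv_cmult[OF that] distrib_left sum_distrib_left mult_ac)
    then show ?thesis unfolding I_def by (simp only: integral_mult_right_zero)
  qed
  have I0: "I \<phi> = 0" if \<phi>: "test_function \<phi>" for \<phi>
  proof -
    have "0 \<le> Re (c * I \<phi>)" for c using ge[OF test_function_cmult[OF \<phi>, of c]] Ic[OF \<phi>] by simp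
    from this[of 1] this[of "-1"] this[of \<i>] this[of "- \<i>"]
    show ?thesis by (simp add: complex_eq_iff)
  qed
  have "(LINT x|lborel. (\<Sum>i\<in>UNIV. ?G x $ i * partial_deriv i \<phi> x)
        + of_real \<omega> * Q x * \<phi> x + of_real ((norm x)\<^sup>2) * Q x * \<phi> x
        + of_real (enn2real (hartree_potential \<alpha> Q x)) * Q x * \<phi> x) = 0" if \<phi>: "test_function \<phi>" for \<phi>
  proof -
    have tc: "test_function (\<lambda>x. cnj (\<phi> x))" by (rule test_function_linear[OF bounded_linear_cnj \<phi>])
    have pc: "partial_deriv i (\<lambda>x. cnj (\<phi> x)) x = cnj (partial_deriv i \<phi> x)" for i x
      by (rule partial_deriv_linear[OF bounded_linear_cnj \<phi>])
    have "cnj (I (\<lambda>x. cnj (\<phi> x))) = (LINT x|lborel. (\<Sum>i\<in>UNIV. ?G x $ i * partial_deriv i \<phi> x)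
        + of_real \<omega> * Q x * \<phi> x + of_real ((norm x)\<^sup>2) * Q x * \<phi> x
        + of_real (enn2real (hartree_potential \<alpha> Q x)) * Q x * \<phi> x)"
      unfolding I_def Bochner_Integration.integral_cnj[symmetric] pc by (simp add: V_def mult.assoc cnj_sum del: Bochner_Integration.integral_cnj)
    then show ?thesis using I0[OF tc] by simp
  qed
  moreover have "locally_integrable (\<lambda>x. of_real (enn2real (hartree_potential \<alpha> Q x)) * Q x)"
    unfolding locally_integrable_def
  proof (intro conjI allI impI)
    show "(\<lambda>x. complex_of_real (enn2real (hartree_potential \<alpha> Q x)) * Q x) \<in> borel_measurable lborel" by measurable
    fix K :: "(real ^ 'n) set" assume K: "compact K"
    have [measurable]: "K \<in> sets borel" using K by (rule borel_compact)
    obtain R where R: "\<And>x. x \<in> K \<Longrightarrow> norm x \<le> R"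
      using compact_imp_bounded[OF K] by (auto simp: bounded_iff)
    have KR: "hartree2 \<alpha> (dens Q) (indicator K) < \<infinity>"
      by (rule hartree2_ref_bounded(1)[OF \<alpha> u indicator_le_ref]) (rule R)
    have "integrable lborel (\<lambda>x. complex_of_real (enn2real (hartree_potential \<alpha> Q x)) * (indicator K x *\<^sub>R Q x))"
    \<comment> \<open>On K one has |Q| \<le> |Q|^2 + 1, and both summands of the majorant have
      finite mutual energy with the density of Q.\<close>
    proof (rule integrable_hartree[OF \<alpha> u, where b = "\<lambda>x. (norm (Q x))\<^sup>2 + indicator K x"])
      have "hartree2 \<alpha> (dens Q) (\<lambda>x. dens Q x + indicator K x) < \<infinity>"
        using uf(5) KR by (simp add: hartree2_add_right)
      then show "hartree2 \<alpha> (dens Q) (\<lambda>x. ennreal ((norm (Q x))\<^sup>2 + indicator K x)) < \<infinity>"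
        by (simp add: dens_def ennreal_indicator)
      show "norm (indicator K x *\<^sub>R Q x) \<le> (norm (Q x))\<^sup>2 + indicator K x" for x
      proof -
        have "0 \<le> (norm (Q x) - 1 / 2)\<^sup>2" by simp
        then have "norm (Q x) \<le> (norm (Q x))\<^sup>2 + 1" by (simp add: power2_eq_square algebra_simps)
        then show ?thesis by (auto simp: indicator_def)
      qed
    qed measurable
    then show "set_integrable lborel K (\<lambda>x. complex_of_real (enn2real (hartree_potential \<alpha> Q x)) * Q x)"
      by (simp add: set_integrable_def)
  qed
  ultimately show ?thesis
    unfolding weak_solution_def \<omega>_def[symmetric] using uf(6) hartree_potential_AE_finite[OF \<alpha> u] by blast
qed

theorem theorem4p3:
  fixes \<alpha> m :: real
  assumes "0 < \<alpha>" and "\<alpha> < real CARD('n :: finite)" and "0 < m"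
  shows "\<exists>Q :: real ^ 'n \<Rightarrow> complex.
    normalized_ground_state \<alpha> m Q \<and>
    (\<exists>\<omega> :: real. weak_solution \<alpha> \<omega> Q) \<and>
    (\<forall>R. normalized_ground_state \<alpha> m R \<longrightarrow> (AE x in lborel. R x = Q x)) \<and>
    (\<forall>u. is_minimizer \<alpha> m u \<longrightarrow>
      (\<exists>\<theta> :: real. AE x in lborel. u x = Q x * exp (\<i> * of_real \<theta>)))"
proof -
  note \<alpha> = assms(1,2) and m = assms(3)
  obtain w :: "real ^ 'n \<Rightarrow> real" where w: "w \<in> admissible m" "total_energy \<alpha> w < \<infinity>"
    "\<And>v. v \<in> (admissible m :: (real ^ 'n \<Rightarrow> real) set) \<Longrightarrow> total_energy \<alpha> w \<le> total_energy \<alpha> v"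
    using exists_minimizer[OF \<alpha> m] by blast
  have wm[measurable]: "w \<in> borel_measurable borel" using w by (simp add: admissible_def)
  define Q where "Q x = complex_of_real (w x)" for x
  have Qmin: "is_min \<alpha> m Q"
    unfolding is_min_def Q_def using w by (auto simp: admissible_def total_energy_of_real sqnorm_of_real)
  have nQ: "norm (Q x) = w x" for x using w(1) by (simp add: Q_def admissible_def)
  have wpos: "AE x in lborel. w x > 0" using minimizer_norm_pos[OF \<alpha> m Qmin] by (simp add: nQ)
  have gs: "normalized_ground_state \<alpha> m Q"
    unfolding normalized_ground_state_def is_minimizer_iff[OF \<alpha> m] using Qmin wpos by (simp add: Q_def)
  have sol: "\<exists>\<omega>. weak_solution \<alpha> \<omega> Q"
    using real_minimizer_weak_solution[OF \<alpha> m, of w] Qmin unfolding Q_def[abs_def] by blast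
  \<comment> \<open>Every minimizer has modulus Q almost everywhere; uniqueness of the positive one
    and the description of all others both reduce to this.\<close>
  have norm_eq: "AE x in lborel. complex_of_real (norm (u x)) = Q x" if "is_minimizer \<alpha> m u" for u
    using minimizer_norm_unique[OF \<alpha> m that[unfolded is_minimizer_iff[OF \<alpha> m]] Qmin]
    by eventually_elim (simp only: nQ, simp only: Q_def)
  have uniq: "AE x in lborel. R x = Q x" if R: "normalized_ground_state \<alpha> m R" for R
  proof -
    have "is_minimizer \<alpha> m R" and pos: "AE x in lborel. Im (R x) = 0 \<and> Re (R x) > 0"
      using R by (auto simp: normalized_ground_state_def)
    from norm_eq[OF this(1)] pos show ?thesis
    proof eventually_elim
      case (elim x)
      then have "norm (R x) = Re (R x)" by (simp add: cmod_def)
      then show ?case using elim by (simp add: complex_eq_iff)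
    qed
  qed
  have phase: "\<exists>\<theta>::real. AE x in lborel. u x = Q x * exp (\<i> * of_real \<theta>)" if u: "is_minimizer \<alpha> m u" for u
  proof -
    obtain \<theta> :: real where "AE x in lborel. u x = complex_of_real (norm (u x)) * exp (\<i> * of_real \<theta>)"
      using minimizer_phase[OF \<alpha> m u[unfolded is_minimizer_iff[OF \<alpha> m]]] by blast
    with norm_eq[OF u] have "AE x in lborel. u x = Q x * exp (\<i> * of_real \<theta>)" by eventually_elim simp
    then show ?thesis by blast
  qed
  show ?thesis using gs sol uniq phase by blast
qed

end
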